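(* Let $\mathcal{C}$ be an $A$-coring with group-like element $\mathbf{x}$, $B=A^{co\mathcal{C}}$, and assume that ${}_A\mathcal{C}$ is flat. Then the following are equivalent: (1) $\mathcal{M}^{\mathcal{C}}$ satisfies the strong structure theorem; (2) ${}_BA$ is faithfully flat and $A/B$ is $\mathcal{C}$-Galois. If moreover ${}_A\mathcal{C}$ is locally projective, then (1) and (2) are moreover equivalent to each of: (3) ${}_BA$ is faithfully flat and $\beta':=\Psi'_{\mathcal{C}}$ is bijective; (4) ${}_BA$ is faithfully flat and for every $M\in\sigma[A_{{}^{*}\mathcal{C}}]$, $\Psi'_M$ is bijective; (5) $A_{{}^{*}\mathcal{C}}$ is quasiprojective and generates each of its submodules, ${}_BA$ is a weak generator and $\sigma[\mathcal{C}_{{}^{*}\mathcal{C}}]=\sigma[A_{{}^{*}\mathcal{C}}]$; (6) $A_{{}^{*}\mathcal{C}}$ is a quasiprogenerator and $\sigma[\mathcal{C}_{{}^{*}\mathcal{C}}]=\sigma[A_{{}^{*}\mathcal{C}}]$; (7) ${}_BA$ is a weak generator, $\Psi'_M$ is an isomorphism for every $M\in\mathrm{Gen}(A_{{}^{*}\mathcal{C}})$ and $\sigma[A_{{}^{*}\mathcal{C}}]=\sigma[\mathcal{C}_{{}^{*}\mathcal{C}}]$; (8) $\mathrm{Hom}^{\mathcal{C}}(A,-):\mathcal{M}^{\mathcal{C}}\to\mathcal{M}_B$ is an equivalence; (9) $A$ is a progenerator in $\mathcal{M}^{\mathcal{C}}$.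
   Context: Rings are associative with unit and modules are unital. $A$ is a not necessarily commutative ring with $1_A\neq 0$. An $A$-coring is an $A$-bimodule $\mathcal{C}$ with $A$-bilinear coassociative $\Delta_{\mathcal{C}}:\mathcal{C}\to\mathcal{C}\otimes_A\mathcal{C}$, $c\mapsto\sum c_1\otimes_A c_2$, and $A$-bilinear counit $\varepsilon_{\mathcal{C}}:\mathcal{C}\to A$; $\mathbf{x}\in\mathcal{C}$ is group-like if $\Delta_{\mathcal{C}}(\mathbf{x})=\mathbf{x}\otimes_A\mathbf{x}$ and $\varepsilon_{\mathcal{C}}(\mathbf{x})=1_A$. $\mathcal{M}^{\mathcal{C}}$ is the category of right $\mathcal{C}$-comodules: right $A$-modules $M$ with a right $A$-linear coassociative counital coaction $\varrho_M:M\to M\otimes_A\mathcal{C}$, $m\mapsto\sum m_{<0>}\otimes_A m_{<1>}$; morphisms ($\mathcal{C}$-colinear maps) form $\mathrm{Hom}^{\mathcal{C}}(-,-)$. $A$ is a right $\mathcal{C}$-comodule via $\varrho_A:a\mapsto\mathbf{x}a\in\mathcal{C}\simeq A\otimes_A\mathcal{C}$. ${}^{*}\mathcal{C}:=\mathrm{Hom}_{A-}(\mathcal{C},A)$ (left $A$-linear maps) is a ring with product $(f\cdot g)(c)=\sum g(c_1f(c_2))$ and unit $\varepsilon_{\mathcal{C}}$. Every right $\mathcal{C}$-comodule is a right ${}^{*}\mathcal{C}$-module by $mg=\sum m_{<0>}g(m_{<1>})$; in particular $a\leftharpoonup g=g(\mathbf{x}a)$ on $A$. For $M\in\mathcal{M}^{\mathcal{C}}$,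 $M^{co\mathcal{C}}:=\{m\in M\mid\varrho_M(m)=m\otimes_A\mathbf{x}\}$, a right module over the subring $B:=A^{co\mathcal{C}}=\{b\in A\mid b\mathbf{x}=\mathbf{x}b\}$ of $A$; $\mathcal{M}_B$ is the category of right $B$-modules. The functor $-\otimes_BA:\mathcal{M}_B\to\mathcal{M}^{\mathcal{C}}$ (coaction $\mathrm{id}_N\otimes_B\varrho_A$ on $N\otimes_BA$) is left adjoint to $(-)^{co\mathcal{C}}:\mathcal{M}^{\mathcal{C}}\to\mathcal{M}_B$, with unit $\Phi_N:N\to(N\otimes_BA)^{co\mathcal{C}}$, $n\mapsto n\otimes_B1_A$, and counit $\Psi_M:M^{co\mathcal{C}}\otimes_BA\to M$, $m\otimes a\mapsto ma$. $\mathcal{M}^{\mathcal{C}}$ satisfies the strong structure theorem if $\Psi_M$ is an isomorphism for all $M\in\mathcal{M}^{\mathcal{C}}$ and $\Phi_N$ is an isomorphism for all $N\in\mathcal{M}_B$. Put $\Psi'_M:\mathrm{Hom}^{\mathcal{C}}(A,M)\otimes_BA\to M$, $f\otimes a\mapsto f(a)$. $A/B$ is $\mathcal{C}$-Galois if $\beta:A\otimes_BA\to\mathcal{C}$, $\widetilde{a}\otimes a\mapsto\widetilde{a}\mathbf{x}a$, is bijective. For a right module $W$ over a ring $T$, $\mathrm{Gen}(W_T)$ is the class of $W$-generated modules (quotients of direct sums of copies of $W$), and $\sigma[W_T]$ is the full subcategory of $W$-subgenerated modules (isomorphic to submodules of $W$-generated modules). A left $S$-module $P$ is a weak generator if for any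 right $S$-module $Y$, $Y\otimes_SP=0$ implies $Y=0$. A right $T$-module $P$ is quasiprojective if it is projective relative to all epimorphisms $P\to P/K$ onto its quotients; it is a quasiprogenerator if it is finitely generated, quasiprojective and generates each of its submodules. A progenerator in $\mathcal{M}^{\mathcal{C}}$ is an object which is finitely generated, projective in $\mathcal{M}^{\mathcal{C}}$ and a generator of $\mathcal{M}^{\mathcal{C}}$. A left $A$-module $W$ is locally projective (Zimmermann-Huisgen) if for every surjective $A$-linear $\pi:L\to N$, every $A$-linear $g:W\to N$ and every finitely generated submodule $\iota:F_0\hookrightarrow W$ there is an $A$-linear $g':W\to L$ with $\pi g'\iota=g\iota$. When ${}_A\mathcal{C}$ is locally projective, $\mathcal{M}^{\mathcal{C}}$ is identified with the full subcategory $\sigma[\mathcal{C}_{{}^{*}\mathcal{C}}]$ of the category of right ${}^{*}\mathcal{C}$-modules.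
   Formalization: Condition (4) as printed does not imply (1) (take C = k² over a field k, x = e₁), so σ[C]=σ[A] over *C is added to (4); "all modules/comodules" means those of size at most an arbitrary infinite bound no smaller than A and C. *)

theory Defs
  imports
    "HOL-Algebra.Module"
    "HOL-Algebra.AbelCoset"
    "HOL-Algebra.Generated_Groups"
    "HOL-Algebra.Free_Abelian_Groups"
begin

section \<open>One-sided modules and bimodules over non-commutative rings\<close>

text \<open>The record carries a left and a right action; a right module uses only the second one, and
  then the type of left scalars is irrelevant (usually \<^typ>\<open>unit\<close>), and symmetrically for
  left modules. As usual for modules in HOL-Algebra, the fields for multiplication and one of the
  underlying ring record are junk.\<close>

record ('l, 'm, 'r) bimodule = "('l, 'm) module" +
  rsmult :: "'m \<Rightarrow> 'r \<Rightarrow> 'm" (infixl \<open>\<star>\<index>\<close> 70)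

locale left_module = R?: ring R + M?: abelian_group M for R (structure) and M (structure) +
  assumes lsmult_closed: "\<lbrakk>a \<in> carrier R; m \<in> carrier M\<rbrakk> \<Longrightarrow> a \<odot>\<^bsub>M\<^esub> m \<in> carrier M"
    and lsmult_l_distr: "\<lbrakk>a \<in> carrier R; b \<in> carrier R; m \<in> carrier M\<rbrakk> \<Longrightarrow>
      (a \<oplus>\<^bsub>R\<^esub> b) \<odot>\<^bsub>M\<^esub> m = a \<odot>\<^bsub>M\<^esub> m \<oplus>\<^bsub>M\<^esub> b \<odot>\<^bsub>M\<^esub> m"
    and lsmult_r_distr: "\<lbrakk>a \<in> carrier R; m \<in> carrier M; n \<in> carrier M\<rbrakk> \<Longrightarrow>
      a \<odot>\<^bsub>M\<^esub> (m \<oplus>\<^bsub>M\<^esub> n) = a \<odot>\<^bsub>M\<^esub> m \<oplus>\<^bsub>M\<^esub> a \<odot>\<^bsub>M\<^esub> n"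
    and lsmult_assoc: "\<lbrakk>a \<in> carrier R; b \<in> carrier R; m \<in> carrier M\<rbrakk> \<Longrightarrow>
      (a \<otimes>\<^bsub>R\<^esub> b) \<odot>\<^bsub>M\<^esub> m = a \<odot>\<^bsub>M\<^esub> (b \<odot>\<^bsub>M\<^esub> m)"
    and lsmult_one: "m \<in> carrier M \<Longrightarrow> \<one>\<^bsub>R\<^esub> \<odot>\<^bsub>M\<^esub> m = m"

locale right_module = R?: ring R + M?: abelian_group M for R (structure) and M (structure) +
  assumes rsmult_closed: "\<lbrakk>m \<in> carrier M; a \<in> carrier R\<rbrakk> \<Longrightarrow> m \<star>\<^bsub>M\<^esub> a \<in> carrier M"
    and rsmult_l_distr: "\<lbrakk>m \<in> carrier M; n \<in> carrier M; a \<in> carrier R\<rbrakk> \<Longrightarrow>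
      (m \<oplus>\<^bsub>M\<^esub> n) \<star>\<^bsub>M\<^esub> a = m \<star>\<^bsub>M\<^esub> a \<oplus>\<^bsub>M\<^esub> n \<star>\<^bsub>M\<^esub> a"
    and rsmult_r_distr: "\<lbrakk>m \<in> carrier M; a \<in> carrier R; b \<in> carrier R\<rbrakk> \<Longrightarrow>
      m \<star>\<^bsub>M\<^esub> (a \<oplus>\<^bsub>R\<^esub> b) = m \<star>\<^bsub>M\<^esub> a \<oplus>\<^bsub>M\<^esub> m \<star>\<^bsub>M\<^esub> b"
    and rsmult_assoc: "\<lbrakk>m \<in> carrier M; a \<in> carrier R; b \<in> carrier R\<rbrakk> \<Longrightarrow>
      m \<star>\<^bsub>M\<^esub> (a \<otimes>\<^bsub>R\<^esub> b) = (m \<star>\<^bsub>M\<^esub> a) \<star>\<^bsub>M\<^esub> b"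
    and rsmult_one: "m \<in> carrier M \<Longrightarrow> m \<star>\<^bsub>M\<^esub> \<one>\<^bsub>R\<^esub> = m"

locale bimodule = left_module R M + right_module T M for R and T and M (structure) +
  assumes smult_rsmult_assoc: "\<lbrakk>a \<in> carrier R; m \<in> carrier M; b \<in> carrier T\<rbrakk> \<Longrightarrow>
      (a \<odot>\<^bsub>M\<^esub> m) \<star>\<^bsub>M\<^esub> b = a \<odot>\<^bsub>M\<^esub> (m \<star>\<^bsub>M\<^esub> b)"

text \<open>The ring itself, with the actions by multiplication. For a subring \<open>B\<close> of \<open>A\<close>, it also serves
  as \<open>A\<close> regarded as a \<open>(B,A)\<close>- or \<open>(A,B)\<close>-bimodule.\<close>

definition regular :: "('a, 'z) ring_scheme \<Rightarrow> ('a, 'a, 'a) bimodule" where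
  "regular A = \<lparr>carrier = carrier A, monoid.mult = mult A, one = \<one>\<^bsub>A\<^esub>, ring.zero = \<zero>\<^bsub>A\<^esub>, add = add A,
     smult = mult A, rsmult = mult A\<rparr>"

definition additive_map ::
  "('m, 'x) ring_scheme \<Rightarrow> ('n, 'y) ring_scheme \<Rightarrow> ('m \<Rightarrow> 'n) \<Rightarrow> bool" where
  "additive_map M N f \<longleftrightarrow> f \<in> carrier M \<rightarrow> carrier N \<and>
     (\<forall>m\<in>carrier M. \<forall>m'\<in>carrier M. f (m \<oplus>\<^bsub>M\<^esub> m') = f m \<oplus>\<^bsub>N\<^esub> f m')"

definition left_linear ::
  "('r, 'z) ring_scheme \<Rightarrow> ('r, 'm, 'x) module_scheme \<Rightarrow> ('r, 'n, 'y) module_scheme \<Rightarrow>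
   ('m \<Rightarrow> 'n) \<Rightarrow> bool" where
  "left_linear R M N f \<longleftrightarrow> additive_map M N f \<and>
     (\<forall>a\<in>carrier R. \<forall>m\<in>carrier M. f (a \<odot>\<^bsub>M\<^esub> m) = a \<odot>\<^bsub>N\<^esub> f m)"

definition right_linear ::
  "('r, 'z) ring_scheme \<Rightarrow> ('l, 'm, 'r, 'x) bimodule_scheme \<Rightarrow> ('k, 'n, 'r, 'y) bimodule_scheme \<Rightarrow>
   ('m \<Rightarrow> 'n) \<Rightarrow> bool" where
  "right_linear R M N f \<longleftrightarrow> additive_map M N f \<and>
     (\<forall>m\<in>carrier M. \<forall>a\<in>carrier R. f (m \<star>\<^bsub>M\<^esub> a) = f m \<star>\<^bsub>N\<^esub> a)"

text \<open>Morphism sets consist of extensional functions, so that equality of morphisms is equality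
  of functions.\<close>

definition right_hom ::
  "('r, 'z) ring_scheme \<Rightarrow> ('l, 'm, 'r, 'x) bimodule_scheme \<Rightarrow> ('k, 'n, 'r, 'y) bimodule_scheme \<Rightarrow>
   ('m \<Rightarrow> 'n) set" where
  "right_hom R M N = {f \<in> extensional (carrier M). right_linear R M N f}"

definition right_iso ::
  "('r, 'z) ring_scheme \<Rightarrow> ('l, 'm, 'r, 'x) bimodule_scheme \<Rightarrow> ('k, 'n, 'r, 'y) bimodule_scheme \<Rightarrow>
   ('m \<Rightarrow> 'n) \<Rightarrow> bool" where
  "right_iso R M N f \<longleftrightarrow> f \<in> right_hom R M N \<and>
     (\<exists>g\<in>right_hom R N M. (\<forall>m\<in>carrier M. g (f m) = m) \<and> (\<forall>n\<in>carrier N. f (g n) = n))"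

locale right_submodule = subgroup K "add_monoid M"
  for K and R :: "('r, 'z) ring_scheme" and M (structure) +
  assumes rsmult_closed: "\<lbrakk>m \<in> K; a \<in> carrier R\<rbrakk> \<Longrightarrow> m \<star>\<^bsub>M\<^esub> a \<in> K"


section \<open>Tensor products\<close>

text \<open>\<open>M \<otimes>\<^sub>R N\<close> is the free abelian group on \<open>M \<times> N\<close> modulo the subgroup generated by the usual
  relations.\<close>

type_synonym ('m, 'n) tensor = "('m \<times> 'n \<Rightarrow>\<^sub>0 int) set"

definition tensor_relations ::
  "('r, 'z) ring_scheme \<Rightarrow> ('l, 'm, 'r, 'x) bimodule_scheme \<Rightarrow> ('r, 'n, 'y) module_scheme \<Rightarrow>
   ('m \<times> 'n \<Rightarrow>\<^sub>0 int) set" where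
  "tensor_relations R M N =
     {frag_of (m \<oplus>\<^bsub>M\<^esub> m', n) - frag_of (m, n) - frag_of (m', n) | m m' n.
        m \<in> carrier M \<and> m' \<in> carrier M \<and> n \<in> carrier N} \<union>
     {frag_of (m, n \<oplus>\<^bsub>N\<^esub> n') - frag_of (m, n) - frag_of (m, n') | m n n'.
        m \<in> carrier M \<and> n \<in> carrier N \<and> n' \<in> carrier N} \<union>
     {frag_of (m \<star>\<^bsub>M\<^esub> a, n) - frag_of (m, a \<odot>\<^bsub>N\<^esub> n) | m a n.
        m \<in> carrier M \<and> a \<in> carrier R \<and> n \<in> carrier N}"

definition tensor_kernel ::
  "('r, 'z) ring_scheme \<Rightarrow> ('l, 'm, 'r, 'x) bimodule_scheme \<Rightarrow> ('r, 'n, 'y) module_scheme \<Rightarrow>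
   ('m \<times> 'n \<Rightarrow>\<^sub>0 int) set" where
  "tensor_kernel R M N =
     generate (free_Abelian_group (carrier M \<times> carrier N)) (tensor_relations R M N)"

definition tensor_group ::
  "('r, 'z) ring_scheme \<Rightarrow> ('l, 'm, 'r, 'x) bimodule_scheme \<Rightarrow> ('r, 'n, 'y) module_scheme \<Rightarrow>
   ('m, 'n) tensor monoid" where
  "tensor_group R M N = free_Abelian_group (carrier M \<times> carrier N) Mod tensor_kernel R M N"

definition pure_tensor ::
  "('r, 'z) ring_scheme \<Rightarrow> ('l, 'm, 'r, 'x) bimodule_scheme \<Rightarrow> ('r, 'n, 'y) module_scheme \<Rightarrow>
   'm \<Rightarrow> 'n \<Rightarrow> ('m, 'n) tensor" where
  "pure_tensor R M N m n =
     tensor_kernel R M N #>\<^bsub>free_Abelian_group (carrier M \<times> carrier N)\<^esub> frag_of (m, n)"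

text \<open>The additive map \<open>M \<otimes>\<^sub>R N \<rightarrow> P\<close> with \<open>m \<otimes> n \<mapsto> b m n\<close> induced by an \<open>R\<close>-balanced biadditive
  map \<open>b\<close>: evaluate any representative \<open>u\<close> of the coset \<open>t\<close>.\<close>

definition tensor_lift ::
  "('p, 'z) ring_scheme \<Rightarrow> ('m \<Rightarrow> 'n \<Rightarrow> 'p) \<Rightarrow> ('m, 'n) tensor \<Rightarrow> 'p" where
  "tensor_lift P b t = the_elem
     ((\<lambda>u. \<Oplus>\<^bsub>P\<^esub>p\<in>Poly_Mapping.keys u. [Poly_Mapping.lookup u p] \<cdot>\<^bsub>P\<^esub> b (fst p) (snd p)) ` t)"

definition tensor_add ::
  "('r, 'z) ring_scheme \<Rightarrow> ('l, 'm, 'r, 'x) bimodule_scheme \<Rightarrow> ('r, 'n, 'y) module_scheme \<Rightarrow>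
   ('m, 'n) tensor ring" where
  "tensor_add R M N =
     \<lparr>carrier = carrier (tensor_group R M N), monoid.mult = undefined, one = undefined,
      ring.zero = \<one>\<^bsub>tensor_group R M N\<^esub>, add = mult (tensor_group R M N)\<rparr>"

definition tensor_prod ::
  "('r, 'z) ring_scheme \<Rightarrow> ('l, 'm, 'r, 'x) bimodule_scheme \<Rightarrow> ('r, 'n, 's, 'y) bimodule_scheme \<Rightarrow>
   ('l, ('m, 'n) tensor, 's) bimodule" where
  "tensor_prod R M N =
     \<lparr>carrier = carrier (tensor_add R M N), monoid.mult = undefined, one = undefined,
      ring.zero = \<zero>\<^bsub>tensor_add R M N\<^esub>, add = add (tensor_add R M N),
      smult = (\<lambda>a. tensor_lift (tensor_add R M N) (\<lambda>m n. pure_tensor R M N (a \<odot>\<^bsub>M\<^esub> m) n)),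
      rsmult = (\<lambda>t a. tensor_lift (tensor_add R M N) (\<lambda>m n. pure_tensor R M N m (n \<star>\<^bsub>N\<^esub> a)) t)\<rparr>"

definition tensor_map ::
  "('r, 'z) ring_scheme \<Rightarrow>
   ('l, 'm, 'r, 'x) bimodule_scheme \<Rightarrow> ('r, 'n, 's, 'y) bimodule_scheme \<Rightarrow>
   ('k, 'm', 'r, 'x') bimodule_scheme \<Rightarrow> ('r, 'n', 's, 'y') bimodule_scheme \<Rightarrow>
   ('m \<Rightarrow> 'm') \<Rightarrow> ('n \<Rightarrow> 'n') \<Rightarrow> ('m, 'n) tensor \<Rightarrow> ('m', 'n') tensor" where
  "tensor_map R M N M' N' f g =
     (\<lambda>t\<in>carrier (tensor_prod R M N).
        tensor_lift (tensor_prod R M' N') (\<lambda>m n. pure_tensor R M' N' (f m) (g n)) t)"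

text \<open>The associativity isomorphism \<open>(M \<otimes>\<^sub>R N) \<otimes>\<^sub>T P \<rightarrow> M \<otimes>\<^sub>R (N \<otimes>\<^sub>T P)\<close> and its inverse.\<close>

definition tensor_assoc ::
  "('r, 'z) ring_scheme \<Rightarrow> ('t, 'w) ring_scheme \<Rightarrow> ('l, 'm, 'r, 'x) bimodule_scheme \<Rightarrow>
   ('r, 'n, 't, 'y) bimodule_scheme \<Rightarrow> ('t, 'p, 's, 'v) bimodule_scheme \<Rightarrow>
   (('m, 'n) tensor, 'p) tensor \<Rightarrow> ('m, ('n, 'p) tensor) tensor" where
  "tensor_assoc R T M N P =
     (let NP = tensor_prod T N P; Q = tensor_prod R M NP in
      tensor_lift Q (\<lambda>t p. tensor_lift Q (\<lambda>m n. pure_tensor R M NP m (pure_tensor T N P n p)) t))"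

definition tensor_assoc_inv ::
  "('r, 'z) ring_scheme \<Rightarrow> ('t, 'w) ring_scheme \<Rightarrow> ('l, 'm, 'r, 'x) bimodule_scheme \<Rightarrow>
   ('r, 'n, 't, 'y) bimodule_scheme \<Rightarrow> ('t, 'p, 's, 'v) bimodule_scheme \<Rightarrow>
   ('m, ('n, 'p) tensor) tensor \<Rightarrow> (('m, 'n) tensor, 'p) tensor" where
  "tensor_assoc_inv R T M N P =
     (let MN = tensor_prod R M N; Q = tensor_prod T MN P in
      tensor_lift Q (\<lambda>m t. tensor_lift Q (\<lambda>n p. pure_tensor T MN P (pure_tensor R M N m n) p) t))"


section \<open>Module-theoretic notions\<close>

text \<open>A type argument \<^typ>\<open>'u itself\<close> is the universe from which test modules take their
  carriers.\<close>

definition flat_left ::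
  "'u itself \<Rightarrow> ('r, 'z) ring_scheme \<Rightarrow> ('r, 'p, 's, 'x) bimodule_scheme \<Rightarrow> bool" where
  "flat_left U R P \<longleftrightarrow> (\<forall>(M :: (unit, 'u, 'r) bimodule) (N :: (unit, 'u, 'r) bimodule) f.
     right_module R M \<and> right_module R N \<and> f \<in> right_hom R M N \<and> inj_on f (carrier M) \<longrightarrow>
     inj_on (tensor_map R M P N P f (\<lambda>p. p)) (carrier (tensor_prod R M P)))"

definition weak_generator ::
  "'u itself \<Rightarrow> ('r, 'z) ring_scheme \<Rightarrow> ('r, 'p, 's, 'x) bimodule_scheme \<Rightarrow> bool" where
  "weak_generator U R P \<longleftrightarrow> (\<forall>Y :: (unit, 'u, 'r) bimodule.
     right_module R Y \<and> carrier (tensor_prod R Y P) = {\<zero>\<^bsub>tensor_prod R Y P\<^esub>} \<longrightarrow>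
     carrier Y = {\<zero>\<^bsub>Y\<^esub>})"

definition faithfully_flat ::
  "'u itself \<Rightarrow> ('r, 'z) ring_scheme \<Rightarrow> ('r, 'p, 's, 'x) bimodule_scheme \<Rightarrow> bool" where
  "faithfully_flat U R P \<longleftrightarrow> flat_left U R P \<and> weak_generator U R P"

definition fin_gen_left ::
  "('r, 'z) ring_scheme \<Rightarrow> ('r, 'm, 'x) module_scheme \<Rightarrow> 'm set \<Rightarrow> bool" where
  "fin_gen_left R W F \<longleftrightarrow> submodule F R W \<and>
     (\<exists>E. finite E \<and> E \<subseteq> F \<and> (\<forall>K. submodule K R W \<and> E \<subseteq> K \<longrightarrow> F \<subseteq> K))"

definition locally_projective ::
  "'u itself \<Rightarrow> ('r, 'z) ring_scheme \<Rightarrow> ('r, 'm, 'x) module_scheme \<Rightarrow> bool" where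
  "locally_projective U R W \<longleftrightarrow> (\<forall>(L :: ('r, 'u) module) (N :: ('r, 'u) module) p g F.
     left_module R L \<and> left_module R N \<and>
     left_linear R L N p \<and> p ` carrier L = carrier N \<and>
     left_linear R W N g \<and> fin_gen_left R W F \<longrightarrow>
     (\<exists>g'. left_linear R W L g' \<and> (\<forall>w\<in>F. p (g' w) = g w)))"

definition direct_sum ::
  "'i set \<Rightarrow> ('l, 'w, 'r, 'x) bimodule_scheme \<Rightarrow> (unit, 'i \<Rightarrow> 'w, 'r) bimodule" where
  "direct_sum I W =
     \<lparr>carrier = {v \<in> I \<rightarrow>\<^sub>E carrier W. finite {i \<in> I. v i \<noteq> \<zero>\<^bsub>W\<^esub>}},
      monoid.mult = undefined, one = undefined,
      ring.zero = (\<lambda>i\<in>I. \<zero>\<^bsub>W\<^esub>), add = (\<lambda>v w. \<lambda>i\<in>I. v i \<oplus>\<^bsub>W\<^esub> w i),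
      smult = undefined, rsmult = (\<lambda>v a. \<lambda>i\<in>I. v i \<star>\<^bsub>W\<^esub> a)\<rparr>"

text \<open>\<open>Gen(W)\<close>. Index sets in the type \<^typ>\<open>'w \<Rightarrow> 'm\<close> suffice: an epimorphism from a direct sum of
  copies of \<open>W\<close> onto \<open>M\<close> is a family of homomorphisms \<open>W \<rightarrow> M\<close>, and repeated members of the family
  do not contribute to its image.\<close>

definition generated_by ::
  "('r, 'z) ring_scheme \<Rightarrow> ('k, 'w, 'r, 'x) bimodule_scheme \<Rightarrow> ('l, 'm, 'r) bimodule set" where
  "generated_by T W = {M. right_module T M \<and>
     (\<exists>(I :: ('w \<Rightarrow> 'm) set) p.
        p \<in> right_hom T (direct_sum I W) M \<and> p ` carrier (direct_sum I W) = carrier M)}"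

text \<open>The objects of \<open>\<sigma>[W]\<close> with carriers in the universe \<^typ>\<open>'u\<close>.\<close>

definition subgenerated_by ::
  "('r, 'z) ring_scheme \<Rightarrow> ('k, 'w, 'r, 'x) bimodule_scheme \<Rightarrow> (unit, 'u, 'r) bimodule set" where
  "subgenerated_by T W = {M. right_module T M \<and>
     (\<exists>(G :: (unit, 'u, 'r) bimodule) K f.
        G \<in> generated_by T W \<and> right_submodule K T G \<and> right_iso T M (G\<lparr>carrier := K\<rparr>) f)}"

definition generates_submodules ::
  "('r, 'z) ring_scheme \<Rightarrow> ('l, 'p, 'r) bimodule \<Rightarrow> bool" where
  "generates_submodules T P \<longleftrightarrow>
     (\<forall>K. right_submodule K T P \<longrightarrow> P\<lparr>carrier := K\<rparr> \<in> generated_by T P)"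

definition quotient_module ::
  "('l, 'm, 'r, 'x) bimodule_scheme \<Rightarrow> 'm set \<Rightarrow> (unit, 'm set, 'r) bimodule" where
  "quotient_module M K =
     \<lparr>carrier = a_rcosets\<^bsub>M\<^esub> K, monoid.mult = undefined, one = undefined,
      ring.zero = K, add = set_add M,
      smult = undefined, rsmult = (\<lambda>X a. \<Union>m\<in>X. K +>\<^bsub>M\<^esub> (m \<star>\<^bsub>M\<^esub> a))\<rparr>"

definition quasiprojective ::
  "('r, 'z) ring_scheme \<Rightarrow> ('l, 'p, 'r, 'x) bimodule_scheme \<Rightarrow> bool" where
  "quasiprojective T P \<longleftrightarrow> (\<forall>K q g. right_submodule K T P \<and>
     q \<in> right_hom T P (quotient_module P K) \<and>
     q ` carrier P = carrier (quotient_module P K) \<and>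
     g \<in> right_hom T P (quotient_module P K) \<longrightarrow>
     (\<exists>h\<in>right_hom T P P. \<forall>p\<in>carrier P. q (h p) = g p))"

definition finitely_generated_right ::
  "('r, 'z) ring_scheme \<Rightarrow> ('l, 'p, 'r, 'x) bimodule_scheme \<Rightarrow> bool" where
  "finitely_generated_right T P \<longleftrightarrow> (\<exists>E. finite E \<and> E \<subseteq> carrier P \<and>
     (\<forall>K. right_submodule K T P \<and> E \<subseteq> K \<longrightarrow> K = carrier P))"

definition quasiprogenerator ::
  "('r, 'z) ring_scheme \<Rightarrow> ('l, 'p, 'r) bimodule \<Rightarrow> bool" where
  "quasiprogenerator T P \<longleftrightarrow>
     finitely_generated_right T P \<and> quasiprojective T P \<and> generates_submodules T P"


section \<open>Corings and comodules\<close>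

record ('a, 'c) coring = "('a, 'c, 'a) bimodule" +
  comult :: "'c \<Rightarrow> ('c, 'c) tensor"
  counit :: "'c \<Rightarrow> 'a"

locale coring = C?: bimodule A A C for A (structure) and C :: "('a, 'c, 'x) coring_scheme" (structure) +
  assumes comult_left_linear: "left_linear A C (tensor_prod A C C) (comult C)"
    and comult_right_linear: "right_linear A C (tensor_prod A C C) (comult C)"
    and counit_left_linear: "left_linear A C (regular A) (counit C)"
    and counit_right_linear: "right_linear A C (regular A) (counit C)"
    and coassoc: "c \<in> carrier C \<Longrightarrow>
      tensor_assoc A A C C C (tensor_map A C C (tensor_prod A C C) C (comult C) (\<lambda>d. d) (comult C c)) =
      tensor_map A C C C (tensor_prod A C C) (\<lambda>d. d) (comult C) (comult C c)"
    and counit_left: "c \<in> carrier C \<Longrightarrow> tensor_lift C (\<lambda>d e. counit C d \<odot>\<^bsub>C\<^esub> e) (comult C c) = c"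
    and counit_right: "c \<in> carrier C \<Longrightarrow> tensor_lift C (\<lambda>d e. d \<star>\<^bsub>C\<^esub> counit C e) (comult C c) = c"

definition group_like :: "('a, 'z) ring_scheme \<Rightarrow> ('a, 'c, 'x) coring_scheme \<Rightarrow> 'c \<Rightarrow> bool" where
  "group_like A C x \<longleftrightarrow>
     x \<in> carrier C \<and> comult C x = pure_tensor A C C x x \<and> counit C x = \<one>\<^bsub>A\<^esub>"

record ('l, 'm, 'a, 'c) comodule = "('l, 'm, 'a) bimodule" +
  coaction :: "'m \<Rightarrow> ('m, 'c) tensor"

locale comodule = M?: right_module A M
  for A (structure) and C :: "('a, 'c, 'x) coring_scheme"
    and M :: "('l, 'm, 'a, 'c, 'y) comodule_scheme" (structure) +
  assumes coaction_linear: "right_linear A M (tensor_prod A M C) (coaction M)"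
    and coaction_coassoc: "m \<in> carrier M \<Longrightarrow>
      tensor_assoc A A M C C (tensor_map A M C (tensor_prod A M C) C (coaction M) (\<lambda>c. c) (coaction M m)) =
      tensor_map A M C M (tensor_prod A C C) (\<lambda>n. n) (comult C) (coaction M m)"
    and coaction_counit: "m \<in> carrier M \<Longrightarrow>
      tensor_lift M (\<lambda>n c. n \<star>\<^bsub>M\<^esub> counit C c) (coaction M m) = m"

definition colinear_maps ::
  "('a, 'z) ring_scheme \<Rightarrow> ('a, 'c, 'x) coring_scheme \<Rightarrow>
   ('l, 'm, 'a, 'c, 'y) comodule_scheme \<Rightarrow> ('k, 'n, 'a, 'c, 'w) comodule_scheme \<Rightarrow> ('m \<Rightarrow> 'n) set" where
  "colinear_maps A C M N = {f \<in> right_hom A M N.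
     \<forall>m\<in>carrier M. coaction N (f m) = tensor_map A M C N C f (\<lambda>c. c) (coaction M m)}"

definition comodule_iso ::
  "('a, 'z) ring_scheme \<Rightarrow> ('a, 'c, 'x) coring_scheme \<Rightarrow>
   ('l, 'm, 'a, 'c, 'y) comodule_scheme \<Rightarrow> ('k, 'n, 'a, 'c, 'w) comodule_scheme \<Rightarrow> ('m \<Rightarrow> 'n) \<Rightarrow> bool" where
  "comodule_iso A C M N f \<longleftrightarrow> f \<in> colinear_maps A C M N \<and>
     (\<exists>g\<in>colinear_maps A C N M. (\<forall>m\<in>carrier M. g (f m) = m) \<and> (\<forall>n\<in>carrier N. f (g n) = n))"

definition with_coaction ::
  "('l, 'm, 'a) bimodule \<Rightarrow> ('m \<Rightarrow> ('m, 'c) tensor) \<Rightarrow> ('l, 'm, 'a, 'c) comodule" where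
  "with_coaction M \<rho> = bimodule.extend M (comodule.fields \<rho>)"

text \<open>\<open>A\<close> as a right comodule by \<open>a \<mapsto> xa\<close>, which is \<open>1 \<otimes> xa\<close> in \<open>A \<otimes>\<^sub>A C\<close>; and \<open>C\<close> as a right
  comodule.\<close>

definition ring_comodule ::
  "('a, 'z) ring_scheme \<Rightarrow> ('a, 'c, 'x) coring_scheme \<Rightarrow> 'c \<Rightarrow> ('a, 'a, 'a, 'c) comodule" where
  "ring_comodule A C x = with_coaction (regular A)
     (\<lambda>a. pure_tensor A (regular A) C \<one>\<^bsub>A\<^esub> (x \<star>\<^bsub>C\<^esub> a))"

definition coring_comodule :: "('a, 'c, 'x) coring_scheme \<Rightarrow> ('a, 'c, 'a, 'c) comodule" where
  "coring_comodule C = with_coaction (bimodule.truncate C) (comult C)"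

definition coinvariants ::
  "('a, 'z) ring_scheme \<Rightarrow> ('a, 'c, 'x) coring_scheme \<Rightarrow> 'c \<Rightarrow>
   ('l, 'm, 'a, 'c, 'y) comodule_scheme \<Rightarrow> 'm set" where
  "coinvariants A C x M = {m \<in> carrier M. coaction M m = pure_tensor A M C m x}"

definition coinvariant_ring :: "'a ring \<Rightarrow> ('a, 'c, 'x) coring_scheme \<Rightarrow> 'c \<Rightarrow> 'a ring" where
  "coinvariant_ring A C x = A\<lparr>carrier := coinvariants A C x (ring_comodule A C x)\<rparr>"

definition coinvariant_module ::
  "('a, 'z) ring_scheme \<Rightarrow> ('a, 'c, 'x) coring_scheme \<Rightarrow> 'c \<Rightarrow>
   ('l, 'm, 'a, 'c, 'y) comodule_scheme \<Rightarrow> ('l, 'm, 'a) bimodule" where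
  "coinvariant_module A C x M = (bimodule.truncate M)\<lparr>carrier := coinvariants A C x M\<rparr>"

text \<open>The comodule \<open>N \<otimes>\<^sub>B A\<close> with coaction \<open>id\<^sub>N \<otimes>\<^sub>B \<rho>\<^sub>A\<close>, where \<open>N \<otimes>\<^sub>B (A \<otimes>\<^sub>A C)\<close> is identified with
  \<open>(N \<otimes>\<^sub>B A) \<otimes>\<^sub>A C\<close>.\<close>

definition induced_comodule ::
  "'a ring \<Rightarrow> ('a, 'c, 'x) coring_scheme \<Rightarrow> 'c \<Rightarrow> ('l, 'n, 'a, 'y) bimodule_scheme \<Rightarrow>
   ('l, ('n, 'a) tensor, 'a, 'c) comodule" where
  "induced_comodule A C x N =
     (let B = coinvariant_ring A C x; AA = regular A in
      with_coaction (tensor_prod B N AA)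
        (\<lambda>t. tensor_assoc_inv B A N AA C
           (tensor_map B N AA N (tensor_prod A AA C) (\<lambda>n. n) (coaction (ring_comodule A C x)) t)))"

definition unit_\<Phi> ::
  "'a ring \<Rightarrow> ('a, 'c, 'x) coring_scheme \<Rightarrow> 'c \<Rightarrow> ('l, 'n, 'a, 'y) bimodule_scheme \<Rightarrow>
   'n \<Rightarrow> ('n, 'a) tensor" where
  "unit_\<Phi> A C x N =
     (\<lambda>n\<in>carrier N. pure_tensor (coinvariant_ring A C x) N (regular A) n \<one>\<^bsub>A\<^esub>)"

definition counit_\<Psi> ::
  "'a ring \<Rightarrow> ('a, 'c, 'x) coring_scheme \<Rightarrow> 'c \<Rightarrow> ('l, 'm, 'a, 'c, 'y) comodule_scheme \<Rightarrow>
   ('m, 'a) tensor \<Rightarrow> 'm" where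
  "counit_\<Psi> A C x M =
     (\<lambda>t\<in>carrier (tensor_prod (coinvariant_ring A C x) (coinvariant_module A C x M) (regular A)).
        tensor_lift M (\<lambda>m a. m \<star>\<^bsub>M\<^esub> a) t)"

definition strong_structure_theorem ::
  "'u itself \<Rightarrow> 'a ring \<Rightarrow> ('a, 'c, 'x) coring_scheme \<Rightarrow> 'c \<Rightarrow> bool" where
  "strong_structure_theorem U A C x \<longleftrightarrow>
     (\<forall>M :: (unit, 'u, 'a, 'c) comodule. comodule A C M \<longrightarrow>
        comodule_iso A C (induced_comodule A C x (coinvariant_module A C x M)) M (counit_\<Psi> A C x M)) \<and>
     (\<forall>N :: (unit, 'u, 'a) bimodule. right_module (coinvariant_ring A C x) N \<longrightarrow>
        right_iso (coinvariant_ring A C x) N (coinvariant_module A C x (induced_comodule A C x N))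
          (unit_\<Phi> A C x N))"

text \<open>\<open>Hom\<^sup>C(A, M)\<close> is a right \<open>B\<close>-module by \<open>(fb)(a) = f(ba)\<close>.\<close>

definition colinear_hom_module ::
  "('a, 'z) ring_scheme \<Rightarrow> ('a, 'c, 'x) coring_scheme \<Rightarrow> 'c \<Rightarrow>
   ('l, 'm, 'a, 'c, 'y) comodule_scheme \<Rightarrow> (unit, 'a \<Rightarrow> 'm, 'a) bimodule" where
  "colinear_hom_module A C x M =
     \<lparr>carrier = colinear_maps A C (ring_comodule A C x) M, monoid.mult = undefined, one = undefined,
      ring.zero = (\<lambda>a\<in>carrier A. \<zero>\<^bsub>M\<^esub>), add = (\<lambda>f g. \<lambda>a\<in>carrier A. f a \<oplus>\<^bsub>M\<^esub> g a),
      smult = undefined, rsmult = (\<lambda>f b. \<lambda>a\<in>carrier A. f (b \<otimes>\<^bsub>A\<^esub> a))\<rparr>"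

definition counit_\<Psi>' ::
  "'a ring \<Rightarrow> ('a, 'c, 'x) coring_scheme \<Rightarrow> 'c \<Rightarrow> ('l, 'm, 'a, 'c, 'y) comodule_scheme \<Rightarrow>
   ('a \<Rightarrow> 'm, 'a) tensor \<Rightarrow> 'm" where
  "counit_\<Psi>' A C x M =
     (\<lambda>t\<in>carrier (tensor_prod (coinvariant_ring A C x) (colinear_hom_module A C x M) (regular A)).
        tensor_lift M (\<lambda>f a. f a) t)"

definition bijective_\<Psi>' ::
  "'a ring \<Rightarrow> ('a, 'c, 'x) coring_scheme \<Rightarrow> 'c \<Rightarrow> ('l, 'm, 'a, 'c, 'y) comodule_scheme \<Rightarrow> bool" where
  "bijective_\<Psi>' A C x M \<longleftrightarrow> bij_betw (counit_\<Psi>' A C x M)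
     (carrier (tensor_prod (coinvariant_ring A C x) (colinear_hom_module A C x M) (regular A)))
     (carrier M)"

definition galois :: "'a ring \<Rightarrow> ('a, 'c, 'x) coring_scheme \<Rightarrow> 'c \<Rightarrow> bool" where
  "galois A C x \<longleftrightarrow> bij_betw (tensor_lift C (\<lambda>a' a. (a' \<odot>\<^bsub>C\<^esub> x) \<star>\<^bsub>C\<^esub> a))
     (carrier (tensor_prod (coinvariant_ring A C x) (regular A) (regular A))) (carrier C)"


section \<open>The left dual ring\<close>

definition dual_ring :: "('a, 'z) ring_scheme \<Rightarrow> ('a, 'c, 'x) coring_scheme \<Rightarrow> ('c \<Rightarrow> 'a) ring" where
  "dual_ring A C =
     \<lparr>carrier = {f \<in> extensional (carrier C). left_linear A C (regular A) f},
      monoid.mult = (\<lambda>f g. \<lambda>c\<in>carrier C. tensor_lift A (\<lambda>d e. g (d \<star>\<^bsub>C\<^esub> f e)) (comult C c)),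
      one = restrict (counit C) (carrier C),
      ring.zero = (\<lambda>c\<in>carrier C. \<zero>\<^bsub>A\<^esub>),
      add = (\<lambda>f g. \<lambda>c\<in>carrier C. f c \<oplus>\<^bsub>A\<^esub> g c)\<rparr>"

text \<open>The right module over the dual ring underlying a comodule.\<close>

definition dual_module ::
  "('l, 'm, 'a, 'c, 'y) comodule_scheme \<Rightarrow> (unit, 'm, 'c \<Rightarrow> 'a) bimodule" where
  "dual_module M =
     \<lparr>carrier = carrier M, monoid.mult = undefined, one = undefined,
      ring.zero = \<zero>\<^bsub>M\<^esub>, add = add M, smult = undefined,
      rsmult = (\<lambda>m g. tensor_lift M (\<lambda>n c. n \<star>\<^bsub>M\<^esub> g c) (coaction M m))\<rparr>"


section \<open>Equivalences of categories\<close>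

text \<open>\<open>comp \<C> X g f\<close> is the composite of \<open>f\<close>, with domain \<open>X\<close>, and \<open>g\<close>; the argument \<open>X\<close> is needed
  for morphisms that are extensional functions.\<close>

record ('o, 'f) category =
  obj :: "'o set"
  mor :: "'o \<Rightarrow> 'o \<Rightarrow> 'f set"
  ident :: "'o \<Rightarrow> 'f"
  comp :: "'o \<Rightarrow> 'f \<Rightarrow> 'f \<Rightarrow> 'f"

definition is_functor ::
  "('o, 'f) category \<Rightarrow> ('p, 'g) category \<Rightarrow> ('o \<Rightarrow> 'p) \<Rightarrow> ('o \<Rightarrow> 'o \<Rightarrow> 'f \<Rightarrow> 'g) \<Rightarrow> bool" where
  "is_functor \<C> \<D> F Fm \<longleftrightarrow>
     (\<forall>X\<in>obj \<C>. F X \<in> obj \<D>) \<and>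
     (\<forall>X\<in>obj \<C>. \<forall>Y\<in>obj \<C>. \<forall>f\<in>mor \<C> X Y. Fm X Y f \<in> mor \<D> (F X) (F Y)) \<and>
     (\<forall>X\<in>obj \<C>. Fm X X (ident \<C> X) = ident \<D> (F X)) \<and>
     (\<forall>X\<in>obj \<C>. \<forall>Y\<in>obj \<C>. \<forall>Z\<in>obj \<C>. \<forall>f\<in>mor \<C> X Y. \<forall>g\<in>mor \<C> Y Z.
        Fm X Z (comp \<C> X g f) = comp \<D> (F X) (Fm Y Z g) (Fm X Y f))"

definition iso_in :: "('o, 'f) category \<Rightarrow> 'o \<Rightarrow> 'o \<Rightarrow> 'f \<Rightarrow> bool" where
  "iso_in \<C> X Y f \<longleftrightarrow> f \<in> mor \<C> X Y \<and>
     (\<exists>g\<in>mor \<C> Y X. comp \<C> X g f = ident \<C> X \<and> comp \<C> Y f g = ident \<C> Y)"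

definition natural_iso_to_id ::
  "('o, 'f) category \<Rightarrow> ('o \<Rightarrow> 'o) \<Rightarrow> ('o \<Rightarrow> 'o \<Rightarrow> 'f \<Rightarrow> 'f) \<Rightarrow> ('o \<Rightarrow> 'f) \<Rightarrow> bool" where
  "natural_iso_to_id \<C> H Hm \<tau> \<longleftrightarrow>
     (\<forall>X\<in>obj \<C>. iso_in \<C> (H X) X (\<tau> X)) \<and>
     (\<forall>X\<in>obj \<C>. \<forall>Y\<in>obj \<C>. \<forall>f\<in>mor \<C> X Y.
        comp \<C> (H X) (\<tau> Y) (Hm X Y f) = comp \<C> (H X) f (\<tau> X))"

definition is_equivalence ::
  "('o, 'f) category \<Rightarrow> ('p, 'g) category \<Rightarrow> ('o \<Rightarrow> 'p) \<Rightarrow> ('o \<Rightarrow> 'o \<Rightarrow> 'f \<Rightarrow> 'g) \<Rightarrow> bool" where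
  "is_equivalence \<C> \<D> F Fm \<longleftrightarrow> is_functor \<C> \<D> F Fm \<and>
     (\<exists>G Gm. is_functor \<D> \<C> G Gm \<and>
        (\<exists>\<tau>. natural_iso_to_id \<C> (\<lambda>X. G (F X)) (\<lambda>X Y f. Gm (F X) (F Y) (Fm X Y f)) \<tau>) \<and>
        (\<exists>\<tau>. natural_iso_to_id \<D> (\<lambda>X. F (G X)) (\<lambda>X Y f. Fm (G X) (G Y) (Gm X Y f)) \<tau>))"

definition comodule_category ::
  "('a, 'z) ring_scheme \<Rightarrow> ('a, 'c, 'x) coring_scheme \<Rightarrow>
   ((unit, 'u, 'a, 'c) comodule, 'u \<Rightarrow> 'u) category" where
  "comodule_category A C =
     \<lparr>obj = {M. comodule A C M}, mor = colinear_maps A C,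
      ident = (\<lambda>M. \<lambda>m\<in>carrier M. m), comp = (\<lambda>M g f. compose (carrier M) g f)\<rparr>"

text \<open>Right \<open>R\<close>-modules that are small with respect to the universe \<^typ>\<open>'u\<close>, but with carriers in
  a type \<^typ>\<open>'n\<close>. For modules of the form \<open>Hom\<^sup>C(A, M)\<close>, \<^typ>\<open>'n\<close> is \<^typ>\<open>'a \<Rightarrow> 'u\<close>; they are small,
  because a colinear map is determined by its value at 1.\<close>

definition module_category ::
  "'u itself \<Rightarrow> ('r, 'z) ring_scheme \<Rightarrow> ((unit, 'n, 'r) bimodule, 'n \<Rightarrow> 'n) category" where
  "module_category U R =
     \<lparr>obj = {N. right_module R N \<and> carrier N \<lesssim> (UNIV :: 'u set)}, mor = right_hom R,
      ident = (\<lambda>N. \<lambda>n\<in>carrier N. n), comp = (\<lambda>N g f. compose (carrier N) g f)\<rparr>"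

definition hom_functor_equivalence ::
  "'u itself \<Rightarrow> 'a ring \<Rightarrow> ('a, 'c, 'x) coring_scheme \<Rightarrow> 'c \<Rightarrow> bool" where
  "hom_functor_equivalence U A C x \<longleftrightarrow>
     is_equivalence
       (comodule_category A C :: ((unit, 'u, 'a, 'c) comodule, 'u \<Rightarrow> 'u) category)
       (module_category U (coinvariant_ring A C x))
       (colinear_hom_module A C x)
       (\<lambda>M N h. \<lambda>f\<in>colinear_maps A C (ring_comodule A C x) M. compose (carrier A) h f)"

text \<open>Projectivity with respect to epimorphisms, i.e. surjective colinear maps.\<close>

definition projective_comodule ::
  "'u itself \<Rightarrow> ('a, 'z) ring_scheme \<Rightarrow> ('a, 'c, 'x) coring_scheme \<Rightarrow>
   ('l, 'p, 'a, 'c, 'y) comodule_scheme \<Rightarrow> bool" where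
  "projective_comodule U A C P \<longleftrightarrow>
     (\<forall>(L :: (unit, 'u, 'a, 'c) comodule) (N :: (unit, 'u, 'a, 'c) comodule) q g.
        comodule A C L \<and> comodule A C N \<and>
        q \<in> colinear_maps A C L N \<and> q ` carrier L = carrier N \<and> g \<in> colinear_maps A C P N \<longrightarrow>
        (\<exists>h\<in>colinear_maps A C P L. \<forall>p\<in>carrier P. q (h p) = g p))"

definition generator_comodule ::
  "'u itself \<Rightarrow> ('a, 'z) ring_scheme \<Rightarrow> ('a, 'c, 'x) coring_scheme \<Rightarrow>
   ('l, 'p, 'a, 'c, 'y) comodule_scheme \<Rightarrow> bool" where
  "generator_comodule U A C P \<longleftrightarrow>
     (\<forall>(M :: (unit, 'u, 'a, 'c) comodule) (N :: (unit, 'u, 'a, 'c) comodule) f g.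
        comodule A C M \<and> comodule A C N \<and>
        f \<in> colinear_maps A C M N \<and> g \<in> colinear_maps A C M N \<and> f \<noteq> g \<longrightarrow>
        (\<exists>h\<in>colinear_maps A C P M. \<exists>p\<in>carrier P. f (h p) \<noteq> g (h p)))"

text \<open>Finite generation is that of the module over the dual ring, in accordance with the
  identification of comodules with modules over the dual ring subgenerated by \<open>C\<close>, so the
  definition is meant for locally projective \<open>C\<close>. (Over \<open>A\<close> the regular comodule is cyclic
  anyway.)\<close>

definition comodule_progenerator ::
  "'u itself \<Rightarrow> ('a, 'z) ring_scheme \<Rightarrow> ('a, 'c, 'x) coring_scheme \<Rightarrow>
   ('l, 'p, 'a, 'c, 'y) comodule_scheme \<Rightarrow> bool" where
  "comodule_progenerator U A C P \<longleftrightarrow>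
     finitely_generated_right (dual_ring A C) (dual_module P) \<and>
     projective_comodule U A C P \<and> generator_comodule U A C P"

end

theory Submission
  imports Defs
begin

text \<open>Write \<open>co M\<close> for the coinvariants of \<open>M\<close>, so that \<open>\<Psi>\<close> is the map \<open>m \<otimes> a \<mapsto> ma\<close> on \<open>co M \<otimes>\<^sub>B A\<close>.

  For (2) \<open>\<Longrightarrow>\<close> (1), the Galois map induces isomorphisms \<open>M \<otimes>\<^sub>B A \<rightarrow> M \<otimes>\<^sub>A C\<close>, \<open>m \<otimes> a \<mapsto> m \<otimes> xa\<close>. They
  identify the coaction of \<open>M\<close> with an equalizer, and \<open>co M \<otimes>\<^sub>B A\<close> with the same equalizer by flatness.
  Conversely, \<open>\<Psi>\<close> for the comodule \<open>C\<close> is the Galois map, and (1) together with flatness of \<open>C\<close> makes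
  \<open>- \<otimes>\<^sub>B A\<close> exact and faithful.

  If \<open>C\<close> is locally projective, homomorphisms from \<open>A\<close> to a comodule are evaluations at coinvariants.
  So \<open>A\<close> is quasiprojective iff elements of \<open>A\<close> that are coinvariant modulo a submodule lift to \<open>B\<close>, and it
  generates its submodules iff these are spanned by coinvariants. Both properties pass from \<open>A\<close> to the
  modules spanned by finitely many coinvariants, by induction on their number. For \<open>co M \<otimes>\<^sub>B A\<close>, spanned
  by the coinvariants \<open>m \<otimes> 1\<close>, this means that \<open>\<Phi>\<close> is onto and that the kernel of \<open>\<Psi>\<close> is generated by
  elements \<open>m \<otimes> 1\<close>, for which \<open>m = \<Psi>(m \<otimes> 1) = 0\<close>; and a module in \<open>\<sigma>[A]\<close>, hence every comodule if
  \<open>\<sigma>[A] = \<sigma>[C]\<close>, is spanned by coinvariants, so \<open>\<Psi>\<close> is onto.\<close>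

\<comment> \<open>The definitions test modules and comodules with carriers in one type
  \<open>'u\<close>, but the argument applies them to tensor products, kernels, quotients, free
  modules and to A and C themselves, which live in other types. Every such hypothesis is therefore
  extended to all small objects by transport of structure, and an infinite \<open>'u\<close> that
  holds A and C stays closed under the tensor products that occur. Local projectivity enters through
  finite dual bases only. They show that a tensor in M \<otimes> C is determined by its evaluations
  at functionals, and that a module over the dual ring is a comodule as soon as each element is
  annihilated by the functionals vanishing on some finite subset of C. Hence submodules and
  quotients of A are comodules. In the conditions on A over the dual ring, A is not known to be flat
  over B, so injectivity of \<Phi> cannot come from descent; it is read off a free cover of N, whose
  coordinates separate elements. In the condition on Gen(A), the cyclic comodules A/K decide: their
  coinvariants come from B because \<Psi> is injective and A is a weak generator.\<close>
text \<open>A subscript names the structure to which an operation belongs, and \<open>m : M\<close> means that \<open>m\<close> is an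
 element of the carrier of \<open>M\<close>.\<close>

syntax "_index_sub" :: "logic => index"  ("\<^sub>_" [1000] 1000)
translations "_index_sub x" \<rightharpoonup> "_index x"

unbundle no member_ASCII_syntax
abbreviation elem :: "'a => ('a, 'b) partial_object_scheme => bool" (infix ":" 50) where
 "m : M \<equiv> m \<in> carrier M"

section \<open>Additive maps\<close>

lemma minus_zero_iff:
 assumes "abelian_group M" "m : M" "m' : M"
 shows "m \<ominus>\<^sub>M m' = \<zero>\<^sub>M \<longleftrightarrow> m = m'"
proof -
 interpret abelian_group M by fact
 have "m \<ominus>\<^sub>M m' \<oplus>\<^sub>M m' = m" using assms(2,3) by (simp add: minus_eq a_assoc l_neg)
 moreover have "m' \<ominus>\<^sub>M m' = \<zero>\<^sub>M" using assms(3) by (simp add: minus_eq r_neg)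
 ultimately show ?thesis using assms by (auto simp del: minus_eq)
qed

lemma additive_map_iff_hom: "additive_map M N f \<longleftrightarrow> f \<in> hom (add_monoid M) (add_monoid N)"
 by (auto simp: additive_map_def hom_def)

lemma additiveI:
 assumes "!!m. m : M ==> f m : N"
  and "!!m m'. [|m : M; m' : M|] ==> f (m \<oplus>\<^sub>M m') = f m \<oplus>\<^sub>N f m'"
 shows "additive_map M N f"
 using assms by (auto simp: additive_map_def)

lemma additive_closed: "[|additive_map M N f; m : M|] ==> f m : N"
 by (auto simp: additive_map_def)

lemma additive_add:
 "[|additive_map M N f; m : M; m' : M|] ==> f (m \<oplus>\<^sub>M m') = f m \<oplus>\<^sub>N f m'"
 by (auto simp: additive_map_def)

lemma additive_map_group_hom:
 assumes "abelian_group M" "abelian_group N" "additive_map M N f"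
 shows "group_hom (add_monoid M) (add_monoid N) f"
 using assms abelian_group.a_group[of M] abelian_group.a_group[of N]
 by (simp add: group_hom_def group_hom_axioms_def additive_map_iff_hom)

lemma additive_zero:
 assumes "abelian_group M" "abelian_group N" "additive_map M N f"
 shows "f \<zero>\<^sub>M = \<zero>\<^sub>N"
 using group_hom.hom_one[OF additive_map_group_hom[OF assms]] by simp

lemma additive_uminus:
 assumes "abelian_group M" "abelian_group N" "additive_map M N f" "m : M"
 shows "f (\<ominus>\<^sub>M m) = \<ominus>\<^sub>N f m"
 using group_hom.hom_inv[OF additive_map_group_hom[OF assms(1-3)], of m] assms(4)
 by (simp add: a_inv_def)

lemma additive_minus:
 assumes "abelian_group M" "abelian_group N" "additive_map M N f" "m : M" "m' : M"
 shows "f (m \<ominus>\<^sub>M m') = f m \<ominus>\<^sub>N f m'"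
 using assms by (simp add: a_minus_def additive_add additive_uminus
   abelian_group.a_inv_closed)

lemma additive_inj:
 assumes "abelian_group M" "abelian_group N" "additive_map M N f"
  and "!!m. [|m : M; f m = \<zero>\<^sub>N|] ==> m = \<zero>\<^sub>M"
 shows "inj_on f (carrier M)"
proof (rule inj_onI)
 interpret M: abelian_group M by fact
 interpret N: abelian_group N by fact
 fix m m' assume m: "m : M" "m' : M" "f m = f m'"
 then have "f (m \<ominus>\<^sub>M m') = \<zero>\<^sub>N"
  using assms(3) by (simp add: additive_minus[OF assms(1-3)] additive_closed N.minus_eq N.r_neg)
 then have "m \<ominus>\<^sub>M m' = \<zero>\<^sub>M" using m assms(4) by simp
 then show "m = m'" using m by (simp add: minus_zero_iff[OF assms(1)])
qed

lemma additive_comp: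
 "[|additive_map M N f; additive_map N P g|] ==> additive_map M P (\<lambda>m. g (f m))"
 by (auto simp: additive_map_def Pi_iff)

lemma additive_cong:
 assumes "abelian_group M" "!!m. m : M ==> f m = g m"
 shows "additive_map M N f \<longleftrightarrow> additive_map M N g"
proof -
 interpret abelian_group M by fact
 show ?thesis using assms(2) by (auto simp: additive_map_def Pi_iff)
qed

lemma additive_sum:
 assumes "abelian_group N" "additive_map M N f" "additive_map M N g"
 shows "additive_map M N (\<lambda>m. f m \<oplus>\<^sub>N g m)"
proof -
 interpret abelian_group N by fact
 show ?thesis
  using assms(2,3) by (auto simp: additive_map_def Pi_iff a_ac)
qed

lemma additive_diff:
 assumes "abelian_group N" "additive_map M N f" "additive_map M N g"
 shows "additive_map M N (\<lambda>m. f m \<ominus>\<^sub>N g m)"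
proof -
 interpret abelian_group N by fact
 show ?thesis
  using assms(2,3) by (auto simp: additive_map_def Pi_iff a_minus_def minus_add a_ac)
qed

section \<open>The universal property of the tensor product\<close>

definition balanced ::
 "('r, 'z) ring_scheme => ('l, 'm, 'r, 'x) bimodule_scheme => ('r, 'n, 'y) module_scheme =>
  ('p, 'w) ring_scheme => ('m => 'n => 'p) => bool" where
 "balanced R M N P b \<longleftrightarrow>
   (\<forall>n\<in>carrier N. additive_map M P (\<lambda>m. b m n)) \<and>
   (\<forall>m\<in>carrier M. additive_map N P (b m)) \<and>
   (\<forall>m\<in>carrier M. \<forall>a\<in>carrier R. \<forall>n\<in>carrier N. b (m \<star>\<^sub>M a) n = b m (a \<odot>\<^sub>N n))"

lemma balancedI:
 assumes "!!m n. [|m : M; n : N|] ==> b m n : P"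
  and "!!m m' n. [|m : M; m' : M; n : N|] ==>
   b (m \<oplus>\<^sub>M m') n = b m n \<oplus>\<^sub>P b m' n"
  and "!!m n n'. [|m : M; n : N; n' : N|] ==>
   b m (n \<oplus>\<^sub>N n') = b m n \<oplus>\<^sub>P b m n'"
  and "!!m a n. [|m : M; a : R; n : N|] ==> b (m \<star>\<^sub>M a) n = b m (a \<odot>\<^sub>N n)"
 shows "balanced R M N P b"
 using assms by (auto simp: balanced_def additive_map_def)

lemma balancedD:
 assumes "balanced R M N P b"
 shows "[|m : M; n : N|] ==> b m n : P"
  and "[|m : M; m' : M; n : N|] ==> b (m \<oplus>\<^sub>M m') n = b m n \<oplus>\<^sub>P b m' n"
  and "[|m : M; n : N; n' : N|] ==> b m (n \<oplus>\<^sub>N n') = b m n \<oplus>\<^sub>P b m n'"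
  and "[|m : M; a : R; n : N|] ==> b (m \<star>\<^sub>M a) n = b m (a \<odot>\<^sub>N n)"
 using assms by (auto simp: balanced_def additive_map_def)

text \<open>The additive extension of b to the free abelian group; \<open>tensor_lift\<close>
  evaluates it at the representatives of a coset.\<close>

definition frag_eval :: "('p, 'z) ring_scheme => ('i => 'p) => ('i \<Rightarrow>\<^sub>0 int) => 'p" where
 "frag_eval P b u = (\<Oplus>\<^bsub>P\<^esub>p\<in>Poly_Mapping.keys u. [Poly_Mapping.lookup u p] \<cdot>\<^bsub>P\<^esub> b p)"

text \<open>The keys of a sum can be fewer than those of the summands, so additivity needs all sums
  over one common index set; terms with coefficient 0 vanish.\<close>

lemma frag_eval_superset:
 assumes "abelian_group P" "finite D" "Poly_Mapping.keys u \<subseteq> D" "!!p. p \<in> D ==> b p : P"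
 shows "frag_eval P b u = (\<Oplus>\<^bsub>P\<^esub>p\<in>D. [Poly_Mapping.lookup u p] \<cdot>\<^bsub>P\<^esub> b p)"
proof -
 interpret P: abelian_group P by fact
 have "[(0 :: int)] \<cdot>\<^bsub>P\<^esub> y = \<zero>\<^sub>P" for y by (simp add: add_pow_def)
 then show ?thesis unfolding frag_eval_def
  by (intro P.add.finprod_mono_neutral_cong_left)
   (use assms in \<open>auto simp: in_keys_iff intro: P.add.int_pow_closed\<close>)
qed

lemma frag_eval_hom:
 assumes "abelian_group P" "!!p. p \<in> S ==> b p : P"
 shows "frag_eval P b \<in> hom (free_Abelian_group S) (add_monoid P)"
proof -
 interpret P: abelian_group P by fact
 show ?thesis
 proof (rule homI)
  fix u assume "u : free_Abelian_group S"
  then show "frag_eval P b u : add_monoid P"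
   using assms by (auto simp: frag_eval_def intro!: P.finsum_closed P.add.int_pow_closed)
 next
  fix u v assume uv: "u : free_Abelian_group S" "v : free_Abelian_group S"
  let ?D = "Poly_Mapping.keys u \<union> Poly_Mapping.keys v"
  have D: "finite ?D" "!!p. p \<in> ?D ==> b p : P"
   using uv assms(2) by auto
  have "frag_eval P b (u + v) = (\<Oplus>\<^bsub>P\<^esub>p\<in>?D. [Poly_Mapping.lookup (u + v) p] \<cdot>\<^bsub>P\<^esub> b p)"
   using D by (intro frag_eval_superset[OF assms(1)] keys_add) auto
  also have "\<dots> = (\<Oplus>\<^bsub>P\<^esub>p\<in>?D. [Poly_Mapping.lookup u p] \<cdot>\<^bsub>P\<^esub> b p \<oplus>\<^sub>P [Poly_Mapping.lookup v p] \<cdot>\<^bsub>P\<^esub> b p)"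
   using D by (intro P.finsum_cong')
    (auto simp: lookup_add P.add.int_pow_mult P.add.int_pow_closed)
  also have "\<dots> = (\<Oplus>\<^bsub>P\<^esub>p\<in>?D. [Poly_Mapping.lookup u p] \<cdot>\<^bsub>P\<^esub> b p) \<oplus>\<^sub>P (\<Oplus>\<^bsub>P\<^esub>p\<in>?D. [Poly_Mapping.lookup v p] \<cdot>\<^bsub>P\<^esub> b p)"
   using D by (intro P.finsum_addf) (auto intro!: P.add.int_pow_closed)
  also have "\<dots> = frag_eval P b u \<oplus>\<^sub>P frag_eval P b v"
   using D frag_eval_superset[OF assms(1) D(1), of u b] frag_eval_superset[OF assms(1) D(1), of v b] by simp
  finally show "frag_eval P b (u \<otimes>\<^bsub>free_Abelian_group S\<^esub> v) = frag_eval P b u \<otimes>\<^bsub>add_monoid P\<^esub> frag_eval P b v"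
   by simp
 qed
qed

lemma frag_eval_frag_of:
 assumes "abelian_group P" "b p : P"
 shows "frag_eval P b (frag_of p) = b p"
proof -
 interpret P: abelian_group P by fact
 show ?thesis using assms by (simp add: frag_eval_def P.add.int_pow_1)
qed

lemma frag_eval_diff:
 assumes "abelian_group P" "!!p. p \<in> S ==> b p : P"
  and "Poly_Mapping.keys u \<subseteq> S" "Poly_Mapping.keys v \<subseteq> S"
 shows "frag_eval P b (u - v) = frag_eval P b u \<ominus>\<^sub>P frag_eval P b v"
proof -
 interpret P: abelian_group P by fact
 interpret h: group_hom "free_Abelian_group S" "add_monoid P" "frag_eval P b"
  using frag_eval_hom[OF assms(1,2)] P.a_group by (simp add: group_hom_def group_hom_axioms_def)
 have "frag_eval P b (u - v) = frag_eval P b u \<oplus>\<^sub>P frag_eval P b (- v)"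
  using h.hom_mult[of u "-v"] assms by simp
 also have "frag_eval P b (- v) = \<ominus>\<^sub>P frag_eval P b v"
  using h.hom_inv[of v] assms(4) by (simp add: a_inv_def)
 finally show ?thesis by (simp add: a_minus_def)
qed

locale tensor = M: right_module R M + N: left_module R N
 for R :: "('r, 'z) ring_scheme" and M :: "('l, 'm, 'r, 'x) bimodule_scheme"
  and N :: "('r, 'n, 'y) module_scheme"
begin

abbreviation "F \<equiv> free_Abelian_group (carrier M \<times> carrier N)"
abbreviation "K \<equiv> tensor_kernel R M N"
abbreviation "T \<equiv> tensor_add R M N"
abbreviation "pt \<equiv> pure_tensor R M N"

lemma relations_subset: "tensor_relations R M N \<subseteq> carrier F"
proof -
 have 1: "Poly_Mapping.keys (frag_of p - frag_of q - frag_of r) \<subseteq> carrier M \<times> carrier N"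
  if "p \<in> carrier M \<times> carrier N" "q \<in> carrier M \<times> carrier N" "r \<in> carrier M \<times> carrier N" for p q r :: "'m \<times> 'n"
  using keys_diff[of "frag_of p - frag_of q" "frag_of r"] keys_diff[of "frag_of p" "frag_of q"] that by auto
 have 2: "Poly_Mapping.keys (frag_of p - frag_of q) \<subseteq> carrier M \<times> carrier N"
  if "p \<in> carrier M \<times> carrier N" "q \<in> carrier M \<times> carrier N" for p q :: "'m \<times> 'n"
  using keys_diff[of "frag_of p" "frag_of q"] that by auto
 show ?thesis
  unfolding tensor_relations_def
  by (intro subsetI, elim UnE CollectE exE conjE)
   (simp_all add: 1 2 M.rsmult_closed N.lsmult_closed)
qed

sublocale F: comm_group F
 by (simp add: abelian_free_Abelian_group)

lemma subgroup_K: "subgroup K F"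
 unfolding tensor_kernel_def by (rule F.generate_is_subgroup[OF relations_subset])

lemma normal_K: "K \<lhd> F"
 by (rule F.subgroup_imp_normal[OF subgroup_K])

lemma carrier_T: "carrier T = rcosets\<^bsub>F\<^esub> K"
 by (simp add: tensor_add_def tensor_group_def FactGroup_def)

lemma add_T: "t \<oplus>\<^sub>T t' = t <#>\<^bsub>F\<^esub> t'"
 by (simp add: tensor_add_def tensor_group_def FactGroup_def)

lemma zero_T: "\<zero>\<^sub>T = K"
 by (simp add: tensor_add_def tensor_group_def FactGroup_def)

lemma abelian_group_T: "abelian_group T"
proof -
 interpret Q: comm_group "F Mod K" by (rule F.abelian_FactGroup[OF subgroup_K])
 have "add_monoid T = F Mod K"
  by (simp add: tensor_add_def tensor_group_def FactGroup_def)
 then show ?thesis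
  using Q.comm_group_axioms
  by (simp add: abelian_group_def abelian_group_axioms_def abelian_monoid_def comm_group_def)
qed

sublocale T: abelian_group T by (rule abelian_group_T)

lemma coset_mem: "u : F ==> K #>\<^bsub>F\<^esub> u : T"
 unfolding carrier_T RCOSETS_def by auto

lemma coset_add: "[|u : F; v : F|] ==> (K #>\<^bsub>F\<^esub> u) \<oplus>\<^sub>T (K #>\<^bsub>F\<^esub> v) = K #>\<^bsub>F\<^esub> (u + v)"
 unfolding add_T using normal.rcos_sum[OF normal_K] by simp

lemma coset_zero: "u \<in> K ==> K #>\<^bsub>F\<^esub> u = \<zero>\<^sub>T"
 unfolding zero_T using F.coset_join2[OF _ subgroup_K] subgroup.mem_carrier[OF subgroup_K] by blast

lemma pure_closed: "[|m : M; n : N|] ==> pt m n : T"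
 unfolding pure_tensor_def by (rule coset_mem) auto

lemma coset_eqI:
 assumes "u : F" "v : F" "u - v \<in> K"
 shows "K #>\<^bsub>F\<^esub> u = K #>\<^bsub>F\<^esub> v"
proof -
 have "u - v : F" using assms(3) subgroup.mem_carrier[OF subgroup_K] by blast
 then have "K #>\<^bsub>F\<^esub> (u - v + v) = (K #>\<^bsub>F\<^esub> (u - v)) \<oplus>\<^sub>T (K #>\<^bsub>F\<^esub> v)"
  using coset_add[of "u - v" v] assms by simp
 then show ?thesis using assms coset_mem[OF assms(2)] by (simp add: coset_zero)
qed

lemma relation_in_K: "r \<in> tensor_relations R M N ==> r \<in> K"
 unfolding tensor_kernel_def by (rule generate.incl)

lemma pure_add_left:
 assumes "m : M" "m' : M" "n : N"
 shows "pt (m \<oplus>\<^sub>M m') n = pt m n \<oplus>\<^sub>T pt m' n"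
proof -
 have "frag_of (m \<oplus>\<^sub>M m', n) - (frag_of (m, n) + frag_of (m', n)) \<in> K"
  unfolding diff_diff_add[symmetric]
  by (rule relation_in_K) (use assms in \<open>unfold tensor_relations_def, blast\<close>)
 moreover have "frag_of (m, n) + frag_of (m', n) : F"
  using F.m_closed[of "frag_of (m, n)" "frag_of (m', n)"] assms by simp
 ultimately show ?thesis
  unfolding pure_tensor_def using assms by (subst coset_add) (simp_all add: coset_eqI)
qed

lemma pure_add_right:
 assumes "m : M" "n : N" "n' : N"
 shows "pt m (n \<oplus>\<^sub>N n') = pt m n \<oplus>\<^sub>T pt m n'"
proof -
 have "frag_of (m, n \<oplus>\<^sub>N n') - (frag_of (m, n) + frag_of (m, n')) \<in> K"
  unfolding diff_diff_add[symmetric]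
  by (rule relation_in_K) (use assms in \<open>unfold tensor_relations_def, blast\<close>)
 moreover have "frag_of (m, n) + frag_of (m, n') : F"
  using F.m_closed[of "frag_of (m, n)" "frag_of (m, n')"] assms by simp
 ultimately show ?thesis
  unfolding pure_tensor_def using assms by (subst coset_add) (simp_all add: coset_eqI)
qed

lemma pure_balanced:
 assumes "m : M" "a : R" "n : N"
 shows "pt (m \<star>\<^sub>M a) n = pt m (a \<odot>\<^sub>N n)"
proof -
 have "frag_of (m \<star>\<^sub>M a, n) - frag_of (m, a \<odot>\<^sub>N n) \<in> K"
  by (rule relation_in_K) (use assms in \<open>unfold tensor_relations_def, blast\<close>)
 then show ?thesis
  unfolding pure_tensor_def using assms
  by (intro coset_eqI) (auto simp: M.rsmult_closed N.lsmult_closed)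
qed

lemmas ax = tensor_axioms and ab_T = abelian_group_T

lemma balanced_pure: "balanced R M N T pt"
 by (rule balancedI) (auto simp: pure_closed pure_add_left pure_add_right pure_balanced)

lemma pure_uminus:
 assumes "m : M" "n : N"
 shows "\<ominus>\<^sub>T pt m n = pt (\<ominus>\<^sub>M m) n"
 using assms additive_uminus[of M T "\<lambda>m. pt m n" m] balanced_pure
 by (simp add: balanced_def M.abelian_group_axioms T.abelian_group_axioms)

lemma pure_zero_left: "n : N ==> pt \<zero>\<^sub>M n = \<zero>\<^sub>T"
 using additive_zero[of M T "\<lambda>m. pt m n"] balanced_pure
 by (simp add: balanced_def M.abelian_group_axioms T.abelian_group_axioms)

lemma pure_zero_right: "m : M ==> pt m \<zero>\<^sub>N = \<zero>\<^sub>T"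
 using additive_zero[of N T "pt m"] balanced_pure
 by (simp add: balanced_def N.abelian_group_axioms T.abelian_group_axioms)

text \<open>A tensor is an integer combination of pure tensors, and -(m \<otimes> n) = (-m)
  \<otimes> n turns it into a plain sum of pure tensors.\<close>

lemma induct [consumes 1, case_names pure add]:
 assumes t: "t : T"
  and pure: "!!m n. [|m : M; n : N|] ==> Q (pt m n)"
  and add: "!!t t'. [|t : T; t' : T; Q t; Q t'|] ==> Q (t \<oplus>\<^sub>T t')"
 shows "Q t"
proof -
 have zero: "Q \<zero>\<^sub>T" using pure[of "\<zero>\<^sub>M" "\<zero>\<^sub>N"] by (simp add: pure_zero_left)
 obtain u where u: "t = K #>\<^bsub>F\<^esub> u" "u : F" using t unfolding carrier_T RCOSETS_def by auto
 \<comment> \<open>The rule \<open>frag_induction\<close> closes under differences and forgets the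
   support condition in that case, so the claim also carries the negative of the coset and
   membership in \<open>F\<close>.\<close>
 have "u : F \<and> Q (K #>\<^bsub>F\<^esub> u) \<and> Q (\<ominus>\<^sub>T (K #>\<^bsub>F\<^esub> u))"
  using u(2) unfolding carrier_free_Abelian_group_iff
 proof (induction u rule: frag_induction)
  case zero
  have m0: "\<ominus>\<^sub>T \<zero>\<^sub>T = \<zero>\<^sub>T" by (rule T.minus_equality) auto
  have "K #>\<^bsub>F\<^esub> 0 = \<zero>\<^sub>T" using subgroup.one_closed[OF subgroup_K] by (simp add: coset_zero)
  then show ?case using \<open>Q \<zero>\<^sub>T\<close> by (simp only: m0) simp
 next
  case (one p)
  then show ?case using pure[of "fst p" "snd p"] pure[of "\<ominus>\<^sub>M (fst p)" "snd p"]
    pure_uminus[of "fst p" "snd p"] by (auto simp: pure_tensor_def)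
 next
  case (diff u v)
  have vF: "- v : F" using diff by simp
  have "(K #>\<^bsub>F\<^esub> v) \<oplus>\<^sub>T (K #>\<^bsub>F\<^esub> (- v)) = \<zero>\<^sub>T"
   using coset_add[of v "-v"] vF diff subgroup.one_closed[OF subgroup_K] by (simp add: coset_zero)
  then have v: "K #>\<^bsub>F\<^esub> (- v) = \<ominus>\<^sub>T (K #>\<^bsub>F\<^esub> v)"
   using coset_mem[of v] coset_mem[of "-v"] vF diff by (metis T.add.inv_equality T.a_comm carrier_free_Abelian_group_iff)
  have uv: "K #>\<^bsub>F\<^esub> (u - v) = (K #>\<^bsub>F\<^esub> u) \<oplus>\<^sub>T \<ominus>\<^sub>T (K #>\<^bsub>F\<^esub> v)"
   using coset_add[of u "-v"] vF diff v by simp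
  have c: "K #>\<^bsub>F\<^esub> u : T" "K #>\<^bsub>F\<^esub> v : T" using diff by (auto intro!: coset_mem)
  have "\<ominus>\<^sub>T (K #>\<^bsub>F\<^esub> (u - v)) = \<ominus>\<^sub>T (K #>\<^bsub>F\<^esub> u) \<oplus>\<^sub>T (K #>\<^bsub>F\<^esub> v)"
   unfolding uv using c by (simp add: T.minus_add T.minus_minus)
  then show ?case unfolding uv using c diff add keys_diff[of u v] by auto
 qed
 then show ?thesis using u by simp
qed

context
 fixes P :: "('p, 'w) ring_scheme" and b
 assumes P: "abelian_group P" and b: "balanced R M N P b"
begin

interpretation P: abelian_group P by (rule P)

text \<open>Balancedness says that \<open>frag_eval\<close> kills the three kinds of relations,
  hence the subgroup that they generate. So it is constant on cosets, which gives
  \<open>the_elem\<close> in \<open>tensor_lift\<close> a meaning.\<close>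

lemma lift_coset:
 assumes "u : F"
 shows "tensor_lift P b (K #>\<^bsub>F\<^esub> u) = frag_eval P (\<lambda>p. b (fst p) (snd p)) u"
proof -
 let ?e = "frag_eval P (\<lambda>p. b (fst p) (snd p))"
 let ?S = "carrier M \<times> carrier N"
 have cl: "!!p. p \<in> ?S ==> b (fst p) (snd p) : P" using balancedD(1)[OF b] by auto
 interpret h: group_hom F "add_monoid P" ?e
  using frag_eval_hom[OF P cl] P.a_group by (simp add: group_hom_def group_hom_axioms_def)
 have fo: "?e (frag_of (m, n)) = b m n" if "m : M" "n : N" for m n
  using frag_eval_frag_of[OF P, of "\<lambda>p. b (fst p) (snd p)" "(m, n)"] that balancedD(1)[OF b] by simp
 have d: "?e (p - q) = ?e p \<ominus>\<^sub>P ?e q" if "p : F" "q : F" for p q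
  using frag_eval_diff[OF P cl, where S = ?S] that by simp
 have "tensor_relations R M N \<subseteq> kernel F (add_monoid P) ?e"
 proof
  fix r assume r: "r \<in> tensor_relations R M N"
  then have "?e r = \<zero>\<^sub>P"
   unfolding tensor_relations_def
  proof (elim UnE CollectE exE conjE)
   fix m m' n assume *: "r = frag_of (m \<oplus>\<^sub>M m', n) - frag_of (m, n) - frag_of (m', n)"
    "m : M" "m' : M" "n : N"
   have "frag_of (m \<oplus>\<^sub>M m', n) - frag_of (m, n) : F"
    using F.m_closed[of "frag_of (m \<oplus>\<^sub>M m', n)" "- frag_of (m, n)"] * by simp
   then show ?thesis unfolding *(1) using *
    by (simp add: d fo balancedD[OF b] P.minus_eq P.minus_add P.a_ac P.r_neg P.r_neg1 P.r_neg2)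
  next
   fix m n n' assume *: "r = frag_of (m, n \<oplus>\<^sub>N n') - frag_of (m, n) - frag_of (m, n')"
    "m : M" "n' : N" "n : N"
   have "frag_of (m, n \<oplus>\<^sub>N n') - frag_of (m, n) : F"
    using F.m_closed[of "frag_of (m, n \<oplus>\<^sub>N n')" "- frag_of (m, n)"] * by simp
   then show ?thesis unfolding *(1) using *
    by (simp add: d fo balancedD[OF b] P.minus_eq P.minus_add P.a_ac P.r_neg P.r_neg1 P.r_neg2)
  next
   fix m a n assume *: "r = frag_of (m \<star>\<^sub>M a, n) - frag_of (m, a \<odot>\<^sub>N n)"
    "m : M" "a : R" "n : N"
   then show ?thesis
    by (simp add: d fo M.rsmult_closed N.lsmult_closed balancedD[OF b] P.minus_eq P.r_neg)
  qed
  then show "r \<in> kernel F (add_monoid P) ?e" using r relations_subset by (auto simp: kernel_def simp del: carrier_free_Abelian_group_iff)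
 qed
 then have "K \<subseteq> kernel F (add_monoid P) ?e"
  unfolding tensor_kernel_def
  by (rule F.generate_subgroup_incl[OF _ h.subgroup_kernel])
 then have z: "k : F" "?e k = \<zero>\<^sub>P" if "k \<in> K" for k
  using that by (auto simp: kernel_def)
 have eq: "?e (k + u) = ?e u" if "k \<in> K" for k
  using h.hom_mult[of k u] z[OF that] h.hom_closed[OF assms] assms by simp
 have "?e ` (K #>\<^bsub>F\<^esub> u) = {?e u}"
  using eq subgroup.one_closed[OF subgroup_K] by (force simp: r_coset_def image_iff)
 then show ?thesis
  unfolding tensor_lift_def frag_eval_def[where b = "\<lambda>p. b (fst p) (snd p)", symmetric] by simp
qed

lemma lift_pure:
 assumes "m : M" "n : N"
 shows "tensor_lift P b (pt m n) = b m n"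
 using lift_coset[of "frag_of (m, n)"] assms balancedD(1)[OF b]
  frag_eval_frag_of[OF P, of "\<lambda>p. b (fst p) (snd p)" "(m, n)"]
 by (simp add: pure_tensor_def)

lemma lift_additive: "additive_map T P (tensor_lift P b)"
proof (rule additiveI)
 let ?e = "frag_eval P (\<lambda>p. b (fst p) (snd p))"
 have "?e \<in> hom F (add_monoid P)" using balancedD(1)[OF b] by (intro frag_eval_hom P) auto
 note h = hom_in_carrier[OF this] hom_mult[OF this]
 have ex: "\<exists>u\<in>carrier F. t = K #>\<^bsub>F\<^esub> u" if "t : T" for t
  using that unfolding carrier_T RCOSETS_def by auto
 fix t assume "t : T"
 then obtain u where u: "u : F" "t = K #>\<^bsub>F\<^esub> u" using ex by blast
 then show "tensor_lift P b t : P" using h(1) by (simp add: lift_coset)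
 fix t' assume "t' : T"
 then obtain u' where u': "u' : F" "t' = K #>\<^bsub>F\<^esub> u'" using ex by blast
 have "u + u' : F" using u u' F.m_closed[of u u'] by simp
 then show "tensor_lift P b (t \<oplus>\<^sub>T t') = tensor_lift P b t \<oplus>\<^sub>P tensor_lift P b t'"
  using u u' h(2)[of u u'] by (simp add: coset_add lift_coset del: carrier_free_Abelian_group_iff)
qed

lemmas lift_closed = additive_closed[OF lift_additive]
end

lemma additive_eqI:
 assumes "additive_map T P f" "additive_map T P g"
  and "!!m n. [|m : M; n : N|] ==> f (pt m n) = g (pt m n)"
  and "t : T"
 shows "f t = g t"
 using assms(4)
 by (induction rule: induct) (auto simp: assms(3) additive_add[OF assms(1)] additive_add[OF assms(2)])

end

section \<open>Modules\<close>

lemma right_moduleD: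
 assumes "right_module R M"
 shows "ring R" "abelian_group M"
 using assms by (simp_all add: right_module_def)

lemma left_moduleD:
 assumes "left_module R M"
 shows "ring R" "abelian_group M"
 using assms by (simp_all add: left_module_def)

lemma right_moduleI:
 assumes "ring R" "abelian_group M"
  and "!!m a. [|m : M; a : R|] ==> m \<star>\<^sub>M a : M"
  and "!!m n a. [|m : M; n : M; a : R|] ==>
   (m \<oplus>\<^sub>M n) \<star>\<^sub>M a = m \<star>\<^sub>M a \<oplus>\<^sub>M n \<star>\<^sub>M a"
  and "!!m a b. [|m : M; a : R; b : R|] ==>
   m \<star>\<^sub>M (a \<oplus>\<^sub>R b) = m \<star>\<^sub>M a \<oplus>\<^sub>M m \<star>\<^sub>M b"
  and "!!m a b. [|m : M; a : R; b : R|] ==>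
   m \<star>\<^sub>M (a \<otimes>\<^sub>R b) = (m \<star>\<^sub>M a) \<star>\<^sub>M b"
  and "!!m. m : M ==> m \<star>\<^sub>M \<one>\<^sub>R = m"
 shows "right_module R M"
 using assms by (simp add: right_module_def right_module_axioms_def)

lemma left_moduleI:
 assumes "ring R" "abelian_group M"
  and "!!m a. [|m : M; a : R|] ==> a \<odot>\<^sub>M m : M"
  and "!!a m n. [|a : R; m : M; n : M|] ==>
   a \<odot>\<^sub>M (m \<oplus>\<^sub>M n) = a \<odot>\<^sub>M m \<oplus>\<^sub>M a \<odot>\<^sub>M n"
  and "!!m a b. [|m : M; a : R; b : R|] ==>
   (a \<oplus>\<^sub>R b) \<odot>\<^sub>M m = a \<odot>\<^sub>M m \<oplus>\<^sub>M b \<odot>\<^sub>M m"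
  and "!!m a b. [|m : M; a : R; b : R|] ==>
   (a \<otimes>\<^sub>R b) \<odot>\<^sub>M m = a \<odot>\<^sub>M (b \<odot>\<^sub>M m)"
  and "!!m. m : M ==> \<one>\<^sub>R \<odot>\<^sub>M m = m"
 shows "left_module R M"
 using assms by (simp add: left_module_def left_module_axioms_def)

lemmas (in right_module) ab_M = M.abelian_group_axioms
lemmas (in left_module) ab_M = M.abelian_group_axioms

lemma (in right_module) additive_rsmult: "a : R ==> additive_map M M (\<lambda>m. m \<star>\<^sub>M a)"
 by (rule additiveI) (auto simp: rsmult_closed rsmult_l_distr)

lemma (in left_module) additive_lsmult: "a : R ==> additive_map M M (\<lambda>m. a \<odot>\<^sub>M m)"
 by (rule additiveI) (auto simp: lsmult_closed lsmult_r_distr)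

lemma (in right_module) additive_rsmult_scalar: "m : M ==> additive_map R M (\<lambda>a. m \<star>\<^sub>M a)"
 by (rule additiveI) (auto simp: rsmult_closed rsmult_r_distr)

lemma (in left_module) additive_lsmult_scalar: "m : M ==> additive_map R M (\<lambda>a. a \<odot>\<^sub>M m)"
 by (rule additiveI) (auto simp: lsmult_closed lsmult_l_distr)

lemma (in right_module) zero_rsmult: "a : R ==> \<zero>\<^sub>M \<star>\<^sub>M a = \<zero>\<^sub>M"
 using additive_zero[OF ab_M ab_M additive_rsmult] .

lemma (in right_module) rsmult_zero: "m : M ==> m \<star>\<^sub>M \<zero>\<^sub>R = \<zero>\<^sub>M"
 using additive_zero[OF R.abelian_group_axioms ab_M additive_rsmult_scalar] .

lemma (in left_module) zero_lsmult: "m : M ==> \<zero>\<^sub>R \<odot>\<^sub>M m = \<zero>\<^sub>M"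
 using additive_zero[OF R.abelian_group_axioms ab_M additive_lsmult_scalar] .

lemma (in right_module) minus_rsmult:
 "[|m : M; n : M; a : R|] ==> (m \<ominus>\<^sub>M n) \<star>\<^sub>M a = m \<star>\<^sub>M a \<ominus>\<^sub>M n \<star>\<^sub>M a"
 using additive_minus[OF ab_M ab_M additive_rsmult] .

lemma (in right_module) rsmult_minus:
 "[|m : M; a : R; b : R|] ==> m \<star>\<^sub>M (a \<ominus>\<^sub>R b) = m \<star>\<^sub>M a \<ominus>\<^sub>M m \<star>\<^sub>M b"
 using additive_minus[OF R.abelian_group_axioms ab_M additive_rsmult_scalar] .

lemma right_linearI:
 assumes "!!m. m : M ==> f m : N"
  and "!!m m'. [|m : M; m' : M|] ==> f (m \<oplus>\<^sub>M m') = f m \<oplus>\<^sub>N f m'"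
  and "!!m a. [|m : M; a : R|] ==> f (m \<star>\<^sub>M a) = f m \<star>\<^sub>N a"
 shows "right_linear R M N f"
 using assms by (auto simp: right_linear_def additive_map_def)

lemma right_linearD:
 assumes "right_linear R M N f"
 shows "additive_map M N f"
  and "m : M ==> f m : N"
  and "[|m : M; m' : M|] ==> f (m \<oplus>\<^sub>M m') = f m \<oplus>\<^sub>N f m'"
  and "[|m : M; a : R|] ==> f (m \<star>\<^sub>M a) = f m \<star>\<^sub>N a"
 using assms by (auto simp: right_linear_def additive_map_def)

lemma left_linearI:
 assumes "!!m. m : M ==> f m : N"
  and "!!m m'. [|m : M; m' : M|] ==> f (m \<oplus>\<^sub>M m') = f m \<oplus>\<^sub>N f m'"
  and "!!m a. [|m : M; a : R|] ==> f (a \<odot>\<^sub>M m) = a \<odot>\<^sub>N f m"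
 shows "left_linear R M N f"
 using assms by (auto simp: left_linear_def additive_map_def)

lemma left_linearD:
 assumes "left_linear R M N f"
 shows "additive_map M N f"
  and "m : M ==> f m : N"
  and "[|m : M; m' : M|] ==> f (m \<oplus>\<^sub>M m') = f m \<oplus>\<^sub>N f m'"
  and "[|m : M; a : R|] ==> f (a \<odot>\<^sub>M m) = a \<odot>\<^sub>N f m"
 using assms by (auto simp: left_linear_def additive_map_def)

lemma left_linear_ident: "left_linear R M M (\<lambda>m. m)"
 by (rule left_linearI) auto

lemma right_linear_ident: "right_linear R M M (\<lambda>m. m)"
 by (rule right_linearI) auto

lemma right_linear_comp:
 "[|right_linear R M N f; right_linear R N P g|] ==> right_linear R M P (\<lambda>m. g (f m))"
 by (rule right_linearI) (auto simp: right_linearD)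

lemma right_linear_inverse:
 assumes "right_module R M" "right_linear R M N f"
  and g: "!!n. n : N ==> g n : M" "!!n. n : N ==> f (g n) = n"
   "!!m. m : M ==> g (f m) = m"
 shows "right_linear R N M g"
proof -
 interpret right_module R M by fact
 note f = right_linearD[OF assms(2)]
 show ?thesis
 proof (rule right_linearI)
  fix m m' assume "m : N" "m' : N"
  then show "g (m \<oplus>\<^sub>N m') = g m \<oplus>\<^sub>M g m'" using f(3)[of "g m" "g m'"] g by (metis M.a_closed)
 next
  fix m a assume "m : N" "a : R"
  then show "g (m \<star>\<^sub>N a) = g m \<star>\<^sub>M a" using f(4)[of "g m" a] g by (metis rsmult_closed)
 qed (use g in auto)
qed

lemma right_linear_restrict:
 assumes "right_module R M"
 shows "right_linear R M N (restrict f (carrier M)) \<longleftrightarrow> right_linear R M N f"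
proof -
 interpret right_module R M by fact
 show ?thesis by (auto simp: right_linear_def additive_map_def rsmult_closed Pi_iff)
qed

text \<open>Negatives come from the action of -1.\<close>

lemma right_submoduleI:
 assumes "right_module R M" "K \<subseteq> carrier M" "\<zero>\<^sub>M \<in> K"
  and "!!m n. [|m \<in> K; n \<in> K|] ==> m \<oplus>\<^sub>M n \<in> K"
  and rs: "!!m a. [|m \<in> K; a : R|] ==> m \<star>\<^sub>M a \<in> K"
 shows "right_submodule K R M"
proof -
 interpret right_module R M by fact
 have "\<ominus>\<^sub>M m \<in> K" if "m \<in> K" for m
 proof -
  have m: "m : M" using that assms by auto
  have "m \<star>\<^sub>M (\<ominus>\<^sub>R \<one>\<^sub>R) = \<ominus>\<^sub>M (m \<star>\<^sub>M \<one>\<^sub>R)"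
   using additive_uminus[OF R.abelian_group_axioms ab_M additive_rsmult_scalar[OF m]] by simp
  then show ?thesis using rs[OF that, of "\<ominus>\<^sub>R \<one>\<^sub>R"] m by (simp add: rsmult_one)
 qed
 then have "subgroup K (add_monoid M)"
  using assms by (intro subgroup.intro) (auto simp flip: a_inv_def)
 then show ?thesis using assms by (simp add: right_submodule_def right_submodule_axioms_def)
qed

lemma right_submoduleD:
 assumes "right_submodule K R M"
 shows "K \<subseteq> carrier M" "\<zero>\<^sub>M \<in> K"
  and "[|m \<in> K; n \<in> K|] ==> m \<oplus>\<^sub>M n \<in> K"
  and "m \<in> K ==> \<ominus>\<^sub>M m \<in> K"
  and "[|m \<in> K; n \<in> K|] ==> m \<ominus>\<^sub>M n \<in> K"
  and "[|m \<in> K; a : R|] ==> m \<star>\<^sub>M a \<in> K"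
proof -
 interpret right_submodule K R M by fact
 show "K \<subseteq> carrier M" "\<zero>\<^sub>M \<in> K" using subset one_closed by auto
 show *: "m \<oplus>\<^sub>M n \<in> K" if "m \<in> K" "n \<in> K" for m n using m_closed that by simp
 show **: "\<ominus>\<^sub>M m \<in> K" if "m \<in> K" for m using m_inv_closed[OF that] by (simp add: a_inv_def)
 show "m \<ominus>\<^sub>M n \<in> K" if "m \<in> K" "n \<in> K" using that * ** by (simp add: a_minus_def)
 show "m \<star>\<^sub>M a \<in> K" if "m \<in> K" "a : R" using that rsmult_closed by simp
qed

lemma submodule_module:
 assumes "right_module R M" "right_submodule K R M"
 shows "right_module R (M\<lparr>carrier := K\<rparr>)"
proof -
 interpret right_module R M by fact
 note K = right_submoduleD[OF assms(2)]
 have "abelian_group (M\<lparr>carrier := K\<rparr>)"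
  using K(1) by (intro abelian_groupI)
   (auto intro: K M.a_assoc M.a_comm simp: subset_iff, metis K(4) M.l_neg)
 then show ?thesis
  using K by (intro right_moduleI R.ring_axioms)
   (auto simp: subset_iff rsmult_l_distr rsmult_r_distr rsmult_assoc rsmult_one)
qed

lemma right_submodule_image:
 assumes "right_module R M" "right_module R N" "right_linear R M N f"
 shows "right_submodule (f ` carrier M) R N"
proof -
 interpret M: right_module R M by fact
 interpret N: right_module R N by fact
 note f = right_linearD[OF assms(3)]
 show ?thesis
  by (rule right_submoduleI[OF assms(2)])
   (auto simp: f(2) additive_zero[OF M.ab_M N.ab_M f(1), symmetric]
    simp flip: f(3,4) intro!: M.rsmult_closed)
qed

lemma right_submodule_kernel:
 assumes "right_module R M" "right_module R N" "right_linear R M N f"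
 shows "right_submodule {m \<in> carrier M. f m = \<zero>\<^sub>N} R M"
proof -
 interpret M: right_module R M by fact
 interpret N: right_module R N by fact
 note f = right_linearD[OF assms(3)]
 have "f \<zero>\<^sub>M = \<zero>\<^sub>N" by (rule additive_zero[OF M.ab_M N.ab_M f(1)])
 then show ?thesis
  by (intro right_submoduleI[OF assms(1)]) (simp_all add: f(3,4) M.rsmult_closed N.zero_rsmult subset_iff)
qed

text \<open>Transport of structure along a surjection that respects the operations. The axioms of
  quotients, of copies in another type and of the module of maps from A are all obtained this
  way.\<close>

lemma right_module_image:
 assumes "right_module R M" and im: "f ` carrier M = carrier N" and zero: "f \<zero>\<^sub>M = \<zero>\<^sub>N"
  and add: "!!m n. [|m : M; n : M|] ==> f m \<oplus>\<^sub>N f n = f (m \<oplus>\<^sub>M n)"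
  and act: "!!m a. [|m : M; a : R|] ==> f m \<star>\<^sub>N a = f (m \<star>\<^sub>M a)"
 shows "right_module R N" "right_linear R M N f"
proof -
 interpret right_module R M by fact
 have "abelian_group N"
 proof (rule abelian_groupI, goal_cases)
  case (6 n)
  then obtain m where "n = f m" "m : M" by (auto simp flip: im)
  then show ?case using zero by (intro bexI[of _ "f (\<ominus>\<^sub>M m)"]) (auto simp: add M.l_neg simp flip: im)
 qed (auto simp: add M.a_ac simp flip: im zero)
 then show "right_module R N"
  by (intro right_moduleI R.ring_axioms)
   (auto simp: add act rsmult_closed rsmult_l_distr rsmult_r_distr rsmult_assoc rsmult_one simp flip: im)
 show "right_linear R M N f" using im by (intro right_linearI) (auto simp: add act)
qed

section \<open>Quotients\<close>

lemma quotient_module_simps [simp]: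
 "carrier (quotient_module M K) = a_rcosets\<^bsub>M\<^esub> K"
 "\<zero>\<^bsub>quotient_module M K\<^esub> = K"
 "X \<oplus>\<^bsub>quotient_module M K\<^esub> Y = X <+>\<^sub>M Y"
 by (simp_all add: quotient_module_def)

lemma quotient_abelian_group:
 assumes "abelian_group M" "subgroup K (add_monoid M)"
 shows "abelian_group (quotient_module M K)"
  and "additive_map M (quotient_module M K) (\<lambda>m. K +>\<^sub>M m)"
  and "(\<lambda>m. K +>\<^sub>M m) ` carrier M = carrier (quotient_module M K)"
  and "m : M ==> K +>\<^sub>M m = \<zero>\<^bsub>quotient_module M K\<^esub> \<longleftrightarrow> m \<in> K"
proof -
 interpret M: abelian_group M by fact
 interpret K: abelian_subgroup K M
  using assms by (intro abelian_subgroupI3 additive_subgroup.intro)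
 interpret Q: comm_group "M A_Mod K" by (rule K.a_factorgroup_is_comm_group)
 have Q: "carrier (M A_Mod K) = a_rcosets\<^bsub>M\<^esub> K" "\<one>\<^bsub>M A_Mod K\<^esub> = K"
  by (simp_all add: A_FactGroup_def FactGroup_def A_RCOSETS_def)
 show "abelian_group (quotient_module M K)"
 proof (rule abelian_groupI, goal_cases)
  case (6 X)
  then show ?case using Q.l_inv_ex[of X] by (simp add: Q)
 qed (use Q.m_closed Q.one_closed Q.m_assoc Q.m_comm Q.l_one Q in \<open>simp_all\<close>)
 show "additive_map M (quotient_module M K) (\<lambda>m. K +>\<^sub>M m)"
  by (rule additiveI) (auto simp: K.a_rcos_sum intro: M.a_rcosetsI K.a_subset)
 show "(\<lambda>m. K +>\<^sub>M m) ` carrier M = carrier (quotient_module M K)"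
  by (auto simp: A_RCOSETS_def' a_r_coset_def')
 show "K +>\<^sub>M m = \<zero>\<^bsub>quotient_module M K\<^esub> \<longleftrightarrow> m \<in> K" if "m : M"
  using that K.a_rcos_self[OF that] M.a_coset_join2[OF that assms(2)] by auto
qed

lemma quotient_eq_iff:
 assumes "right_module R M" "right_submodule K R M" "m : M" "n : M"
 shows "K +>\<^sub>M m = K +>\<^sub>M n \<longleftrightarrow> m \<ominus>\<^sub>M n \<in> K"
proof -
 interpret right_module R M by fact
 have sub: "subgroup K (add_monoid M)" using assms(2) by (simp add: right_submodule_def)
 note q = quotient_abelian_group[OF ab_M sub]
 show ?thesis
  using q(4)[of "m \<ominus>\<^sub>M n"] assms(3,4)
   additive_minus[OF ab_M q(1,2) assms(3,4)]
   minus_zero_iff[OF q(1), of "K +>\<^sub>M m" "K +>\<^sub>M n"]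
   additive_closed[OF q(2)] by simp
qed

lemma quotient_right_module:
 assumes "right_module R M" "right_submodule K R M"
 shows "right_module R (quotient_module M K)"
  and "right_linear R M (quotient_module M K) (\<lambda>m. K +>\<^sub>M m)"
proof -
 interpret right_module R M by fact
 note K = right_submoduleD[OF assms(2)] and eq = quotient_eq_iff[OF assms]
 note q = quotient_abelian_group[OF ab_M right_submodule.axioms(1)[OF assms(2)]]
 \<comment> \<open>The action on a coset is a union over its members. All terms of the union agree,
   because n = k + m gives na - ma = ka in K.\<close>
 have act: "(K +>\<^sub>M m) \<star>\<^bsub>quotient_module M K\<^esub> a = K +>\<^sub>M (m \<star>\<^sub>M a)" if m: "m : M" and a: "a : R" for m a
 proof -
  have "K +>\<^sub>M (n \<star>\<^sub>M a) = K +>\<^sub>M (m \<star>\<^sub>M a)" if n: "n \<in> K +>\<^sub>M m" for n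
  proof -
   obtain k where k: "k \<in> K" "n = k \<oplus>\<^sub>M m" using n unfolding a_r_coset_def' by auto
   have kM: "k : M" using k K by auto
   have "n \<star>\<^sub>M a \<ominus>\<^sub>M m \<star>\<^sub>M a = k \<star>\<^sub>M a"
    using k(2) kM m a by (simp add: rsmult_l_distr rsmult_closed M.minus_eq M.a_assoc M.r_neg)
   then show ?thesis using eq[of "n \<star>\<^sub>M a"] K(6)[OF k(1) a] k(2) kM m a by (simp add: rsmult_closed)
  qed
  moreover have "m \<in> K +>\<^sub>M m" using m K(2) unfolding a_r_coset_def' by (force simp: M.l_zero)
  ultimately have "(\<Union>n\<in>K +>\<^sub>M m. K +>\<^sub>M (n \<star>\<^sub>M a)) = K +>\<^sub>M (m \<star>\<^sub>M a)" by blast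
  then show ?thesis by (simp add: quotient_module_def)
 qed
 have zero: "K +>\<^sub>M \<zero>\<^sub>M = \<zero>\<^bsub>quotient_module M K\<^esub>" using q(4)[OF M.zero_closed] K(2) by blast
 note im = right_module_image[OF assms(1) q(3) zero additive_add[OF q(2), symmetric] act]
 show "right_module R (quotient_module M K)" "right_linear R M (quotient_module M K) (\<lambda>m. K +>\<^sub>M m)"
  by (rule im; assumption)+
qed

section \<open>Bimodule structures on tensor products\<close>

lemma tensor_prod_simps [simp]:
 "carrier (tensor_prod R M N) = carrier (tensor_add R M N)"
 "\<zero>\<^bsub>tensor_prod R M N\<^esub> = \<zero>\<^bsub>tensor_add R M N\<^esub>"
 "add (tensor_prod R M N) = add (tensor_add R M N)"
 by (simp_all add: tensor_prod_def)

lemma uminus_tensor_prod [simp]: "\<ominus>\<^bsub>tensor_prod R M N\<^esub> t = \<ominus>\<^bsub>tensor_add R M N\<^esub> t"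
 by (simp add: a_inv_def m_inv_def)

lemma minus_tensor_prod [simp]: "t \<ominus>\<^bsub>tensor_prod R M N\<^esub> t' = t \<ominus>\<^bsub>tensor_add R M N\<^esub> t'"
 by (simp add: a_minus_def)

lemma abelian_group_cong:
 assumes "abelian_group M" "carrier N = carrier M" "add N = add M" "\<zero>\<^sub>N = \<zero>\<^sub>M"
 shows "abelian_group N"
proof -
 interpret M: abelian_group M by fact
 show ?thesis
  by (rule abelian_groupI) (auto simp: assms(2-4) M.a_ac intro: bexI[OF _ M.a_inv_closed] M.l_neg)
qed

lemma abelian_group_tensor_prod [simp]:
 "abelian_group (tensor_prod R M N) \<longleftrightarrow> abelian_group (tensor_add R M N)"
 by (auto elim: abelian_group_cong)

lemma additive_map_tensor_prod [simp]:
 "additive_map (tensor_prod R M N) P f \<longleftrightarrow> additive_map (tensor_add R M N) P f"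
 by (simp add: additive_map_def)

lemma additive_map_into_tensor_prod [simp]:
 "additive_map P (tensor_prod R M N) f \<longleftrightarrow> additive_map P (tensor_add R M N) f"
 by (simp add: additive_map_def)

text \<open>\<open>tensor_lift\<close> reads only carrier, zero and addition of its target. The
  definitions are unfolded down to these fields because the two records have different
  types.\<close>

lemma tensor_lift_tensor_prod [simp]:
 "tensor_lift (tensor_prod R M N) b = tensor_lift (tensor_add R M N) b"
 by (rule ext, unfold tensor_lift_def finsum_def finprod_def add_pow_def int_pow_def m_inv_def Let_def)
  (simp cong: if_cong)

lemma pure_tensor_cong:
 assumes "carrier M = carrier M'" "add M = add M'" "rsmult M = rsmult M'"
  and "carrier N = carrier N'" "add N = add N'" "smult N = smult N'"
 shows "pure_tensor R M N = pure_tensor R M' N'" "tensor_add R M N = tensor_add R M' N'"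
 using assms by (auto simp: fun_eq_iff pure_tensor_def tensor_add_def tensor_group_def
   tensor_kernel_def tensor_relations_def)

lemma tensor_prod_cong:
 assumes "carrier M = carrier M'" "add M = add M'" "rsmult M = rsmult M'" "smult M = smult M'"
  and "carrier N = carrier N'" "add N = add N'" "smult N = smult N'" "rsmult N = rsmult N'"
 shows "tensor_prod R M N = tensor_prod R M' N'"
 using assms by (simp add: tensor_prod_def pure_tensor_cong[OF assms(1,2,3,5,6,7)])

lemma tensor_map_balanced:
 assumes "tensor R M' N'" "right_linear R M M' f" "left_linear R N N' g"
 shows "balanced R M N (tensor_add R M' N') (\<lambda>m n. pure_tensor R M' N' (f m) (g n))"
proof -
 interpret T': tensor R M' N' by fact
 note f = right_linearD[OF assms(2)] and g = left_linearD[OF assms(3)]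
 show ?thesis
  by (rule balancedI) (simp_all add: f g T'.pure_closed T'.pure_add_left T'.pure_add_right T'.pure_balanced)
qed

lemma tensor_map_pure:
 assumes "tensor R M N" "tensor R M' N'" "right_linear R M M' f" "left_linear R N N' g"
  and "m : M" "n : N"
 shows "tensor_map R M N M' N' f g (pure_tensor R M N m n) = pure_tensor R M' N' (f m) (g n)"
proof -
 interpret T: tensor R M N by fact
 interpret T': tensor R M' N' by fact
 show ?thesis
  using assms(3-6) by (simp add: tensor_map_def T.pure_closed
    T.lift_pure[OF T'.ab_T tensor_map_balanced[OF assms(2-4)]])
qed

lemma tensor_map_additive:
 assumes "tensor R M N" "tensor R M' N'" "right_linear R M M' f" "left_linear R N N' g"
 shows "additive_map (tensor_add R M N) (tensor_add R M' N') (tensor_map R M N M' N' f g)"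
proof -
 interpret T: tensor R M N by fact
 interpret T': tensor R M' N' by fact
 have "additive_map T.T T'.T (tensor_lift T'.T (\<lambda>m n. T'.pt (f m) (g n)))"
  by (rule T.lift_additive[OF T'.ab_T tensor_map_balanced[OF assms(2-4)]])
 then show ?thesis
  by (subst additive_cong[OF T.ab_T]) (auto simp: tensor_map_def)
qed

lemma tensor_map_compose:
 assumes "tensor R M N" "tensor R M' N'" "tensor R M'' N''"
  and "right_linear R M M' f" "left_linear R N N' g" "right_linear R M' M'' f'" "left_linear R N' N'' g'"
  and "t : tensor_add R M N"
 shows "tensor_map R M' N' M'' N'' f' g' (tensor_map R M N M' N' f g t) =
  tensor_map R M N M'' N'' (\<lambda>m. f' (f m)) (\<lambda>n. g' (g n)) t"
proof -
 interpret T: tensor R M N by fact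
 have f: "right_linear R M M'' (\<lambda>m. f' (f m))"
  by (rule right_linear_comp) fact+
 have g: "left_linear R N N'' (\<lambda>n. g' (g n))"
  using assms(5,7) by (intro left_linearI) (auto simp: left_linearD)
 show ?thesis
  by (rule T.additive_eqI[OF additive_comp[OF tensor_map_additive[OF assms(1,2,4,5)]
     tensor_map_additive[OF assms(2,3,6,7)]] tensor_map_additive[OF assms(1,3) f g] _ assms(8)])
   (use assms right_linearD(2)[OF assms(4)] left_linearD(2)[OF assms(5)] in \<open>simp add: tensor_map_pure f g\<close>)
qed

abbreviation tmap ::
 "('r, 'z) ring_scheme => ('l, 'm, 'r, 'x) bimodule_scheme => ('k, 'n, 'r, 'y) bimodule_scheme =>
  ('r, 'p, 's, 'v) bimodule_scheme => ('m => 'n) => ('m, 'p) tensor => ('n, 'p) tensor" where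
 "tmap R M N P f \<equiv> tensor_map R M P N P f (\<lambda>p. p)"

lemmas tmap_pure = tensor_map_pure[OF _ _ _ left_linear_ident]
 and tmap_additive = tensor_map_additive[OF _ _ _ left_linear_ident]
 and tmap_compose = tensor_map_compose[OF _ _ _ _ left_linear_ident _ left_linear_ident]

lemma tensor_map_cong:
 assumes "tensor R M N" "tensor R M' N'" "right_linear R M M' f" "left_linear R N N' g"
  and "right_linear R M M' f'" "left_linear R N N' g'"
  and "!!m. m : M ==> f m = f' m" "!!n. n : N ==> g n = g' n"
 shows "tensor_map R M N M' N' f g = tensor_map R M N M' N' f' g'"
proof
 fix t
 interpret T: tensor R M N by fact
 show "tensor_map R M N M' N' f g t = tensor_map R M N M' N' f' g' t"
 proof (cases "t : T.T")
  case True
  show ?thesis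
   by (rule T.additive_eqI[OF tensor_map_additive[OF assms(1-4)] tensor_map_additive[OF assms(1,2,5,6)]])
    (simp_all add: tensor_map_pure assms True)
 qed (simp add: tensor_map_def)
qed

lemma tensor_map_ident:
 assumes "tensor R M N" "t : tensor_add R M N"
 shows "tmap R M M N (\<lambda>m. m) t = t"
proof -
 interpret T: tensor R M N by fact
 show ?thesis
  by (rule T.additive_eqI[OF tensor_map_additive[OF assms(1,1) right_linear_ident left_linear_ident] _ _ assms(2)])
   (simp_all add: additive_map_def tensor_map_pure assms(1) right_linear_ident left_linear_ident)
qed

lemma bimoduleD:
 assumes "bimodule R S N"
 shows "left_module R N" "right_module S N"
  and "[|a : R; m : N; b : S|] ==>
   (a \<odot>\<^sub>N m) \<star>\<^sub>N b = a \<odot>\<^sub>N (m \<star>\<^sub>N b)"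
 using assms by (simp_all add: bimodule_def bimodule_axioms_def)

lemma bimoduleI:
 assumes "left_module R N" "right_module S N"
  and "!!a m b. [|a : R; m : N; b : S|] ==>
   (a \<odot>\<^sub>N m) \<star>\<^sub>N b = a \<odot>\<^sub>N (m \<star>\<^sub>N b)"
 shows "bimodule R S N"
 using assms by (simp add: bimodule_def bimodule_axioms_def)

lemma tensorI: "[|right_module R M; left_module R N|] ==> tensor R M N"
 by (rule tensor.intro)

lemma bimodule_rsmult_linear: "[|bimodule R S N; a : S|] ==> left_linear R N N (\<lambda>n. n \<star>\<^sub>N a)"
proof -
 assume N: "bimodule R S N" and a: "a : S"
 interpret right_module S N using bimoduleD(2)[OF N] .
 show ?thesis using a by (intro left_linearI) (auto simp: rsmult_closed rsmult_l_distr bimoduleD(3)[OF N])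
qed

lemma bimodule_lsmult_linear: "[|bimodule R S N; a : R|] ==> right_linear S N N (\<lambda>n. a \<odot>\<^sub>N n)"
proof -
 assume N: "bimodule R S N" and a: "a : R"
 interpret left_module R N using bimoduleD(1)[OF N] .
 show ?thesis using a by (intro right_linearI) (auto simp: lsmult_closed lsmult_r_distr bimoduleD(3)[OF N])
qed

lemma tensor_prod_rsmult:
 assumes "right_module R M" "bimodule R S N" "a : S" "t : tensor_add R M N"
 shows "t \<star>\<^bsub>tensor_prod R M N\<^esub> a = tensor_map R M N M N (\<lambda>m. m) (\<lambda>n. n \<star>\<^sub>N a) t"
proof -
 have "t \<star>\<^bsub>tensor_prod R M N\<^esub> a = tensor_lift (tensor_add R M N) (\<lambda>m n. pure_tensor R M N m (n \<star>\<^sub>N a)) t"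
  by (simp add: tensor_prod_def)
 then show ?thesis using assms by (simp add: tensor_map_def)
qed

lemma tensor_prod_lsmult:
 assumes "t : tensor_add R M N"
 shows "a \<odot>\<^bsub>tensor_prod R M N\<^esub> t = tmap R M M N (\<lambda>m. a \<odot>\<^sub>M m) t"
proof -
 have "a \<odot>\<^bsub>tensor_prod R M N\<^esub> t = tensor_lift (tensor_add R M N) (\<lambda>m n. pure_tensor R M N (a \<odot>\<^sub>M m) n) t"
  by (simp add: tensor_prod_def)
 then show ?thesis using assms by (simp add: tensor_map_def)
qed

lemma rsmult_pure:
 assumes "right_module R M" "bimodule R S N" "a : S" "m : M" "n : N"
 shows "pure_tensor R M N m n \<star>\<^bsub>tensor_prod R M N\<^esub> a = pure_tensor R M N m (n \<star>\<^sub>N a)"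
proof -
 have T: "tensor R M N" by (intro tensorI assms bimoduleD(1)[OF assms(2)])
 show ?thesis
  using assms by (simp add: tensor_prod_rsmult tensor.pure_closed[OF T] tensor_map_pure[OF T T]
    right_linear_ident bimodule_rsmult_linear)
qed

lemma lsmult_pure:
 assumes "bimodule L R M" "left_module R N" "a : L" "m : M" "n : N"
 shows "a \<odot>\<^bsub>tensor_prod R M N\<^esub> pure_tensor R M N m n = pure_tensor R M N (a \<odot>\<^sub>M m) n"
proof -
 have T: "tensor R M N" by (intro tensorI assms bimoduleD(2)[OF assms(1)])
 show ?thesis
  using assms by (simp add: tensor_prod_lsmult tensor.pure_closed[OF T] tensor_map_pure[OF T T]
    left_linear_ident bimodule_lsmult_linear)
qed

text \<open>Each axiom compares two maps that are additive in t, so it is checked on pure tensors,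
  where it is the axiom of N.\<close>

lemma right_module_tensor_prod:
 assumes "right_module R M" "bimodule R S N"
 shows "right_module S (tensor_prod R M N)"
proof -
 interpret T: tensor R M N by (intro tensorI assms bimoduleD(1)[OF assms(2)])
 interpret NS: right_module S N by (rule bimoduleD(2)[OF assms(2)])
 let ?P = "tensor_prod R M N"
 have P: "abelian_group ?P" using T.ab_T by simp
 note add = tensor_map_additive[OF T.ax T.ax right_linear_ident bimodule_rsmult_linear[OF assms(2)]]
 have ra: "additive_map T.T T.T (\<lambda>t. t \<star>\<^bsub>?P\<^esub> a)" if "a : S" for a
  using add[OF that] that assms by (subst additive_cong[OF T.ab_T tensor_prod_rsmult]) auto
 note pure = rsmult_pure[OF assms]
 note ext = T.additive_eqI
 show ?thesis
 proof (rule right_moduleI[OF NS.R.ring_axioms P])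
  fix t a assume "t : ?P" "a : S"
  then show "t \<star>\<^bsub>?P\<^esub> a : ?P" using additive_closed[OF ra] by simp
 next
  fix t u a assume "t : ?P" "u : ?P" "a : S"
  then show "(t \<oplus>\<^bsub>?P\<^esub> u) \<star>\<^bsub>?P\<^esub> a = t \<star>\<^bsub>?P\<^esub> a \<oplus>\<^bsub>?P\<^esub> u \<star>\<^bsub>?P\<^esub> a"
   using additive_add[OF ra] by simp
 next
  fix t a b assume t: "t : ?P" and ab: "a : S" "b : S"
  have "t \<star>\<^bsub>?P\<^esub> (a \<oplus>\<^sub>S b) = t \<star>\<^bsub>?P\<^esub> a \<oplus>\<^bsub>T.T\<^esub> t \<star>\<^bsub>?P\<^esub> b"
   by (rule ext[OF ra additive_sum[OF T.ab_T ra ra]])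
    (use t ab in \<open>simp_all add: pure NS.rsmult_r_distr T.pure_add_right NS.rsmult_closed\<close>)
  then show "t \<star>\<^bsub>?P\<^esub> (a \<oplus>\<^sub>S b) = t \<star>\<^bsub>?P\<^esub> a \<oplus>\<^bsub>?P\<^esub> t \<star>\<^bsub>?P\<^esub> b" by simp
  show "t \<star>\<^bsub>?P\<^esub> (a \<otimes>\<^sub>S b) = t \<star>\<^bsub>?P\<^esub> a \<star>\<^bsub>?P\<^esub> b"
   by (rule ext[OF ra additive_comp[OF ra ra]])
    (use t ab in \<open>simp_all add: pure NS.rsmult_assoc NS.rsmult_closed\<close>)
 next
  fix t assume t: "t : ?P"
  show "t \<star>\<^bsub>?P\<^esub> \<one>\<^sub>S = t"
   by (rule ext[OF ra]) (use t in \<open>simp_all add: pure NS.rsmult_one additive_map_def\<close>)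
 qed
qed

lemma left_module_tensor_prod:
 assumes "bimodule L R M" "left_module R N"
 shows "left_module L (tensor_prod R M N)"
proof -
 interpret T: tensor R M N by (intro tensorI assms bimoduleD(2)[OF assms(1)])
 interpret LM: left_module L M by (rule bimoduleD(1)[OF assms(1)])
 let ?P = "tensor_prod R M N"
 have P: "abelian_group ?P" using T.ab_T by simp
 note add = tmap_additive[OF T.ax T.ax bimodule_lsmult_linear[OF assms(1)]]
 have la: "additive_map T.T T.T (\<lambda>t. a \<odot>\<^bsub>?P\<^esub> t)" if "a : L" for a
  using add[OF that] by (subst additive_cong[OF T.ab_T tensor_prod_lsmult]) auto
 note pure = lsmult_pure[OF assms]
 note ext = T.additive_eqI
 show ?thesis
 proof (rule left_moduleI[OF LM.R.ring_axioms P])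
  fix t a assume "t : ?P" "a : L"
  then show "a \<odot>\<^bsub>?P\<^esub> t : ?P" using additive_closed[OF la] by simp
 next
  fix t u a assume "t : ?P" "u : ?P" "a : L"
  then show "a \<odot>\<^bsub>?P\<^esub> (t \<oplus>\<^bsub>?P\<^esub> u) = a \<odot>\<^bsub>?P\<^esub> t \<oplus>\<^bsub>?P\<^esub> a \<odot>\<^bsub>?P\<^esub> u"
   using additive_add[OF la] by simp
 next
  fix t a b assume t: "t : ?P" and ab: "a : L" "b : L"
  have "(a \<oplus>\<^sub>L b) \<odot>\<^bsub>?P\<^esub> t = a \<odot>\<^bsub>?P\<^esub> t \<oplus>\<^bsub>T.T\<^esub> b \<odot>\<^bsub>?P\<^esub> t"
   by (rule ext[OF la additive_sum[OF T.ab_T la la]])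
    (use t ab in \<open>simp_all add: pure LM.lsmult_l_distr T.pure_add_left LM.lsmult_closed\<close>)
  then show "(a \<oplus>\<^sub>L b) \<odot>\<^bsub>?P\<^esub> t = a \<odot>\<^bsub>?P\<^esub> t \<oplus>\<^bsub>?P\<^esub> b \<odot>\<^bsub>?P\<^esub> t" by simp
  show "(a \<otimes>\<^sub>L b) \<odot>\<^bsub>?P\<^esub> t = a \<odot>\<^bsub>?P\<^esub> (b \<odot>\<^bsub>?P\<^esub> t)"
   by (rule ext[OF la additive_comp[OF la la]])
    (use t ab in \<open>simp_all add: pure LM.lsmult_assoc LM.lsmult_closed\<close>)
 next
  fix t assume t: "t : ?P"
  show "\<one>\<^sub>L \<odot>\<^bsub>?P\<^esub> t = t"
   by (rule ext[OF la]) (use t in \<open>simp_all add: pure LM.lsmult_one additive_map_def\<close>)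
 qed
qed

lemma tensor_map_right_linear:
 assumes "right_module R M" "right_module R M'" "bimodule R S N" "bimodule R S N'"
  and "right_linear R M M' f" "left_linear R N N' g" "right_linear S N N' g"
 shows "right_linear S (tensor_prod R M N) (tensor_prod R M' N') (tensor_map R M N M' N' f g)"
proof -
 interpret T: tensor R M N by (intro tensorI assms bimoduleD(1)[OF assms(3)])
 interpret T': tensor R M' N' by (intro tensorI assms bimoduleD(1)[OF assms(4)])
 interpret P: right_module S "tensor_prod R M N" by (rule right_module_tensor_prod) fact+
 interpret P': right_module S "tensor_prod R M' N'" by (rule right_module_tensor_prod) fact+
 interpret N: right_module S N by (rule bimoduleD(2)[OF assms(3)])
 note add = tensor_map_additive[OF T.ax T'.ax assms(5,6)]
 note pure = tensor_map_pure[OF T.ax T'.ax assms(5,6)]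
 have "tensor_map R M N M' N' f g (t \<star>\<^bsub>tensor_prod R M N\<^esub> a) = tensor_map R M N M' N' f g t \<star>\<^bsub>tensor_prod R M' N'\<^esub> a"
  if "t : T.T" "a : S" for t a
  by (rule T.additive_eqI[OF additive_comp[OF P.additive_rsmult[OF that(2), simplified] add]
     additive_comp[OF add P'.additive_rsmult[OF that(2), simplified]]])
   (use that right_linearD(2)[OF assms(5)] left_linearD(2)[OF assms(6)] right_linearD(4)[OF assms(7)] in
    \<open>simp_all add: rsmult_pure[OF assms(1,3)] rsmult_pure[OF assms(2,4)] pure N.rsmult_closed\<close>)
 then show ?thesis using add by (simp add: right_linear_def)
qed

section \<open>Associativity of the tensor product\<close>

locale tensor3 =
 fixes R :: "('r, 'z) ring_scheme" and T :: "('t, 'w) ring_scheme"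
  and M :: "('l, 'm, 'r, 'x) bimodule_scheme" and N :: "('r, 'n, 't, 'y) bimodule_scheme"
  and P :: "('t, 'p, 's, 'v) bimodule_scheme"
 assumes M: "right_module R M" and N: "bimodule R T N" and P: "left_module T P"
begin

abbreviation "MN \<equiv> tensor_prod R M N"
abbreviation "NP \<equiv> tensor_prod T N P"

sublocale MN: tensor R M N by (intro tensorI M bimoduleD(1)[OF N])
sublocale NP: tensor T N P by (intro tensorI P bimoduleD(2)[OF N])
sublocale MN_P: tensor T MN P by (intro tensorI P right_module_tensor_prod M N)
sublocale M_NP: tensor R M NP by (intro tensorI M left_module_tensor_prod N P)

text \<open>\<open>tensor_assoc\<close> is a lift within a lift. With p fixed, the inner one moves
  scalars of R across through the left action on N \<otimes> P.\<close>

lemma assoc_inner: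
 assumes "p : P"
 shows "balanced R M N M_NP.T (\<lambda>m n. M_NP.pt m (NP.pt n p))"
proof -
 have "a \<odot>\<^bsub>NP\<^esub> NP.pt n p = NP.pt (a \<odot>\<^sub>N n) p" if "a : R" "n : N" for a n
  by (rule lsmult_pure[OF N P that assms])
 note a = this[symmetric]
 show ?thesis
  using assms M_NP.pure_balanced M_NP.pure_add_right
  by (intro balancedI) (simp_all add: a M_NP.pure_closed NP.pure_closed NP.pure_add_left M_NP.pure_add_left)
qed

lemma assoc_outer:
 "balanced T MN P M_NP.T (\<lambda>t p. tensor_lift M_NP.T (\<lambda>m n. M_NP.pt m (NP.pt n p)) t)"
proof -
 note cl = MN.lift_closed[OF M_NP.ab_T assoc_inner]
 note ad = MN.lift_additive[OF M_NP.ab_T assoc_inner]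
 note pure = MN.lift_pure[OF M_NP.ab_T assoc_inner]
 show ?thesis
 proof (rule balancedI)
  fix t p p' assume *: "t : MN" "p : P" "p' : P"
  show "tensor_lift M_NP.T (\<lambda>m n. M_NP.pt m (NP.pt n (p \<oplus>\<^sub>P p'))) t =
    tensor_lift M_NP.T (\<lambda>m n. M_NP.pt m (NP.pt n p)) t \<oplus>\<^bsub>M_NP.T\<^esub>
    tensor_lift M_NP.T (\<lambda>m n. M_NP.pt m (NP.pt n p')) t"
   by (rule MN.additive_eqI[OF ad additive_sum[OF M_NP.ab_T ad ad]])
    (use * M_NP.pure_add_right in \<open>simp_all add: pure NP.pure_add_right NP.pure_closed\<close>)
 next
  fix t a p assume *: "t : MN" "a : T" "p : P"
  have pt: "NP.pt (n \<star>\<^sub>N a) p = NP.pt n (a \<odot>\<^sub>P p)" if "n : N" for n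
   by (rule NP.pure_balanced[OF that *(2,3)])
  show "tensor_lift M_NP.T (\<lambda>m n. M_NP.pt m (NP.pt n p)) (t \<star>\<^bsub>MN\<^esub> a) =
    tensor_lift M_NP.T (\<lambda>m n. M_NP.pt m (NP.pt n (a \<odot>\<^sub>P p))) t"
   by (rule MN.additive_eqI[OF additive_comp[OF MN_P.M.additive_rsmult[simplified] ad] ad])
    (use * in \<open>simp_all add: pure rsmult_pure[OF M N] NP.N.lsmult_closed NP.M.rsmult_closed pt\<close>)
 qed (use cl additive_add[OF ad] in simp_all)
qed

lemma assoc_additive: "additive_map MN_P.T M_NP.T (tensor_assoc R T M N P)"
 unfolding tensor_assoc_def Let_def using MN_P.lift_additive[OF M_NP.ab_T assoc_outer] by simp

lemma assoc_pure:
 assumes "m : M" "n : N" "p : P"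
 shows "tensor_assoc R T M N P (MN_P.pt (MN.pt m n) p) = M_NP.pt m (NP.pt n p)"
 unfolding tensor_assoc_def Let_def
 using assms MN_P.lift_pure[OF M_NP.ab_T assoc_outer]
  MN.lift_pure[OF M_NP.ab_T assoc_inner] by (simp add: MN.pure_closed)

lemma assoc_inv_inner:
 assumes "m : M"
 shows "balanced T N P MN_P.T (\<lambda>n p. MN_P.pt (MN.pt m n) p)"
proof -
 interpret N': right_module T N by (rule bimoduleD(2)[OF N])
 have "MN.pt m n \<star>\<^bsub>MN\<^esub> a = MN.pt m (n \<star>\<^sub>N a)" if "a : T" "n : N" for a n
  by (rule rsmult_pure[OF M N that(1) assms that(2)])
 note a = this[symmetric]
 show ?thesis
  using assms MN_P.pure_balanced MN_P.pure_add_left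
  by (intro balancedI) (simp_all add: a MN_P.pure_closed MN.pure_closed MN.pure_add_right MN_P.pure_add_right)
qed

lemma assoc_inv_outer:
 "balanced R M NP MN_P.T (\<lambda>m t. tensor_lift MN_P.T (\<lambda>n p. MN_P.pt (MN.pt m n) p) t)"
proof -
 note cl = NP.lift_closed[OF MN_P.ab_T assoc_inv_inner]
 note ad = NP.lift_additive[OF MN_P.ab_T assoc_inv_inner]
 note pure = NP.lift_pure[OF MN_P.ab_T assoc_inv_inner]
 show ?thesis
 proof (rule balancedI)
  fix t m m' assume *: "t : NP" "m : M" "m' : M"
  show "tensor_lift MN_P.T (\<lambda>n p. MN_P.pt (MN.pt (m \<oplus>\<^sub>M m') n) p) t =
    tensor_lift MN_P.T (\<lambda>n p. MN_P.pt (MN.pt m n) p) t \<oplus>\<^bsub>MN_P.T\<^esub>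
    tensor_lift MN_P.T (\<lambda>n p. MN_P.pt (MN.pt m' n) p) t"
   by (rule NP.additive_eqI[OF ad additive_sum[OF MN_P.ab_T ad ad]])
    (use * MN_P.pure_add_left in \<open>simp_all add: pure MN.pure_add_left MN.pure_closed\<close>)
 next
  fix t a m assume *: "m : M" "a : R" "t : NP"
  have pt: "MN.pt (m \<star>\<^sub>M a) n = MN.pt m (a \<odot>\<^sub>N n)" if "n : N" for n
   by (rule MN.pure_balanced[OF *(1,2) that])
  show "tensor_lift MN_P.T (\<lambda>n p. MN_P.pt (MN.pt (m \<star>\<^sub>M a) n) p) t =
    tensor_lift MN_P.T (\<lambda>n p. MN_P.pt (MN.pt m n) p) (a \<odot>\<^bsub>NP\<^esub> t)"
   by (rule NP.additive_eqI[OF ad additive_comp[OF M_NP.N.additive_lsmult[simplified] ad]])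
    (use * in \<open>simp_all add: pure lsmult_pure[OF N P] MN.N.lsmult_closed MN.M.rsmult_closed pt\<close>)
 qed (use cl additive_add[OF ad] in simp_all)
qed

lemma assoc_inv_additive: "additive_map M_NP.T MN_P.T (tensor_assoc_inv R T M N P)"
 unfolding tensor_assoc_inv_def Let_def using M_NP.lift_additive[OF MN_P.ab_T assoc_inv_outer] by simp

lemma assoc_inv_pure:
 assumes "m : M" "n : N" "p : P"
 shows "tensor_assoc_inv R T M N P (M_NP.pt m (NP.pt n p)) = MN_P.pt (MN.pt m n) p"
 unfolding tensor_assoc_inv_def Let_def
 using assms M_NP.lift_pure[OF MN_P.ab_T assoc_inv_outer]
  NP.lift_pure[OF MN_P.ab_T assoc_inv_inner] by (simp add: NP.pure_closed)

lemma additive_eqI_left: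
 assumes "additive_map MN_P.T Q f" "additive_map MN_P.T Q g"
  and "!!m n p. [|m : M; n : N; p : P|] ==>
   f (MN_P.pt (MN.pt m n) p) = g (MN_P.pt (MN.pt m n) p)"
  and "t : MN_P.T"
 shows "f t = g t"
proof (rule MN_P.additive_eqI[OF assms(1,2) _ assms(4)])
 fix s p assume s: "s : MN" and p: "p : P"
 have "additive_map MN.T MN_P.T (\<lambda>s. MN_P.pt s p)"
  using MN_P.balanced_pure p by (simp add: balanced_def)
 note ad = additive_comp[OF this assms(1)] additive_comp[OF this assms(2)]
 show "f (MN_P.pt s p) = g (MN_P.pt s p)"
  by (rule MN.additive_eqI[OF ad]) (use s p assms(3) in auto)
qed

lemma additive_eqI_right:
 assumes "additive_map M_NP.T Q f" "additive_map M_NP.T Q g"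
  and "!!m n p. [|m : M; n : N; p : P|] ==>
   f (M_NP.pt m (NP.pt n p)) = g (M_NP.pt m (NP.pt n p))"
  and "t : M_NP.T"
 shows "f t = g t"
proof (rule M_NP.additive_eqI[OF assms(1,2) _ assms(4)])
 fix m s assume s: "s : NP" and m: "m : M"
 have "additive_map NP.T M_NP.T (M_NP.pt m)"
  using M_NP.balanced_pure m by (simp add: balanced_def)
 note ad = additive_comp[OF this assms(1)] additive_comp[OF this assms(2)]
 show "f (M_NP.pt m s) = g (M_NP.pt m s)"
  by (rule NP.additive_eqI[OF ad]) (use s m assms(3) in auto)
qed

lemma assoc_assoc_inv:
 assumes "t : M_NP.T"
 shows "tensor_assoc R T M N P (tensor_assoc_inv R T M N P t) = t"
 by (rule additive_eqI_right[OF additive_comp[OF assoc_inv_additive assoc_additive] _ _ assms])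
  (simp_all add: assoc_pure assoc_inv_pure additive_map_def)

lemma assoc_inv_assoc:
 assumes "t : MN_P.T"
 shows "tensor_assoc_inv R T M N P (tensor_assoc R T M N P t) = t"
 by (rule additive_eqI_left[OF additive_comp[OF assoc_additive assoc_inv_additive] _ _ assms])
  (simp_all add: assoc_pure assoc_inv_pure additive_map_def)

end

section \<open>Cardinality and copies of modules\<close>

abbreviation small :: "'u itself => ('m, 'z) partial_object_scheme => bool" where
 "small U M \<equiv> carrier M \<lesssim> (UNIV :: 'u set)"

text \<open>An infinite type has as many finite lists as elements, so whatever is coded by lists
  over \<open>'u\<close> fits into \<open>'u\<close>.\<close>

lemma lepoll_range_list:
 fixes F :: "'u list => 'b"
 assumes "infinite (UNIV :: 'u set)" "X \<subseteq> range F"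
 shows "X \<lesssim> (UNIV :: 'u set)"
proof -
 have "lists (UNIV :: 'u set) \<approx> (UNIV :: 'u set)"
  using card_of_lists_infinite[OF assms(1)] by (simp add: eqpoll_iff_card_of_ordIso)
 then have "(UNIV :: 'u list set) \<lesssim> (UNIV :: 'u set)" by (simp add: eqpoll_imp_lepoll)
 then show ?thesis using subset_image_lepoll[OF assms(2)] lepoll_trans by blast
qed

lemma times_lepoll_UNIV:
 assumes "infinite (UNIV :: 'u set)" "X \<lesssim> (UNIV :: 'u set)" "Y \<lesssim> (UNIV :: 'u set)"
 shows "X \<times> Y \<lesssim> (UNIV :: 'u set)"
proof -
 have "X \<times> Y \<lesssim> (UNIV :: 'u set) \<times> (UNIV :: 'u set)" by (rule times_lepoll_mono) fact+
 also have "(UNIV :: 'u set) \<times> (UNIV :: 'u set) \<approx> (UNIV :: 'u set)"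
  using card_of_Times_same_infinite[OF assms(1)] by (simp add: eqpoll_iff_card_of_ordIso)
 finally show ?thesis .
qed

text \<open>A tensor is a finite sum of pure tensors, hence coded by a list over \<open>'u\<close>
  whose entries code pairs.\<close>

lemma (in tensor) lepoll_T:
 assumes "infinite (UNIV :: 'u set)" "small TYPE('u) M" "small TYPE('u) N"
 shows "small TYPE('u) T"
proof -
 obtain d :: "'u => 'm \<times> 'n" where d: "carrier M \<times> carrier N \<subseteq> range d"
  using times_lepoll_UNIV[OF assms] by (auto simp: lepoll_iff)
 \<comment> \<open>Codes that stand for no pair contribute zero, so that every list has a value in
   \<open>T\<close>.\<close>
 define e where "e u = (if d u \<in> carrier M \<times> carrier N then pt (fst (d u)) (snd (d u)) else \<zero>\<^sub>T)" for u
 define sm where "sm l = foldr (\<lambda>u t. e u \<oplus>\<^sub>T t) l \<zero>\<^sub>T" for l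
 have e: "e u : T" for u by (auto simp: e_def pure_closed)
 have Fc: "sm l : T" for l by (induction l) (auto simp: sm_def e)
 have app: "sm (l @ l') = sm l \<oplus>\<^sub>T sm l'" for l l'
 proof (induction l)
  case (Cons u l)
  then show ?case using e Fc[of l] Fc[of l'] T.a_assoc[OF e Fc Fc] by (simp add: sm_def)
 qed (use Fc in \<open>simp add: sm_def\<close>)
 have "carrier T \<subseteq> range sm"
 proof
  fix t assume "t : T"
  then show "t \<in> range sm"
  proof (induction rule: induct)
   case (pure m n)
   then obtain u where "(m, n) = d u" using d by blast
   then have "pt m n = sm [u]" using pure e[of u] by (simp add: sm_def) (simp add: e_def \<open>(m, n) = d u\<close>[symmetric])
   then show ?case by blast
  next
   case (add t t')
   then obtain l l' where "t = sm l" "t' = sm l'" by auto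
   then have "t \<oplus>\<^sub>T t' = sm (l @ l')" by (simp only: app)
   then show ?case by blast
  qed
 qed
 then show ?thesis by (rule lepoll_range_list[OF assms(1)])
qed

text \<open>An isomorphism given together with its inverse. Unlike \<open>right_iso\<close> it does
  not ask for extensional functions, so copies compose without restrictions.\<close>

definition right_copy ::
 "('r, 'z) ring_scheme => ('l, 'm, 'r, 'x) bimodule_scheme => ('k, 'n, 'r, 'y) bimodule_scheme =>
  ('m => 'n) => ('n => 'm) => bool" where
 "right_copy R M N \<phi> \<psi> \<longleftrightarrow> right_module R M \<and> right_module R N \<and> right_linear R M N \<phi> \<and> right_linear R N M \<psi> \<and>
   (\<forall>m\<in>carrier M. \<psi> (\<phi> m) = m) \<and> (\<forall>n\<in>carrier N. \<phi> (\<psi> n) = n)"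

lemma right_copyD:
 assumes "right_copy R M N \<phi> \<psi>"
 shows "right_module R M" "right_module R N" "right_linear R M N \<phi>" "right_linear R N M \<psi>"
  "m : M ==> \<psi> (\<phi> m) = m" "n : N ==> \<phi> (\<psi> n) = n"
  "m : M ==> \<phi> m : N" "n : N ==> \<psi> n : M"
 using assms by (auto simp: right_copy_def dest: right_linearD(2))

lemma right_copy_sym: "right_copy R M N \<phi> \<psi> ==> right_copy R N M \<psi> \<phi>"
 unfolding right_copy_def by simp

text \<open>Transport of structure along an injection into \<open>'u\<close>; definitions that test
  modules over \<open>'u\<close> apply to the copy.\<close>

lemma obtain_right_copy:
 fixes M :: "('l, 'm, 'r, 'x) bimodule_scheme"
 assumes "right_module R M" "small TYPE('u) M"
 obtains N :: "(unit, 'u, 'r) bimodule" and \<phi> \<psi> where "right_copy R M N \<phi> \<psi>"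
proof -
 interpret right_module R M by fact
 obtain \<phi> :: "'m => 'u" where inj: "inj_on \<phi> (carrier M)" using assms(2) by (auto simp: lepoll_def)
 define \<psi> where "\<psi> = inv_into (carrier M) \<phi>"
 define N :: "(unit, 'u, 'r) bimodule" where
  "N = \<lparr>carrier = \<phi> ` carrier M, monoid.mult = undefined, one = undefined, ring.zero = \<phi> \<zero>\<^sub>M,
   add = (\<lambda>u v. \<phi> (\<psi> u \<oplus>\<^sub>M \<psi> v)), smult = undefined, rsmult = (\<lambda>u a. \<phi> (\<psi> u \<star>\<^sub>M a))\<rparr>"
 have \<psi>: "\<psi> (\<phi> m) = m" if "m : M" for m using that inj by (simp add: \<psi>_def)
 have N: "carrier N = \<phi> ` carrier M" "\<zero>\<^sub>N = \<phi> \<zero>\<^sub>M"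
  "!!u v. u \<oplus>\<^sub>N v = \<phi> (\<psi> u \<oplus>\<^sub>M \<psi> v)" "!!u a. u \<star>\<^sub>N a = \<phi> (\<psi> u \<star>\<^sub>M a)"
  by (simp_all add: N_def)
 have "right_module R N" "right_linear R M N \<phi>"
  by (rule right_module_image[OF assms(1), of \<phi>]; simp add: N \<psi> rsmult_closed)+
 moreover have "right_linear R N M \<psi>"
  by (rule right_linearI; auto simp: N \<psi> rsmult_closed)
 ultimately show ?thesis
  by (intro that[of N \<phi> \<psi>]) (auto simp: right_copy_def assms(1) N \<psi>)
qed

lemma tensor_map_copy:
 assumes "right_copy R M M' \<phi> \<psi>" "left_module R N" "t : tensor_add R M N"
 shows "tmap R M' M N \<psi> (tmap R M M' N \<phi> t) = t"
proof -
 note c = right_copyD[OF assms(1)]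
 have T: "tensor R M N" "tensor R M' N" by (auto intro: tensorI c assms)
 have "tmap R M' M N \<psi> (tmap R M M' N \<phi> t) =
   tmap R M M N (\<lambda>m. \<psi> (\<phi> m)) t"
  by (rule tensor_map_compose[OF T T(1) c(3) left_linear_ident c(4) left_linear_ident assms(3)])
 also have "\<dots> = tmap R M M N (\<lambda>m. m) t"
  by (subst tensor_map_cong[OF T(1,1) right_linear_comp[OF c(3,4)] left_linear_ident right_linear_ident left_linear_ident])
   (simp_all add: c)
 also have "\<dots> = t" by (rule tensor_map_ident) fact+
 finally show ?thesis .
qed

lemma tensor_map_cong_id:
 assumes "right_module R M" "right_module R M'" "left_module R N" "right_linear R M M' f"
  and "!!m. m : M ==> f m = f' m"
 shows "tmap R M M' N f = tmap R M M' N f'"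
proof -
 interpret M: right_module R M by fact
 have "right_linear R M M' f'"
  using right_linearD[OF assms(4)] by (intro right_linearI) (simp_all add: M.rsmult_closed flip: assms(5))
 then show ?thesis
  using assms by (intro tensor_map_cong) (auto intro: tensorI left_linear_ident)
qed

section \<open>Flat modules and weak generators\<close>

text \<open>\<open>flat_left\<close> tests only modules over \<open>'u\<close>. The map is
  conjugated by copies of its source and target, and injectivity is carried back along the square of
  induced maps between tensor products.\<close>

lemma flat_left_inj:
 fixes N :: "('r, 'n, 's, 'y) bimodule_scheme"
 assumes flat: "flat_left TYPE('u) R N" and mods: "right_module R M" "right_module R P" "left_module R N"
  and small: "small TYPE('u) M" "small TYPE('u) P"
  and f: "right_linear R M P f" "inj_on f (carrier M)"
 shows "inj_on (tmap R M P N f) (carrier (tensor_add R M N))"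
proof -
 obtain M' :: "(unit, 'u, 'r) bimodule" and \<phi> \<psi> where M': "right_copy R M M' \<phi> \<psi>"
  using obtain_right_copy[OF mods(1) small(1)] .
 obtain P' :: "(unit, 'u, 'r) bimodule" and \<phi>' \<psi>' where P': "right_copy R P P' \<phi>' \<psi>'"
  using obtain_right_copy[OF mods(2) small(2)] .
 note c = right_copyD[OF M'] and c' = right_copyD[OF P']
 have T: "tensor R M N" "tensor R P N" "tensor R M' N" "tensor R P' N"
  by (auto intro: tensorI mods c c')
 interpret M'm: right_module R M' by (rule c)
 let ?f = "restrict (\<lambda>m. \<phi>' (f (\<psi> m))) (carrier M')"
 have lin: "right_linear R M' P' (\<lambda>m. \<phi>' (f (\<psi> m)))"
  by (intro right_linear_comp[OF right_linear_comp[OF c(4) f(1)] c'(3)])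
 then have f': "?f \<in> right_hom R M' P'"
  by (simp add: right_hom_def right_linear_restrict[OF c(2)])
 have f'l: "right_linear R M' P' ?f" using f' unfolding right_hom_def by blast
 have "inj_on ?f (carrier M')"
 proof (rule inj_onI)
  fix x y assume xy: "x : M'" "y : M'" "?f x = ?f y"
  then have "f (\<psi> x) = f (\<psi> y)"
   using c'(5) c(8) right_linearD(2)[OF f(1)] by (metis restrict_apply)
  then have "\<psi> x = \<psi> y" using f(2) c(8) xy by (auto simp: inj_on_def)
  then show "x = y" using c(6) xy by metis
 qed
 then have inj: "inj_on (tmap R M' P' N ?f) (carrier (tensor_add R M' N))"
  using flat f' c(2) c'(2) unfolding flat_left_def by simp
 have eq: "tmap R M' P' N ?f (tmap R M M' N \<phi> t) =
   tmap R P P' N \<phi>' (tmap R M P N f t)"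
  if "t : tensor_add R M N" for t
 proof -
  have "tmap R M' P' N ?f (tmap R M M' N \<phi> t) =
   tmap R M P' N (\<lambda>m. ?f (\<phi> m)) t"
   by (intro tensor_map_compose that T c left_linear_ident f'l)
  also have "\<dots> = tmap R M P' N (\<lambda>m. \<phi>' (f m)) t"
  proof -
   have "right_linear R M P' (\<lambda>m. ?f (\<phi> m))"
    by (rule right_linear_comp[OF c(3) f'l])
   then have "tmap R M P' N (\<lambda>m. ?f (\<phi> m)) = tmap R M P' N (\<lambda>m. \<phi>' (f m))"
    by (rule tensor_map_cong_id[OF mods(1) c'(2) mods(3)]) (simp add: c)
   then show ?thesis by simp
  qed
  also have "\<dots> = tmap R P P' N \<phi>' (tmap R M P N f t)"
   by (rule tensor_map_compose[symmetric]) (intro that T f c' left_linear_ident)+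
  finally show ?thesis .
 qed
 show ?thesis
 proof (rule inj_onI)
  fix t t' assume t: "t : tensor_add R M N" "t' : tensor_add R M N"
   and "tmap R M P N f t = tmap R M P N f t'"
  then have "tmap R M' P' N ?f (tmap R M M' N \<phi> t) =
   tmap R M' P' N ?f (tmap R M M' N \<phi> t')"
   by (simp add: eq)
  then have "tmap R M M' N \<phi> t = tmap R M M' N \<phi> t'"
   using inj t additive_closed[OF tensor_map_additive[OF T(1,3) c(3) left_linear_ident]]
   by (auto simp: inj_on_def)
  then show "t = t'" using tensor_map_copy[OF M' mods(3)] t by metis
 qed
qed

lemma lepoll_subset: "[|Y \<lesssim> Z; X \<subseteq> Y|] ==> X \<lesssim> Z"
 by (meson lepoll_trans subset_imp_lepoll)

text \<open>Divide M \<otimes> N by the image I of K \<otimes> N. Then (f m, n) \<mapsto> m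
  \<otimes> n modulo I is balanced on J and N, and its lift composed with f \<otimes> N is the
  projection modulo I. So an element killed by f \<otimes> N lies in I.\<close>

lemma tensor_right_exact:
 fixes N :: "('r, 'n, 's, 'y) bimodule_scheme"
 assumes mods: "right_module R M" "right_module R J" "left_module R N"
  and f: "right_linear R M J f" "f ` carrier M = carrier J"
  and t: "t : tensor_add R M N" "tmap R M J N f t = \<zero>\<^bsub>tensor_add R J N\<^esub>"
 defines "K \<equiv> M\<lparr>carrier := {m \<in> carrier M. f m = \<zero>\<^sub>J}\<rparr>"
 shows "\<exists>s\<in>carrier (tensor_add R K N). tmap R K M N (\<lambda>m. m) s = t"
proof -
 interpret M: right_module R M by fact
 interpret J: right_module R J by fact
 interpret N: left_module R N by fact
 have K: "right_module R K" unfolding K_def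
  by (rule submodule_module[OF mods(1) right_submodule_kernel[OF mods(1,2) f(1)]])
 interpret TM: tensor R M N by (intro tensorI mods)
 interpret TK: tensor R K N by (intro tensorI mods K)
 interpret TJ: tensor R J N by (intro tensorI mods)
 have iK: "right_linear R K M (\<lambda>m. m)" by (rule right_linearI) (auto simp: K_def)
 let ?k = "tmap R K M N (\<lambda>m. m)"
 have k_add: "additive_map TK.T TM.T ?k"
  by (rule tmap_additive[OF TK.ax TM.ax iK])
 define I where "I = ?k ` carrier TK.T"
 have I: "subgroup I (add_monoid TM.T)"
  unfolding I_def using group_hom.img_is_subgroup[OF additive_map_group_hom[OF TK.ab_T TM.ab_T k_add]] by simp
 define Q where "Q = quotient_module (tensor_prod R M N) I"
 have I': "subgroup I (add_monoid (tensor_prod R M N))"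
  using I by (auto simp: subgroup_def m_inv_def)
 have TM': "abelian_group (tensor_prod R M N)" using TM.ab_T by simp
 note q = quotient_abelian_group[OF TM' I', folded Q_def]
 let ?q = "\<lambda>t. I +>\<^bsub>tensor_prod R M N\<^esub> t"
 interpret Q: abelian_group Q by (rule q)
 have qadd: "additive_map TM.T Q ?q" using q(2) by simp
 have q_eq: "?q (TM.pt m n) = ?q (TM.pt m' n)"
  if "m : M" "m' : M" "f m = f m'" "n : N" for m m' n
 proof -
  have "m \<ominus>\<^sub>M m' : K"
   using that by (simp add: K_def additive_minus[OF M.ab_M J.ab_M right_linearD(1)[OF f(1)]]
     right_linearD(2)[OF f(1)] minus_zero_iff J.ab_M)
  then have "?k (TK.pt (m \<ominus>\<^sub>M m') n) = TM.pt (m \<ominus>\<^sub>M m') n" "TK.pt (m \<ominus>\<^sub>M m') n : TK.T"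
   using tmap_pure[OF TK.ax TM.ax iK] TK.pure_closed that by auto
  then have "TM.pt (m \<ominus>\<^sub>M m') n \<in> I" unfolding I_def by force
  moreover have "TM.pt (m \<ominus>\<^sub>M m') n = TM.pt m n \<ominus>\<^bsub>TM.T\<^esub> TM.pt m' n"
   using additive_minus[of M TM.T "\<lambda>m. TM.pt m n" m m'] TM.balanced_pure that
   by (simp add: balanced_def M.ab_M TM.ab_T)
  ultimately have "?q (TM.pt m n \<ominus>\<^bsub>TM.T\<^esub> TM.pt m' n) = \<zero>\<^sub>Q"
   using q(4) TM.pure_closed that by simp
  then show ?thesis
   using additive_minus[OF TM.ab_T q(1) qadd] that TM.pure_closed
    minus_zero_iff[OF q(1)] additive_closed[OF qadd] by metis
 qed
 \<comment> \<open>The preimage is chosen arbitrarily; by \<open>q_eq\<close> two preimages differ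
   by an element of \<open>K\<close>, which does not change the class modulo
   \<open>I\<close>.\<close>
 define b where "b j n = ?q (TM.pt (inv_into (carrier M) f j) n)" for j n
 have b: "b (f m) n = ?q (TM.pt m n)" if "m : M" "n : N" for m n
  unfolding b_def using that by (intro q_eq) (auto simp: inv_into_into f_inv_into_f)
 have bal: "balanced R J N Q b"
 proof (rule balancedI)
  fix j n assume "j : J" "n : N"
  then show "b j n : Q" using b additive_closed[OF qadd] TM.pure_closed unfolding f(2)[symmetric] by auto
 next
  fix j j' n assume *: "j : J" "j' : J" "n : N"
  then obtain m m' where m: "j = f m" "j' = f m'" "m : M" "m' : M" unfolding f(2)[symmetric] by auto
  have "j \<oplus>\<^sub>J j' = f (m \<oplus>\<^sub>M m')" using m right_linearD(3)[OF f(1)] by simp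
  then show "b (j \<oplus>\<^sub>J j') n = b j n \<oplus>\<^sub>Q b j' n"
   using m *(3) by (simp add: b TM.pure_add_left additive_add[OF qadd] TM.pure_closed)
 next
  fix j n n' assume *: "j : J" "n : N" "n' : N"
  then show "b j (n \<oplus>\<^sub>N n') = b j n \<oplus>\<^sub>Q b j n'"
   unfolding f(2)[symmetric] by (auto simp: b TM.pure_add_right additive_add[OF qadd] TM.pure_closed)
 next
  fix j a n assume *: "j : J" "a : R" "n : N"
  then obtain m where m: "j = f m" "m : M" unfolding f(2)[symmetric] by auto
  then have "j \<star>\<^sub>J a = f (m \<star>\<^sub>M a)" using * right_linearD(4)[OF f(1)] by simp
  then show "b (j \<star>\<^sub>J a) n = b j (a \<odot>\<^sub>N n)"
   using m * by (simp add: b M.rsmult_closed N.lsmult_closed TM.pure_balanced)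
 qed
 let ?fJ = "tmap R M J N f"
 have fJ_add: "additive_map TM.T TJ.T ?fJ"
  by (rule tmap_additive[OF TM.ax TJ.ax f(1)])
 have "tensor_lift Q b (?fJ t) = ?q t"
  by (rule TM.additive_eqI[OF additive_comp[OF fJ_add TJ.lift_additive[OF q(1) bal]] qadd _ t(1)])
   (use tmap_pure[OF TM.ax TJ.ax f(1)]
    TJ.lift_pure[OF q(1) bal] right_linearD(2)[OF f(1)] b in simp)
 then have "?q t = \<zero>\<^sub>Q"
  using t(2) additive_zero[OF TJ.ab_T q(1) TJ.lift_additive[OF q(1) bal]] by simp
 then have "t \<in> I" using q(4) t(1) by simp
 then show ?thesis by (auto simp: I_def)
qed

text \<open>Factor f through its image J. Flatness keeps the inclusion of J into P injective after
  tensoring, so t is already killed in J \<otimes> N, and right exactness applies to M \<rightarrow>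
  J.\<close>

lemma flat_left_kernel:
 fixes N :: "('r, 'n, 's, 'y) bimodule_scheme"
 assumes flat: "flat_left TYPE('u) R N" and mods: "right_module R M" "right_module R P" "left_module R N"
  and small: "small TYPE('u) P"
  and f: "right_linear R M P f"
  and t: "t : tensor_add R M N" "tmap R M P N f t = \<zero>\<^bsub>tensor_add R P N\<^esub>"
 defines "K \<equiv> M\<lparr>carrier := {m \<in> carrier M. f m = \<zero>\<^sub>P}\<rparr>"
 shows "\<exists>s\<in>carrier (tensor_add R K N). tmap R K M N (\<lambda>m. m) s = t"
proof -
 define J where "J = P\<lparr>carrier := f ` carrier M\<rparr>"
 have J: "right_module R J" unfolding J_def
  by (rule submodule_module[OF mods(2) right_submodule_image[OF mods(1,2) f]])
 interpret TM: tensor R M N by (intro tensorI mods)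
 interpret TP: tensor R P N by (intro tensorI mods)
 interpret TJ: tensor R J N by (intro tensorI mods J)
 have iJ: "right_linear R J P (\<lambda>m. m)"
  by (rule right_linearI) (auto simp: J_def right_linearD(2)[OF f])
 have fJ: "right_linear R M J f"
  by (rule right_linearI) (auto simp: J_def right_linearD[OF f])
 let ?fJ = "tmap R M J N f"
 note fJ_add = tmap_additive[OF TM.ax TJ.ax fJ]
 have "?fJ t = \<zero>\<^bsub>TJ.T\<^esub>"
 proof -
  let ?i = "tmap R J P N (\<lambda>m. m)"
  have inj: "inj_on ?i (carrier TJ.T)"
  proof (rule flat_left_inj[OF flat J mods(2,3) _ small iJ])
   show "small TYPE('u) J" using right_linearD(2)[OF f]
    by (intro lepoll_subset[OF small]) (auto simp: J_def)
  qed (simp add: inj_on_def)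
  have i_add: "additive_map TJ.T TP.T ?i"
   by (rule tmap_additive[OF TJ.ax TP.ax iJ])
  have "?i (?fJ t) = tmap R M P N f t"
   by (rule tmap_compose[OF TM.ax TJ.ax TP.ax fJ iJ t(1)])
  also have "\<dots> = ?i \<zero>\<^bsub>TJ.T\<^esub>"
   using t(2) additive_zero[OF TJ.ab_T TP.ab_T i_add] by simp
  finally show ?thesis
   using inj additive_closed[OF fJ_add t(1)] by (auto simp: inj_on_def)
 qed
 from tensor_right_exact[OF mods(1) J mods(3) fJ _ t(1) this]
 show ?thesis by (simp add: J_def K_def)
qed

lemma weak_generator_zero:
 fixes N :: "('r, 'n, 's, 'y) bimodule_scheme"
 assumes "weak_generator TYPE('u) R N" "right_module R Y" "left_module R N" "small TYPE('u) Y"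
  and zero: "!!y n. [|y : Y; n : N|] ==> pure_tensor R Y N y n = \<zero>\<^bsub>tensor_add R Y N\<^esub>"
 shows "carrier Y = {\<zero>\<^sub>Y}"
proof -
 obtain Y' :: "(unit, 'u, 'r) bimodule" and \<phi> \<psi> where Y': "right_copy R Y Y' \<phi> \<psi>"
  using obtain_right_copy[OF assms(2,4)] .
 note c = right_copyD[OF Y']
 interpret T: tensor R Y N by (intro tensorI assms)
 interpret T': tensor R Y' N by (intro tensorI assms c)
 note add = tmap_additive[OF T.ax T'.ax c(3)]
 have "T'.pt y n = \<zero>\<^bsub>T'.T\<^esub>" if "y : Y'" "n : N" for y n
  using tmap_pure[OF T.ax T'.ax c(3), of "\<psi> y" n] c that zero
   additive_zero[OF T.ab_T T'.ab_T add] by simp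
 note z = this
 have "t = \<zero>\<^bsub>T'.T\<^esub>" if "t : T'.T" for t
  using that by (induction rule: T'.induct) (auto simp: z)
 then have "carrier (tensor_prod R Y' N) = {\<zero>\<^bsub>tensor_prod R Y' N\<^esub>}" using T'.T.zero_closed by auto
 then have Y'0: "carrier Y' = {\<zero>\<^sub>Y'}" using assms(1) c(2) by (auto simp: weak_generator_def)
 have "y = \<zero>\<^sub>Y" if "y : Y" for y
 proof -
  have "\<phi> y = \<phi> \<zero>\<^sub>Y" using Y'0 c(7)[OF that] c(7)[OF T.M.zero_closed] by simp
  then show ?thesis using c(5)[OF that] c(5)[OF T.M.zero_closed] by metis
 qed
 then show ?thesis by auto
qed

text \<open>If I \<otimes> N reaches every pure tensor of P \<otimes> N, then (P/I) \<otimes> N = 0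
  and so P = I. In this form a weak generator shows that a submodule is everything.\<close>

lemma weak_generator_eq:
 fixes N :: "('r, 'n, 's, 'y) bimodule_scheme"
 assumes wg: "weak_generator TYPE('u) R N" and P: "right_module R P" and N: "left_module R N"
  and small: "small TYPE('u) P" and I: "right_submodule I R P"
  and span: "!!p n. [|p : P; n : N|] ==> \<exists>s\<in>carrier (tensor_add R (P\<lparr>carrier := I\<rparr>) N).
   tmap R (P\<lparr>carrier := I\<rparr>) P N (\<lambda>p. p) s = pure_tensor R P N p n"
 shows "I = carrier P"
proof -
 let ?I = "P\<lparr>carrier := I\<rparr>" and ?Q = "quotient_module P I"
 interpret P: right_module R P by fact
 note sub = right_submoduleD[OF I]
 have I': "right_module R ?I" by (rule submodule_module[OF P I])
 note Q = quotient_right_module[OF P I]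
 have I0: "subgroup I (add_monoid P)" using I by (simp add: right_submodule_def)
 note q = quotient_abelian_group[OF P.ab_M I0]
 interpret TI: tensor R ?I N by (intro tensorI N I')
 interpret TP: tensor R P N by (intro tensorI N P)
 interpret TQ: tensor R ?Q N by (intro tensorI N Q)
 have iI: "right_linear R ?I P (\<lambda>p. p)" using sub(1) by (intro right_linearI) auto
 let ?q = "tmap R P ?Q N (\<lambda>m. I +>\<^sub>P m)"
 let ?i = "tmap R ?I P N (\<lambda>p. p)"
 have i_add: "additive_map TI.T TP.T ?i"
  by (rule tmap_additive[OF TI.ax TP.ax iI])
 have q_add: "additive_map TP.T TQ.T ?q"
  by (rule tmap_additive[OF TP.ax TQ.ax Q(2)])
 have z: "?q (?i s) = \<zero>\<^bsub>TQ.T\<^esub>" if "s : TI.T" for s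
  using that
 proof (induction rule: TI.induct)
  case (pure p n)
  then have "I +>\<^sub>P p = \<zero>\<^bsub>?Q\<^esub>" using q(4) sub by auto
  then show ?case
   using pure sub(1) TQ.pure_zero_left[of n]
    tmap_pure[OF TI.ax TP.ax iI, of p n]
    tmap_pure[OF TP.ax TQ.ax Q(2), of p n]
   by auto
 next
  case (add t t')
  then show ?case
   using additive_add[OF i_add] additive_add[OF q_add] additive_closed[OF i_add] by simp
 qed
 have "carrier ?Q = {\<zero>\<^bsub>?Q\<^esub>}"
 proof (rule weak_generator_zero[OF wg Q(1) N])
  show "small TYPE('u) ?Q"
   using q(3) image_lepoll small lepoll_trans by metis
 next
  fix y n assume "y : ?Q" and n: "n : N"
  then obtain p where p: "y = I +>\<^sub>P p" "p : P" using q(3) by blast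
  obtain s where s: "s : TI.T" "?i s = TP.pt p n" using span[OF p(2) n] by blast
  have "TQ.pt y n = ?q (TP.pt p n)"
   using tmap_pure[OF TP.ax TQ.ax Q(2) p(2) n] p by simp
  also have "\<dots> = \<zero>\<^bsub>TQ.T\<^esub>" using z[OF s(1)] s(2) by simp
  finally show "TQ.pt y n = \<zero>\<^bsub>TQ.T\<^esub>" .
 qed
 then have "p \<in> I" if "p : P" for p
  using q(4)[OF that] additive_closed[OF q(2) that] by simp
 then show ?thesis using sub(1) by auto
qed

section \<open>Comodules\<close>

lemma tensor_lift_cong:
 assumes "carrier P = carrier P'" "add P = add P'" "\<zero>\<^sub>P = \<zero>\<^sub>P'"
 shows "tensor_lift P b = tensor_lift P' b"
 unfolding tensor_lift_def finsum_def finprod_def add_pow_def int_pow_def m_inv_def Let_def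
 using assms by (simp cong: if_cong)

lemma right_module_cong:
 assumes "carrier M = carrier M'" "add M = add M'" "\<zero>\<^sub>M = \<zero>\<^sub>M'" "rsmult M = rsmult M'"
 shows "right_module R M \<longleftrightarrow> right_module R M'"
 using assms abelian_group_cong[of M M'] abelian_group_cong[of M' M]
 by (auto simp: right_module_def right_module_axioms_def)

text \<open>A comodule, its underlying bimodule and a truncated record have different types and
  cannot be equated. This relation carries modules, linear maps and tensor products from one to the
  other by rewriting.\<close>

definition same_module :: "('l, 'm, 'r, 'x) bimodule_scheme => ('l, 'm, 'r, 'y) bimodule_scheme => bool" where
 "same_module M M' \<longleftrightarrow> carrier M = carrier M' \<and> \<zero>\<^sub>M = \<zero>\<^sub>M' \<and> add M = add M' \<and> smult M = smult M' \<and>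
   rsmult M = rsmult M'"

lemma same_module_tensor:
 assumes "same_module M M'"
 shows "tensor_add R M N = tensor_add R M' N" "pure_tensor R M N = pure_tensor R M' N"
  and "tensor_prod R M P = tensor_prod R M' P"
 using assms unfolding same_module_def by (intro pure_tensor_cong tensor_prod_cong; simp)+

lemma same_module_simps:
 fixes M :: "('l, 'm, 'r, 'x) bimodule_scheme" and M' :: "('l, 'm, 'r, 'y) bimodule_scheme"
 assumes "same_module M M'"
 shows "carrier M = carrier M'" "\<zero>\<^sub>M = \<zero>\<^sub>M'" "add M = add M'" "smult M = smult M'" "rsmult M = rsmult M'"
  and "right_module R M \<longleftrightarrow> right_module R M'"
  and "right_linear R M Q f \<longleftrightarrow> right_linear R M' Q f" "right_linear R Q M h \<longleftrightarrow> right_linear R Q M' h"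
  and "tensor_lift M b = tensor_lift M' b"
  and "tensor_map R M P Q P' f g = tensor_map R M' P Q P' f g" "tensor_map R Q P' M P h k = tensor_map R Q P' M' P h k"
  and "tensor_assoc R T M P L = tensor_assoc R T M' P L" "tensor_assoc_inv R T M P L = tensor_assoc_inv R T M' P L"
proof -
 show *: "carrier M = carrier M'" "\<zero>\<^sub>M = \<zero>\<^sub>M'" "add M = add M'" "smult M = smult M'" "rsmult M = rsmult M'"
  using assms by (simp_all add: same_module_def)
 show "right_module R M \<longleftrightarrow> right_module R M'" by (rule right_module_cong; simp add: *)
 show "tensor_lift M b = tensor_lift M' b" by (rule tensor_lift_cong; simp add: *)
 show "right_linear R M Q f \<longleftrightarrow> right_linear R M' Q f" "right_linear R Q M h \<longleftrightarrow> right_linear R Q M' h"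
  by (simp_all add: * right_linear_def additive_map_def)
 show "tensor_map R M P Q P' f g = tensor_map R M' P Q P' f g" "tensor_map R Q P' M P h k = tensor_map R Q P' M' P h k"
  "tensor_assoc R T M P L = tensor_assoc R T M' P L" "tensor_assoc_inv R T M P L = tensor_assoc_inv R T M' P L"
  by (simp_all add: tensor_map_def tensor_assoc_def tensor_assoc_inv_def same_module_tensor[OF assms])
qed

lemma with_coaction_same: "same_module (with_coaction M \<rho>) M"
 by (simp add: same_module_def with_coaction_def bimodule.defs)

lemma coaction_with_coaction [simp]: "coaction (with_coaction M \<rho>) = \<rho>"
 by (simp add: with_coaction_def bimodule.defs comodule.defs)

lemma truncate_same: "same_module (bimodule.truncate M) M"
 by (simp add: same_module_def bimodule.defs)

lemmas with_coaction_simps [simp] = same_module_simps[OF with_coaction_same] same_module_tensor[OF with_coaction_same]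
 and truncate_simps [simp] = same_module_simps[OF truncate_same] same_module_tensor[OF truncate_same]

lemma regular_simps [simp]:
 "carrier (regular A) = carrier A"
 "\<zero>\<^bsub>regular A\<^esub> = \<zero>\<^sub>A"
 "add (regular A) = add A"
 "smult (regular A) = monoid.mult A"
 "rsmult (regular A) = monoid.mult A"
 by (simp_all add: regular_def)

lemma bimodule_regular:
 assumes "ring A"
 shows "bimodule A A (regular A)"
proof -
 interpret ring A by fact
 have "abelian_group (regular A)" by (rule abelian_group_cong[OF abelian_group_axioms]) simp_all
 then show ?thesis
  by (intro bimoduleI left_moduleI right_moduleI ring_axioms) (auto simp: l_distr r_distr m_assoc)
qed

text \<open>Membership in \<open>colinear_maps\<close> without extensionality, so that it applies to
  lambda terms and composes freely.\<close>

definition colinear ::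
 "('a, 'z) ring_scheme => ('a, 'c, 'x) coring_scheme =>
  ('l, 'm, 'a, 'c, 'y) comodule_scheme => ('k, 'n, 'a, 'c, 'w) comodule_scheme => ('m => 'n) => bool" where
 "colinear A C M N f \<longleftrightarrow> right_linear A M N f \<and>
   (\<forall>m\<in>carrier M. coaction N (f m) = tmap A M N C f (coaction M m))"

text \<open>Applied to a coaction this gives the action of the dual ring; with the counit as g it
  expresses the counit law.\<close>

definition tensor_eval ::
 "('l, 'm, 'a, 'y) bimodule_scheme => ('c => 'a) => ('m, 'c) tensor => 'm" where
 "tensor_eval M g = tensor_lift M (\<lambda>m c. m \<star>\<^sub>M g c)"

lemma tensor_eval_with_coaction [simp]: "tensor_eval (with_coaction M \<rho>) g = tensor_eval M g"
 by (simp add: tensor_eval_def)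

locale eval_setting = tensor A M C
 for A :: "('a, 'z) ring_scheme" and M :: "('l, 'm, 'a, 'y) bimodule_scheme" and C :: "('a, 'c, 'x) module_scheme" +
 fixes g
 assumes g: "left_linear A C (regular A) g"
begin

lemma eval_balanced: "balanced A M C M (\<lambda>m c. m \<star>\<^sub>M g c)"
 using left_linearD[OF g]
 by (intro balancedI) (auto simp: M.rsmult_closed M.rsmult_l_distr M.rsmult_r_distr M.rsmult_assoc)

lemma eval_additive: "additive_map T M (tensor_eval M g)"
 unfolding tensor_eval_def by (rule lift_additive[OF M.abelian_group_axioms eval_balanced])

lemma eval_closed: "t : T ==> tensor_eval M g t : M"
 by (rule additive_closed[OF eval_additive])

lemma eval_pure: "[|m : M; c : C|] ==> tensor_eval M g (pt m c) = m \<star>\<^sub>M g c"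
 unfolding tensor_eval_def by (rule lift_pure[OF M.abelian_group_axioms eval_balanced])

end

lemma eval_settingI:
 "[|right_module A M; left_module A C; left_linear A C (regular A) g|] ==> eval_setting A M C g"
 by (simp add: eval_setting_def eval_setting_axioms_def tensorI)

lemma tensor_eval_natural:
 assumes "right_module A M" "right_module A M'" "left_module A C" "left_linear A C (regular A) g"
  and "right_linear A M M' f" "t : tensor_add A M C"
 shows "tensor_eval M' g (tmap A M M' C f t) = f (tensor_eval M g t)"
proof -
 interpret M: eval_setting A M C g by (intro eval_settingI assms)
 interpret M': eval_setting A M' C g by (intro eval_settingI assms)
 note add = tmap_additive[OF M.ax M'.ax assms(5)]
 show ?thesis
  by (rule M.additive_eqI[OF additive_comp[OF add M'.eval_additive]
     additive_comp[OF M.eval_additive right_linearD(1)[OF assms(5)]] _ assms(6)])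
   (use left_linearD(2)[OF assms(4)] in \<open>simp add: tmap_pure[OF M.ax M'.ax assms(5)]
    M.eval_pure M'.eval_pure right_linearD[OF assms(5)]\<close>)
qed

lemma assoc_inv_natural:
 assumes "right_module R M" "right_module R M'" "bimodule R T N" "left_module T P"
  and f: "right_linear R M M' f"
  and t: "t : tensor_add R M (tensor_prod T N P)"
 shows "tmap T (tensor_prod R M N) (tensor_prod R M' N) P (tmap R M M' N f)
   (tensor_assoc_inv R T M N P t) =
  tensor_assoc_inv R T M' N P (tmap R M M' (tensor_prod T N P) f t)"
proof -
 interpret M: tensor3 R T M N P by (intro tensor3.intro assms)
 interpret M': tensor3 R T M' N P by (intro tensor3.intro assms)
 let ?f = "tmap R M M' N f"
 have N: "right_linear T N N (\<lambda>n. n)" "left_linear R N N (\<lambda>n. n)"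
  by (rule right_linear_ident left_linear_ident)+
 have fN: "right_linear T (tensor_prod R M N) (tensor_prod R M' N) ?f"
  by (rule tensor_map_right_linear[OF assms(1,2,3,3) f N(2,1)])
 note fN_pure = tmap_pure[OF M.MN.ax M'.MN.ax f]
 note fNP_pure = tmap_pure[OF M.MN_P.ax M'.MN_P.ax fN]
 note fNP'_pure = tmap_pure[OF M.M_NP.ax M'.M_NP.ax f]
 show ?thesis
  by (rule M.additive_eqI_right[OF additive_comp[OF M.assoc_inv_additive
     tmap_additive[OF M.MN_P.ax M'.MN_P.ax fN]]
     additive_comp[OF tmap_additive[OF M.M_NP.ax M'.M_NP.ax f]
     M'.assoc_inv_additive] _ t])
   (simp add: M.assoc_inv_pure M'.assoc_inv_pure fN_pure fNP_pure fNP'_pure M.MN.pure_closed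
    M.NP.pure_closed right_linearD(2)[OF f])
qed

section \<open>Comodule structures over a coring\<close>

locale coring_setting =
 fixes A :: "('a, 'z) ring_scheme" and C :: "('a, 'c, 'x) coring_scheme"
 assumes coring: "coring A C"
begin

lemma bimodule_C: "bimodule A A C"
 using coring by (simp add: coring_def)

lemmas comult_left_linear = coring.comult_left_linear[OF coring]
 and comult_right_linear = coring.comult_right_linear[OF coring]
 and counit_linear = coring.counit_left_linear[OF coring]
 and counit_right_linear = coring.counit_right_linear[OF coring]

lemma left_C: "left_module A C" by (rule bimoduleD(1)[OF bimodule_C])
lemma right_C: "right_module A C" by (rule bimoduleD(2)[OF bimodule_C])
lemma ring_A: "ring A" by (rule left_moduleD(1)[OF left_C])

sublocale A: ring A by (rule ring_A)
sublocale C_left: left_module A C by (rule left_C)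
sublocale C_right: right_module A C by (rule right_C)

abbreviation "CC \<equiv> tensor_prod A C C"

lemma tensor_C: "right_module A M ==> tensor A M C"
 by (intro tensorI left_C)

lemma tensor3_C: "right_module A M ==> tensor3 A A M C C"
 by (intro tensor3.intro bimodule_C left_C)

lemma right_module_MC: "right_module A M ==> right_module A (tensor_prod A M C)"
 by (rule right_module_tensor_prod[OF _ bimodule_C])

lemma tensor_map_C_linear:
 assumes "right_module A M" "right_module A M'" "right_linear A M M' f"
 shows "right_linear A (tensor_prod A M C) (tensor_prod A M' C) (tmap A M M' C f)"
 by (rule tensor_map_right_linear[OF assms(1,2) bimodule_C bimodule_C assms(3) left_linear_ident right_linear_ident])

text \<open>Comultiplication of the last factor, rebracketed to (M \<otimes> C) \<otimes> C.
  Coassociativity becomes (\<rho> \<otimes> C) \<rho> = \<open>split\<close> \<rho>, with both sides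
  in a tensor product over the module M \<otimes> C, where the last factor can be evaluated and
  injections of M \<otimes> C can be applied.\<close>

definition split ::
 "('l, 'm, 'a, 'y) bimodule_scheme => ('m, 'c) tensor => (('m, 'c) tensor, 'c) tensor" where
 "split M t = tensor_assoc_inv A A M C C (tensor_map A M C M CC (\<lambda>m. m) (comult C) t)"

lemma split_additive:
 assumes "right_module A M"
 shows "additive_map (tensor_add A M C) (tensor_add A (tensor_prod A M C) C) (split M)"
proof -
 interpret tensor3 A A M C C by (rule tensor3_C[OF assms])
 show ?thesis unfolding split_def
  by (rule additive_comp[OF tensor_map_additive[OF MN.ax M_NP.ax
      right_linear_ident comult_left_linear] assoc_inv_additive])
qed

lemma split_pure:
 assumes "right_module A M" "m : M" "c : C"
 shows "split M (pure_tensor A M C m c) = tensor_assoc_inv A A M C C (pure_tensor A M CC m (comult C c))"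
proof -
 interpret tensor3 A A M C C by (rule tensor3_C[OF assms(1)])
 show ?thesis unfolding split_def
  using assms by (simp add: tensor_map_pure[OF MN.ax M_NP.ax right_linear_ident comult_left_linear])
qed

lemma split_natural:
 assumes "right_module A M" "right_module A M'" "right_linear A M M' f" "t : tensor_add A M C"
 shows "tmap A (tensor_prod A M C) (tensor_prod A M' C) C (tmap A M M' C f) (split M t) =
  split M' (tmap A M M' C f t)"
proof -
 interpret M: tensor3 A A M C C by (rule tensor3_C[OF assms(1)])
 interpret M': tensor3 A A M' C C by (rule tensor3_C[OF assms(2)])
 note \<Delta> = comult_left_linear
 have "tmap A M M' CC f (tensor_map A M C M CC (\<lambda>m. m) (comult C) t) =
   tensor_map A M' C M' CC (\<lambda>m. m) (comult C) (tmap A M M' C f t)"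
  using tensor_map_compose[OF M.MN.ax M.M_NP.ax M'.M_NP.ax right_linear_ident \<Delta> assms(3) left_linear_ident assms(4)]
   tensor_map_compose[OF M.MN.ax M'.MN.ax M'.M_NP.ax assms(3) left_linear_ident right_linear_ident \<Delta> assms(4)]
  by simp
 moreover have "tensor_map A M C M CC (\<lambda>m. m) (comult C) t : M.M_NP.T"
  by (rule additive_closed[OF tensor_map_additive[OF M.MN.ax M.M_NP.ax right_linear_ident \<Delta>] assms(4)])
 ultimately show ?thesis
  unfolding split_def using assoc_inv_natural[OF assms(1,2) bimodule_C left_C assms(3)] by simp
qed

lemma coassoc_iff:
 assumes "right_module A M" "right_linear A M (tensor_prod A M C) \<rho>" "m : M"
 shows "tensor_assoc A A M C C (tmap A M (tensor_prod A M C) C \<rho> (\<rho> m)) =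
   tensor_map A M C M CC (\<lambda>n. n) (comult C) (\<rho> m) \<longleftrightarrow>
  tmap A M (tensor_prod A M C) C \<rho> (\<rho> m) = split M (\<rho> m)"
proof -
 interpret tensor3 A A M C C by (rule tensor3_C[OF assms(1)])
 have \<rho>: "\<rho> m : MN.T" using right_linearD(2)[OF assms(2,3)] by simp
 have 1: "tmap A M (tensor_prod A M C) C \<rho> (\<rho> m) : MN_P.T"
  by (rule additive_closed[OF tmap_additive[OF MN.ax MN_P.ax assms(2)] \<rho>])
 have 2: "tensor_map A M C M CC (\<lambda>n. n) (comult C) (\<rho> m) : M_NP.T"
  by (rule additive_closed[OF tensor_map_additive[OF MN.ax M_NP.ax right_linear_ident comult_left_linear] \<rho>])
 show ?thesis unfolding split_def using assoc_inv_assoc[OF 1] assoc_assoc_inv[OF 2] by metis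
qed

lemma comoduleI:
 assumes "right_module A M" "right_linear A M (tensor_prod A M C) (coaction M)"
  and "!!m. m : M ==>
   tmap A M (tensor_prod A M C) C (coaction M) (coaction M m) = split M (coaction M m)"
  and "!!m. m : M ==> tensor_eval M (counit C) (coaction M m) = m"
 shows "comodule A C M"
 using assms(1,2,4) assms(3) coassoc_iff[OF assms(1,2)]
 by (simp add: comodule_def comodule_axioms_def tensor_eval_def)

lemma comoduleD:
 assumes "comodule A C M"
 shows "right_module A M" "right_linear A M (tensor_prod A M C) (coaction M)"
  and "m : M ==>
   tmap A M (tensor_prod A M C) C (coaction M) (coaction M m) = split M (coaction M m)"
  and "m : M ==> tensor_eval M (counit C) (coaction M m) = m"
  and "m : M ==> coaction M m : tensor_add A M C"
proof -
 show 1: "right_module A M" "right_linear A M (tensor_prod A M C) (coaction M)"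
  and "m : M ==> tensor_eval M (counit C) (coaction M m) = m"
  using assms by (simp_all add: comodule_def comodule_axioms_def tensor_eval_def)
 show "m : M ==>
   tmap A M (tensor_prod A M C) C (coaction M) (coaction M m) = split M (coaction M m)"
  using assms coassoc_iff[OF 1] by (simp add: comodule_def comodule_axioms_def)
 show "m : M ==> coaction M m : tensor_add A M C"
  using right_linearD(2)[OF 1(2)] by simp
qed

lemma split_with_coaction [simp]: "split (with_coaction M \<rho>) = split M"
 by (simp add: split_def fun_eq_iff)

text \<open>Linearity, coassociativity and the counit law hold after applying f \<otimes> C, (f
  \<otimes> C) \<otimes> C and f, because they hold in L, and these maps are injective. So a
  pointwise lift of the coaction of L is a coaction. This serves for kernels and for copies.\<close>

lemma sub_comodule:
 assumes L: "comodule A C L" and M: "right_module A M" and f: "right_linear A M L f" "inj_on f (carrier M)"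
  and inj: "inj_on (tmap A M L C f) (carrier (tensor_add A M C))"
  and inj2: "inj_on (tmap A (tensor_prod A M C) (tensor_prod A L C) C (tmap A M L C f))
    (carrier (tensor_add A (tensor_prod A M C) C))"
  and \<rho>: "!!m. m : M ==> \<rho> m : tensor_add A M C"
   "!!m. m : M ==> tmap A M L C f (\<rho> m) = coaction L (f m)"
 shows "comodule A C (with_coaction M \<rho>)" "colinear A C (with_coaction M \<rho>) L f"
proof -
 note l = comoduleD[OF L]
 interpret TM: tensor3 A A M C C by (rule tensor3_C[OF M])
 interpret TL: tensor3 A A L C C by (rule tensor3_C[OF l(1)])
 let ?f = "tmap A M L C f"
 let ?ff = "tmap A (tensor_prod A M C) (tensor_prod A L C) C ?f"
 have fl: "right_linear A (tensor_prod A M C) (tensor_prod A L C) ?f"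
  by (rule tensor_map_C_linear[OF M l(1) f(1)])
 note fa = right_linearD[OF fl, simplified]
 have lin: "right_linear A M (tensor_prod A M C) \<rho>"
 proof (rule right_linearI)
  fix m m' assume m: "m : M" "m' : M"
  have "?f (\<rho> (m \<oplus>\<^sub>M m')) = ?f (\<rho> m \<oplus>\<^bsub>TM.MN.T\<^esub> \<rho> m')"
   using m right_linearD(2)[OF f(1)] by (simp add: \<rho> fa right_linearD(3)[OF f(1)] right_linearD(3)[OF l(2), simplified])
  then show "\<rho> (m \<oplus>\<^sub>M m') = \<rho> m \<oplus>\<^bsub>tensor_prod A M C\<^esub> \<rho> m'"
   using inj m \<rho>(1) by (simp add: inj_on_eq_iff)
 next
  fix m a assume m: "m : M" "a : A"
  have cl: "\<rho> m \<star>\<^bsub>tensor_prod A M C\<^esub> a : TM.MN.T"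
   using right_module.rsmult_closed[OF right_module_MC[OF M]] \<rho>(1) m by simp
  have "?f (\<rho> (m \<star>\<^sub>M a)) = ?f (\<rho> m \<star>\<^bsub>tensor_prod A M C\<^esub> a)"
   using m right_linearD(2)[OF f(1)]
   by (simp add: \<rho> fa right_linearD(4)[OF f(1)] right_linearD(4)[OF l(2), simplified] TM.MN.M.rsmult_closed)
  then show "\<rho> (m \<star>\<^sub>M a) = \<rho> m \<star>\<^bsub>tensor_prod A M C\<^esub> a"
   using inj m \<rho>(1) cl by (simp add: inj_on_eq_iff TM.MN.M.rsmult_closed)
 qed (use \<rho> in simp)
 show "comodule A C (with_coaction M \<rho>)"
 proof (rule comoduleI; simp)
  show "right_module A M" "right_linear A M (tensor_prod A M C) \<rho>" by fact+
  fix m assume m: "m : M"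
  have fm: "f m : L" using m right_linearD(2)[OF f(1)] by simp
  let ?r = "tmap A M (tensor_prod A M C) C \<rho>"
  have r: "?r (\<rho> m) : TM.MN_P.T"
   by (rule additive_closed[OF tmap_additive[OF TM.MN.ax TM.MN_P.ax lin] \<rho>(1)[OF m]])
  have "?ff (?r (\<rho> m)) = tmap A M (tensor_prod A L C) C (\<lambda>m. ?f (\<rho> m)) (\<rho> m)"
   by (rule tmap_compose[OF TM.MN.ax TM.MN_P.ax TL.MN_P.ax lin fl \<rho>(1)[OF m]])
  also have "\<dots> = tmap A M (tensor_prod A L C) C (\<lambda>m. coaction L (f m)) (\<rho> m)"
   by (subst tensor_map_cong_id[OF M right_module_MC[OF l(1)] left_C right_linear_comp[OF lin fl]]) (simp_all add: \<rho>)
  also have "\<dots> = tmap A L (tensor_prod A L C) C (coaction L) (?f (\<rho> m))"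
   by (rule tmap_compose[OF TM.MN.ax TL.MN.ax TL.MN_P.ax f(1) l(2) \<rho>(1)[OF m], symmetric])
  also have "\<dots> = split L (?f (\<rho> m))"
   using l(3)[OF fm] by (simp add: \<rho>(2)[OF m])
  also have "\<dots> = ?ff (split M (\<rho> m))"
   by (rule split_natural[OF M l(1) f(1) \<rho>(1)[OF m], symmetric])
  finally show "?r (\<rho> m) = split M (\<rho> m)"
   using inj2 r additive_closed[OF split_additive[OF M] \<rho>(1)[OF m]] by (simp add: inj_on_eq_iff)
  have "f (tensor_eval M (counit C) (\<rho> m)) = f m"
   using tensor_eval_natural[OF M l(1) left_C counit_linear f(1) \<rho>(1)[OF m]] l(4)[OF fm] by (simp add: \<rho>(2)[OF m])
  then show "tensor_eval M (counit C) (\<rho> m) = m"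
   using f(2) m eval_setting.eval_closed[OF eval_settingI[OF M left_C counit_linear] \<rho>(1)[OF m]]
   by (simp add: inj_on_eq_iff)
 qed
 show "colinear A C (with_coaction M \<rho>) L f"
  using f(1) \<rho>(2) by (simp add: colinear_def)
qed

lemma colinear_compose:
 assumes "comodule A C M" "comodule A C N" "comodule A C P" "colinear A C M N f" "colinear A C N P g"
 shows "colinear A C M P (\<lambda>m. g (f m))"
proof -
 note m = comoduleD[OF assms(1)] and n = comoduleD[OF assms(2)] and p = comoduleD[OF assms(3)]
 have f: "right_linear A M N f" and g: "right_linear A N P g" using assms(4,5) by (auto simp: colinear_def)
 show ?thesis unfolding colinear_def
 proof (intro conjI ballI)
  show "right_linear A M P (\<lambda>m. g (f m))" by (rule right_linear_comp[OF f g])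
  fix u assume u: "u : M"
  have "coaction P (g (f u)) = tmap A N P C g (tmap A M N C f (coaction M u))"
   using assms(4,5) u right_linearD(2)[OF f u] by (simp add: colinear_def)
  also have "\<dots> = tmap A M P C (\<lambda>m. g (f m)) (coaction M u)"
   by (rule tmap_compose[OF tensor_C[OF m(1)] tensor_C[OF n(1)] tensor_C[OF p(1)] f g m(5)[OF u]])
  finally show "coaction P (g (f u)) = tmap A M P C (\<lambda>m. g (f m)) (coaction M u)" .
 qed
qed

lemma colinear_ident:
 assumes "comodule A C M"
 shows "colinear A C M M (\<lambda>m. m)"
 using tensor_map_ident[OF tensor_C[OF comoduleD(1)[OF assms]] comoduleD(5)[OF assms]]
 by (simp add: colinear_def right_linear_ident)

lemma colinear_cong:
 assumes "comodule A C M" "comodule A C N" "colinear A C M N f" "!!m. m : M ==> f m = g m"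
 shows "colinear A C M N g"
proof -
 note m = comoduleD[OF assms(1)] and n = comoduleD[OF assms(2)]
 interpret M: right_module A M by (rule m)
 have f: "right_linear A M N f" using assms(3) by (simp add: colinear_def)
 have "right_linear A M N g"
  using right_linearD[OF f] by (intro right_linearI) (simp_all add: M.rsmult_closed flip: assms(4))
 then show ?thesis
  using assms(3) assms(4) tensor_map_cong_id[OF m(1) n(1) left_C f assms(4)] by (simp add: colinear_def)
qed

lemma colinear_maps_iff:
 assumes "comodule A C M" "comodule A C N"
 shows "f \<in> colinear_maps A C M N \<longleftrightarrow> f \<in> extensional (carrier M) \<and> colinear A C M N f"
 by (auto simp: colinear_maps_def right_hom_def colinear_def)

lemma colinear_restrict:
 assumes "comodule A C M" "comodule A C N" "colinear A C M N f"
 shows "restrict f (carrier M) \<in> colinear_maps A C M N"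
 using colinear_cong[OF assms, of "restrict f (carrier M)"] by (simp add: colinear_maps_iff assms)

lemma colinear_inverse:
 assumes "comodule A C M" "comodule A C N" "colinear A C M N f"
  and g: "!!n. n : N ==> g n : M" "!!n. n : N ==> f (g n) = n"
   "!!m. m : M ==> g (f m) = m"
 shows "colinear A C N M g"
proof -
 note m = comoduleD[OF assms(1)] and n = comoduleD[OF assms(2)]
 have f: "right_linear A M N f" using assms(3) by (simp add: colinear_def)
 have gl: "right_linear A N M g" by (rule right_linear_inverse[OF m(1) f g])
 have copy: "right_copy A M N f g" using m(1) n(1) f gl g by (simp add: right_copy_def)
 have "coaction M (g u) = tmap A N M C g (coaction N u)" if "u : N" for u
 proof -
  have "coaction N (f (g u)) = tmap A M N C f (coaction M (g u))"
   using assms(3) g(1)[OF that] by (simp add: colinear_def)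
  then show ?thesis
   using g(2)[OF that] tensor_map_copy[OF copy left_C m(5)[OF g(1)[OF that]]] by simp
 qed
 then show ?thesis using gl by (simp add: colinear_def)
qed

lemma comodule_iso_iff:
 assumes "comodule A C M" "comodule A C N"
 shows "comodule_iso A C M N f \<longleftrightarrow> f \<in> extensional (carrier M) \<and> colinear A C M N f \<and> bij_betw f (carrier M) (carrier N)"
proof
 assume "comodule_iso A C M N f"
 then obtain g where f: "f \<in> colinear_maps A C M N" and g: "g \<in> colinear_maps A C N M"
  "\<forall>m\<in>carrier M. g (f m) = m" "\<forall>n\<in>carrier N. f (g n) = n"
  by (auto simp: comodule_iso_def)
 then show "f \<in> extensional (carrier M) \<and> colinear A C M N f \<and> bij_betw f (carrier M) (carrier N)"
  by (auto simp: colinear_maps_iff assms colinear_def dest: right_linearD(2)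
    intro!: bij_betw_byWitness[where f' = g])
next
 assume *: "f \<in> extensional (carrier M) \<and> colinear A C M N f \<and> bij_betw f (carrier M) (carrier N)"
 let ?g = "inv_into (carrier M) f"
 have inj: "inj_on f (carrier M)" and im: "f ` carrier M = carrier N" using * by (auto simp: bij_betw_def)
 have g: "!!n. n : N ==> ?g n : M" "!!n. n : N ==> f (?g n) = n"
  using im by (auto simp: inv_into_into f_inv_into_f)
 have g': "!!m. m : M ==> ?g (f m) = m" using inj by simp
 have "colinear A C N M ?g" by (rule colinear_inverse[OF assms _ g g']) (use * in auto)
 then have "restrict ?g (carrier N) \<in> colinear_maps A C N M" by (rule colinear_restrict[OF assms(2,1)])
 moreover have "f \<in> carrier M \<rightarrow> carrier N" using im by auto
 ultimately show "comodule_iso A C M N f"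
  unfolding comodule_iso_def using * g g' by (auto simp: colinear_maps_iff assms intro!: bexI[of _ "restrict ?g (carrier N)"])
qed

text \<open>The coaction is conjugated by the copy. \<open>sub_comodule\<close> applies to the
  inverse map, which stays injective under tensoring because it has a left inverse.\<close>

lemma obtain_comodule_copy:
 assumes L: "comodule A C L" and small: "small TYPE('u) L"
 obtains M :: "(unit, 'u, 'a, 'c) comodule" and \<phi> \<psi>
 where "comodule A C M" "right_copy A L M \<phi> \<psi>" "colinear A C L M \<phi>" "colinear A C M L \<psi>"
proof -
 note l = comoduleD[OF L]
 obtain M :: "(unit, 'u, 'a) bimodule" and \<phi> \<psi> where copy: "right_copy A L M \<phi> \<psi>"
  using obtain_right_copy[OF l(1) small] .
 note c = right_copyD[OF copy]
 let ?\<rho> = "\<lambda>u. tmap A L M C \<phi> (coaction L (\<psi> u))"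
 have M: "right_module A M" by (rule c)
 have inj: "inj_on \<psi> (carrier M)" using c(6) by (rule inj_on_inverseI)
 have inj1: "inj_on (tmap A M L C \<psi>) (carrier (tensor_add A M C))"
  using tensor_map_copy[OF right_copy_sym[OF copy] left_C] by (rule inj_on_inverseI)
 have copy2: "right_copy A (tensor_prod A L C) (tensor_prod A M C)
   (tmap A L M C \<phi>) (tmap A M L C \<psi>)"
  using right_module_MC[OF M] right_module_MC[OF l(1)] tensor_map_C_linear[OF l(1) M c(3)] tensor_map_C_linear[OF M l(1) c(4)]
   tensor_map_copy[OF copy left_C] tensor_map_copy[OF right_copy_sym[OF copy] left_C]
  by (simp add: right_copy_def)
 have inj2: "inj_on (tmap A (tensor_prod A M C) (tensor_prod A L C) C (tmap A M L C \<psi>))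
    (carrier (tensor_add A (tensor_prod A M C) C))"
  using tensor_map_copy[OF right_copy_sym[OF copy2] left_C] by (rule inj_on_inverseI)
 have \<rho>: "?\<rho> m : tensor_add A M C" "tmap A M L C \<psi> (?\<rho> m) = coaction L (\<psi> m)"
  if "m : M" for m
 proof -
  have "coaction L (\<psi> m) : tensor_add A L C" using l(5) c(8) that by simp
  then show "?\<rho> m : tensor_add A M C" "tmap A M L C \<psi> (?\<rho> m) = coaction L (\<psi> m)"
   using right_linearD(2)[OF tensor_map_C_linear[OF l(1) M c(3)]] tensor_map_copy[OF copy left_C] by auto
 qed
 note s = sub_comodule[OF L M c(4) inj inj1 inj2 \<rho>]
 show ?thesis
 proof (rule that[OF s(1) _ _ s(2)])
  show "right_copy A L (with_coaction M ?\<rho>) \<phi> \<psi>" using copy by (simp add: right_copy_def)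
  show "colinear A C L (with_coaction M ?\<rho>) \<phi>"
   by (rule colinear_inverse[OF s(1) L s(2)]) (use c(5-8) in auto)
 qed
qed

end

section \<open>Coinvariants and induced comodules\<close>

lemma coinvariant_module_simps [simp]:
 "carrier (coinvariant_module A C x M) = coinvariants A C x M"
 "\<zero>\<^bsub>coinvariant_module A C x M\<^esub> = \<zero>\<^sub>M"
 "add (coinvariant_module A C x M) = add M"
 "rsmult (coinvariant_module A C x M) = rsmult M"
 by (simp_all add: coinvariant_module_def)

lemma coinvariant_ring_simps [simp]:
 "\<zero>\<^bsub>coinvariant_ring A C x\<^esub> = \<zero>\<^sub>A"
 "\<one>\<^bsub>coinvariant_ring A C x\<^esub> = \<one>\<^sub>A"
 "add (coinvariant_ring A C x) = add A"
 "monoid.mult (coinvariant_ring A C x) = monoid.mult A"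
 by (simp_all add: coinvariant_ring_def)

lemma ring_comodule_same: "same_module (ring_comodule A C x) (regular A)"
 by (simp add: ring_comodule_def with_coaction_same)

lemma coaction_ring_comodule [simp]:
 "coaction (ring_comodule A C x) a = pure_tensor A (regular A) C \<one>\<^sub>A (x \<star>\<^sub>C a)"
 by (simp add: ring_comodule_def)

lemmas ring_comodule_simps [simp] = same_module_simps[OF ring_comodule_same] same_module_tensor[OF ring_comodule_same]

locale grouplike_coring = coring_setting A C
 for A :: "'a ring" and C :: "('a, 'c, 'x) coring_scheme" +
 fixes x
 assumes grouplike: "group_like A C x"
begin

abbreviation "B \<equiv> coinvariant_ring A C x"
abbreviation "AA \<equiv> regular A"
abbreviation "AC \<equiv> ring_comodule A C x"
abbreviation "co M \<equiv> coinvariants A C x M"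
abbreviation "coM M \<equiv> coinvariant_module A C x M"
abbreviation "ind N \<equiv> induced_comodule A C x N"

lemma x: "x : C" "comult C x = pure_tensor A C C x x" "counit C x = \<one>\<^sub>A"
 using grouplike by (auto simp: group_like_def)

lemma comult_xa: "a : A ==> comult C (x \<star>\<^sub>C a) = pure_tensor A C C x (x \<star>\<^sub>C a)"
 using right_linearD(4)[OF comult_right_linear x(1), of a]
  rsmult_pure[OF right_C bimodule_C _ x(1) x(1), of a] x(2) by simp

lemma counit_xa: "a : A ==> counit C (x \<star>\<^sub>C a) = a"
 using right_linearD(4)[OF counit_right_linear x(1), of a] x(3) ring.ring_simprules(12)[OF ring_A]
 by (simp add: monoid.l_one[OF ring.is_monoid[OF ring_A]])

lemma bimodule_AA: "bimodule A A AA" by (rule bimodule_regular[OF ring_A])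
lemma right_AA: "right_module A AA" by (rule bimoduleD(2)[OF bimodule_AA])
lemma left_AA: "left_module A AA" by (rule bimoduleD(1)[OF bimodule_AA])

sublocale TA: tensor A AA C by (rule tensor_C[OF right_AA])

lemma xa_closed [simp]: "a : A ==> x \<star>\<^sub>C a : C"
 by (rule C_right.rsmult_closed[OF x(1)])

lemma lsmult_balanced: "balanced A AA C C (\<lambda>a c. a \<odot>\<^sub>C c)"
 by (rule balancedI)
  (auto simp: C_left.lsmult_closed C_left.lsmult_l_distr C_left.lsmult_r_distr C_left.lsmult_assoc)

text \<open>The tensor product of A and C over A is C by a \<otimes> c \<mapsto> ac, so its pure
  tensors are compared in C.\<close>

lemma pure_TA_eq:
 assumes "a : A" "c : C" "a' : A" "c' : C"
 shows "TA.pt a c = TA.pt a' c' \<longleftrightarrow> a \<odot>\<^sub>C c = a' \<odot>\<^sub>C c'"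
proof
 assume "TA.pt a c = TA.pt a' c'"
 then have "tensor_lift C (\<lambda>a c. a \<odot>\<^sub>C c) (TA.pt a c) = tensor_lift C (\<lambda>a c. a \<odot>\<^sub>C c) (TA.pt a' c')" by simp
 then show "a \<odot>\<^sub>C c = a' \<odot>\<^sub>C c'"
  using assms by (simp add: TA.lift_pure[OF C_left.ab_M lsmult_balanced])
next
 assume *: "a \<odot>\<^sub>C c = a' \<odot>\<^sub>C c'"
 have "TA.pt a c = TA.pt \<one>\<^sub>A (a \<odot>\<^sub>C c)" if "a : A" "c : C" for a c
  using TA.pure_balanced[of "\<one>\<^sub>A" a c] that by simp
 then show "TA.pt a c = TA.pt a' c'" using * assms by metis
qed

lemma carrier_B: "carrier B = {b \<in> carrier A. b \<odot>\<^sub>C x = x \<star>\<^sub>C b}"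
proof -
 have "TA.pt \<one>\<^sub>A (x \<star>\<^sub>C b) = TA.pt b x \<longleftrightarrow> b \<odot>\<^sub>C x = x \<star>\<^sub>C b" if "b : A" for b
  using that by (auto simp only: pure_TA_eq x A.one_closed xa_closed C_left.lsmult_one)
 then show ?thesis by (simp add: coinvariant_ring_def coinvariants_def cong: conj_cong)
qed

lemma B_A: "b : B ==> b : A"
 by (simp add: carrier_B)

lemma B_x: "b : B ==> b \<odot>\<^sub>C x = x \<star>\<^sub>C b"
 by (simp add: carrier_B)

lemma one_B: "\<one>\<^sub>A : B"
 by (simp add: carrier_B C_left.lsmult_one C_right.rsmult_one x)

lemma mult_B: "[|b : B; b' : B|] ==> b \<otimes>\<^sub>A b' : B"
 by (auto simp: carrier_B C_left.lsmult_assoc C_right.rsmult_assoc x)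
  (metis bimoduleD(3)[OF bimodule_C] x(1))

lemma ring_B: "ring B"
proof (rule ringI)
 have neg: "\<ominus>\<^sub>A b : B" if "b : B" for b
 proof -
  have "(\<ominus>\<^sub>A b) \<odot>\<^sub>C x = \<ominus>\<^sub>C (b \<odot>\<^sub>C x)"
   by (rule additive_uminus[OF A.abelian_group_axioms C_left.ab_M C_left.additive_lsmult_scalar[OF x(1)] B_A[OF that]])
  moreover have "x \<star>\<^sub>C (\<ominus>\<^sub>A b) = \<ominus>\<^sub>C (x \<star>\<^sub>C b)"
   by (rule additive_uminus[OF A.abelian_group_axioms C_left.ab_M C_right.additive_rsmult_scalar[OF x(1)] B_A[OF that]])
  ultimately show ?thesis using that by (simp add: carrier_B)
 qed
 show "abelian_group B"
 proof (rule abelian_groupI, goal_cases)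
  case (6 b)
  then show ?case using neg[of b] A.l_neg[OF B_A] by (intro bexI[of _ "\<ominus>\<^sub>A b"]) auto
 qed (auto simp: carrier_B A.a_ac C_left.lsmult_l_distr C_right.rsmult_r_distr x
   C_left.zero_lsmult C_right.rsmult_zero)
 show "Group.monoid B"
  using one_B mult_B by (intro monoidI) (auto simp: A.m_assoc B_A)
qed (auto simp: A.l_distr A.r_distr B_A)

lemma left_B_AA: "left_module B AA"
 using left_moduleD(2)[OF left_AA] ring_B
 by (intro left_moduleI) (auto simp: B_A A.l_distr A.r_distr A.m_assoc)

lemma bimodule_B_AA: "bimodule B A AA"
 using right_AA left_B_AA by (intro bimoduleI) (auto simp: B_A A.m_assoc)

lemma right_module_B:
 assumes "right_module A M"
 shows "right_module B M"
proof -
 interpret right_module A M by fact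
 show ?thesis
  by (intro right_moduleI ring_B M.abelian_group_axioms)
   (auto simp: B_A rsmult_closed rsmult_l_distr rsmult_r_distr rsmult_assoc rsmult_one)
qed

lemma right_linear_B: "right_linear A M N f ==> right_linear B M N f"
 by (simp add: right_linear_def B_A)

lemma tensor_B: "right_module B N ==> tensor B N AA"
 by (intro tensorI left_B_AA)

lemma right_NA: "right_module B N ==> right_module A (tensor_prod B N AA)"
 by (rule right_module_tensor_prod[OF _ bimodule_B_AA])

lemma comodule_AC: "comodule A C AC"
proof (rule comoduleI)
 show "right_module A AC" using right_AA by simp
 show "right_linear A AC (tensor_prod A AC C) (coaction AC)"
  using rsmult_pure[OF right_AA bimodule_C, of _ "\<one>\<^sub>A"]
  by (intro right_linearI)
   (simp_all add: TA.pure_closed C_right.rsmult_r_distr x TA.pure_add_right C_right.rsmult_assoc)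
 fix a assume "a : AC"
 then have a: "a : A" by simp
 interpret T3: tensor3 A A AA C C by (rule tensor3_C[OF right_AA])
 have lin: "right_linear A AA (tensor_prod A AA C) (coaction AC)"
  using rsmult_pure[OF right_AA bimodule_C, of _ "\<one>\<^sub>A"]
  by (intro right_linearI)
   (simp_all add: TA.pure_closed C_right.rsmult_r_distr x TA.pure_add_right C_right.rsmult_assoc)
 show "tmap A AC (tensor_prod A AC C) C (coaction AC) (coaction AC a) = split AC (coaction AC a)"
  using a tmap_pure[OF TA.ax T3.MN_P.ax lin, of "\<one>\<^sub>A" "x \<star>\<^sub>C a"]
  by (simp add: ring_comodule_def split_pure[OF right_AA] comult_xa T3.assoc_inv_pure x C_right.rsmult_one)
 interpret e: eval_setting A AA C "counit C" by (rule eval_settingI[OF right_AA left_C counit_linear])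
 show "tensor_eval AC (counit C) (coaction AC a) = a"
  using a e.eval_pure[of "\<one>\<^sub>A" "x \<star>\<^sub>C a"] by (simp add: ring_comodule_def counit_xa)
qed

lemma coD:
 assumes "m \<in> co M"
 shows "m : M" "coaction M m = pure_tensor A M C m x"
 using assms by (auto simp: coinvariants_def)

lemma co_submodule:
 assumes "comodule A C M"
 shows "right_submodule (co M) B M"
proof -
 note m = comoduleD[OF assms]
 interpret T: tensor A M C by (rule tensor_C[OF m(1)])
 note l = right_linearD[OF m(2), simplified]
 show ?thesis
 proof (rule right_submoduleI[OF right_module_B[OF m(1)]])
  show "co M \<subseteq> carrier M" by (auto simp: coinvariants_def)
  show "\<zero>\<^sub>M \<in> co M"
   using additive_zero[OF T.M.ab_M T.ab_T l(1)] T.pure_zero_left[OF x(1)]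
   by (simp add: coinvariants_def)
  show "m \<oplus>\<^sub>M n \<in> co M" if "m \<in> co M" "n \<in> co M" for m n
   using that by (auto simp: coinvariants_def l T.pure_add_left x)
  show "m \<star>\<^sub>M b \<in> co M" if "m \<in> co M" "b : B" for m b
   using that rsmult_pure[OF m(1) bimodule_C B_A[OF that(2)] coD(1)[OF that(1)] x(1)]
    T.pure_balanced[OF coD(1)[OF that(1)] B_A[OF that(2)] x(1)]
   by (simp add: coinvariants_def l T.M.rsmult_closed B_A B_x)
 qed
qed

lemma right_co: "comodule A C M ==> right_module B (coM M)"
proof -
 assume M: "comodule A C M"
 have "right_module B ((bimodule.truncate M)\<lparr>carrier := co M\<rparr>)"
 proof (rule submodule_module)
  show "right_module B (bimodule.truncate M)" using right_module_B[OF comoduleD(1)[OF M]] by simp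
  show "right_submodule (co M) B (bimodule.truncate M)"
   using right_submoduleD[OF co_submodule[OF M]] right_module_B[OF comoduleD(1)[OF M]]
   by (intro right_submoduleI) auto
 qed
 then show ?thesis by (simp add: coinvariant_module_def)
qed

lemma colinear_co:
 assumes "comodule A C M" "comodule A C N" "colinear A C M N f" "m \<in> co M"
 shows "f m \<in> co N"
 using assms(3) coD[OF assms(4)] tmap_pure[OF tensor_C[OF comoduleD(1)[OF assms(1)]]
   tensor_C[OF comoduleD(1)[OF assms(2)]] _, of f m x] x(1)
 by (auto simp: coinvariants_def colinear_def right_linearD(2))

lemma colinear_coM:
 assumes "comodule A C M" "comodule A C N" "colinear A C M N f"
 shows "right_linear B (coM M) (coM N) f"
proof -
 have f: "right_linear A M N f" using assms(3) by (simp add: colinear_def)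
 show ?thesis using colinear_co[OF assms] right_linearD[OF f]
  by (intro right_linearI) (auto simp: B_A coD)
qed

lemma co_inclusion: "comodule A C M ==> right_linear B (coM M) M (\<lambda>m. m)"
 by (rule right_linearI) (auto simp: coD)

lemma coaction_co_mult:
 assumes "comodule A C M" "m \<in> co M" "a : A"
 shows "coaction M (m \<star>\<^sub>M a) = pure_tensor A M C m (x \<star>\<^sub>C a)"
 using right_linearD(4)[OF comoduleD(2)[OF assms(1)] coD(1)[OF assms(2)] assms(3)] coD[OF assms(2)]
  rsmult_pure[OF comoduleD(1)[OF assms(1)] bimodule_C assms(3) coD(1)[OF assms(2)] x(1)]
 by simp

lemma co_hom:
 assumes "comodule A C M" "m \<in> co M"
 shows "colinear A C AC M (\<lambda>a. m \<star>\<^sub>M a)"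
proof -
 interpret M: right_module A M by (rule comoduleD(1)[OF assms(1)])
 have l: "right_linear A AA M (\<lambda>a. m \<star>\<^sub>M a)"
  using coD(1)[OF assms(2)] by (intro right_linearI) (auto simp: M.rsmult_closed M.rsmult_r_distr M.rsmult_assoc)
 then show ?thesis
  using coaction_co_mult[OF assms] coD(1)[OF assms(2)]
   tmap_pure[OF TA.ax tensor_C[OF M.right_module_axioms] l, of "\<one>\<^sub>A"]
  by (simp add: colinear_def M.rsmult_one)
qed

text \<open>The element 1 generates A, and it is coinvariant since its coaction is 1 \<otimes>
  x.\<close>

lemma colinear_from_A:
 assumes "comodule A C M" "colinear A C AC M f"
 shows "f \<one>\<^sub>A \<in> co M" "a : A ==> f a = f \<one>\<^sub>A \<star>\<^sub>M a"
proof -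
 have "\<one>\<^sub>A \<in> co AC" by (simp add: coinvariants_def C_right.rsmult_one x)
 then show "f \<one>\<^sub>A \<in> co M" by (rule colinear_co[OF comodule_AC assms])
 show "f a = f \<one>\<^sub>A \<star>\<^sub>M a" if "a : A"
  using assms(2) right_linearD(4)[of A AA M f "\<one>\<^sub>A" a] that by (simp add: colinear_def)
qed

lemma induced_same: "same_module (ind N) (tensor_prod B N AA)"
 by (simp add: induced_comodule_def Let_def with_coaction_same)

lemmas induced_simps [simp] = same_module_simps[OF induced_same] same_module_tensor[OF induced_same]

context
 fixes N :: "('l, 'n, 'a, 'y) bimodule_scheme"
 assumes N: "right_module B N"
begin

interpretation T3: tensor3 B A N AA C
 by (intro tensor3.intro N bimodule_B_AA left_C)

text \<open>Here bx = xb for b in B enters. It is what makes id \<otimes> \<rho> well defined on N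
  \<otimes> A over B.\<close>

lemma left_linear_coaction_AC: "left_linear B AA (tensor_prod A AA C) (coaction AC)"
proof (rule left_linearI)
 fix a b assume "a : AA" "b : B"
 then have a: "a : A" and b: "b : A" "b \<odot>\<^sub>C x = x \<star>\<^sub>C b" by (auto simp: B_A B_x)
 have "b \<odot>\<^sub>C (x \<star>\<^sub>C a) = x \<star>\<^sub>C (b \<otimes>\<^sub>A a)"
  using a b bimoduleD(3)[OF bimodule_C, of b x a] x(1) by (simp add: C_right.rsmult_assoc)
 then show "coaction AC (b \<odot>\<^bsub>AA\<^esub> a) = b \<odot>\<^bsub>tensor_prod A AA C\<^esub> coaction AC a"
  using a b lsmult_pure[OF bimodule_AA left_C, of b "\<one>\<^sub>A" "x \<star>\<^sub>C a"]
  by (simp add: pure_TA_eq C_left.lsmult_one)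
qed (simp_all add: TA.pure_closed C_right.rsmult_r_distr x TA.pure_add_right)

lemma induced_coaction_additive: "additive_map T3.MN.T T3.MN_P.T (coaction (ind N))"
proof -
 have "additive_map T3.MN.T T3.M_NP.T (tensor_map B N AA N (tensor_prod A AA C) (\<lambda>n. n) (coaction AC))"
  by (rule tensor_map_additive[OF T3.MN.ax T3.M_NP.ax right_linear_ident left_linear_coaction_AC])
 then show ?thesis
  unfolding induced_comodule_def Let_def coaction_with_coaction
  by (rule additive_comp[OF _ T3.assoc_inv_additive])
qed

lemma induced_coaction_pure:
 assumes "n : N" "a : A"
 shows "coaction (ind N) (T3.MN.pt n a) = T3.MN_P.pt (T3.MN.pt n \<one>\<^sub>A) (x \<star>\<^sub>C a)"
 using assms tensor_map_pure[OF T3.MN.ax T3.M_NP.ax right_linear_ident left_linear_coaction_AC, of n a]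
 by (simp add: induced_comodule_def Let_def T3.assoc_inv_pure)

lemma NA_mult: "[|n : N; a : A; a' : A|] ==>
  T3.MN.pt n a \<star>\<^bsub>tensor_prod B N AA\<^esub> a' = T3.MN.pt n (a \<otimes>\<^sub>A a')"
 using rsmult_pure[OF N bimodule_B_AA, of a' n a] by simp

lemma induced_coaction_linear: "right_linear A (tensor_prod B N AA) (tensor_prod A (tensor_prod B N AA) C) (coaction (ind N))"
proof -
 note add = induced_coaction_additive
 have "coaction (ind N) (t \<star>\<^bsub>tensor_prod B N AA\<^esub> a) = coaction (ind N) t \<star>\<^bsub>tensor_prod A (tensor_prod B N AA) C\<^esub> a"
  if "t : T3.MN.T" "a : A" for t a
  by (rule T3.MN.additive_eqI[OF additive_comp[OF right_module.additive_rsmult[OF right_NA[OF N] that(2), simplified] add]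
     additive_comp[OF add right_module.additive_rsmult[OF right_module_MC[OF right_NA[OF N]] that(2), simplified]]])
   (use that in \<open>simp_all add: NA_mult induced_coaction_pure T3.MN.pure_closed
     rsmult_pure[OF right_NA[OF N] bimodule_C] C_right.rsmult_assoc x\<close>)
 then show ?thesis using add by (simp add: right_linear_def)
qed

text \<open>On n \<otimes> a both sides of coassociativity are ((n \<otimes> 1) \<otimes> x)
  \<otimes> xa, because x is group-like.\<close>

lemma comodule_ind: "comodule A C (ind N)"
proof (rule comoduleI)
 interpret T': tensor3 A A "tensor_prod B N AA" C C by (rule tensor3_C[OF right_NA[OF N]])
 show "right_module A (ind N)" using right_NA[OF N] by simp
 show "right_linear A (ind N) (tensor_prod A (ind N) C) (coaction (ind N))"
  using induced_coaction_linear by simp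
 fix t assume t: "t : ind N"
 let ?r = "tmap A (tensor_prod B N AA) (tensor_prod A (tensor_prod B N AA) C) C (coaction (ind N))"
 have r_add: "additive_map T3.MN_P.T T'.MN_P.T ?r"
  by (rule tmap_additive[OF T3.MN_P.ax T'.MN_P.ax induced_coaction_linear])
 note r_pure = tmap_pure[OF T3.MN_P.ax T'.MN_P.ax induced_coaction_linear]
 have "?r (coaction (ind N) t) = split (tensor_prod B N AA) (coaction (ind N) t)"
  by (rule T3.MN.additive_eqI[OF additive_comp[OF induced_coaction_additive r_add]
     additive_comp[OF induced_coaction_additive split_additive[OF right_NA[OF N]]]])
   (use t in \<open>simp_all add: induced_coaction_pure r_pure T3.MN.pure_closed C_right.rsmult_one x
    split_pure[OF right_NA[OF N]] comult_xa T'.assoc_inv_pure\<close>)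
 then show "tmap A (ind N) (tensor_prod A (ind N) C) C (coaction (ind N)) (coaction (ind N) t) =
   split (ind N) (coaction (ind N) t)"
  by (subst (3) induced_comodule_def) (simp add: Let_def)
 interpret e: eval_setting A "tensor_prod B N AA" C "counit C"
  by (rule eval_settingI[OF right_NA[OF N] left_C counit_linear])
 have "tensor_eval (tensor_prod B N AA) (counit C) (coaction (ind N) t) = t"
  by (rule T3.MN.additive_eqI[OF additive_comp[OF induced_coaction_additive e.eval_additive[simplified]]])
   (use t in \<open>simp_all add: induced_coaction_pure e.eval_pure T3.MN.pure_closed counit_xa NA_mult additive_map_def\<close>)
 then show "tensor_eval (ind N) (counit C) (coaction (ind N) t) = t"
  by (simp add: induced_comodule_def Let_def)
qed

lemma unit_co: "n : N ==> T3.MN.pt n \<one>\<^sub>A \<in> co (ind N)"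
 using induced_coaction_pure[of n "\<one>\<^sub>A"] T3.MN.pure_closed[of n "\<one>\<^sub>A"]
 by (simp add: coinvariants_def C_right.rsmult_one x)

lemma unit_linear: "right_linear B N (coM (ind N)) (\<lambda>n. T3.MN.pt n \<one>\<^sub>A)"
 using T3.MN.pure_balanced[of _ _ "\<one>\<^sub>A"]
 by (intro right_linearI) (simp_all add: unit_co T3.MN.pure_add_left NA_mult B_A)

end

lemma ind_colinear:
 assumes "right_module B N" "right_module B N'" "right_linear B N N' f"
 shows "colinear A C (ind N) (ind N') (tmap B N N' AA f)"
proof -
 interpret T: tensor3 B A N AA C by (intro tensor3.intro assms bimodule_B_AA left_C)
 interpret T': tensor3 B A N' AA C by (intro tensor3.intro assms bimodule_B_AA left_C)
 let ?f = "tmap B N N' AA f"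
 have lin: "right_linear A (tensor_prod B N AA) (tensor_prod B N' AA) ?f"
  by (rule tensor_map_right_linear[OF assms(1,2) bimodule_B_AA bimodule_B_AA assms(3) left_linear_ident right_linear_ident])
 note f_pure = tmap_pure[OF T.MN.ax T'.MN.ax assms(3)]
 note fC_pure = tmap_pure[OF T.MN_P.ax T'.MN_P.ax lin]
 have "coaction (ind N') (?f t) = tmap A (tensor_prod B N AA) (tensor_prod B N' AA) C ?f (coaction (ind N) t)"
  if "t : T.MN.T" for t
  by (rule T.MN.additive_eqI[OF additive_comp[OF right_linearD(1)[OF lin, simplified] induced_coaction_additive[OF assms(2)]]
     additive_comp[OF induced_coaction_additive[OF assms(1)]
      tmap_additive[OF T.MN_P.ax T'.MN_P.ax lin]]])
   (use that right_linearD(2)[OF assms(3)] in \<open>simp_all add: f_pure fC_pure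
    induced_coaction_pure[OF assms(1)] induced_coaction_pure[OF assms(2)] T.MN.pure_closed\<close>)
 then show ?thesis using lin by (simp add: colinear_def)
qed

section \<open>The unit and the counit\<close>

definition psi :: "('l, 'm, 'a, 'c, 'y) comodule_scheme => ('m, 'a) tensor => 'm" where
 "psi M = tensor_lift M (\<lambda>m a. m \<star>\<^sub>M a)"

abbreviation "coA M \<equiv> tensor_add B (coM M) AA"

lemma psi_balanced:
 assumes "right_module A M" "right_module B N" "right_linear B N M (\<lambda>m. m)"
 shows "balanced B N AA M (\<lambda>m a. m \<star>\<^sub>M a)"
proof -
 interpret M: right_module A M by fact
 note l = right_linearD[OF assms(3)]
 show ?thesis
  by (rule balancedI)
   (auto simp: l M.rsmult_closed M.rsmult_l_distr M.rsmult_r_distr B_A M.rsmult_assoc)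
qed

context
 fixes M :: "('l, 'm, 'a, 'c, 'y) comodule_scheme"
 assumes M: "comodule A C M"
begin

interpretation T3: tensor3 B A "coM M" AA C
 by (intro tensor3.intro right_co[OF M] bimodule_B_AA left_C)

interpretation M: right_module A M by (rule comoduleD(1)[OF M])

lemma psi_bal: "balanced B (coM M) AA M (\<lambda>m a. m \<star>\<^sub>M a)"
 by (rule psi_balanced[OF comoduleD(1)[OF M] right_co[OF M] co_inclusion[OF M]])

lemma psi_additive: "additive_map (coA M) M (psi M)"
 unfolding psi_def by (rule T3.MN.lift_additive[OF M.ab_M psi_bal])

lemma psi_pure: "[|m \<in> co M; a : A|] ==> psi M (pure_tensor B (coM M) AA m a) = m \<star>\<^sub>M a"
 unfolding psi_def using T3.MN.lift_pure[OF M.ab_M psi_bal] by simp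

lemma psi_colinear: "colinear A C (ind (coM M)) M (psi M)"
proof -
 have M': "right_module A M" by (rule comoduleD(1)[OF M])
 note add = psi_additive
 have lin: "right_linear A (tensor_prod B (coM M) AA) M (psi M)"
 proof (rule right_linearI)
  fix t a assume t: "t : tensor_prod B (coM M) AA" "a : A"
  show "psi M (t \<star>\<^bsub>tensor_prod B (coM M) AA\<^esub> a) = psi M t \<star>\<^sub>M a"
   by (rule T3.MN.additive_eqI[OF additive_comp[OF right_module.additive_rsmult[OF right_NA[OF right_co[OF M]] t(2), simplified] add]
     additive_comp[OF add M.additive_rsmult[OF t(2)]]])
    (use t in \<open>simp_all add: NA_mult[OF right_co[OF M], simplified] psi_pure M.rsmult_assoc coD\<close>)
 qed (use add in \<open>simp_all add: additive_closed additive_add\<close>)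
 interpret TM: tensor A M C by (rule tensor_C[OF M'])
 have "coaction M (psi M t) = tmap A (tensor_prod B (coM M) AA) M C (psi M) (coaction (ind (coM M)) t)"
  if "t : coA M" for t
  by (rule T3.MN.additive_eqI[OF additive_comp[OF add right_linearD(1)[OF comoduleD(2)[OF M], simplified]]
    additive_comp[OF induced_coaction_additive[OF right_co[OF M]]
     tmap_additive[OF T3.MN_P.ax TM.ax lin]]])
   (use that in \<open>simp_all add: psi_pure coaction_co_mult[OF M] induced_coaction_pure[OF right_co[OF M], simplified]
    tmap_pure[OF T3.MN_P.ax TM.ax lin]
    T3.MN.pure_closed coD M.rsmult_one\<close>)
 then show ?thesis using lin by (simp add: colinear_def)
qed

text \<open>The counit is always colinear, and the inverse of a colinear bijection is colinear, so
  only bijectivity is in question.\<close>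

lemma counit_iso_iff:
 "comodule_iso A C (ind (coM M)) M (counit_\<Psi> A C x M) \<longleftrightarrow> bij_betw (psi M) (carrier (coA M)) (carrier M)"
proof -
 have eq: "counit_\<Psi> A C x M = restrict (psi M) (carrier (coA M))"
  by (simp add: counit_\<Psi>_def psi_def)
 have "colinear A C (ind (coM M)) M (counit_\<Psi> A C x M)"
  by (rule colinear_cong[OF comodule_ind[OF right_co[OF M]] M psi_colinear]) (simp add: eq)
 then show ?thesis
  unfolding comodule_iso_iff[OF comodule_ind[OF right_co[OF M]] M] by (simp add: eq)
qed

end

abbreviation "phi N \<equiv> (\<lambda>n. pure_tensor B N AA n \<one>\<^sub>A)"
abbreviation "bij_psi M \<equiv> bij_betw (psi M) (carrier (coA M)) (carrier M)"
abbreviation "bij_phi N \<equiv> bij_betw (phi N) (carrier N) (co (ind N))"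

lemma unit_iso_iff:
 assumes "right_module B N"
 shows "right_iso B N (coM (ind N)) (unit_\<Phi> A C x N) \<longleftrightarrow> bij_phi N"
proof
 have eq: "unit_\<Phi> A C x N = restrict (phi N) (carrier N)"
  by (simp add: unit_\<Phi>_def)
 {
  assume "right_iso B N (coM (ind N)) (unit_\<Phi> A C x N)"
  then obtain g where g: "g \<in> right_hom B (coM (ind N)) N"
   "\<forall>m\<in>carrier N. g (unit_\<Phi> A C x N m) = m" "\<forall>n\<in>carrier (coM (ind N)). unit_\<Phi> A C x N (g n) = n"
   by (auto simp: right_iso_def)
  have gc: "g n : N" if "n \<in> co (ind N)" for n
   using g(1) that right_linearD(2)[of B "coM (ind N)" N g n] by (simp add: right_hom_def)
  show "bij_phi N"
   using g(2,3) gc unit_co[OF assms] by (intro bij_betw_byWitness[where f' = g]) (auto simp: eq)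
 }
 assume bij: "bij_phi N"
 define g where "g = inv_into (carrier N) (phi N)"
 have g: "!!t. t : coM (ind N) ==> g t : N" "!!t. t : coM (ind N) ==> phi N (g t) = t"
  "!!n. n : N ==> g (phi N n) = n"
 proof -
  have inj: "inj_on (phi N) (carrier N)" and im: "phi N ` carrier N = co (ind N)"
   using bij by (simp_all add: bij_betw_def)
  show "g t : N" if "t : coM (ind N)" for t
   unfolding g_def using that by (intro inv_into_into) (simp add: im)
  show "phi N (g t) = t" if "t : coM (ind N)" for t
   unfolding g_def using that by (intro f_inv_into_f) (simp add: im)
  show "g (phi N n) = n" if "n : N" for n
   unfolding g_def by (rule inv_into_f_f[OF inj that])
 qed
 have gl: "right_linear B (coM (ind N)) N g"
  by (rule right_linear_inverse[OF assms unit_linear[OF assms] g])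
 show "right_iso B N (coM (ind N)) (unit_\<Phi> A C x N)"
  unfolding right_iso_def
 proof (intro conjI bexI[of _ "restrict g (co (ind N))"])
  show "unit_\<Phi> A C x N \<in> right_hom B N (coM (ind N))"
   unfolding right_hom_def eq using unit_linear[OF assms] right_linear_restrict[OF assms] by auto
  show "restrict g (co (ind N)) \<in> right_hom B (coM (ind N)) N"
   using gl right_linear_restrict[OF right_co[OF comodule_ind[OF assms]], of N g] by (simp add: right_hom_def)
 qed (use g unit_co[OF assms] in \<open>auto simp: eq\<close>)
qed

text \<open>Bijectivity of the counit and of the unit is invariant under isomorphism, hence independent of
 the universe.\<close>

lemma psi_natural:
 assumes "comodule A C M" "comodule A C M'" "colinear A C M M' f" "t : coA M"
 shows "psi M' (tmap B (coM M) (coM M') AA f t) = f (psi M t)"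
proof -
 note r = right_co[OF assms(1)] right_co[OF assms(2)]
 interpret T: tensor B "coM M" AA by (rule tensor_B[OF r(1)])
 interpret T': tensor B "coM M'" AA by (rule tensor_B[OF r(2)])
 have f: "right_linear A M M' f" using assms(3) by (simp add: colinear_def)
 note co = colinear_coM[OF assms(1-3)]
 show ?thesis
  by (rule T.additive_eqI[OF additive_comp[OF tmap_additive[OF T.ax T'.ax co]
     psi_additive[OF assms(2)]] additive_comp[OF psi_additive[OF assms(1)] right_linearD(1)[OF f]] _ assms(4)])
   (use colinear_co[OF assms(1-3)] in \<open>simp add: tmap_pure[OF T.ax T'.ax co]
    psi_pure assms(1,2) right_linearD(4)[OF f] coD\<close>)
qed

lemma co_copy:
 assumes "comodule A C M" "comodule A C M'" "right_copy A M M' \<phi> \<psi>"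
  and "colinear A C M M' \<phi>" "colinear A C M' M \<psi>"
 shows "right_copy B (coM M) (coM M') \<phi> \<psi>"
 using right_copyD[OF assms(3)] assms(1,2)
 by (auto simp: right_copy_def right_co colinear_coM assms coD)

lemma psi_bij_copy:
 assumes "comodule A C M" "comodule A C M'" "right_copy A M M' \<phi> \<psi>"
  and "colinear A C M M' \<phi>" "colinear A C M' M \<psi>"
  and bij: "bij_betw (psi M') (carrier (coA M')) (carrier M')"
 shows "bij_psi M"
proof -
 note c = right_copyD[OF assms(3)]
 note co = co_copy[OF assms(1-5)]
 note cc = right_copyD[OF co]
 interpret T: tensor B "coM M" AA by (rule tensor_B[OF cc(1)])
 interpret T': tensor B "coM M'" AA by (rule tensor_B[OF cc(2)])
 let ?f = "tmap B (coM M) (coM M') AA \<phi>"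
 let ?g = "tmap B (coM M') (coM M) AA \<psi>"
 have fbij: "bij_betw ?f (carrier T.T) (carrier T'.T)"
  using tensor_map_copy[OF co left_B_AA] tensor_map_copy[OF right_copy_sym[OF co] left_B_AA]
   additive_closed[OF tmap_additive[OF T.ax T'.ax cc(3)]]
   additive_closed[OF tmap_additive[OF T'.ax T.ax cc(4)]]
  by (intro bij_betw_byWitness[where f' = ?g]) auto
 have \<psi>bij: "bij_betw \<psi> (carrier M') (carrier M)"
  using c by (intro bij_betw_byWitness[where f' = \<phi>]) auto
 have "bij_betw (\<psi> \<circ> (psi M' \<circ> ?f)) (carrier T.T) (carrier M)"
  by (rule bij_betw_trans[OF bij_betw_trans[OF fbij bij] \<psi>bij])
 moreover have "(\<psi> \<circ> (psi M' \<circ> ?f)) t = psi M t" if "t : T.T" for t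
  using psi_natural[OF assms(1,2,4) that] c(5) additive_closed[OF psi_additive[OF assms(1)] that] by simp
 ultimately show ?thesis by (simp cong: bij_betw_cong)
qed

lemma phi_bij_copy:
 assumes copy: "right_copy B N N' \<phi> \<psi>" and bij: "bij_betw (phi N') (carrier N') (co (ind N'))"
 shows "bij_phi N"
proof -
 note c = right_copyD[OF copy]
 interpret T: tensor B N AA by (rule tensor_B[OF c(1)])
 interpret T': tensor B N' AA by (rule tensor_B[OF c(2)])
 let ?f = "tmap B N N' AA \<phi>"
 let ?g = "tmap B N' N AA \<psi>"
 note f_co = colinear_co[OF comodule_ind[OF c(1)] comodule_ind[OF c(2)] ind_colinear[OF c(1,2,3)]]
 note g_co = colinear_co[OF comodule_ind[OF c(2)] comodule_ind[OF c(1)] ind_colinear[OF c(2,1,4)]]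
 have gbij: "bij_betw ?g (co (ind N')) (co (ind N))"
  using tensor_map_copy[OF copy left_B_AA] tensor_map_copy[OF right_copy_sym[OF copy] left_B_AA] f_co g_co
   coD(1)[of _ "ind N"] coD(1)[of _ "ind N'"]
  by (intro bij_betw_byWitness[where f' = ?f]) auto
 have \<phi>bij: "bij_betw \<phi> (carrier N) (carrier N')"
  using c by (intro bij_betw_byWitness[where f' = \<psi>]) auto
 have "bij_betw (?g \<circ> (phi N' \<circ> \<phi>)) (carrier N) (co (ind N))"
  by (rule bij_betw_trans[OF bij_betw_trans[OF \<phi>bij bij] gbij])
 moreover have "(?g \<circ> (phi N' \<circ> \<phi>)) n = phi N n" if "n : N" for n
  using that c(5,7) tmap_pure[OF T'.ax T.ax c(4), of "\<phi> n" "\<one>\<^sub>A"] by simp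
 ultimately show ?thesis by (simp cong: bij_betw_cong)
qed

lemma strong_structure_iff:
 "strong_structure_theorem TYPE('u) A C x \<longleftrightarrow>
   (\<forall>M :: (unit, 'u, 'a, 'c) comodule. comodule A C M --> bij_psi M) \<and>
   (\<forall>N :: (unit, 'u, 'a) bimodule. right_module B N --> bij_phi N)"
 unfolding strong_structure_theorem_def using counit_iso_iff unit_iso_iff by blast

text \<open>The theorem speaks of carriers in \<open>'u\<close>; small objects of other types, such
  as C or a kernel inside a tensor product, are reached through copies.\<close>

lemma strong_structureD:
 assumes "strong_structure_theorem TYPE('u) A C x"
 shows "[|comodule A C M; small TYPE('u) M|] ==> bij_psi M"
  and "[|right_module B N; small TYPE('u) N|] ==> bij_phi N"
proof -
 assume M: "comodule A C M" "small TYPE('u) M"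
 obtain M' :: "(unit, 'u, 'a, 'c) comodule" and \<phi> \<psi>
  where M': "comodule A C M'" "right_copy A M M' \<phi> \<psi>" "colinear A C M M' \<phi>" "colinear A C M' M \<psi>"
  using obtain_comodule_copy[OF M] .
 show "bij_psi M"
  using assms M'(1) by (intro psi_bij_copy[OF M(1) M']) (simp add: strong_structure_iff)
next
 assume N: "right_module B N" "small TYPE('u) N"
 obtain N' :: "(unit, 'u, 'a) bimodule" and \<phi> \<psi> where N': "right_copy B N N' \<phi> \<psi>"
  using obtain_right_copy[OF N] .
 show "bij_phi N"
  using assms right_copyD(2)[OF N'] by (intro phi_bij_copy[OF N']) (simp add: strong_structure_iff)
qed

end

section \<open>Galois corings and faithful flatness\<close>

lemma right_copyI:
 assumes "right_module R M" "right_module R N" "right_linear R M N f"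
  and "!!n. n : N ==> g n : M" "!!n. n : N ==> f (g n) = n"
   "!!m. m : M ==> g (f m) = m"
 shows "right_copy R M N f g"
 using assms right_linear_inverse[OF assms(1,3-6)] by (simp add: right_copy_def)

lemma tensor_map_copy_bij:
 assumes "right_copy R M M' \<phi> \<psi>" "left_module R N"
 shows "bij_betw (tmap R M M' N \<phi>) (carrier (tensor_add R M N)) (carrier (tensor_add R M' N))"
proof -
 note c = right_copyD[OF assms(1)]
 have T: "tensor R M N" "tensor R M' N" by (auto intro: tensorI c assms)
 show ?thesis
  using tensor_map_copy[OF assms] tensor_map_copy[OF right_copy_sym[OF assms(1)] assms(2)]
   additive_closed[OF tensor_map_additive[OF T c(3) left_linear_ident]]
   additive_closed[OF tensor_map_additive[OF T(2,1) c(4) left_linear_ident]]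
  by (intro bij_betw_byWitness[where f' = "tmap R M' M N \<psi>"]) auto
qed

lemma coring_comodule_same: "same_module (coring_comodule C) C"
 using with_coaction_same[of "bimodule.truncate C"] truncate_same[of C]
 by (simp add: coring_comodule_def same_module_def)

lemma coaction_coring_comodule [simp]: "coaction (coring_comodule C) = comult C"
 by (simp add: coring_comodule_def)

lemmas coring_comodule_simps [simp] = same_module_simps[OF coring_comodule_same] same_module_tensor[OF coring_comodule_same]

lemma (in coring_setting) comodule_C: "comodule A C (coring_comodule C)"
 using coring right_C comult_right_linear
 by (simp add: comodule_def comodule_axioms_def coring.coassoc coring.counit_right)

lemma colinear_hom_module_simps [simp]:
 "carrier (colinear_hom_module A C x M) = colinear_maps A C (ring_comodule A C x) M"
 "\<zero>\<^bsub>colinear_hom_module A C x M\<^esub> = (\<lambda>a\<in>carrier A. \<zero>\<^sub>M)"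
 "f \<oplus>\<^bsub>colinear_hom_module A C x M\<^esub> g = (\<lambda>a\<in>carrier A. f a \<oplus>\<^sub>M g a)"
 "f \<star>\<^bsub>colinear_hom_module A C x M\<^esub> b = (\<lambda>a\<in>carrier A. f (b \<otimes>\<^sub>A a))"
 by (simp_all add: colinear_hom_module_def)

section \<open>Colinear maps from A and the map \<Psi>'\<close>

context grouplike_coring begin

abbreviation "homA M \<equiv> colinear_hom_module A C x M"

text \<open>Evaluation at 1 identifies the colinear maps from A to M with the coinvariants of M. The
  B-module axioms for these maps are carried over from the coinvariants, and \<Psi>' becomes
  \<Psi>.\<close>

lemma hom_copy:
 assumes M: "comodule A C M"
 shows "right_copy B (homA M) (coM M) (\<lambda>f. f \<one>\<^sub>A) (\<lambda>m. \<lambda>a\<in>carrier A. m \<star>\<^sub>M a)"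
proof -
 interpret M: right_module A M by (rule comoduleD(1)[OF M])
 note co = right_submoduleD[OF co_submodule[OF M]]
 have f: "f \<in> extensional (carrier A)" "f \<one>\<^sub>A \<in> co M" "f \<one>\<^sub>A : M"
  "!!a. a : A ==> f a = f \<one>\<^sub>A \<star>\<^sub>M a" if "f : homA M" for f
 proof -
  have col: "f \<in> extensional (carrier A)" "colinear A C AC M f"
   using that by (simp_all add: colinear_maps_iff[OF comodule_AC M])
  show "f \<in> extensional (carrier A)" "f \<one>\<^sub>A \<in> co M" "f \<one>\<^sub>A : M"
   using col(1) colinear_from_A(1)[OF M col(2)] coD(1)[OF colinear_from_A(1)[OF M col(2)]] by simp_all
  show "f a = f \<one>\<^sub>A \<star>\<^sub>M a" if "a : A" for a
   by (rule colinear_from_A(2)[OF M col(2) that])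
 qed
 have g: "(\<lambda>a\<in>carrier A. m \<star>\<^sub>M a) : homA M" if "m \<in> co M" for m
  using colinear_restrict[OF comodule_AC M co_hom[OF M that]] by simp
 have eq: "f = (\<lambda>a\<in>carrier A. m \<star>\<^sub>M a)" if "f \<in> extensional (carrier A)" "!!a. a : A ==> f a = m \<star>\<^sub>M a" for f m
  using that by (auto simp: extensional_def)
 have gf: "(\<lambda>a\<in>carrier A. f \<one>\<^sub>A \<star>\<^sub>M a) = f" if "f : homA M" for f
  by (rule eq[symmetric]) (rule f[OF that], assumption?)+
 have fg: "(\<lambda>a\<in>carrier A. m \<star>\<^sub>M a) \<one>\<^sub>A = m" if "m \<in> co M" for m
  using coD(1)[OF that] by (simp add: M.rsmult_one)
 have im: "(\<lambda>m. \<lambda>a\<in>carrier A. m \<star>\<^sub>M a) ` carrier (coM M) = carrier (homA M)"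
 proof
  show "(\<lambda>m. \<lambda>a\<in>carrier A. m \<star>\<^sub>M a) ` carrier (coM M) \<subseteq> carrier (homA M)" using g by auto
  show "carrier (homA M) \<subseteq> (\<lambda>m. \<lambda>a\<in>carrier A. m \<star>\<^sub>M a) ` carrier (coM M)"
  proof
   show "f \<in> (\<lambda>m. \<lambda>a\<in>carrier A. m \<star>\<^sub>M a) ` carrier (coM M)" if "f : homA M" for f
    by (rule image_eqI[of _ _ "f \<one>\<^sub>A"]) (use gf[OF that] f(2)[OF that] in simp_all)
  qed
 qed
 have hm: "right_module B (homA M)" "right_linear B (coM M) (homA M) (\<lambda>m. \<lambda>a\<in>carrier A. m \<star>\<^sub>M a)"
  by (rule right_module_image[OF right_co[OF M] im];
   auto simp: fun_eq_iff M.zero_rsmult M.rsmult_l_distr M.rsmult_assoc B_A coD(1))+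
 show ?thesis
  by (rule right_copy_sym, rule right_copyI[OF right_co[OF M] hm]) (use f(2) fg gf in auto)
qed

abbreviation "psi' M \<equiv> tensor_lift M (\<lambda>f a. f a)"

lemma psi'_eq:
 assumes M: "comodule A C M" and t: "t : tensor_add B (homA M) AA"
 shows "psi' M t = psi M (tmap B (homA M) (coM M) AA (\<lambda>f. f \<one>\<^sub>A) t)"
  and "additive_map (tensor_add B (homA M) AA) M (psi' M)"
  and "[|f : homA M; a : A|] ==> psi' M (pure_tensor B (homA M) AA f a) = f a"
proof -
 note c = right_copyD[OF hom_copy[OF M]]
 interpret M: right_module A M by (rule comoduleD(1)[OF M])
 interpret TH: tensor B "homA M" AA by (rule tensor_B[OF c(1)])
 interpret TM: tensor B "coM M" AA by (rule tensor_B[OF c(2)])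
 have f: "f \<one>\<^sub>A \<in> co M" "f a : M" "f a = f \<one>\<^sub>A \<star>\<^sub>M a"
  if "f : homA M" "a : A" for f a
 proof -
  have col: "colinear A C AC M f" using that(1) by (simp add: colinear_maps_iff[OF comodule_AC M])
  show "f \<one>\<^sub>A \<in> co M" "f a = f \<one>\<^sub>A \<star>\<^sub>M a"
   by (rule colinear_from_A[OF M col] that)+
  show "f a : M" using col that(2) right_linearD(2)[of A AA M f a] by (simp add: colinear_def)
 qed
 have add: "f (a \<oplus>\<^sub>A a') = f a \<oplus>\<^sub>M f a'" if "f : homA M" "a : A" "a' : A" for f a a'
  using that right_linearD(3)[of A AA M f a a'] by (simp add: colinear_maps_iff[OF comodule_AC M] colinear_def)
 have bal: "balanced B (homA M) AA M (\<lambda>f a. f a)"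
  using f(2) add by (intro balancedI) (auto simp: B_A)
 note co = tmap_additive[OF TH.ax TM.ax c(3)]
 note pure = TH.lift_pure[OF M.ab_M bal]
 show lin: "additive_map (tensor_add B (homA M) AA) M (psi' M)"
  by (rule TH.lift_additive[OF M.ab_M bal])
 show "psi' M t = psi M (tmap B (homA M) (coM M) AA (\<lambda>f. f \<one>\<^sub>A) t)"
 proof (rule TH.additive_eqI[OF lin additive_comp[OF co psi_additive[OF M]] _ t])
  fix g a assume "g : homA M" "a : AA"
  then show "psi' M (TH.pt g a) = psi M (tmap B (homA M) (coM M) AA (\<lambda>f. f \<one>\<^sub>A) (TH.pt g a))"
   using tmap_pure[OF TH.ax TM.ax c(3), of g a]
    f(1,3)[of g a] pure[of g a] by (simp add: psi_pure[OF M])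
 qed
 show "psi' M (TH.pt f a) = f a" if "f : homA M" "a : A"
  using pure[of f a] that by simp
qed

lemma bijective_psi':
 assumes M: "comodule A C M"
 shows "bijective_\<Psi>' A C x M \<longleftrightarrow> bij_psi M"
proof -
 let ?h = "tmap B (homA M) (coM M) AA (\<lambda>f. f \<one>\<^sub>A)"
 have h: "bij_betw ?h (carrier (tensor_add B (homA M) AA)) (carrier (coA M))"
  by (rule tensor_map_copy_bij[OF hom_copy[OF M] left_B_AA])
 have "bijective_\<Psi>' A C x M \<longleftrightarrow> bij_betw (psi' M) (carrier (tensor_add B (homA M) AA)) (carrier M)"
  by (simp add: bijective_\<Psi>'_def counit_\<Psi>'_def)
 also have "\<dots> \<longleftrightarrow> bij_betw (psi M \<circ> ?h) (carrier (tensor_add B (homA M) AA)) (carrier M)"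
  using psi'_eq(1)[OF M] by (intro bij_betw_cong) simp
 also have "\<dots> \<longleftrightarrow> bij_psi M"
  by (rule bij_betw_comp_iff[OF h, symmetric])
 finally show ?thesis .
qed

lemma counit_iso'_iff:
 assumes M: "comodule A C M"
 shows "comodule_iso A C (ind (homA M)) M (counit_\<Psi>' A C x M) \<longleftrightarrow> bij_psi M"
proof -
 let ?h = "tmap B (homA M) (coM M) AA (\<lambda>f. f \<one>\<^sub>A)"
 note c = right_copyD[OF hom_copy[OF M]]
 note i = comodule_ind[OF c(1)]
 have eq: "counit_\<Psi>' A C x M = restrict (psi' M) (carrier (tensor_add B (homA M) AA))"
  by (simp add: counit_\<Psi>'_def)
 have "colinear A C (ind (homA M)) M (\<lambda>t. psi M (?h t))"
  by (rule colinear_compose[OF i comodule_ind[OF c(2)] M ind_colinear[OF c(1,2,3)] psi_colinear[OF M]])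
 then have "colinear A C (ind (homA M)) M (counit_\<Psi>' A C x M)"
  by (rule colinear_cong[OF i M]) (simp add: eq psi'_eq(1)[OF M])
 then show ?thesis
  unfolding comodule_iso_iff[OF i M] bijective_psi'[OF M, symmetric] bijective_\<Psi>'_def
  by (simp add: eq)
qed

section \<open>The Galois map and its extension to modules\<close>

definition beta :: "('a, 'a) tensor => 'c" where
 "beta = tensor_lift C (\<lambda>a' a. (a' \<odot>\<^sub>C x) \<star>\<^sub>C a)"

lemma right_B_AA: "right_module B AA"
 by (rule right_module_B[OF right_AA])

sublocale TBA: tensor B AA AA by (rule tensor_B[OF right_B_AA])

lemma beta_balanced: "balanced B AA AA C (\<lambda>a' a. (a' \<odot>\<^sub>C x) \<star>\<^sub>C a)"
proof (rule balancedI)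
 fix a b a' assume *: "a : AA" "b : B" "a' : AA"
 then have "(a \<otimes>\<^sub>A b) \<odot>\<^sub>C x = (a \<odot>\<^sub>C x) \<star>\<^sub>C b"
  using bimoduleD(3)[OF bimodule_C, of a x b] x(1) by (simp add: C_left.lsmult_assoc B_A B_x)
 then show "((a \<star>\<^bsub>AA\<^esub> b) \<odot>\<^sub>C x) \<star>\<^sub>C a' = (a \<odot>\<^sub>C x) \<star>\<^sub>C (b \<odot>\<^bsub>AA\<^esub> a')"
  using * by (simp add: C_right.rsmult_assoc C_left.lsmult_closed x B_A)
qed (auto simp: x C_left.lsmult_closed C_right.rsmult_closed C_left.lsmult_l_distr C_right.rsmult_l_distr C_right.rsmult_r_distr)

lemmas beta_additive = TBA.lift_additive[OF C_left.ab_M beta_balanced, folded beta_def]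
 and beta_pure = TBA.lift_pure[OF C_left.ab_M beta_balanced, folded beta_def]

lemma galois_iff: "galois A C x \<longleftrightarrow> bij_betw beta (carrier TBA.T) (carrier C)"
 by (simp add: galois_def beta_def)

text \<open>Coinvariance of c reads \<Delta>(c) = c \<otimes> x, and the left counit law turns this
  into c = \<epsilon>(c)x.\<close>

lemma co_C: "co (coring_comodule C) = (\<lambda>a. a \<odot>\<^sub>C x) ` carrier A"
proof
 show "(\<lambda>a. a \<odot>\<^sub>C x) ` carrier A \<subseteq> co (coring_comodule C)"
  using left_linearD(4)[OF comult_left_linear x(1)] lsmult_pure[OF bimodule_C left_C _ x(1) x(1)] x(2)
  by (auto simp: coinvariants_def C_left.lsmult_closed x(1))
next
 have "balanced A C C C (\<lambda>d e. counit C d \<odot>\<^sub>C e)"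
  using right_linearD[OF counit_right_linear]
  by (intro balancedI) (auto simp: C_left.lsmult_closed C_left.lsmult_l_distr C_left.lsmult_r_distr C_left.lsmult_assoc)
 note lift = tensor.lift_pure[OF tensor_C[OF right_C] C_left.ab_M this]
 have "c = counit C c \<odot>\<^sub>C x \<and> counit C c : A" if "c \<in> co (coring_comodule C)" for c
  using that coring.counit_left[OF coring, of c] lift[of c x] x(1) right_linearD(2)[OF counit_right_linear, of c]
  by (auto simp: coinvariants_def)
 then show "co (coring_comodule C) \<subseteq> (\<lambda>a. a \<odot>\<^sub>C x) ` carrier A" by blast
qed

text \<open>By \<open>co_C\<close>, a \<mapsto> ax is an isomorphism from A to the coinvariants of
  C, with the counit as inverse; it turns \<beta> into \<Psi> for C.\<close>

lemma galois_iff_psi: "galois A C x \<longleftrightarrow> bij_betw (psi (coring_comodule C)) (carrier (coA (coring_comodule C))) (carrier C)"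
proof -
 let ?CC = "coring_comodule C" and ?f = "\<lambda>a. a \<odot>\<^sub>C x"
 have lin: "right_linear B AA (coM ?CC) ?f"
  by (rule right_linearI)
   (auto simp: co_C C_left.lsmult_l_distr C_left.lsmult_assoc x B_A B_x bimoduleD(3)[OF bimodule_C])
 have e: "counit C (?f a) = a" if "a : A" for a
  using left_linearD(4)[OF counit_linear x(1) that] that x(3) by simp
 have copy: "right_copy B AA (coM ?CC) ?f (counit C)"
  by (rule right_copyI[OF right_B_AA right_co[OF comodule_C] lin]) (auto simp: co_C e)
 let ?h = "tmap B AA (coM ?CC) AA ?f"
 have h: "bij_betw ?h (carrier TBA.T) (carrier (coA ?CC))"
  by (rule tensor_map_copy_bij[OF copy left_B_AA])
 interpret T': tensor B "coM ?CC" AA by (rule tensor_B[OF right_co[OF comodule_C]])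
 have "additive_map (coA ?CC) C (psi ?CC)" using psi_additive[OF comodule_C] by (simp add: additive_map_def)
 note ad = additive_comp[OF tmap_additive[OF TBA.ax T'.ax lin] this]
 have "beta t = psi ?CC (?h t)" if "t : TBA.T" for t
  by (rule TBA.additive_eqI[OF beta_additive ad _ that])
   (simp add: beta_pure tmap_pure[OF TBA.ax T'.ax lin] psi_pure[OF comodule_C] co_C)
 then have "bij_betw beta (carrier TBA.T) (carrier C) \<longleftrightarrow> bij_betw (psi ?CC \<circ> ?h) (carrier TBA.T) (carrier C)"
  by (intro bij_betw_cong) simp
 then show ?thesis unfolding galois_iff using bij_betw_comp_iff[OF h] by metis
qed

text \<open>The Galois property extends to all modules: \<open>m \<otimes> a \<mapsto> m \<otimes> xa\<close> is bijective, with inverse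
 \<open>m \<otimes> c \<mapsto> m \<cdot> \<beta>\<^sup>-\<^sup>1(c)\<close>.\<close>

definition can :: "('l, 'm, 'a, 'y) bimodule_scheme => ('m, 'a) tensor => ('m, 'c) tensor" where
 "can M = tensor_lift (tensor_add A M C) (\<lambda>m a. pure_tensor A M C m (x \<star>\<^sub>C a))"

context
 fixes M :: "('l, 'm, 'a, 'y) bimodule_scheme"
 assumes M: "right_module A M"
begin

interpretation M: right_module A M by (rule M)
interpretation TB: tensor B M AA by (rule tensor_B[OF right_module_B[OF M]])
interpretation TC: tensor A M C by (rule tensor_C[OF M])

lemma can_balanced: "balanced B M AA TC.T (\<lambda>m a. TC.pt m (x \<star>\<^sub>C a))"
proof (rule balancedI)
 fix m b a assume *: "m : M" "b : B" "a : AA"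
 then show "TC.pt (m \<star>\<^sub>M b) (x \<star>\<^sub>C a) = TC.pt m (x \<star>\<^sub>C (b \<odot>\<^bsub>AA\<^esub> a))"
  using bimoduleD(3)[OF bimodule_C, of b x a] x(1)
  by (simp add: TC.pure_balanced B_A B_x C_right.rsmult_assoc)
qed (auto simp: TC.pure_closed TC.pure_add_left TC.pure_add_right C_right.rsmult_r_distr x)

lemmas can_additive = TB.lift_additive[OF TC.ab_T can_balanced, folded can_def]
 and can_pure = TB.lift_pure[OF TC.ab_T can_balanced, folded can_def]

lemma can_bij:
 assumes "galois A C x"
 shows "bij_betw (can M) (carrier TB.T) (carrier TC.T)"
proof -
 let ?D = "tensor_prod B AA AA"
 have bimod_B: "bimodule A B AA"
  using right_B_AA by (intro bimoduleI left_AA) (auto simp: B_A A.m_assoc)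
 interpret D: left_module A ?D by (rule left_module_tensor_prod[OF bimod_B left_B_AA])
 have D_smult: "a \<odot>\<^bsub>?D\<^esub> TBA.pt a' a'' = TBA.pt (a \<otimes>\<^sub>A a') a''"
  if "a : A" "a' : A" "a'' : A" for a a' a''
  using lsmult_pure[OF bimod_B left_B_AA] that by simp
 define \<gamma> where "\<gamma> = inv_into (carrier TBA.T) beta"
 have bij: "bij_betw beta (carrier TBA.T) (carrier C)" using assms by (simp add: galois_iff)
 have \<gamma>: "\<gamma> c : TBA.T" "beta (\<gamma> c) = c" if "c : C" for c
  using bij that by (auto simp: \<gamma>_def bij_betw_def inv_into_into f_inv_into_f)
 have \<gamma>b: "\<gamma> (beta d) = d" if "d : TBA.T" for d
  using bij that by (simp add: \<gamma>_def bij_betw_def)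
 have b_smult: "beta (a \<odot>\<^bsub>?D\<^esub> d) = a \<odot>\<^sub>C beta d" if "a : A" "d : TBA.T" for a d
  by (rule TBA.additive_eqI[OF additive_comp[OF D.additive_lsmult[OF that(1), simplified] beta_additive]
    additive_comp[OF beta_additive C_left.additive_lsmult[OF that(1)]] _ that(2)])
   (use that in \<open>simp add: D_smult beta_pure C_left.lsmult_assoc x C_left.lsmult_closed bimoduleD(3)[OF bimodule_C]\<close>)
 have g_add: "\<gamma> (c \<oplus>\<^sub>C c') = \<gamma> c \<oplus>\<^bsub>TBA.T\<^esub> \<gamma> c'" if "c : C" "c' : C" for c c'
  using \<gamma>b[of "\<gamma> c \<oplus>\<^bsub>TBA.T\<^esub> \<gamma> c'"] \<gamma> that by (simp add: additive_add[OF beta_additive])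
 have g_smult: "\<gamma> (a \<odot>\<^sub>C c) = a \<odot>\<^bsub>?D\<^esub> \<gamma> c" if "a : A" "c : C" for a c
  using \<gamma>b[of "a \<odot>\<^bsub>?D\<^esub> \<gamma> c"] \<gamma> that D.lsmult_closed[of a "\<gamma> c"] by (simp add: b_smult)
 \<comment> \<open>An element m of M acts on the first factor of A \<otimes> A; this is the dot in m
   \<cdot> \<beta>^-1(c).\<close>
 define p where "p m = tmap B AA M AA (\<lambda>a'. m \<star>\<^sub>M a')" for m
 have ml: "right_linear B AA M (\<lambda>a'. m \<star>\<^sub>M a')" if "m : M" for m
  using that by (intro right_linearI) (auto simp: B_A M.rsmult_closed M.rsmult_r_distr M.rsmult_assoc)
 have p_add: "additive_map TBA.T TB.T (p m)" if "m : M" for m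
  unfolding p_def by (rule tmap_additive[OF TBA.ax TB.ax ml[OF that]])
 have p_pure: "p m (TBA.pt a' a) = TB.pt (m \<star>\<^sub>M a') a" if "m : M" "a' : A" "a : A" for m a a'
  unfolding p_def using tmap_pure[OF TBA.ax TB.ax ml[OF that(1)]] that by simp
 have p1: "p (m \<oplus>\<^sub>M m') d = p m d \<oplus>\<^bsub>TB.T\<^esub> p m' d"
  if "m : M" "m' : M" "d : TBA.T" for m m' d
  by (rule TBA.additive_eqI[OF p_add additive_sum[OF TB.ab_T p_add p_add] _ that(3)])
   (use that in \<open>simp_all add: p_pure M.rsmult_l_distr TB.pure_add_left M.rsmult_closed\<close>)
 have p2: "p (m \<star>\<^sub>M a) d = p m (a \<odot>\<^bsub>?D\<^esub> d)" if "m : M" "a : A" "d : TBA.T" for m a d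
  by (rule TBA.additive_eqI[OF p_add additive_comp[OF D.additive_lsmult[OF that(2), simplified] p_add] _ that(3)])
   (use that in \<open>simp_all add: p_pure D_smult M.rsmult_assoc M.rsmult_closed\<close>)
 \<comment> \<open>Balancedness over A rests on the left A-linearity of \<beta>^-1 and on p (ma) d =
   p m (ad).\<close>
 have bal: "balanced A M C TB.T (\<lambda>m c. p m (\<gamma> c))"
  using \<gamma> additive_closed[OF p_add]
  by (intro balancedI) (simp_all add: p1 g_add additive_add[OF p_add] p2 g_smult)
 note inv_add = TC.lift_additive[OF TB.ab_T bal] and inv_pure = TC.lift_pure[OF TB.ab_T bal]
 let ?inv = "tensor_lift TB.T (\<lambda>m c. p m (\<gamma> c))"
 have can_p: "can M (p m d) = TC.pt m (beta d)" if "m : M" "d : TBA.T" for m d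
 proof -
  have "additive_map TBA.T TC.T (\<lambda>d. TC.pt m (beta d))"
   using TC.balanced_pure that by (intro additive_comp[OF beta_additive]) (simp add: balanced_def)
  then show ?thesis
   by (rule TBA.additive_eqI[OF additive_comp[OF p_add[OF that(1)] can_additive] _ _ that(2)])
    (use that x in \<open>simp add: p_pure can_pure M.rsmult_closed beta_pure TC.pure_balanced bimoduleD(3)[OF bimodule_C]\<close>)
 qed
 have 1: "can M (?inv t) = t" if "t : TC.T" for t
  by (rule TC.additive_eqI[OF additive_comp[OF inv_add can_additive] _ _ that])
   (simp_all add: inv_pure can_p \<gamma> additive_map_def)
 have \<gamma>x: "\<gamma> (x \<star>\<^sub>C a) = TBA.pt \<one>\<^sub>A a" if "a : A" for a
  using \<gamma>b[of "TBA.pt \<one>\<^sub>A a"] that by (simp add: beta_pure TBA.pure_closed C_left.lsmult_one x)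
 have 2: "?inv (can M t) = t" if "t : TB.T" for t
  by (rule TB.additive_eqI[OF additive_comp[OF can_additive inv_add] _ _ that])
   (simp_all add: can_pure inv_pure \<gamma>x p_pure M.rsmult_one additive_map_def)
 show ?thesis
  using 1 2 additive_closed[OF inv_add] additive_closed[OF can_additive]
  by (intro bij_betw_byWitness[where f' = ?inv]) auto
qed

end

end

section \<open>The strong structure theorem and faithful flatness\<close>

locale small_coring = grouplike_coring A C x
 for A :: "'a ring" and C :: "('a, 'c, 'x) coring_scheme" and x +
 fixes U :: "'u itself"
 assumes infinite_U: "infinite (UNIV :: 'u set)"
  and small_A: "small TYPE('u) A"
  and small_C: "small TYPE('u) C"
begin

text \<open>The conditions on the universe keep M \<otimes> C, and below N \<otimes> A, small, so
  that flatness and the strong structure theorem apply to iterated tensor products.\<close>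

lemma small_MC: "[|right_module A M; small TYPE('u) M|] ==> small TYPE('u) (tensor_add A M C)"
 by (rule tensor.lepoll_T[OF tensor_C infinite_U _ small_C])

lemma small_NA: "[|right_module B N; small TYPE('u) N|] ==> small TYPE('u) (tensor_add B N AA)"
 using small_A by (intro tensor.lepoll_T[OF tensor_B infinite_U]) auto

text \<open>For k in the kernel K of g, the coaction of k is killed by g \<otimes> C, and flatness
  of C identifies the kernel of g \<otimes> C with K \<otimes> C. So the coaction restricts to
  K.\<close>

lemma kernel_comodule:
 assumes flat: "flat_left TYPE('u) A C"
  and L: "comodule A C L" and N: "comodule A C N" and g: "colinear A C L N g"
  and small: "small TYPE('u) L" "small TYPE('u) N"
 defines "K \<equiv> (bimodule.truncate L)\<lparr>carrier := {l \<in> carrier L. g l = \<zero>\<^sub>N}\<rparr>"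
 obtains \<rho> where "comodule A C (with_coaction K \<rho>)" "colinear A C (with_coaction K \<rho>) L (\<lambda>l. l)"
proof -
 note l = comoduleD[OF L] and n = comoduleD[OF N]
 have gl: "right_linear A L N g" using g by (simp add: colinear_def)
 have K: "right_module A K" unfolding K_def
  using right_submodule_kernel[of A "bimodule.truncate L" N g] l(1) n(1) gl
  by (intro submodule_module) simp_all
 have iK: "right_linear A K L (\<lambda>l. l)" by (rule right_linearI) (auto simp: K_def)
 have smallK: "small TYPE('u) K" by (rule lepoll_subset[OF small(1)]) (auto simp: K_def)
 let ?i = "tmap A K L C (\<lambda>l. l)"
 have inj: "inj_on ?i (carrier (tensor_add A K C))"
  by (rule flat_left_inj[OF flat K l(1) left_C smallK small(1) iK]) simp
 have inj2: "inj_on (tmap A (tensor_prod A K C) (tensor_prod A L C) C ?i)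
   (carrier (tensor_add A (tensor_prod A K C) C))"
  using inj small_MC[OF K smallK] small_MC[OF l(1) small(1)]
  by (intro flat_left_inj[OF flat right_module_MC[OF K] right_module_MC[OF l(1)] left_C _ _ tensor_map_C_linear[OF K l(1) iK]]) simp_all
 have "\<exists>s\<in>carrier (tensor_add A K C). ?i s = coaction L m" if "m : K" for m
 proof -
  have m: "m : L" "g m = \<zero>\<^sub>N" using that by (auto simp: K_def)
  interpret N: right_module A N by (rule n)
  have "tmap A L N C g (coaction L m) = \<zero>\<^bsub>tensor_add A N C\<^esub>"
  proof -
   have "tmap A L N C g (coaction L m) = coaction N (g m)"
    using g m(1) by (simp add: colinear_def)
   then show ?thesis
    using m(2) additive_zero[OF N.ab_M tensor.ab_T[OF tensor_C[OF n(1)]] right_linearD(1)[OF n(2), simplified]]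
    by simp
  qed
  then show ?thesis
   using flat_left_kernel[OF flat, of "bimodule.truncate L" N g "coaction L m"] l(1) n(1) left_C small(2) gl l(5)[OF m(1)]
   by (simp add: K_def)
 qed
 then obtain \<rho> where \<rho>: "!!m. m : K ==> \<rho> m : tensor_add A K C"
   "!!m. m : K ==> ?i (\<rho> m) = coaction L m" by metis
 show ?thesis
  using sub_comodule[OF L K iK _ inj inj2 \<rho>] that by simp
qed

text \<open>If Y \<otimes> A = 0, the injective unit from Y to Y \<otimes> A forces Y = 0.\<close>

lemma strong_structure_weak_generator:
 assumes "strong_structure_theorem TYPE('u) A C x"
 shows "weak_generator TYPE('u) B AA"
 unfolding weak_generator_def
proof (intro allI impI, elim conjE)
 fix Y :: "(unit, 'u, 'a) bimodule"
 assume Y: "right_module B Y" and 0: "carrier (tensor_prod B Y AA) = {\<zero>\<^bsub>tensor_prod B Y AA\<^esub>}"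
 interpret T: tensor B Y AA by (rule tensor_B[OF Y])
 have inj: "inj_on (phi Y) (carrier Y)"
  using assms Y by (auto simp: strong_structure_iff bij_betw_def)
 have "phi Y y = \<zero>\<^bsub>T.T\<^esub>" if "y : Y" for y
  using 0 T.pure_closed[OF that] by auto
 then show "carrier Y = {\<zero>\<^sub>Y}"
  using inj_onD[OF inj] T.M.zero_closed by auto
qed

text \<open>The kernel K of f \<otimes> A is a comodule by flatness of C. Its coinvariants have the
  form m \<otimes> 1 because \<Phi> is onto, and f(m) \<otimes> 1 = 0 gives f(m) = 0, so m = 0. As
  \<Psi> for K is onto, K = 0.\<close>

lemma strong_structure_flat:
 assumes flat: "flat_left TYPE('u) A C" and sst: "strong_structure_theorem TYPE('u) A C x"
 shows "flat_left TYPE('u) B AA"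
 unfolding flat_left_def
proof (intro allI impI, elim conjE)
 fix M N :: "(unit, 'u, 'a) bimodule" and f
 assume M: "right_module B M" and N: "right_module B N" and "f \<in> right_hom B M N" and inj: "inj_on f (carrier M)"
 then have f: "right_linear B M N f" by (simp add: right_hom_def)
 interpret TM: tensor B M AA by (rule tensor_B[OF M])
 interpret TN: tensor B N AA by (rule tensor_B[OF N])
 let ?f = "tmap B M N AA f"
 have UN: "X \<lesssim> (UNIV :: 'u set)" for X :: "'u set" by (rule subset_imp_lepoll) simp
 have small: "small TYPE('u) (ind M)" "small TYPE('u) (ind N)"
  using small_NA[OF M UN] small_NA[OF N UN] by simp_all
 note fc = ind_colinear[OF M N f]
 let ?K = "(bimodule.truncate (ind M))\<lparr>carrier := {t \<in> carrier (ind M). ?f t = \<zero>\<^bsub>ind N\<^esub>}\<rparr>"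
 obtain \<rho> where \<rho>: "comodule A C (with_coaction ?K \<rho>)" "colinear A C (with_coaction ?K \<rho>) (ind M) (\<lambda>l. l)"
  using kernel_comodule[OF flat comodule_ind[OF M] comodule_ind[OF N] fc small] .
 define KM where "KM = with_coaction ?K \<rho>"
 note K = \<rho>[folded KM_def]
 have carK: "carrier KM = {t \<in> carrier TM.T. ?f t = \<zero>\<^bsub>TN.T\<^esub>}" by (simp add: KM_def)
 have zK: "\<zero>\<^bsub>KM\<^esub> = \<zero>\<^bsub>TM.T\<^esub>" by (simp add: KM_def)
 have smallK: "small TYPE('u) KM"
  by (rule lepoll_subset[OF small(1)]) (auto simp: carK)
 interpret KM: right_module A KM by (rule comoduleD(1)[OF K(1)])
 interpret TK: tensor B "coM KM" AA by (rule tensor_B[OF right_co[OF K(1)]])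
 have coK: "t = \<zero>\<^bsub>TM.T\<^esub>" if t: "t \<in> co KM" for t
 proof -
  have "t \<in> co (ind M)" by (rule colinear_co[OF K(1) comodule_ind[OF M] K(2) t])
  moreover have "phi M ` carrier M = co (ind M)"
   using sst M by (auto simp: strong_structure_iff bij_betw_def)
  ultimately obtain m where m: "m : M" "t = phi M m" by auto
  have "phi N (f m) = ?f t"
   using tmap_pure[OF TM.ax TN.ax f m(1), of "\<one>\<^sub>A"] m by simp
  also have "\<dots> = phi N \<zero>\<^sub>N" using coD(1)[OF t] by (simp add: carK TN.pure_zero_left)
  finally have eq: "phi N (f m) = phi N \<zero>\<^sub>N" .
  have "inj_on (phi N) (carrier N)"
   using sst N by (auto simp: strong_structure_iff bij_betw_def)
  from inj_onD[OF this eq right_linearD(2)[OF f m(1)] TN.M.zero_closed] have "f m = \<zero>\<^sub>N" .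
  also have "\<dots> = f \<zero>\<^sub>M"
   using additive_zero[OF TM.M.ab_M TN.M.ab_M right_linearD(1)[OF f]] by simp
  finally have "m = \<zero>\<^sub>M" using inj m(1) by (auto dest: inj_onD)
  then show ?thesis using m by (simp add: TM.pure_zero_left)
 qed
 have zero: "psi KM s = \<zero>\<^bsub>KM\<^esub>" if "s : TK.T" for s
  using that
 proof (induction rule: TK.induct)
  case (pure m a)
  then have "m = \<zero>\<^bsub>KM\<^esub>" using coK by (simp add: zK)
  then show ?case using pure by (simp add: psi_pure[OF K(1)] KM.zero_rsmult)
 qed (simp add: additive_add[OF psi_additive[OF K(1)]])
 have "inj_on ?f (carrier TM.T)"
 proof (rule additive_inj[OF TM.ab_T TN.ab_T tmap_additive[OF TM.ax TN.ax f]])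
  fix t assume "t : TM.T" "?f t = \<zero>\<^bsub>TN.T\<^esub>"
  then have "t : KM" by (simp add: carK)
  then obtain s where "s : TK.T" "t = psi KM s"
   using strong_structureD(1)[OF sst K(1) smallK] by (auto simp: bij_betw_def)
  then show "t = \<zero>\<^bsub>TM.T\<^esub>" using zero by (simp add: zK)
 qed
 then show "inj_on (tmap B M N AA f) (carrier (tensor_prod B M AA))" by simp
qed

lemma strong_structure_galois:
 assumes "strong_structure_theorem TYPE('u) A C x"
 shows "galois A C x"
 using strong_structureD(1)[OF assms comodule_C] small_C by (simp add: galois_iff_psi)

text \<open>The kernel K of \<Phi> satisfies K \<otimes> A = 0: flatness embeds K \<otimes> A into N
  \<otimes> A, where k \<otimes> a = (k \<otimes> 1)a vanishes. For the image, \<Psi> is a left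
  inverse of \<Phi> \<otimes> A, so its injectivity makes \<Phi> \<otimes> A onto, and the weak
  generator A carries this back to \<Phi>.\<close>

lemma phi_bij:
 assumes ff: "faithfully_flat TYPE('u) B AA" and N: "right_module B N" and small: "small TYPE('u) N"
  and psi: "inj_on (psi (ind N)) (carrier (coA (ind N)))"
 shows "bij_phi N"
proof -
 interpret N: right_module B N by fact
 interpret T: tensor B N AA by (rule tensor_B[OF N])
 have flat: "flat_left TYPE('u) B AA" and wg: "weak_generator TYPE('u) B AA"
  using ff by (auto simp: faithfully_flat_def)
 note indN = comodule_ind[OF N]
 have phil: "right_linear B N (coM (ind N)) (phi N)" by (rule unit_linear[OF N])
 have phil': "right_linear B N (tensor_prod B N AA) (phi N)"
  using right_linear_comp[OF phil co_inclusion[OF indN]] by (simp add: right_linear_def additive_map_def)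
 have r: "right_module B (tensor_prod B N AA)" by (rule right_module_B[OF right_NA[OF N]])
 define K where "K = N\<lparr>carrier := {n \<in> carrier N. phi N n = \<zero>\<^bsub>T.T\<^esub>}\<rparr>"
 have K: "right_module B K"
  using submodule_module[OF N right_submodule_kernel[OF N r phil']] by (simp add: K_def)
 interpret TK: tensor B K AA by (rule tensor_B[OF K])
 have smallK: "small TYPE('u) K" by (rule lepoll_subset[OF small]) (auto simp: K_def)
 have iK: "right_linear B K N (\<lambda>n. n)" by (rule right_linearI) (auto simp: K_def)
 let ?i = "tmap B K N AA (\<lambda>n. n)"
 have inj: "inj_on ?i (carrier TK.T)"
  by (rule flat_left_inj[OF flat K N left_B_AA smallK small iK]) simp
 have "carrier K = {\<zero>\<^sub>K}"
 proof (rule weak_generator_zero[OF wg K left_B_AA smallK])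
  fix k a assume k: "k : K" "a : AA"
  interpret NA: right_module A "tensor_prod B N AA" by (rule right_NA[OF N])
  have "?i (TK.pt k a) = T.pt k a"
   using k tmap_pure[OF TK.ax T.ax iK] by simp
  also have "\<dots> = phi N k \<star>\<^bsub>tensor_prod B N AA\<^esub> a" using k NA_mult[OF N, of k "\<one>\<^sub>A" a] by (simp add: K_def)
  also have "\<dots> = \<zero>\<^bsub>T.T\<^esub>" using k NA.zero_rsmult[of a] by (simp add: K_def)
  also have "\<dots> = ?i \<zero>\<^bsub>TK.T\<^esub>"
   using additive_zero[OF TK.ab_T T.ab_T tmap_additive[OF TK.ax T.ax iK]] by simp
  finally show "TK.pt k a = \<zero>\<^bsub>TK.T\<^esub>" using inj TK.pure_closed[OF k] by (auto dest: inj_onD)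
 qed
 then have K0: "n = \<zero>\<^sub>N" if "n : N" "phi N n = \<zero>\<^bsub>T.T\<^esub>" for n
  using that by (auto simp: K_def)
 have "inj_on (phi N) (carrier N)"
  by (rule additive_inj[OF N.ab_M _ right_linearD(1)[OF phil']]) (use T.ab_T K0 in simp_all)
 moreover have "phi N ` carrier N = carrier (coM (ind N))"
 proof (rule weak_generator_eq[OF wg right_co[OF indN] left_B_AA])
  show "small TYPE('u) (coM (ind N))"
   using coD(1)[of _ "ind N"] by (intro lepoll_subset[OF small_NA[OF N small]]) auto
  show I: "right_submodule (phi N ` carrier N) B (coM (ind N))"
   by (rule right_submodule_image[OF N right_co[OF indN] phil])
  let ?I = "(coM (ind N))\<lparr>carrier := phi N ` carrier N\<rparr>"
  have rI: "right_module B ?I" by (rule submodule_module[OF right_co[OF indN] I])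
  interpret TI: tensor B ?I AA by (rule tensor_B[OF rI])
  interpret TP: tensor B "coM (ind N)" AA by (rule tensor_B[OF right_co[OF indN]])
  have iI: "right_linear B ?I (coM (ind N)) (\<lambda>p. p)"
   using right_submoduleD(1)[OF I] by (intro right_linearI) auto
  have pI: "right_linear B N ?I (phi N)"
   using right_linearD[OF phil] by (intro right_linearI) auto
  let ?iI = "tmap B ?I (coM (ind N)) AA (\<lambda>p. p)"
  let ?pI = "tmap B N ?I AA (phi N)"
  note iI_add = tmap_additive[OF TI.ax TP.ax iI]
  note pI_add = tmap_additive[OF T.ax TI.ax pI]
  have psi_add: "additive_map TP.T T.T (psi (ind N))" using psi_additive[OF indN] by (simp add: additive_map_def)
  have eq: "psi (ind N) (?iI (?pI u)) = u" if "u : T.T" for u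
  proof (rule T.additive_eqI[OF additive_comp[OF additive_comp[OF pI_add iI_add] psi_add] _ _ that])
   fix n a assume na: "n : N" "a : AA"
   then show "psi (ind N) (?iI (?pI (T.pt n a))) = T.pt n a"
    using tmap_pure[OF T.ax TI.ax pI na]
     tmap_pure[OF TI.ax TP.ax iI, of "phi N n" a]
     psi_pure[OF indN unit_co[OF N], of n a] NA_mult[OF N, of n "\<one>\<^sub>A" a] by simp
  qed (simp add: additive_map_def)
  show "\<exists>s\<in>carrier TI.T. ?iI s = TP.pt p a" if p: "p : coM (ind N)" "a : AA" for p a
  proof (intro bexI)
   let ?u = "psi (ind N) (TP.pt p a)"
   have u: "?u : T.T" by (rule additive_closed[OF psi_add TP.pure_closed[OF p]])
   show s: "?pI ?u : TI.T" by (rule additive_closed[OF pI_add u])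
   show "?iI (?pI ?u) = TP.pt p a"
    by (rule inj_onD[OF psi eq[OF u] additive_closed[OF iI_add s] TP.pure_closed[OF p]])
  qed
 qed
 ultimately show ?thesis by (simp add: bij_betw_def)
qed

lemma galois_psi_bij:
 assumes flat: "flat_left TYPE('u) B AA" and gal: "galois A C x"
  and M: "comodule A C M" and small: "small TYPE('u) M"
 shows "bij_psi M"
proof -
 note m = comoduleD[OF M]
 have MB: "right_module B M" by (rule right_module_B[OF m(1)])
 interpret M: right_module A M by (rule m)
 interpret T3: tensor3 A A M C C by (rule tensor3_C[OF m(1)])
 let ?MC = "tensor_prod A M C"
 have MCA: "right_module A ?MC" by (rule right_module_MC[OF m(1)])
 interpret TK: tensor B "coM M" AA by (rule tensor_B[OF right_co[OF M]])
 interpret TB: tensor B M AA by (rule tensor_B[OF MB])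
 interpret TCB: tensor B ?MC AA by (rule tensor_B[OF right_module_B[OF MCA]])
 let ?i = "tmap B (coM M) M AA (\<lambda>m. m)"
 have smallco: "small TYPE('u) (coM M)"
  using coD(1)[of _ M] by (intro lepoll_subset[OF small]) auto
 have inj: "inj_on ?i (carrier TK.T)"
  by (rule flat_left_inj[OF flat right_co[OF M] MB left_B_AA smallco small co_inclusion[OF M]]) simp
 note i_add = tmap_additive[OF TK.ax TB.ax co_inclusion[OF M]]
 note i_pure = tmap_pure[OF TK.ax TB.ax co_inclusion[OF M]]
 have \<rho>_add: "additive_map M T3.MN.T (coaction M)" using right_linearD(1)[OF m(2)] by simp
 have \<rho>psi: "coaction M (psi M t) = can M (?i t)" if "t : TK.T" for t
  by (rule TK.additive_eqI[OF additive_comp[OF psi_additive[OF M] \<rho>_add]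
     additive_comp[OF i_add can_additive[OF m(1)]] _ that])
   (simp add: psi_pure[OF M] i_pure can_pure[OF m(1)] coaction_co_mult[OF M] coD)
 have can: "bij_betw (can M) (carrier TB.T) (carrier T3.MN.T)" by (rule can_bij[OF m(1) gal])
 have can2: "bij_betw (can ?MC) (carrier TCB.T) (carrier T3.MN_P.T)" by (rule can_bij[OF MCA gal])
 \<comment> \<open>The kernel of this map is the module of coinvariants. It is B-linear, and
   flatness over B will describe the kernel of \<delta> \<otimes> A.\<close>
 define \<delta> where "\<delta> m = coaction M m \<ominus>\<^bsub>T3.MN.T\<^esub> T3.MN.pt m x" for m
 have xl: "right_linear B M ?MC (\<lambda>m. T3.MN.pt m x)"
  using rsmult_pure[OF m(1) bimodule_C B_A _ x(1)] T3.MN.pure_balanced[OF _ B_A x(1)]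
  by (intro right_linearI) (simp_all add: T3.MN.pure_closed x T3.MN.pure_add_left B_x)
 have \<rho>l: "right_linear B M ?MC (coaction M)" by (rule right_linear_B[OF m(2)])
 have \<delta>l: "right_linear B M ?MC \<delta>"
 proof -
  have "additive_map M ?MC \<delta>" unfolding \<delta>_def
   using additive_diff[OF T3.MN.ab_T right_linearD(1)[OF \<rho>l, simplified] right_linearD(1)[OF xl, simplified]] by simp
  moreover have "\<delta> (m \<star>\<^sub>M b) = \<delta> m \<star>\<^bsub>?MC\<^esub> b" if "m : M" "b : B" for m b
   using that right_linearD(4)[OF \<rho>l that] right_linearD(4)[OF xl that] TCB.M.minus_rsmult[of "coaction M m" "T3.MN.pt m x" b]
   by (simp add: \<delta>_def m(5) T3.MN.pure_closed x)
  ultimately show ?thesis by (simp add: right_linear_def)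
 qed
 have coM: "coM M = (bimodule.truncate M)\<lparr>carrier := {m \<in> carrier M. \<delta> m = \<zero>\<^bsub>?MC\<^esub>}\<rparr>"
  using minus_zero_iff[OF T3.MN.ab_T m(5) T3.MN.pure_closed[OF _ x(1)]]
  by (simp add: coinvariant_module_def coinvariants_def \<delta>_def cong: conj_cong)
 let ?d = "tensor_map B M AA ?MC AA \<delta> (\<lambda>a. a)"
 let ?r = "tmap A M ?MC C (coaction M)"
 have r_add: "additive_map T3.MN.T T3.MN_P.T ?r"
  by (rule tmap_additive[OF T3.MN.ax T3.MN_P.ax m(2)])
 have d_add: "additive_map TB.T TCB.T ?d"
  by (rule tmap_additive[OF TB.ax TCB.ax \<delta>l])
 \<comment> \<open>\<open>can\<close> turns \<delta> \<otimes> A into the difference of the two maps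
   from M \<otimes> C to (M \<otimes> C) \<otimes> C that coassociativity equates on the image of
   the coaction.\<close>
 have key: "can ?MC (?d t) = ?r (can M t) \<ominus>\<^bsub>T3.MN_P.T\<^esub> split M (can M t)" if "t : TB.T" for t
 proof (rule TB.additive_eqI[OF additive_comp[OF d_add can_additive[OF MCA]]
    additive_diff[OF T3.MN_P.ab_T additive_comp[OF can_additive[OF m(1)] r_add]
     additive_comp[OF can_additive[OF m(1)] split_additive[OF m(1)]]] _ that])
  fix u a assume u: "u : M" "a : AA"
  have "can ?MC (?d (TB.pt u a)) = T3.MN_P.pt (\<delta> u) (x \<star>\<^sub>C a)"
   using u right_linearD(2)[OF \<delta>l u(1)] tmap_pure[OF TB.ax TCB.ax \<delta>l u]
   by (simp add: can_pure[OF MCA])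
  also have "\<dots> = T3.MN_P.pt (coaction M u) (x \<star>\<^sub>C a) \<ominus>\<^bsub>T3.MN_P.T\<^esub> T3.MN_P.pt (T3.MN.pt u x) (x \<star>\<^sub>C a)"
   using additive_minus[of ?MC T3.MN_P.T "\<lambda>s. T3.MN_P.pt s (x \<star>\<^sub>C a)" "coaction M u" "T3.MN.pt u x"]
    T3.MN_P.balanced_pure u T3.MN.ab_T T3.MN_P.ab_T
   by (simp add: balanced_def \<delta>_def m(5) T3.MN.pure_closed x)
  also have "T3.MN_P.pt (coaction M u) (x \<star>\<^sub>C a) = ?r (can M (TB.pt u a))"
   using u by (simp add: can_pure[OF m(1)] tmap_pure[OF T3.MN.ax T3.MN_P.ax m(2)])
  also have "T3.MN_P.pt (T3.MN.pt u x) (x \<star>\<^sub>C a) = split M (can M (TB.pt u a))"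
   using u by (simp add: can_pure[OF m(1)] split_pure[OF m(1)] comult_xa T3.assoc_inv_pure x)
  finally show "can ?MC (?d (TB.pt u a)) = ?r (can M (TB.pt u a)) \<ominus>\<^bsub>T3.MN_P.T\<^esub> split M (can M (TB.pt u a))" .
 qed
 have "inj_on (psi M) (carrier TK.T)"
 proof (rule inj_onI)
  fix s t assume st: "s : TK.T" "t : TK.T" "psi M s = psi M t"
  then have "can M (?i s) = can M (?i t)" using \<rho>psi by metis
  then have "?i s = ?i t" using can st additive_closed[OF i_add] by (auto simp: bij_betw_def dest: inj_onD)
  then show "s = t" using inj st by (auto dest: inj_onD)
 qed
 moreover have "psi M ` carrier TK.T = carrier M"
 proof
  show "psi M ` carrier TK.T \<subseteq> carrier M" using additive_closed[OF psi_additive[OF M]] by auto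
  show "carrier M \<subseteq> psi M ` carrier TK.T"
  proof
   fix u assume u: "u : M"
   obtain t where t: "t : TB.T" "can M t = coaction M u"
    using m(5)[OF u] unfolding bij_betw_imp_surj_on[OF can, symmetric] by (elim imageE) simp
   have "can ?MC (?d t) = \<zero>\<^bsub>T3.MN_P.T\<^esub>"
    using key[OF t(1)] m(3)[OF u] t(2) additive_closed[OF r_add m(5)[OF u]]
    by (simp add: T3.MN_P.T.minus_eq T3.MN_P.T.r_neg)
   also have "\<dots> = can ?MC \<zero>\<^bsub>TCB.T\<^esub>"
    using additive_zero[OF TCB.ab_T T3.MN_P.ab_T can_additive[OF MCA]] by simp
   finally have "?d t = \<zero>\<^bsub>TCB.T\<^esub>"
    using can2 additive_closed[OF d_add t(1)] by (auto simp: bij_betw_def dest: inj_onD)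
   then obtain s where s: "s : TK.T" "?i s = t"
    using flat_left_kernel[OF flat, of "bimodule.truncate M" ?MC \<delta> t] MB right_module_B[OF MCA] left_B_AA
     small_MC[OF m(1) small] \<delta>l t(1) unfolding coM by auto
   \<comment> \<open>It is enough to compare coactions, since the counit law makes the coaction
     injective.\<close>
   have "coaction M (psi M s) = coaction M u" using \<rho>psi[OF s(1)] s(2) t(2) by simp
   then have "psi M s = u"
    using m(4)[OF u] m(4)[OF additive_closed[OF psi_additive[OF M] s(1)]] by metis
   then show "u \<in> psi M ` carrier TK.T" using s(1) by blast
  qed
 qed
 ultimately show ?thesis by (simp add: bij_betw_def)
qed

lemma galois_imp_strong_structure:
 assumes ff: "faithfully_flat TYPE('u) B AA" and gal: "galois A C x"
 shows "strong_structure_theorem TYPE('u) A C x"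
 unfolding strong_structure_iff
proof (intro conjI allI impI)
 have UN: "X \<lesssim> (UNIV :: 'u set)" for X :: "'u set" by (rule subset_imp_lepoll) simp
 have flat: "flat_left TYPE('u) B AA" using ff by (simp add: faithfully_flat_def)
 show "bij_psi M" if "comodule A C M" for M :: "(unit, 'u, 'a, 'c) comodule"
  by (rule galois_psi_bij[OF flat gal that UN])
 show "bij_phi N" if N: "right_module B N" for N :: "(unit, 'u, 'a) bimodule"
  using galois_psi_bij[OF flat gal comodule_ind[OF N]] small_NA[OF N UN]
  by (intro phi_bij[OF ff N UN]) (simp add: bij_betw_def)
qed

theorem strong_structure_iff_galois:
 assumes "flat_left TYPE('u) A C"
 shows "strong_structure_theorem TYPE('u) A C x \<longleftrightarrow> faithfully_flat TYPE('u) B AA \<and> galois A C x"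
 using galois_imp_strong_structure strong_structure_galois strong_structure_flat[OF assms]
  strong_structure_weak_generator unfolding faithfully_flat_def by blast

end

section \<open>The left dual ring and locally projective corings\<close>

context coring_setting begin

abbreviation "S \<equiv> dual_ring A C"

lemma S_simps [simp]:
 "\<zero>\<^sub>S = (\<lambda>c\<in>carrier C. \<zero>\<^sub>A)" "\<one>\<^sub>S = restrict (counit C) (carrier C)"
 "f \<oplus>\<^sub>S g = (\<lambda>c\<in>carrier C. f c \<oplus>\<^sub>A g c)"
 by (simp_all add: dual_ring_def)

lemma S_iff: "f : S \<longleftrightarrow> f \<in> extensional (carrier C) \<and> left_linear A C (regular A) f"
 by (auto simp: dual_ring_def)

lemma S_linear: "f : S ==> left_linear A C (regular A) f"
 by (simp add: S_iff)

lemma S_closed: "[|f : S; c : C|] ==> f c : A"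
 using left_linearD(2)[OF S_linear] by simp

lemma left_linear_cong:
 assumes "left_linear A C (regular A) f" "!!c. c : C ==> f c = g c"
 shows "left_linear A C (regular A) g"
 using left_linearD[OF assms(1)]
 by (intro left_linearI) (simp_all add: C_left.lsmult_closed flip: assms(2))

lemma S_restrict: "left_linear A C (regular A) f ==> restrict f (carrier C) : S"
 using left_linear_cong[of f "restrict f (carrier C)"] by (simp add: S_iff)

lemma S_eqI: "[|f : S; g : S; !!c. c : C ==> f c = g c|] ==> f = g"
 unfolding S_iff by (rule extensionalityI) auto

lemma eval_S: "[|right_module A M; g : S|] ==> eval_setting A M C g"
 by (intro eval_settingI left_C S_linear)

lemma tensor_eval_cong:
 assumes "right_module A M" "left_linear A C (regular A) g"
  and "!!c. c : C ==> g c = g' c" "t : tensor_add A M C"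
 shows "tensor_eval M g t = tensor_eval M g' t"
proof -
 interpret g: eval_setting A M C g by (rule eval_settingI[OF assms(1) left_C assms(2)])
 interpret g': eval_setting A M C g' by (rule eval_settingI[OF assms(1) left_C left_linear_cong[OF assms(2,3)]])
 show ?thesis
  by (rule g.additive_eqI[OF g.eval_additive g'.eval_additive _ assms(4)])
   (simp add: g.eval_pure g'.eval_pure assms(3))
qed

text \<open>The right action of the dual ring on C. Products in the dual ring are composites with
  it: f \<cdot> g is g after the action of f.\<close>

definition dact :: "'c => ('c => 'a) => 'c" where
 "dact c f = tensor_eval C f (comult C c)"

lemma comult_closed: "c : C ==> comult C c : tensor_add A C C"
 using left_linearD(2)[OF comult_left_linear] by simp

lemma dact_closed: "[|f : S; c : C|] ==> dact c f : C"
 unfolding dact_def by (rule eval_setting.eval_closed[OF eval_S[OF right_C] comult_closed])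

lemma tensor_eval_lsmult:
 assumes "left_linear A C (regular A) f" "t : tensor_add A C C" "a : A"
 shows "tensor_eval C f (a \<odot>\<^bsub>tensor_prod A C C\<^esub> t) = a \<odot>\<^sub>C tensor_eval C f t"
proof -
 interpret f: eval_setting A C C f by (rule eval_settingI[OF right_C left_C assms(1)])
 interpret CC: left_module A "tensor_prod A C C" by (rule left_module_tensor_prod[OF bimodule_C left_C])
 show ?thesis
  by (rule f.additive_eqI[OF additive_comp[OF CC.additive_lsmult[OF assms(3), simplified] f.eval_additive]
     additive_comp[OF f.eval_additive C_left.additive_lsmult[OF assms(3)]] _ assms(2)])
   (use left_linearD(2)[OF assms(1)] assms(3) in \<open>simp add: lsmult_pure[OF bimodule_C left_C]
    f.eval_pure C_left.lsmult_closed bimoduleD(3)[OF bimodule_C]\<close>)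
qed

lemma dact_linear:
 assumes "f : S"
 shows "left_linear A C C (\<lambda>c. dact c f)"
proof -
 interpret f: eval_setting A C C f by (rule eval_S[OF right_C assms])
 show ?thesis
  using left_linearD[OF comult_left_linear] tensor_eval_lsmult[OF S_linear[OF assms] comult_closed]
  by (intro left_linearI) (simp_all add: dact_def f.eval_closed additive_add[OF f.eval_additive])
qed

lemma S_mult:
 assumes "f : S" "g : S"
 shows "f \<otimes>\<^sub>S g = (\<lambda>c\<in>carrier C. g (dact c f))" "f \<otimes>\<^sub>S g : S"
proof -
 interpret f: eval_setting A C C f by (rule eval_S[OF right_C assms(1)])
 note gl = left_linearD[OF S_linear[OF assms(2)], simplified]
 have fa: "additive_map f.T A (\<lambda>t. g (tensor_eval C f t))"
  using gl by (intro additive_comp[OF f.eval_additive]) (simp add: additive_map_def)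
 have bal: "balanced A C C A (\<lambda>d e. g (d \<star>\<^sub>C f e))"
  using f.eval_balanced gl by (simp add: balanced_def additive_map_def Pi_iff)
 have "tensor_lift A (\<lambda>d e. g (d \<star>\<^sub>C f e)) t = g (tensor_eval C f t)" if "t : f.T" for t
  by (rule f.additive_eqI[OF f.lift_additive[OF A.abelian_group_axioms bal] fa _ that])
   (simp add: f.lift_pure[OF A.abelian_group_axioms bal] f.eval_pure)
 then show eq: "f \<otimes>\<^sub>S g = (\<lambda>c\<in>carrier C. g (dact c f))"
  by (auto simp: dual_ring_def dact_def comult_closed)
 have "left_linear A C (regular A) (\<lambda>c. g (dact c f))"
  using left_linearD[OF dact_linear[OF assms(1)]] gl by (intro left_linearI) simp_all
 then show "f \<otimes>\<^sub>S g : S" unfolding eq by (rule S_restrict)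
qed

text \<open>Evaluating the last factor by f gives m \<otimes> c1 f(c2), and evaluating this by g
  gives m g(c1 f(c2)), which is m times the product of f and g at c. Through this lemma
  coassociativity becomes associativity of the action.\<close>

lemma eval_split:
 assumes M: "right_module A M" and f: "f : S" and g: "g : S"
  and t: "t : tensor_add A M C"
 shows "tensor_eval M g (tensor_eval (tensor_prod A M C) f (split M t)) = tensor_eval M (f \<otimes>\<^sub>S g) t"
proof -
 interpret T3: tensor3 A A M C C by (rule tensor3_C[OF M])
 interpret Mg: eval_setting A M C g by (rule eval_S[OF M g])
 interpret Mfg: eval_setting A M C "f \<otimes>\<^sub>S g" by (rule eval_S[OF M S_mult(2)[OF f g]])
 interpret MCf: eval_setting A "tensor_prod A M C" C f by (rule eval_S[OF right_module_MC[OF M] f])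
 interpret Cf: eval_setting A C C f by (rule eval_S[OF right_C f])
 have MCf_add: "additive_map T3.MN_P.T T3.MN.T (tensor_eval (tensor_prod A M C) f)" using MCf.eval_additive by simp
 note gl = left_linearD[OF S_linear[OF g], simplified]
 show ?thesis
 proof (rule T3.MN.additive_eqI[OF additive_comp[OF additive_comp[OF split_additive[OF M] MCf_add] Mg.eval_additive]
    Mfg.eval_additive _ t])
  fix m c assume m: "m : M" and c: "c : C"
  have 1: "additive_map T3.NP.T T3.M_NP.T (\<lambda>d. T3.M_NP.pt m d)"
   using T3.M_NP.balanced_pure m by (simp add: balanced_def)
  have 2: "additive_map T3.NP.T M (\<lambda>d. m \<star>\<^sub>M g (tensor_eval C f d))"
   using additive_comp[OF Cf.eval_additive, of A g] gl
   by (intro additive_comp[OF _ right_module.additive_rsmult_scalar[OF M m]]) (simp add: additive_map_def)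
  have "tensor_eval M g (tensor_eval (tensor_prod A M C) f (tensor_assoc_inv A A M C C (T3.M_NP.pt m d))) =
    m \<star>\<^sub>M g (tensor_eval C f d)" if "d : T3.NP.T" for d
   by (rule T3.NP.additive_eqI[OF additive_comp[OF additive_comp[OF additive_comp[OF 1 T3.assoc_inv_additive] MCf_add] Mg.eval_additive] 2 _ that])
    (use m S_closed[OF f] in \<open>simp add: T3.assoc_inv_pure MCf.eval_pure T3.MN.pure_closed
     rsmult_pure[OF M bimodule_C] Mg.eval_pure Cf.eval_pure C_right.rsmult_closed\<close>)
  from this[OF comult_closed[OF c]]
  show "tensor_eval M g (tensor_eval (tensor_prod A M C) f (split M (T3.MN.pt m c))) = tensor_eval M (f \<otimes>\<^sub>S g) (T3.MN.pt m c)"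
   using m c by (simp add: split_pure[OF M] Mfg.eval_pure) (simp add: S_mult(1)[OF f g] dact_def)
 qed
qed

lemma eval_coaction:
 assumes M: "comodule A C M" and g: "g : S" and t: "t : tensor_add A M C"
 shows "tensor_eval (tensor_prod A M C) g (tmap A M (tensor_prod A M C) C (coaction M) t) =
  coaction M (tensor_eval M g t)"
 by (rule tensor_eval_natural[OF comoduleD(1)[OF M] right_module_MC[OF comoduleD(1)[OF M]] left_C S_linear[OF g] comoduleD(2)[OF M] t])

lemma dual_module_simps [simp]:
 "carrier (dual_module M) = carrier M" "\<zero>\<^bsub>dual_module M\<^esub> = \<zero>\<^sub>M" "add (dual_module M) = add M"
 "m \<star>\<^bsub>dual_module M\<^esub> g = tensor_eval M g (coaction M m)"
 by (simp_all add: dual_module_def tensor_eval_def)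

lemma dual_act_assoc:
 assumes M: "comodule A C M" and f: "f : S" and g: "g : S" and m: "m : M"
 shows "tensor_eval M (f \<otimes>\<^sub>S g) (coaction M m) = tensor_eval M g (coaction M (tensor_eval M f (coaction M m)))"
 using eval_split[OF comoduleD(1)[OF M] f g comoduleD(5)[OF M m]] eval_coaction[OF M f comoduleD(5)[OF M m]]
  comoduleD(3)[OF M m] by simp

lemma counit_S: "\<one>\<^sub>S : S"
 using S_restrict[OF counit_linear] by simp

lemma dact_assoc:
 assumes "f : S" "g : S" "c : C"
 shows "dact c (f \<otimes>\<^sub>S g) = dact (dact c f) g"
 using dual_act_assoc[OF comodule_C assms(1,2), of c] assms(3) by (simp add: dact_def tensor_eval_def)

lemma dual_act_one:
 assumes "comodule A C M" "m : M"
 shows "tensor_eval M \<one>\<^sub>S (coaction M m) = m"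
 using tensor_eval_cong[OF comoduleD(1)[OF assms(1)] counit_linear, of "\<one>\<^sub>S" "coaction M m"]
  comoduleD(4,5)[OF assms] by simp

lemma dact_one: "c : C ==> dact c \<one>\<^sub>S = c"
 using dual_act_one[OF comodule_C, of c] by (simp add: dact_def tensor_eval_def)

lemma tensor_eval_add_left:
 assumes "right_module A M" "f : S" "g : S" "t : tensor_add A M C"
 shows "tensor_eval M (f \<oplus>\<^sub>S g) t = tensor_eval M f t \<oplus>\<^sub>M tensor_eval M g t"
proof -
 interpret f: eval_setting A M C f by (rule eval_S[OF assms(1,2)])
 interpret g: eval_setting A M C g by (rule eval_S[OF assms(1,3)])
 have "left_linear A C (regular A) (\<lambda>c. f c \<oplus>\<^sub>A g c)"
  using left_linearD[OF S_linear[OF assms(2)], simplified] left_linearD[OF S_linear[OF assms(3)], simplified]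
  by (intro left_linearI) (simp_all add: A.a_ac A.r_distr)
 from S_restrict[OF this] interpret fg: eval_setting A M C "f \<oplus>\<^sub>S g"
  by (intro eval_S[OF assms(1)]) simp
 show ?thesis
  by (rule f.additive_eqI[OF fg.eval_additive additive_sum[OF f.M.ab_M f.eval_additive g.eval_additive] _ assms(4)])
   (simp add: f.eval_pure g.eval_pure fg.eval_pure del: S_simps, simp add: f.M.rsmult_r_distr S_closed assms)
qed

lemma S_add: "[|f : S; g : S|] ==> f \<oplus>\<^sub>S g : S"
proof -
 assume fg: "f : S" "g : S"
 have "left_linear A C (regular A) (\<lambda>c. f c \<oplus>\<^sub>A g c)"
  using left_linearD[OF S_linear[OF fg(1)], simplified] left_linearD[OF S_linear[OF fg(2)], simplified]
  by (intro left_linearI) (simp_all add: A.a_ac A.r_distr)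
 from S_restrict[OF this] show ?thesis by simp
qed

lemma S_zero: "\<zero>\<^sub>S : S"
proof -
 have "left_linear A C (regular A) (\<lambda>c. \<zero>\<^sub>A)" by (rule left_linearI) auto
 from S_restrict[OF this] show ?thesis by simp
qed

lemma abelian_group_S: "abelian_group S"
proof (rule abelian_groupI)
 fix f g h assume f: "f : S" and g: "g : S" and h: "h : S"
 show "f \<oplus>\<^sub>S g : S" by (rule S_add[OF f g])
 show "f \<oplus>\<^sub>S g \<oplus>\<^sub>S h = f \<oplus>\<^sub>S (g \<oplus>\<^sub>S h)" "f \<oplus>\<^sub>S g = g \<oplus>\<^sub>S f"
  using f g h by (auto simp: S_closed A.a_ac)
next
 fix f assume f: "f : S"
 show "\<zero>\<^sub>S \<oplus>\<^sub>S f = f"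
  by (rule S_eqI[OF S_add[OF S_zero f] f]) (simp add: S_closed f)
 have "left_linear A C (regular A) (\<lambda>c. \<ominus>\<^sub>A f c)"
  using left_linearD[OF S_linear[OF f], simplified]
  by (intro left_linearI) (simp_all add: A.minus_add A.r_minus)
 from S_restrict[OF this] show "\<exists>g\<in>carrier S. g \<oplus>\<^sub>S f = \<zero>\<^sub>S"
  by (rule bexI[rotated]) (use S_closed[OF f] in \<open>auto simp: A.l_neg\<close>)
qed (rule S_zero)

text \<open>Associativity and the left unit are the module laws of C over its dual. The right unit
  is the left counit law: \<epsilon>(c1 f(c2)) = f(\<epsilon>(c1) c2) = f(c).\<close>

lemma ring_S: "ring S"
proof (rule ringI[OF abelian_group_S])
 show "Group.monoid S"
 proof (rule monoidI)
  show "f \<otimes>\<^sub>S g : S" if "f : S" "g : S" for f g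
   by (rule S_mult(2)[OF that])
  show "\<one>\<^sub>S : S" by (rule counit_S)
  show "f \<otimes>\<^sub>S g \<otimes>\<^sub>S h = f \<otimes>\<^sub>S (g \<otimes>\<^sub>S h)" if "f : S" "g : S" "h : S" for f g h
  proof (rule S_eqI)
   fix c assume c: "c : C"
   then show "(f \<otimes>\<^sub>S g \<otimes>\<^sub>S h) c = (f \<otimes>\<^sub>S (g \<otimes>\<^sub>S h)) c"
    unfolding S_mult(1)[OF S_mult(2)[OF that(1,2)] that(3)] S_mult(1)[OF that(1) S_mult(2)[OF that(2,3)]]
    using that by (simp add: S_mult(1)[OF that(2,3)] dact_assoc[OF that(1,2) c] dact_closed)
  qed (intro S_mult that)+
  show "\<one>\<^sub>S \<otimes>\<^sub>S f = f" if "f : S" for f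
   by (rule S_eqI[OF S_mult(2)[OF counit_S that] that])
    (simp add: S_mult(1)[OF counit_S that] dact_one del: S_simps)
  show "f \<otimes>\<^sub>S \<one>\<^sub>S = f" if f: "f : S" for f
  proof (rule S_eqI[OF S_mult(2)[OF f counit_S] f])
   fix c assume c: "c : C"
   interpret f: eval_setting A C C f by (rule eval_S[OF right_C f])
   note fl = left_linearD[OF S_linear[OF f], simplified] and \<epsilon> = left_linearD[OF counit_linear, simplified]
    and \<epsilon>r = right_linearD[OF counit_right_linear, simplified]
   have bal: "balanced A C C C (\<lambda>d e. counit C d \<odot>\<^sub>C e)"
    by (intro balancedI) (auto simp: \<epsilon> \<epsilon>r C_left.lsmult_closed C_left.lsmult_l_distr C_left.lsmult_r_distr C_left.lsmult_assoc)
   have 1: "additive_map f.T A (\<lambda>t. counit C (tensor_eval C f t))"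
    using \<epsilon> by (intro additive_comp[OF f.eval_additive]) (simp add: additive_map_def)
   have 2: "additive_map f.T A (\<lambda>t. f (tensor_lift C (\<lambda>d e. counit C d \<odot>\<^sub>C e) t))"
    using fl by (intro additive_comp[OF f.lift_additive[OF C_left.ab_M bal]]) (simp add: additive_map_def)
   have "counit C (tensor_eval C f t) = f (tensor_lift C (\<lambda>d e. counit C d \<odot>\<^sub>C e) t)" if "t : f.T" for t
    by (rule f.additive_eqI[OF 1 2 _ that])
     (simp add: f.eval_pure f.lift_pure[OF C_left.ab_M bal] \<epsilon> \<epsilon>r fl)
   from this[OF comult_closed[OF c]] show "(f \<otimes>\<^sub>S \<one>\<^sub>S) c = f c"
    unfolding S_mult(1)[OF f counit_S] using c dact_closed[OF f c] coring.counit_left[OF coring c]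
    by (simp add: dact_def)
  qed
 qed
next
 fix f g h assume s: "f : S" "g : S" "h : S"
 show "(f \<oplus>\<^sub>S g) \<otimes>\<^sub>S h = f \<otimes>\<^sub>S h \<oplus>\<^sub>S g \<otimes>\<^sub>S h"
 proof (rule S_eqI)
  fix c assume c: "c : C"
  have "dact c (f \<oplus>\<^sub>S g) = dact c f \<oplus>\<^sub>C dact c g"
   unfolding dact_def by (rule tensor_eval_add_left[OF right_C s(1,2) comult_closed[OF c]])
  then show "((f \<oplus>\<^sub>S g) \<otimes>\<^sub>S h) c = (f \<otimes>\<^sub>S h \<oplus>\<^sub>S g \<otimes>\<^sub>S h) c"
   unfolding S_mult(1)[OF S_add[OF s(1,2)] s(3)] S_mult(1)[OF s(1,3)] S_mult(1)[OF s(2,3)]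
   using c left_linearD(3)[OF S_linear[OF s(3)], of "dact c f" "dact c g"] s dact_closed by simp
 qed (intro S_mult S_add s)+
 show "h \<otimes>\<^sub>S (f \<oplus>\<^sub>S g) = h \<otimes>\<^sub>S f \<oplus>\<^sub>S h \<otimes>\<^sub>S g"
 proof (rule S_eqI)
  fix c assume c: "c : C"
  show "(h \<otimes>\<^sub>S (f \<oplus>\<^sub>S g)) c = (h \<otimes>\<^sub>S f \<oplus>\<^sub>S h \<otimes>\<^sub>S g) c"
   unfolding S_mult(1)[OF s(3) S_add[OF s(1,2)]] S_mult(1)[OF s(3,1)] S_mult(1)[OF s(3,2)]
   using c dact_closed[OF s(3) c] by simp
 qed (intro S_mult S_add s)+
qed

lemma right_S_dual:
 assumes M: "comodule A C M"
 shows "right_module S (dual_module M)"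
proof -
 note m = comoduleD[OF M]
 interpret M: right_module A M by (rule m)
 have ab: "abelian_group (dual_module M)" by (rule abelian_group_cong[OF M.ab_M]) simp_all
 note ev = eval_S[OF m(1)]
 show ?thesis
 proof (rule right_moduleI[OF ring_S ab])
  fix u f assume "u : dual_module M" "f : S"
  then show "u \<star>\<^bsub>dual_module M\<^esub> f : dual_module M" using eval_setting.eval_closed[OF ev] m(5) by simp
 next
  fix u v f assume "u : dual_module M" "v : dual_module M" "f : S"
  then show "(u \<oplus>\<^bsub>dual_module M\<^esub> v) \<star>\<^bsub>dual_module M\<^esub> f = u \<star>\<^bsub>dual_module M\<^esub> f \<oplus>\<^bsub>dual_module M\<^esub> v \<star>\<^bsub>dual_module M\<^esub> f"
   using additive_add[OF eval_setting.eval_additive[OF ev] m(5) m(5)] right_linearD(3)[OF m(2)] by simp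
 next
  fix u f g assume *: "u : dual_module M" "f : S" "g : S"
  then show "u \<star>\<^bsub>dual_module M\<^esub> (f \<oplus>\<^sub>S g) = u \<star>\<^bsub>dual_module M\<^esub> f \<oplus>\<^bsub>dual_module M\<^esub> u \<star>\<^bsub>dual_module M\<^esub> g"
   using tensor_eval_add_left[OF m(1) *(2,3) m(5)] by (simp del: S_simps)
  show "u \<star>\<^bsub>dual_module M\<^esub> (f \<otimes>\<^sub>S g) = u \<star>\<^bsub>dual_module M\<^esub> f \<star>\<^bsub>dual_module M\<^esub> g"
   using dual_act_assoc[OF M *(2,3)] * by simp
 next
  fix u assume "u : dual_module M"
  then show "u \<star>\<^bsub>dual_module M\<^esub> \<one>\<^sub>S = u" using dual_act_one[OF M] by (simp del: S_simps)
 qed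
qed

text \<open>The ring homomorphism \<open>A \<rightarrow> \<^sup>*C\<close>.\<close>

definition scal :: "'a => 'c => 'a" where
 "scal a = (\<lambda>c\<in>carrier C. counit C c \<otimes>\<^sub>A a)"

lemma scal_S: "a : A ==> scal a : S"
 unfolding scal_def using left_linearD[OF counit_linear, simplified]
 by (intro S_restrict left_linearI) (simp_all add: A.l_distr A.m_assoc)

lemma counit_closed: "c : C ==> counit C c : A"
 using left_linearD(2)[OF counit_linear] by simp

lemma eval_scal:
 assumes "right_module A M" "a : A" "t : tensor_add A M C"
 shows "tensor_eval M (scal a) t = tensor_eval M (counit C) t \<star>\<^sub>M a"
proof -
 interpret s: eval_setting A M C "scal a" by (rule eval_S[OF assms(1) scal_S[OF assms(2)]])
 interpret e: eval_setting A M C "counit C" by (rule eval_settingI[OF assms(1) left_C counit_linear])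
 show ?thesis
  by (rule s.additive_eqI[OF s.eval_additive additive_comp[OF e.eval_additive s.M.additive_rsmult[OF assms(2)]] _ assms(3)])
   (simp add: s.eval_pure e.eval_pure, simp add: scal_def s.M.rsmult_assoc counit_closed assms(2))
qed

lemma dual_act_scal: "[|comodule A C M; m : M; a : A|] ==> tensor_eval M (scal a) (coaction M m) = m \<star>\<^sub>M a"
 by (simp add: eval_scal[OF comoduleD(1)] comoduleD(4,5))

lemma dact_scal: "[|c : C; a : A|] ==> dact c (scal a) = c \<star>\<^sub>C a"
 using dual_act_scal[OF comodule_C, of c a] by (simp add: dact_def tensor_eval_def)

lemma scal_mult: "[|a : A; g : S; c : C|] ==> (scal a \<otimes>\<^sub>S g) c = g (c \<star>\<^sub>C a)"
 by (simp add: S_mult[OF scal_S] dact_scal)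

lemma mult_scal: "[|a : A; g : S; c : C|] ==> (g \<otimes>\<^sub>S scal a) c = g c \<otimes>\<^sub>A a"
proof -
 assume *: "a : A" "g : S" "c : C"
 interpret S: ring S by (rule ring_S)
 have "(g \<otimes>\<^sub>S \<one>\<^sub>S) c = g c" using S.r_one[OF *(2)] by simp
 then have "counit C (dact c g) = g c"
  unfolding S_mult(1)[OF *(2) counit_S] using * dact_closed[OF *(2,3)] by simp
 then show ?thesis using * dact_closed[OF *(2,3)] by (simp add: S_mult(1)[OF _ scal_S]) (simp add: scal_def)
qed

lemma scal_hom:
 assumes "a : A" "b : A"
 shows "scal (a \<otimes>\<^sub>A b) = scal a \<otimes>\<^sub>S scal b" "scal (a \<oplus>\<^sub>A b) = scal a \<oplus>\<^sub>S scal b"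
proof -
 show "scal (a \<otimes>\<^sub>A b) = scal a \<otimes>\<^sub>S scal b"
  using assms by (intro S_eqI S_mult scal_S) (simp_all add: mult_scal scal_S, simp_all add: scal_def A.m_assoc counit_closed)
qed (use assms in \<open>auto simp: scal_def counit_closed A.r_distr\<close>)

lemma scal_one: "scal \<one>\<^sub>A = \<one>\<^sub>S"
 by (auto simp: scal_def counit_closed)

text \<open>Restriction of scalars along \<open>scal\<close>.\<close>

definition as_A :: "('l, 'm, 'c => 'a, 'y) bimodule_scheme => (unit, 'm, 'a) bimodule" where
 "as_A X = \<lparr>carrier = carrier X, monoid.mult = undefined, one = undefined, ring.zero = \<zero>\<^sub>X, add = add X,
   smult = undefined, rsmult = (\<lambda>m a. m \<star>\<^sub>X scal a)\<rparr>"

lemma as_A_simps [simp]: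
 "carrier (as_A X) = carrier X" "\<zero>\<^bsub>as_A X\<^esub> = \<zero>\<^sub>X" "add (as_A X) = add X" "m \<star>\<^bsub>as_A X\<^esub> a = m \<star>\<^sub>X scal a"
 by (simp_all add: as_A_def)

lemma right_as_A:
 assumes "right_module S X"
 shows "right_module A (as_A X)"
proof -
 interpret X: right_module S X by fact
 have ab: "abelian_group (as_A X)" by (rule abelian_group_cong[OF X.ab_M]) simp_all
 show ?thesis
  by (rule right_moduleI[OF ring_A ab])
   (simp_all add: scal_S scal_hom scal_one X.rsmult_closed X.rsmult_l_distr X.rsmult_r_distr X.rsmult_assoc X.rsmult_one del: S_simps)
qed

lemma eval_rsmult:
 assumes "right_module A M" "a : A" "h : S" "t : tensor_add A M C"
 shows "tensor_eval M h (t \<star>\<^bsub>tensor_prod A M C\<^esub> a) = tensor_eval M (scal a \<otimes>\<^sub>S h) t"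
proof -
 interpret h: eval_setting A M C h by (rule eval_S[OF assms(1,3)])
 interpret ah: eval_setting A M C "scal a \<otimes>\<^sub>S h" by (rule eval_S[OF assms(1) S_mult(2)[OF scal_S[OF assms(2)] assms(3)]])
 interpret P: right_module A "tensor_prod A M C" by (rule right_module_MC[OF assms(1)])
 show ?thesis
  by (rule h.additive_eqI[OF additive_comp[OF P.additive_rsmult[OF assms(2), simplified] h.eval_additive] ah.eval_additive _ assms(4)])
   (simp add: rsmult_pure[OF assms(1) bimodule_C assms(2)] h.eval_pure ah.eval_pure C_right.rsmult_closed scal_mult assms(2,3))
qed

text \<open>Expansion of c along pairs (g_i, w_i). A dual basis on a finite set E is a list for
  which it fixes every element of E.\<close>

primrec psum :: "(('c => 'a) \<times> 'c) list => 'c => 'c" where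
 "psum [] c = \<zero>\<^sub>C"
| "psum (gw # l) c = fst gw c \<odot>\<^sub>C snd gw \<oplus>\<^sub>C psum l c"

lemma psum_closed:
 assumes "set l \<subseteq> carrier S \<times> carrier C" "c : C"
 shows "psum l c : C"
 using assms by (induction l) (auto simp: S_closed C_left.lsmult_closed)

end

section \<open>Direct sums\<close>

lemma direct_sum_simps [simp]:
 "carrier (direct_sum I W) = {v \<in> I \<rightarrow>\<^sub>E carrier W. finite {i \<in> I. v i \<noteq> \<zero>\<^sub>W}}"
 "\<zero>\<^bsub>direct_sum I W\<^esub> = (\<lambda>i\<in>I. \<zero>\<^sub>W)"
 "v \<oplus>\<^bsub>direct_sum I W\<^esub> w = (\<lambda>i\<in>I. v i \<oplus>\<^sub>W w i)"
 "v \<star>\<^bsub>direct_sum I W\<^esub> a = (\<lambda>i\<in>I. v i \<star>\<^sub>W a)"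
 by (simp_all add: direct_sum_def)

lemma direct_sum_memI:
 assumes "!!i. i \<in> I ==> f i : W" "finite F" "!!i. [|i \<in> I; i \<notin> F|] ==> f i = \<zero>\<^sub>W"
 shows "(\<lambda>i\<in>I. f i) : direct_sum I W"
proof -
 have "finite {i \<in> I. f i \<noteq> \<zero>\<^sub>W}" by (rule finite_subset[OF _ assms(2)]) (use assms(3) in auto)
 then show ?thesis using assms(1) by (simp cong: conj_cong)
qed

lemma direct_sumD:
 assumes "v : direct_sum I W"
 shows "v \<in> extensional I" "i \<in> I ==> v i : W" "finite {i \<in> I. v i \<noteq> \<zero>\<^sub>W}"
 using assms by (auto simp: PiE_iff)

lemma right_module_direct_sum:
 assumes "right_module T W"
 shows "right_module T (direct_sum I W)"
proof -
 interpret W: right_module T W by fact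
 let ?D = "direct_sum I W"
 note c = direct_sumD[of _ I W] and ext = extensionalityI[of _ I]
 have "abelian_group ?D"
 proof (rule abelian_groupI)
  fix u v w assume u: "u : ?D" and v: "v : ?D" and w: "w : ?D"
  show "u \<oplus>\<^bsub>?D\<^esub> v : ?D" unfolding direct_sum_simps(3)
   by (rule direct_sum_memI[OF _ finite_UnI[OF c(3)[OF u] c(3)[OF v]]]) (use c(2)[OF u] c(2)[OF v] in auto)
  show "u \<oplus>\<^bsub>?D\<^esub> v \<oplus>\<^bsub>?D\<^esub> w = u \<oplus>\<^bsub>?D\<^esub> (v \<oplus>\<^bsub>?D\<^esub> w)" "u \<oplus>\<^bsub>?D\<^esub> v = v \<oplus>\<^bsub>?D\<^esub> u" "\<zero>\<^bsub>?D\<^esub> \<oplus>\<^bsub>?D\<^esub> u = u"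
   by (rule ext; simp add: c(1,2)[OF u] c(2)[OF v] c(2)[OF w] W.M.a_ac)+
  have "(\<lambda>i\<in>I. \<ominus>\<^sub>W u i) : ?D" by (rule direct_sum_memI[OF _ c(3)[OF u]]) (use c(2)[OF u] in auto)
  moreover have "(\<lambda>i\<in>I. \<ominus>\<^sub>W u i) \<oplus>\<^bsub>?D\<^esub> u = \<zero>\<^bsub>?D\<^esub>" by (rule ext) (simp_all add: c(2)[OF u] W.M.l_neg)
  ultimately show "\<exists>v\<in>carrier ?D. v \<oplus>\<^bsub>?D\<^esub> u = \<zero>\<^bsub>?D\<^esub>" by blast
 qed simp
 then show ?thesis
 proof (rule right_moduleI[OF W.R.ring_axioms])
  fix u a b assume u: "u : ?D" and a: "a : T"
  show "u \<star>\<^bsub>?D\<^esub> a : ?D" unfolding direct_sum_simps(4)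
   by (rule direct_sum_memI[OF _ c(3)[OF u]]) (use c(2)[OF u] a in \<open>auto simp: W.zero_rsmult W.rsmult_closed\<close>)
  show "(u \<oplus>\<^bsub>?D\<^esub> v) \<star>\<^bsub>?D\<^esub> a = u \<star>\<^bsub>?D\<^esub> a \<oplus>\<^bsub>?D\<^esub> v \<star>\<^bsub>?D\<^esub> a" if "v : ?D" for v
   by (rule ext) (simp_all add: c(2)[OF u] c(2)[OF that] a W.rsmult_l_distr)
  assume b: "b : T"
  show "u \<star>\<^bsub>?D\<^esub> (a \<oplus>\<^sub>T b) = u \<star>\<^bsub>?D\<^esub> a \<oplus>\<^bsub>?D\<^esub> u \<star>\<^bsub>?D\<^esub> b" "u \<star>\<^bsub>?D\<^esub> (a \<otimes>\<^sub>T b) = u \<star>\<^bsub>?D\<^esub> a \<star>\<^bsub>?D\<^esub> b"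
   by (rule ext; simp add: c(2)[OF u] a b W.rsmult_r_distr W.rsmult_assoc)+
 next
  fix u assume u: "u : ?D"
  show "u \<star>\<^bsub>?D\<^esub> \<one>\<^sub>T = u" by (rule ext) (simp_all add: c(1,2)[OF u] W.rsmult_one)
 qed
qed

text \<open>The map is a sum over the support. Allowing any finite index set J that contains the
  support makes additivity a termwise matter and lets \<open>dual_basis\<close> use one index set
  for several elements.\<close>

lemma direct_sum_eval:
 assumes W: "right_module T W" and M: "right_module T M" and \<phi>: "!!i. i \<in> I ==> right_linear T W M (\<phi> i)"
 obtains p where "right_linear T (direct_sum I W) M p"
  "!!v J. [|v : direct_sum I W; finite J; {i \<in> I. v i \<noteq> \<zero>\<^sub>W} \<subseteq> J; J \<subseteq> I|] ==> p v = (\<Oplus>\<^bsub>M\<^esub>i\<in>J. \<phi> i (v i))"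
  "!!i w. [|i \<in> I; w : W|] ==> p (\<lambda>j\<in>I. if j = i then w else \<zero>\<^sub>W) = \<phi> i w"
proof -
 interpret W: right_module T W by fact
 interpret M: right_module T M by fact
 let ?D = "direct_sum I W" and ?s = "\<lambda>v. {i \<in> I. v i \<noteq> \<zero>\<^sub>W}"
 interpret D: right_module T ?D by (rule right_module_direct_sum[OF W])
 define p where "p v = (\<Oplus>\<^bsub>M\<^esub>i\<in>?s v. \<phi> i (v i))" for v
 have \<phi>v: "\<phi> i (v i) : M" if "v : ?D" "i \<in> I" for v i
  by (rule right_linearD(2)[OF \<phi>[OF that(2)] direct_sumD(2)[OF that]])
 have psup: "p v = (\<Oplus>\<^bsub>M\<^esub>i\<in>J. \<phi> i (v i))" if "v : ?D" "finite J" "?s v \<subseteq> J" "J \<subseteq> I" for v J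
  unfolding p_def
 proof (rule M.M.add.finprod_mono_neutral_cong_left[OF that(2,3)])
  show "\<phi> i (v i) = \<zero>\<^sub>M" if "i \<in> J - ?s v" for i
   using that \<open>J \<subseteq> I\<close> additive_zero[OF W.ab_M M.ab_M right_linearD(1)[OF \<phi>]] by auto
  show "(\<lambda>i. \<phi> i (v i)) \<in> J \<rightarrow> carrier M" using \<phi>v[OF that(1)] that(4) by blast
 qed simp
 have lin: "right_linear T ?D M p"
 proof (rule right_linearI)
  fix u v a assume u: "u : ?D"
  note su = direct_sumD(3)[OF u]
  show "p u : M" unfolding p_def using \<phi>v[OF u] by (intro M.M.finsum_closed) auto
  show "p (u \<oplus>\<^bsub>?D\<^esub> v) = p u \<oplus>\<^sub>M p v" if v: "v : ?D"
  proof -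
   let ?J = "?s u \<union> ?s v"
   have J: "finite ?J" "?J \<subseteq> I" "?s (u \<oplus>\<^bsub>?D\<^esub> v) \<subseteq> ?J" using su direct_sumD(3)[OF v] by auto
   have "p (u \<oplus>\<^bsub>?D\<^esub> v) = (\<Oplus>\<^bsub>M\<^esub>i\<in>?J. \<phi> i (u i) \<oplus>\<^sub>M \<phi> i (v i))"
    unfolding psup[OF D.M.a_closed[OF u v] J(1,3,2)]
    using right_linearD(3)[OF \<phi>] direct_sumD(2)[OF u] direct_sumD(2)[OF v] \<phi>v[OF u] \<phi>v[OF v]
    by (intro M.M.finsum_cong') auto
   also have "\<dots> = (\<Oplus>\<^bsub>M\<^esub>i\<in>?J. \<phi> i (u i)) \<oplus>\<^sub>M (\<Oplus>\<^bsub>M\<^esub>i\<in>?J. \<phi> i (v i))"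
    using \<phi>v[OF u] \<phi>v[OF v] by (intro M.M.finsum_addf) auto
   finally show ?thesis using psup[OF u J(1) _ J(2)] psup[OF v J(1) _ J(2)] by simp
  qed
  show "p (u \<star>\<^bsub>?D\<^esub> a) = p u \<star>\<^sub>M a" if a: "a : T"
  proof -
   have J: "?s (u \<star>\<^bsub>?D\<^esub> a) \<subseteq> ?s u" "?s u \<subseteq> I" using a by (auto simp: W.zero_rsmult)
   have "p (u \<star>\<^bsub>?D\<^esub> a) = (\<Oplus>\<^bsub>M\<^esub>i\<in>?s u. \<phi> i (u i) \<star>\<^sub>M a)"
    unfolding psup[OF D.rsmult_closed[OF u a] su J]
    using right_linearD(4)[OF \<phi> _ a] direct_sumD(2)[OF u] \<phi>v[OF u] a
    by (intro M.M.finsum_cong') (auto simp: M.rsmult_closed)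
   moreover have "(\<Oplus>\<^bsub>M\<^esub>i\<in>J. \<phi> i (u i) \<star>\<^sub>M a) = (\<Oplus>\<^bsub>M\<^esub>i\<in>J. \<phi> i (u i)) \<star>\<^sub>M a" if "finite J" "J \<subseteq> I" for J
    using that
   proof (induction J rule: finite_induct)
    case (insert i J)
    then have "!!j. j \<in> insert i J ==> \<phi> j (u j) : M" using \<phi>v[OF u] by blast
    then show ?case using insert a by (simp add: Pi_iff M.rsmult_closed M.rsmult_l_distr M.M.finsum_closed)
   qed (simp add: M.zero_rsmult a)
   ultimately show ?thesis using su J(2) by (simp add: p_def)
  qed
 qed
 have single: "p (\<lambda>j\<in>I. if j = i then w else \<zero>\<^sub>W) = \<phi> i w" if i: "i \<in> I" and w: "w : W" for i w
 proof -
  let ?v = "\<lambda>j\<in>I. if j = i then w else \<zero>\<^sub>W"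
  have "?v : ?D" by (rule direct_sum_memI[of _ _ _ "{i}"]) (use w in auto)
  then have "p ?v = (\<Oplus>\<^bsub>M\<^esub>j\<in>{i}. \<phi> j (?v j))" by (rule psup) (use i in auto)
  then show ?thesis using i right_linearD(2)[OF \<phi>[OF i] w] by simp
 qed
 show ?thesis by (rule that[OF lin psup single])
qed

text \<open>The free module on the set of elements of M, each m being the image of its basis vector.
  It is used over the opposite ring of A for dual bases and over B for the injectivity of
  \<Phi>.\<close>

lemma obtain_free_cover:
 assumes M: "right_module R M"
 obtains p where "right_linear R (direct_sum (carrier M) (regular R)) M p"
  "p ` carrier (direct_sum (carrier M) (regular R)) = carrier M"
  "!!v J. [|v : direct_sum (carrier M) (regular R); finite J; {m \<in> carrier M. v m \<noteq> \<zero>\<^sub>R} \<subseteq> J; J \<subseteq> carrier M|] ==>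
   p v = (\<Oplus>\<^bsub>M\<^esub>m\<in>J. m \<star>\<^sub>M v m)"
proof -
 interpret M: right_module R M by fact
 let ?D = "direct_sum (carrier M) (regular R)" and ?s = "\<lambda>m. \<lambda>n\<in>carrier M. if n = m then \<one>\<^sub>R else \<zero>\<^sub>R"
 have R: "right_module R (regular R)" by (rule bimoduleD(2)[OF bimodule_regular[OF M.R.ring_axioms]])
 have lin: "right_linear R (regular R) M (\<lambda>a. m \<star>\<^sub>M a)" if "m : M" for m
  using that by (intro right_linearI) (simp_all add: M.rsmult_closed M.rsmult_r_distr M.rsmult_assoc)
 show ?thesis
 proof (rule direct_sum_eval[OF R M, of "carrier M" "\<lambda>m a. m \<star>\<^sub>M a", OF lin, unfolded regular_simps(1,2)], assumption)
  fix p assume p: "right_linear R ?D M p"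
   "!!m a. [|m : M; a : R|] ==> p (\<lambda>n\<in>carrier M. if n = m then a else \<zero>\<^sub>R) = m \<star>\<^sub>M a"
  assume sup: "!!v J. [|v : ?D; finite J; {m \<in> carrier M. v m \<noteq> \<zero>\<^sub>R} \<subseteq> J; J \<subseteq> carrier M|] ==>
   p v = (\<Oplus>\<^bsub>M\<^esub>m\<in>J. m \<star>\<^sub>M v m)"
  have "m \<in> p ` carrier ?D" if m: "m : M" for m
  proof (rule image_eqI)
   show "m = p (?s m)" using p(2)[OF m M.R.one_closed] m by (simp add: M.rsmult_one)
   show "?s m : ?D" by (rule direct_sum_memI[of _ _ _ "{m}"]) auto
  qed
  then have "p ` carrier ?D = carrier M" using right_linearD(2)[OF p(1)] by blast
  then show thesis by (rule that[OF p(1) _ sup])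
 qed
qed

text \<open>Left modules are right modules over the opposite ring; only local projectivity needs this passage.\<close>

definition op_ring :: "('r, 'z) ring_scheme => 'r ring" where
 "op_ring R = \<lparr>carrier = carrier R, monoid.mult = (\<lambda>a b. b \<otimes>\<^sub>R a), one = \<one>\<^sub>R, ring.zero = \<zero>\<^sub>R, add = add R\<rparr>"

definition flip_left :: "('l, 'm, 'r, 'x) bimodule_scheme => ('r, 'm) module" where
 "flip_left M = \<lparr>carrier = carrier M, monoid.mult = undefined, one = undefined, ring.zero = \<zero>\<^sub>M, add = add M,
   smult = (\<lambda>a m. m \<star>\<^sub>M a)\<rparr>"

definition flip_right :: "('r, 'm, 'x) module_scheme => (unit, 'm, 'r) bimodule" where
 "flip_right M = \<lparr>carrier = carrier M, monoid.mult = undefined, one = undefined, ring.zero = \<zero>\<^sub>M, add = add M,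
   smult = undefined, rsmult = (\<lambda>m a. a \<odot>\<^sub>M m)\<rparr>"

lemma flip_simps [simp]:
 "carrier (op_ring R) = carrier R" "a \<otimes>\<^bsub>op_ring R\<^esub> b = b \<otimes>\<^sub>R a" "\<one>\<^bsub>op_ring R\<^esub> = \<one>\<^sub>R"
 "\<zero>\<^bsub>op_ring R\<^esub> = \<zero>\<^sub>R" "add (op_ring R) = add R"
 "carrier (flip_left M) = carrier M" "\<zero>\<^bsub>flip_left M\<^esub> = \<zero>\<^sub>M" "add (flip_left M) = add M" "a \<odot>\<^bsub>flip_left M\<^esub> m = m \<star>\<^sub>M a"
 "carrier (flip_right N) = carrier N" "\<zero>\<^bsub>flip_right N\<^esub> = \<zero>\<^sub>N" "add (flip_right N) = add N" "n \<star>\<^bsub>flip_right N\<^esub> a = a \<odot>\<^sub>N n"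
 by (simp_all add: op_ring_def flip_left_def flip_right_def)

lemma right_module_flip:
 assumes "left_module R M"
 shows "right_module (op_ring R) (flip_right M)"
proof -
 interpret left_module R M by fact
 have "abelian_group (op_ring R)" by (rule abelian_group_cong[OF R.abelian_group_axioms]) simp_all
 then have op: "ring (op_ring R)" by (rule ringI) (auto intro!: monoidI simp: R.m_assoc R.l_distr R.r_distr)
 have "abelian_group (flip_right M)" by (rule abelian_group_cong[OF ab_M]) simp_all
 then show ?thesis
  by (rule right_moduleI[OF op]) (simp_all add: lsmult_closed lsmult_l_distr lsmult_r_distr lsmult_assoc lsmult_one)
qed

lemma left_module_flip:
 assumes "ring R" "right_module (op_ring R) M"
 shows "left_module R (flip_left M)"
proof -
 interpret right_module "op_ring R" M by fact
 have "abelian_group (flip_left M)" by (rule abelian_group_cong[OF ab_M]) simp_all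
 then show ?thesis
  using rsmult_closed rsmult_l_distr rsmult_r_distr rsmult_assoc rsmult_one
  by (intro left_moduleI[OF assms(1)]) simp_all
qed

section \<open>Dual bases for locally projective corings\<close>

context small_coring begin

text \<open>A finitely supported function is determined by its graph over the support, a finite set
  of pairs, hence by a list over \<open>'u\<close>.\<close>

lemma small_free:
 "carrier (direct_sum (carrier C) (regular (op_ring A))) \<lesssim> (UNIV :: 'u set)"
proof -
 obtain d :: "'u => 'c \<times> 'a" where d: "carrier C \<times> carrier A \<subseteq> range d"
  using times_lepoll_UNIV[OF infinite_U small_C small_A] by (auto simp: lepoll_iff)
 \<comment> \<open>The pairs coded by the list are read as a graph, with value 0 where no pair is
   listed.\<close>
 define fn where "fn l = (\<lambda>c\<in>carrier C. if \<exists>a. (c, a) \<in> d ` set l then SOME a. (c, a) \<in> d ` set l else \<zero>\<^sub>A)" for l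
 have "carrier (direct_sum (carrier C) (regular (op_ring A))) \<subseteq> range fn"
 proof
  fix v assume v: "v : direct_sum (carrier C) (regular (op_ring A))"
  let ?s = "{c \<in> carrier C. v c \<noteq> \<zero>\<^sub>A}"
  obtain u where u: "!!c. c : C ==> d (u c) = (c, v c)"
  proof -
   have "\<exists>u. d u = (c, v c)" if "c : C" for c
    using d v that by (force simp: PiE_iff image_iff subset_iff)
   then show ?thesis using that by metis
  qed
  have "finite ?s" using v by simp
  then obtain xs where xs: "set xs = ?s" using finite_list by blast
  have im: "(c, a) \<in> d ` set (map u xs) \<longleftrightarrow> c \<in> ?s \<and> a = v c" for c a
   using u xs by (auto simp: image_iff)
  have "v = fn (map u xs)"
  proof (rule extensionalityI[of _ "carrier C"])
   show "v c = fn (map u xs) c" if "c : C" for c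
    using that unfolding fn_def by (simp only: im) simp
  qed (use v in \<open>auto simp: PiE_iff fn_def\<close>)
  then show "v \<in> range fn" by blast
 qed
 then show ?thesis by (rule lepoll_range_list[OF infinite_U])
qed

lemma fin_gen_span:
 assumes "finite E" "E \<subseteq> carrier C"
 obtains F where "fin_gen_left A C F" "E \<subseteq> F" "F \<subseteq> carrier C"
proof -
 let ?F = "\<Inter>{K. submodule K A C \<and> E \<subseteq> K}"
 have top: "submodule (carrier C) A C"
  using C_left.M.add.subgroup_self by (simp add: submodule_def submodule_axioms_def C_left.lsmult_closed)
 have "subgroup ?F (add_monoid C)"
  by (rule C_left.M.add.subgroups_Inter) (use top assms(2) in \<open>auto simp: submodule_def\<close>)
 then have "submodule ?F A C"
  by (auto simp: submodule_def submodule_axioms_def)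
 then have "fin_gen_left A C ?F"
  unfolding fin_gen_left_def using assms by (auto intro!: exI[of _ E])
 moreover have "?F \<subseteq> carrier C" using top assms(2) by blast
 ultimately show ?thesis by (intro that[of ?F]) auto
qed

text \<open>Cover C by a free module and lift the identity on a finitely generated submodule
  containing E. The coordinates of the lift are left linear functionals, and only finitely many of
  them are nonzero somewhere on E.\<close>

lemma dual_basis:
 assumes lp: "locally_projective TYPE('u) A C" and E: "finite E" "E \<subseteq> carrier C"
 obtains l where "set l \<subseteq> carrier S \<times> carrier C" "!!e. e \<in> E ==> psum l e = e"
proof -
 let ?op = "op_ring A" and ?C = "flip_right C"
 let ?L = "direct_sum (carrier C) (regular ?op)"
 have C: "right_module ?op ?C" by (rule right_module_flip[OF left_C])
 have D: "right_module ?op ?L"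
  by (rule right_module_direct_sum[OF bimoduleD(2)[OF bimodule_regular[OF right_moduleD(1)[OF C]]]])
 obtain p where p: "right_linear ?op ?L ?C p" "p ` carrier ?L = carrier C"
  and sup: "!!v J. [|v : ?L; finite J; {c \<in> carrier C. v c \<noteq> \<zero>\<^sub>A} \<subseteq> J; J \<subseteq> carrier C|] ==>
   p v = (\<Oplus>\<^bsub>?C\<^esub>c\<in>J. v c \<odot>\<^sub>C c)"
  by (rule obtain_free_cover[OF C, unfolded flip_simps]) (rule that; blast)
 obtain L :: "(unit, 'u, 'a) bimodule" and \<phi> \<psi> where "right_copy ?op ?L L \<phi> \<psi>" using obtain_right_copy[OF D small_free] .
 note L = right_copyD[OF this]
 obtain N :: "(unit, 'u, 'a) bimodule" and \<phi>' \<psi>' where "right_copy ?op ?C N \<phi>' \<psi>'"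
  using obtain_right_copy[OF C] small_C by auto
 note N = right_copyD[OF this]
 obtain F where F: "fin_gen_left A C F" "E \<subseteq> F" "F \<subseteq> carrier C" using fin_gen_span[OF E] .
 let ?p = "\<lambda>u. \<phi>' (p (\<psi> u))"
 have lin: "right_linear ?op L N ?p" by (rule right_linear_comp[OF right_linear_comp[OF L(4) p(1)] N(3)])
 have "n \<in> ?p ` carrier L" if n: "n : N" for n
 proof -
  have "\<psi>' n \<in> p ` carrier ?L" unfolding p(2) using N(8)[OF n] by simp
  then obtain v where v: "v : ?L" "\<psi>' n = p v" by (elim imageE) simp
  have "n = ?p (\<phi> v)" using v L(5)[OF v(1)] N(6)[OF n] by simp
  then show ?thesis using L(7)[OF v(1)] by blast
 qed
 then have "?p ` carrier L = carrier N" using right_linearD(2)[OF lin] by blast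
 then have "left_module A (flip_left L) \<and> left_module A (flip_left N) \<and> left_linear A (flip_left L) (flip_left N) ?p \<and>
   ?p ` carrier (flip_left L) = carrier (flip_left N) \<and> left_linear A C (flip_left N) \<phi>' \<and> fin_gen_left A C F"
  using left_module_flip[OF ring_A L(2)] left_module_flip[OF ring_A N(2)] lin N(3) F(1)
  by (simp add: left_linear_def right_linear_def additive_map_def)
 from lp[unfolded locally_projective_def, rule_format, OF this]
 obtain g where g: "left_linear A C (flip_left L) g" "\<forall>w\<in>F. ?p (g w) = \<phi>' w" by blast
 note g' = left_linearD[OF g(1), unfolded flip_simps]
 \<comment> \<open>The coordinate at w of the lifted identity.\<close>
 define h where "h w = (\<lambda>c\<in>carrier C. \<psi> (g c) w)" for w
 have pg: "\<psi> (g c) : ?L" if "c : C" for c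
  by (rule L(8)[OF g'(2)[OF that]])
 have hS: "h w : S" if "w : C" for w
  unfolding h_def using pg that g' right_linearD[OF L(4)]
  by (intro S_restrict left_linearI) (auto simp: PiE_iff)
 have pe: "p (\<psi> (g e)) = e" if "e \<in> E" for e
 proof -
  have e: "e : C" using that E by auto
  have "\<phi>' (p (\<psi> (g e))) = \<phi>' e" using g(2) F(2) that by auto
  then show ?thesis using N(5)[of e] N(5)[OF right_linearD(2)[OF p(1) pg[OF e]]] e by (metis flip_simps(10))
 qed
 let ?D = "\<Union>e\<in>E. {c \<in> carrier C. \<psi> (g e) c \<noteq> \<zero>\<^sub>A}"
 have "finite ?D"
 proof (rule finite_UN_I[OF E(1)])
  show "finite {c \<in> carrier C. \<psi> (g e) c \<noteq> \<zero>\<^sub>A}" if "e \<in> E" for e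
  proof -
   have "\<psi> (g e) : ?L" by (rule pg) (use that E(2) in blast)
   then show ?thesis by simp
  qed
 qed
 from finite_distinct_list[OF this] obtain ws where ws: "set ws = ?D" "distinct ws" by (elim exE conjE)
 let ?l = "map (\<lambda>w. (h w, w)) ws"
 have D: "?D \<subseteq> carrier C" by auto
 \<comment> \<open>Sums in the flipped module are sums in C, since they depend on carrier, zero and
   addition only.\<close>
 have fin: "finsum ?C f J = finsum C f J" for f and J :: "'c set" by (simp add: finsum_def finprod_def cong: if_cong)
 show ?thesis
 proof (rule that[of ?l])
  show "set ?l \<subseteq> carrier S \<times> carrier C" using ws hS by auto
  fix e assume e: "e \<in> E"
  then have eC: "e : C" using E by auto
  have ps: "psum (map (\<lambda>w. (h w, w)) us) e = (\<Oplus>\<^bsub>C\<^esub>c\<in>set us. \<psi> (g e) c \<odot>\<^sub>C c)"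
   if "distinct us" "set us \<subseteq> carrier C" for us
   using that
  proof (induction us)
   case (Cons u us)
   have "!!c. c : C ==> \<psi> (g e) c \<odot>\<^sub>C c : C"
    using pg[OF eC] by (auto simp: PiE_iff intro!: C_left.lsmult_closed)
   then show ?case using Cons eC by (simp add: h_def Pi_iff subset_iff)
  qed simp
  have "p (\<psi> (g e)) = (\<Oplus>\<^bsub>C\<^esub>c\<in>?D. \<psi> (g e) c \<odot>\<^sub>C c)"
   using sup[OF pg[OF eC] \<open>finite ?D\<close> _ D] e unfolding fin by auto
  then show "psum ?l e = e" using ps[OF ws(2)] ws(1) D pe[OF e] by simp
 qed
qed

end

section \<open>Tensors and their evaluations at functionals\<close>

locale lp_coring = small_coring A C x U
 for A :: "'a ring" and C :: "('a, 'c, 'x) coring_scheme" and x and U :: "'u itself" +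
 assumes locally_projective: "locally_projective TYPE('u) A C"
begin

lemmas lp_basis = dual_basis[OF locally_projective]

text \<open>Rebuilds a tensor t from its evaluations at the g_i as the sum of the t(g_i) \<otimes>
  w_i; on m \<otimes> c this replaces c by \<open>psum l c\<close>.\<close>

primrec expand :: "('l, 'm, 'a, 'y) bimodule_scheme => (('c => 'a) \<times> 'c) list => ('m, 'c) tensor => ('m, 'c) tensor" where
 "expand M [] t = \<zero>\<^bsub>tensor_add A M C\<^esub>"
| "expand M (gw # l) t = pure_tensor A M C (tensor_eval M (fst gw) t) (snd gw) \<oplus>\<^bsub>tensor_add A M C\<^esub> expand M l t"

context
 fixes M :: "('l, 'm, 'a, 'y) bimodule_scheme"
 assumes M: "right_module A M"
begin

interpretation T: tensor A M C by (rule tensor_C[OF M])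

lemma expand_additive:
 assumes "set l \<subseteq> carrier S \<times> carrier C"
 shows "additive_map T.T T.T (expand M l)"
 using assms
proof (induction l)
 case Nil
 then show ?case by (simp add: additive_map_def)
next
 case (Cons gw l)
 obtain g w where gw: "gw = (g, w)" "g : S" "w : C" using Cons.prems by (cases gw) auto
 have 1: "additive_map M T.T (\<lambda>m. T.pt m w)" using T.balanced_pure gw by (simp add: balanced_def)
 show ?case
  using additive_sum[OF T.ab_T additive_comp[OF eval_setting.eval_additive[OF eval_S[OF M gw(2)]] 1]] Cons
  by (simp add: gw)
qed

lemma expand_pure:
 assumes "set l \<subseteq> carrier S \<times> carrier C" "m : M" "c : C"
 shows "expand M l (T.pt m c) = T.pt m (psum l c)"
 using assms
proof (induction l)
 case (Cons gw l)
 obtain g w where gw: "gw = (g, w)" "g : S" "w : C" using Cons.prems by (cases gw) auto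
 then show ?case
  using Cons eval_setting.eval_pure[OF eval_S[OF M gw(2)]] psum_closed[of l c]
  by (simp add: T.pure_add_right C_left.lsmult_closed S_closed T.pure_balanced)
qed (simp add: T.pure_zero_right)

text \<open>A tensor involves finitely many elements of C, and a dual basis on these reproduces
  it.\<close>

lemma expand_support:
 assumes "t : T.T"
 shows "\<exists>E. finite E \<and> E \<subseteq> carrier C \<and>
  (\<forall>l. set l \<subseteq> carrier S \<times> carrier C \<and> (\<forall>e\<in>E. psum l e = e) --> expand M l t = t)"
 using assms
proof (induction rule: T.induct)
 case (pure m c)
 then show ?case by (intro exI[of _ "{c}"]) (simp add: expand_pure)
next
 case (add t t')
 then obtain E E' where "finite E" "E \<subseteq> carrier C" "finite E'" "E' \<subseteq> carrier C"
  "!!l. set l \<subseteq> carrier S \<times> carrier C ==> (\<forall>e\<in>E. psum l e = e) ==> expand M l t = t"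
  "!!l. set l \<subseteq> carrier S \<times> carrier C ==> (\<forall>e\<in>E'. psum l e = e) ==> expand M l t' = t'" by metis
 then show ?case using add(1,2)
  by (intro exI[of _ "E \<union> E'"]) (auto simp: additive_add[OF expand_additive])
qed

text \<open>The \<open>\<alpha>\<close>-condition: \<open>M \<otimes>\<^sub>A C\<close> embeds into the maps from the dual ring to \<open>M\<close>.\<close>

lemma tensor_eval_zero:
 assumes t: "t : T.T" and z: "!!g. g : S ==> tensor_eval M g t = \<zero>\<^sub>M"
 shows "t = \<zero>\<^bsub>T.T\<^esub>"
proof -
 obtain E where E: "finite E" "E \<subseteq> carrier C"
  "!!l. set l \<subseteq> carrier S \<times> carrier C ==> (\<forall>e\<in>E. psum l e = e) ==> expand M l t = t"
  using expand_support[OF t] by metis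
 obtain l where l: "set l \<subseteq> carrier S \<times> carrier C" "!!e. e \<in> E ==> psum l e = e" using lp_basis[OF E(1,2)] by blast
 have "expand M l t = \<zero>\<^bsub>T.T\<^esub>" using l(1) z by (induction l) (auto simp: T.pure_zero_left)
 then show ?thesis using E(3)[of l] l by simp
qed

lemma tensor_eval_inject:
 assumes "t : T.T" "t' : T.T" "!!g. g : S ==> tensor_eval M g t = tensor_eval M g t'"
 shows "t = t'"
proof -
 have "tensor_eval M g (t \<ominus>\<^bsub>T.T\<^esub> t') = \<zero>\<^sub>M" if "g : S" for g
 proof -
  interpret g: eval_setting A M C g by (rule eval_S[OF M that])
  show ?thesis
   using additive_minus[OF T.ab_T T.M.ab_M g.eval_additive assms(1,2)]
    assms(3)[OF that] g.eval_closed[OF assms(2)] by (simp add: T.M.M.minus_eq T.M.M.r_neg)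
 qed
 then have "t \<ominus>\<^bsub>T.T\<^esub> t' = \<zero>\<^bsub>T.T\<^esub>" using assms(1,2) by (intro tensor_eval_zero) auto
 then show ?thesis using minus_zero_iff[OF T.ab_T assms(1,2)] by simp
qed

text \<open>The same finiteness seen from the dual ring: functionals that vanish on the elements of
  C occurring in t annihilate it. This makes comodules rational.\<close>

lemma tensor_eval_support:
 assumes "t : T.T"
 shows "\<exists>E. finite E \<and> E \<subseteq> carrier C \<and> (\<forall>g\<in>carrier S. (\<forall>e\<in>E. g e = \<zero>\<^sub>A) --> tensor_eval M g t = \<zero>\<^sub>M)"
 using assms
proof (induction rule: T.induct)
 case (pure m c)
 then show ?case
  by (intro exI[of _ "{c}"]) (simp add: eval_setting.eval_pure[OF eval_S[OF M]] T.M.rsmult_zero)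
next
 case (add t t')
 then obtain E E' where "finite E" "E \<subseteq> carrier C" "finite E'" "E' \<subseteq> carrier C"
  "\<forall>g\<in>carrier S. (\<forall>e\<in>E. g e = \<zero>\<^sub>A) --> tensor_eval M g t = \<zero>\<^sub>M"
  "\<forall>g\<in>carrier S. (\<forall>e\<in>E'. g e = \<zero>\<^sub>A) --> tensor_eval M g t' = \<zero>\<^sub>M" by metis
 then show ?case using add(1,2)
  by (intro exI[of _ "E \<union> E'"]) (auto simp: additive_add[OF eval_setting.eval_additive[OF eval_S[OF M]]])
qed

end

section \<open>Comodules as rational modules over the dual ring\<close>

text \<open>The annihilator of y is open in the finite topology of the dual ring. By
  \<open>rational_dual\<close> and \<open>rational_comodule\<close>, the modules in which every
  element has this property are exactly those that come from comodules.\<close>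

definition rational :: "('l, 'm, 'c => 'a, 'y) bimodule_scheme => 'm => bool" where
 "rational X y \<longleftrightarrow> (\<exists>E. finite E \<and> E \<subseteq> carrier C \<and>
   (\<forall>g\<in>carrier S. (\<forall>e\<in>E. g e = \<zero>\<^sub>A) --> y \<star>\<^sub>X g = \<zero>\<^sub>X))"

lemma rational_dual: "[|comodule A C M; m : M|] ==> rational (dual_module M) m"
 using tensor_eval_support[OF comoduleD(1) comoduleD(5)] by (simp add: rational_def)

lemma rational_image:
 assumes "right_module S X" "right_module S Y" "right_linear S X Y f" "y : X" "rational X y"
 shows "rational Y (f y)"
proof -
 interpret X: right_module S X by fact
 interpret Y: right_module S Y by fact
 note f = right_linearD[OF assms(3)]
 have "f \<zero>\<^sub>X = \<zero>\<^sub>Y" by (rule additive_zero[OF X.ab_M Y.ab_M f(1)])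
 then show ?thesis using assms(4,5) f(4) unfolding rational_def by metis
qed

lemma rational_add:
 assumes "right_module S X" "y : X" "y' : X" "rational X y" "rational X y'"
 shows "rational X (y \<oplus>\<^sub>X y')"
proof -
 interpret X: right_module S X by fact
 obtain E E' where "finite E" "E \<subseteq> carrier C" "finite E'" "E' \<subseteq> carrier C"
  "\<forall>g\<in>carrier S. (\<forall>e\<in>E. g e = \<zero>\<^sub>A) --> y \<star>\<^sub>X g = \<zero>\<^sub>X"
  "\<forall>g\<in>carrier S. (\<forall>e\<in>E'. g e = \<zero>\<^sub>A) --> y' \<star>\<^sub>X g = \<zero>\<^sub>X"
  using assms(4,5) unfolding rational_def by metis
 then show ?thesis unfolding rational_def using assms(2,3)
  by (intro exI[of _ "E \<union> E'"]) (auto simp: X.rsmult_l_distr)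
qed

text \<open>The functional c \<mapsto> h(\<open>psum l c\<close>) written inside the dual ring, so
  that its action on a module element can be computed from the g_i.\<close>

primrec lcomb :: "(('c => 'a) \<times> 'c) list => ('c => 'a) => 'c => 'a" where
 "lcomb [] h = \<zero>\<^sub>S"
| "lcomb (gw # l) h = fst gw \<otimes>\<^sub>S scal (h (snd gw)) \<oplus>\<^sub>S lcomb l h"

lemma lcomb_S: "[|set l \<subseteq> carrier S \<times> carrier C; h : S|] ==> lcomb l h : S"
 by (induction l) (auto intro!: S_add S_zero S_mult(2) scal_S simp del: S_simps simp: S_closed)

lemma lcomb_apply:
 assumes "set l \<subseteq> carrier S \<times> carrier C" "h : S" "c : C"
 shows "lcomb l h c = h (psum l c)"
 using assms
proof (induction l)
 case Nil
 show ?case using Nil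
   additive_zero[OF C_left.ab_M left_moduleD(2)[OF left_AA] left_linearD(1)[OF S_linear[OF Nil(2)]]]
  by simp
next
 case (Cons gw l)
 note h = left_linearD[OF S_linear[OF Cons.prems(2)], simplified]
 have "psum l c : C" using Cons.prems by (intro psum_closed) auto
 then show ?case using Cons by (auto simp: mult_scal S_closed h C_left.lsmult_closed)
qed

text \<open>Take a dual basis (g_i, w_i) on the finite set E belonging to y, and let t be the sum of
  the y g_i \<otimes> w_i. The value of t at h is y acted on by \<open>lcomb l h\<close>. This
  functional agrees with h on E, so both act alike on y.\<close>

lemma rational_tensor:
 assumes X: "right_module S X" and y: "y : X" "rational X y"
 shows "\<exists>t\<in>carrier (tensor_add A (as_A X) C). \<forall>h\<in>carrier S. tensor_eval (as_A X) h t = y \<star>\<^sub>X h"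
proof -
 interpret X: right_module S X by fact
 have XA: "right_module A (as_A X)" by (rule right_as_A[OF X])
 interpret T: tensor A "as_A X" C by (rule tensor_C[OF XA])
 obtain E where E: "finite E" "E \<subseteq> carrier C"
  "!!g. g : S ==> (!!e. e \<in> E ==> g e = \<zero>\<^sub>A) ==> y \<star>\<^sub>X g = \<zero>\<^sub>X"
  using y(2) unfolding rational_def by metis
 obtain l where l: "set l \<subseteq> carrier S \<times> carrier C" "!!e. e \<in> E ==> psum l e = e" using lp_basis[OF E(1,2)] by blast
 define t where "t l = foldr (\<lambda>gw s. T.pt (y \<star>\<^sub>X fst gw) (snd gw) \<oplus>\<^bsub>T.T\<^esub> s) l \<zero>\<^bsub>T.T\<^esub>" for l
 have t: "t l : T.T" if "set l \<subseteq> carrier S \<times> carrier C" for l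
  using that by (induction l) (auto simp: t_def y X.rsmult_closed T.pure_closed)
 have ev: "tensor_eval (as_A X) h (t l) = y \<star>\<^sub>X lcomb l h"
  if "set l \<subseteq> carrier S \<times> carrier C" and h: "h : S" for l h
  using that(1)
 proof (induction l)
  case Nil
  show ?case
   using additive_zero[OF T.ab_T T.M.ab_M eval_setting.eval_additive[OF eval_S[OF XA h]]]
    X.rsmult_zero[OF y(1)] by (simp add: t_def del: S_simps)
 next
  case (Cons gw l)
  obtain g w where gw: "gw = (g, w)" "g : S" "w : C" using Cons.prems by (cases gw) auto
  interpret h: eval_setting A "as_A X" C h by (rule eval_S[OF XA h])
  have tl: "t (gw # l) = T.pt (y \<star>\<^sub>X g) w \<oplus>\<^bsub>T.T\<^esub> t l" by (simp add: t_def gw)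
  have yg: "y \<star>\<^sub>X g : X" using y gw X.rsmult_closed by simp
  have lh: "lcomb l h : S" using Cons.prems h by (intro lcomb_S) auto
  have sc: "scal (h w) : S" by (rule scal_S[OF S_closed[OF h gw(3)]])
  have "tensor_eval (as_A X) h (t (gw # l)) = (y \<star>\<^sub>X g) \<star>\<^sub>X scal (h w) \<oplus>\<^sub>X y \<star>\<^sub>X lcomb l h"
   unfolding tl using Cons yg gw(2,3) t[of l]
   by (simp add: additive_add[OF h.eval_additive] T.pure_closed h.eval_pure)
  also have "\<dots> = y \<star>\<^sub>X lcomb (gw # l) h"
   using X.rsmult_assoc[OF y(1) gw(2) sc] X.rsmult_r_distr[OF y(1) S_mult(2)[OF gw(2) sc] lh] by (simp add: gw del: S_simps)
  finally show ?case .
 qed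
 have "y \<star>\<^sub>X lcomb l h = y \<star>\<^sub>X h" if h: "h : S" for h
 proof -
  have lh: "lcomb l h : S" by (rule lcomb_S[OF l(1) h])
  have d: "h \<ominus>\<^sub>S lcomb l h : S" using h lh by simp
  have "(h \<ominus>\<^sub>S lcomb l h) e = \<zero>\<^sub>A" if "e \<in> E" for e
  proof -
   have e: "e : C" using that E by auto
   have "((h \<ominus>\<^sub>S lcomb l h) \<oplus>\<^sub>S lcomb l h) e = h e"
    using h lh by (simp add: X.R.minus_eq X.R.a_assoc X.R.l_neg del: S_simps)
   then have "(h \<ominus>\<^sub>S lcomb l h) e \<oplus>\<^sub>A h e = h e"
    using e lcomb_apply[OF l(1) h e] l(2)[OF that] by simp
   then show ?thesis using S_closed[OF d e] S_closed[OF h e]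
    by (metis A.add.r_cancel_one' A.a_comm)
  qed
  then have "y \<star>\<^sub>X (h \<ominus>\<^sub>S lcomb l h) = \<zero>\<^sub>X" by (rule E(3)[OF d])
  then have "y \<star>\<^sub>X h \<ominus>\<^sub>X y \<star>\<^sub>X lcomb l h = \<zero>\<^sub>X" using X.rsmult_minus[OF y(1) h lh] by simp
  then show ?thesis using minus_zero_iff[OF X.ab_M] X.rsmult_closed y(1) h lh by metis
 qed
 then show ?thesis using ev[OF l(1)] t[OF l(1)] by auto
qed

text \<open>A tensor with the evaluations y g is unique, so \<rho> is determined by the action.
  Linearity and coassociativity hold because both sides have the same evaluations.\<close>

lemma rational_comodule:
 assumes X: "right_module S X" and rat: "!!y. y : X ==> rational X y"
 obtains \<rho> where "comodule A C (with_coaction (as_A X) \<rho>)"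
  "!!y g. [|y : X; g : S|] ==> tensor_eval (as_A X) g (\<rho> y) = y \<star>\<^sub>X g"
proof -
 interpret X: right_module S X by fact
 have XA: "right_module A (as_A X)" by (rule right_as_A[OF X])
 interpret T3: tensor3 A A "as_A X" C C by (rule tensor3_C[OF XA])
 obtain \<rho> where \<rho>: "!!y. y : X ==> \<rho> y : T3.MN.T"
  "!!y g. [|y : X; g : S|] ==> tensor_eval (as_A X) g (\<rho> y) = y \<star>\<^sub>X g"
  using rational_tensor[OF X _ rat] by metis
 note inj = tensor_eval_inject[OF XA]
 note ev = eval_S[OF XA]
 have lin: "right_linear A (as_A X) (tensor_prod A (as_A X) C) \<rho>"
 proof (rule right_linearI)
  fix y y' assume "y : as_A X" "y' : as_A X"
  then have y: "y : X" "y' : X" by simp_all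
  have "\<rho> (y \<oplus>\<^sub>X y') = \<rho> y \<oplus>\<^bsub>T3.MN.T\<^esub> \<rho> y'"
   using y by (intro inj) (simp_all add: \<rho> additive_add[OF eval_setting.eval_additive[OF ev]] X.rsmult_l_distr)
  then show "\<rho> (y \<oplus>\<^bsub>as_A X\<^esub> y') = \<rho> y \<oplus>\<^bsub>tensor_prod A (as_A X) C\<^esub> \<rho> y'" by simp
 next
  fix y a assume "y : as_A X" and a: "a : A"
  then have y: "y : X" by simp
  show "\<rho> (y \<star>\<^bsub>as_A X\<^esub> a) = \<rho> y \<star>\<^bsub>tensor_prod A (as_A X) C\<^esub> a"
   using y a right_module.rsmult_closed[OF right_module_MC[OF XA], of "\<rho> y" a]
   by (intro inj) (simp_all add: \<rho> eval_rsmult[OF XA a] S_mult(2) scal_S X.rsmult_closed X.rsmult_assoc)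
 qed (use \<rho> in simp)
 have "comodule A C (with_coaction (as_A X) \<rho>)"
 proof (rule comoduleI; simp)
  show "right_module A (as_A X)" "right_linear A (as_A X) (tensor_prod A (as_A X) C) \<rho>" by fact+
  fix y assume y: "y : X"
  let ?r = "tmap A (as_A X) (tensor_prod A (as_A X) C) C \<rho>"
  show "?r (\<rho> y) = split (as_A X) (\<rho> y)"
  proof (rule tensor_eval_inject[OF right_module_MC[OF XA]])
   show r: "?r (\<rho> y) : T3.MN_P.T"
    by (rule additive_closed[OF tmap_additive[OF T3.MN.ax T3.MN_P.ax lin] \<rho>(1)[OF y]])
   show s: "split (as_A X) (\<rho> y) : T3.MN_P.T"
    by (rule additive_closed[OF split_additive[OF XA] \<rho>(1)[OF y]])
   fix f assume f: "f : S"
   interpret f: eval_setting A "tensor_prod A (as_A X) C" C f by (rule eval_S[OF right_module_MC[OF XA] f])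
   have 1: "tensor_eval (tensor_prod A (as_A X) C) f (?r (\<rho> y)) = \<rho> (y \<star>\<^sub>X f)"
    using tensor_eval_natural[OF XA right_module_MC[OF XA] left_C S_linear[OF f] lin \<rho>(1)[OF y]] \<rho>(2)[OF y f] by simp
   show "tensor_eval (tensor_prod A (as_A X) C) f (?r (\<rho> y)) = tensor_eval (tensor_prod A (as_A X) C) f (split (as_A X) (\<rho> y))"
    using f.eval_closed[OF r] f.eval_closed[OF s] y f
    by (intro inj) (simp_all add: 1 \<rho>(2) eval_split[OF XA f _ \<rho>(1)[OF y]] S_mult(2) X.rsmult_closed X.rsmult_assoc)
  qed
  have "tensor_eval (as_A X) (counit C) (\<rho> y) = tensor_eval (as_A X) \<one>\<^sub>S (\<rho> y)"
   by (rule tensor_eval_cong[OF XA counit_linear _ \<rho>(1)[OF y]]) simp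
  then show "tensor_eval (as_A X) (counit C) (\<rho> y) = y"
   using \<rho>(2)[OF y counit_S] X.rsmult_one[OF y] by simp
 qed
 then show ?thesis using \<rho>(2) by (rule that)
qed

text \<open>Evaluations separate tensors, so compatibility with the coactions can be tested against
  the dual ring. A-linearity is the case of the functionals \<open>scal a\<close>.\<close>

lemma S_linear_iff_colinear:
 assumes M: "comodule A C M" and N: "comodule A C N"
 shows "right_linear S (dual_module M) (dual_module N) f \<longleftrightarrow> colinear A C M N f"
proof
 note m = comoduleD[OF M] and n = comoduleD[OF N]
 {
  assume "colinear A C M N f"
  then have f: "right_linear A M N f" "!!u. u : M ==> coaction N (f u) = tmap A M N C f (coaction M u)"
   by (auto simp: colinear_def)
  then show "right_linear S (dual_module M) (dual_module N) f"
   using tensor_eval_natural[OF m(1) n(1) left_C S_linear f(1) m(5)] right_linearD[OF f(1)]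
   by (intro right_linearI) simp_all
 }
 assume *: "right_linear S (dual_module M) (dual_module N) f"
 note l = right_linearD[OF *, simplified]
 have f: "right_linear A M N f"
  using l(2,3) l(4)[OF _ scal_S] by (intro right_linearI) (simp_all add: dual_act_scal M N)
 have "coaction N (f u) = tmap A M N C f (coaction M u)" if u: "u : M" for u
  using tensor_eval_natural[OF m(1) n(1) left_C S_linear f m(5)[OF u]] l(4)[OF u] n(5)[OF l(2)[OF u]]
   additive_closed[OF tmap_additive[OF tensor_C[OF m(1)] tensor_C[OF n(1)] f] m(5)[OF u]]
  by (intro tensor_eval_inject[OF n(1)]) simp_all
 then show "colinear A C M N f" using f by (simp add: colinear_def)
qed

lemma rational_comodule_copy:
 assumes X: "right_module S X" and rat: "!!y. y : X ==> rational X y"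
  and small: "small TYPE('u) X"
 obtains M :: "(unit, 'u, 'a, 'c) comodule" and \<phi> \<psi>
 where "comodule A C M" "right_copy S X (dual_module M) \<phi> \<psi>"
proof -
 obtain \<rho> where \<rho>: "comodule A C (with_coaction (as_A X) \<rho>)"
  "!!y g. [|y : X; g : S|] ==> tensor_eval (as_A X) g (\<rho> y) = y \<star>\<^sub>X g"
  using rational_comodule[OF X rat] by blast
 let ?X = "with_coaction (as_A X) \<rho>"
 obtain M :: "(unit, 'u, 'a, 'c) comodule" and \<phi> \<psi>
  where M: "comodule A C M" "right_copy A ?X M \<phi> \<psi>" "colinear A C ?X M \<phi>" "colinear A C M ?X \<psi>"
  using obtain_comodule_copy[OF \<rho>(1)] small by auto
 have "right_linear S (dual_module ?X) (dual_module M) \<phi>"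
  using S_linear_iff_colinear[OF \<rho>(1) M(1)] M(3) by simp
 then have "right_linear S X (dual_module M) \<phi>"
  using \<rho>(2) by (simp add: right_linear_def additive_map_def)
 then have "right_copy S X (dual_module M) \<phi> \<psi>"
  using right_copyD[OF M(2)] by (intro right_copyI X right_S_dual M) simp_all
 then show ?thesis by (rule that[OF M(1)])
qed

text \<open>For an \<open>S\<close>-module, the elements that generate images of \<open>A\<close>.\<close>

definition sco :: "('l, 'm, 'c => 'a, 'y) bimodule_scheme => 'm set" where
 "sco X = {m \<in> carrier X. \<forall>g\<in>carrier S. m \<star>\<^sub>X g = m \<star>\<^sub>X scal (g x)}"

text \<open>The tensors \<rho>(u) and u \<otimes> x are compared by their evaluations, which are u g
  and u g(x).\<close>

lemma co_eq_sco: "comodule A C M ==> co M = sco (dual_module M)"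
proof -
 assume M: "comodule A C M"
 note m = comoduleD[OF M]
 interpret T: tensor A M C by (rule tensor_C[OF m(1)])
 have "coaction M u = T.pt u x \<longleftrightarrow> (\<forall>g\<in>carrier S. tensor_eval M g (coaction M u) = u \<star>\<^sub>M g x)" if u: "u : M" for u
 proof -
  have "tensor_eval M g (T.pt u x) = u \<star>\<^sub>M g x" if "g : S" for g
   by (rule eval_setting.eval_pure[OF eval_S[OF m(1) that] u x(1)])
  then show ?thesis
   using tensor_eval_inject[OF m(1) m(5)[OF u] T.pure_closed[OF u x(1)]] by auto
 qed
 then show ?thesis
  by (simp add: coinvariants_def sco_def dual_act_scal[OF M] S_closed x(1) cong: conj_cong)
qed

abbreviation "A\<^sub>S \<equiv> dual_module AC"

lemma AS_act:
 assumes "a : A" "g : S"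
 shows "tensor_eval AC g (TA.pt \<one>\<^sub>A (x \<star>\<^sub>C a)) = g (x \<star>\<^sub>C a)"
proof -
 interpret g: eval_setting A AA C g by (rule eval_S[OF right_AA assms(2)])
 show ?thesis
  using assms g.eval_pure[of "\<one>\<^sub>A" "x \<star>\<^sub>C a"] by (simp add: ring_comodule_def S_closed)
qed

lemma right_S_A: "right_module S A\<^sub>S"
 by (rule right_S_dual[OF comodule_AC])

lemma sco_A: "sco A\<^sub>S = carrier B"
 using co_eq_sco[OF comodule_AC] by (simp add: coinvariant_ring_def)

end

section \<open>Modules generated by a given module\<close>

lemma right_submodule_preimage:
 assumes "right_module R M" "right_module R N" "right_linear R M N f" "right_submodule K R N"
 shows "right_submodule {m \<in> carrier M. f m \<in> K} R M"
proof -
 interpret M: right_module R M by fact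
 interpret N: right_module R N by fact
 note f = right_linearD[OF assms(3)] and K = right_submoduleD[OF assms(4)]
 have "f \<zero>\<^sub>M = \<zero>\<^sub>N" by (rule additive_zero[OF M.ab_M N.ab_M f(1)])
 then show ?thesis
  by (intro right_submoduleI[OF assms(1)]) (auto simp: f M.rsmult_closed K)
qed

definition submodule_sum :: "('m, 'z) ring_scheme => 'm set => 'm set => 'm set" where
 "submodule_sum M K L = {k \<oplus>\<^sub>M l | k l. k \<in> K \<and> l \<in> L}"

lemma right_submodule_sum:
 assumes "right_module R M" "right_submodule K R M" "right_submodule L R M"
 shows "right_submodule (submodule_sum M K L) R M"
proof -
 interpret M: right_module R M by fact
 note K = right_submoduleD[OF assms(2)] and L = right_submoduleD[OF assms(3)]
 have KL: "k : M" "l : M" if "k \<in> K" "l \<in> L" for k l using K(1) L(1) that by auto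
 show ?thesis
 proof (rule right_submoduleI[OF assms(1)])
  show "submodule_sum M K L \<subseteq> carrier M" using KL by (auto simp: submodule_sum_def)
  show "\<zero>\<^sub>M \<in> submodule_sum M K L" using K(2) L(2) by (force simp: submodule_sum_def)
  fix m assume "m \<in> submodule_sum M K L"
  then obtain k l where m: "m = k \<oplus>\<^sub>M l" "k \<in> K" "l \<in> L" by (auto simp: submodule_sum_def)
  show "m \<oplus>\<^sub>M n \<in> submodule_sum M K L" if n: "n \<in> submodule_sum M K L" for n
  proof -
   obtain k' l' where n: "n = k' \<oplus>\<^sub>M l'" "k' \<in> K" "l' \<in> L" using n by (auto simp: submodule_sum_def)
   have "m \<oplus>\<^sub>M n = (k \<oplus>\<^sub>M k') \<oplus>\<^sub>M (l \<oplus>\<^sub>M l')"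
    using KL[OF m(2,3)] KL[OF n(2,3)] by (simp add: m n M.M.a_ac)
   then show ?thesis using K(3)[OF m(2) n(2)] L(3)[OF m(3) n(3)] by (auto simp: submodule_sum_def)
  qed
  show "m \<star>\<^sub>M a \<in> submodule_sum M K L" if "a : R" for a
   using that m KL[OF m(2,3)] K(6)[OF m(2) that] L(6)[OF m(3) that]
   by (auto simp: submodule_sum_def M.rsmult_l_distr)
 qed
qed

text \<open>Induction on the support of a preimage in the direct sum, peeling off one coordinate at
  a time; a coordinate inclusion followed by p is a homomorphism from W.\<close>

lemma generated_by_induct:
 fixes M :: "('l, 'm, 'r) bimodule" and W :: "('k, 'w, 'r, 'x) bimodule_scheme"
 assumes W: "right_module T W" and M: "M \<in> generated_by T W" and m: "m : M"
  and zero: "Q \<zero>\<^sub>M"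
  and add: "!!f w m. [|right_linear T W M f; w : W; m : M; Q m|] ==> Q (f w \<oplus>\<^sub>M m)"
 shows "Q m"
proof -
 obtain I :: "('w => 'm) set" and p where M': "right_module T M"
  and p: "p \<in> right_hom T (direct_sum I W) M" "p ` carrier (direct_sum I W) = carrier M"
  using M unfolding generated_by_def by blast
 interpret W: right_module T W by fact
 interpret M: right_module T M by fact
 let ?D = "direct_sum I W"
 have "right_linear T ?D M p" using p(1) by (simp add: right_hom_def)
 note pl = right_linearD[OF this]
 define s where "s i w = (\<lambda>j\<in>I. if j = i then w else \<zero>\<^sub>W)" for i w
 have sup: "{j \<in> I. s i w j \<noteq> \<zero>\<^sub>W} \<subseteq> {i}" for i w by (auto simp: s_def)
 have s: "s i w : ?D" if "w : W" for i w
  using that finite_subset[OF sup] by (auto simp: s_def)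
 have sl: "right_linear T W M (\<lambda>w. p (s i w))" for i
 proof (rule right_linearI)
  fix v w assume vw: "v : W" "w : W"
  have "s i (v \<oplus>\<^sub>W w) = s i v \<oplus>\<^bsub>?D\<^esub> s i w" by (auto simp: s_def fun_eq_iff)
  then show "p (s i (v \<oplus>\<^sub>W w)) = p (s i v) \<oplus>\<^sub>M p (s i w)" using pl(3)[OF s[OF vw(1)] s[OF vw(2)]] by metis
 next
  fix w a assume wa: "w : W" "a : T"
  have "s i (w \<star>\<^sub>W a) = s i w \<star>\<^bsub>?D\<^esub> a" using wa by (auto simp: s_def fun_eq_iff W.zero_rsmult)
  then show "p (s i (w \<star>\<^sub>W a)) = p (s i w) \<star>\<^sub>M a" using pl(4)[OF s[OF wa(1)] wa(2)] by metis
 qed (use s pl(2) in blast)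
 have main: "Q (p v)" if "finite D" "v : ?D" "{i \<in> I. v i \<noteq> \<zero>\<^sub>W} \<subseteq> D" for D v
  using that
 proof (induction D arbitrary: v rule: finite_induct)
  case empty
  \<comment> \<open>The zero vector, written with entry 0 at an arbitrary index.\<close>
  then have "v = s undefined \<zero>\<^sub>W" by (auto simp: s_def fun_eq_iff PiE_iff extensional_def)
  moreover have "p (s undefined \<zero>\<^sub>W) = \<zero>\<^sub>M"
   by (rule additive_zero[OF W.ab_M M.ab_M right_linearD(1)[OF sl]])
  ultimately show ?case using zero by simp
 next
  case (insert i D)
  show ?case
  proof (cases "i \<in> I")
   case False
   then show ?thesis using insert by auto
  next
   case True
   define v' where "v' = v(i := \<zero>\<^sub>W)"
   have vi: "v i : W" using insert.prems True by (auto simp: PiE_iff)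
   have sub: "{j \<in> I. v' j \<noteq> \<zero>\<^sub>W} \<subseteq> D" using insert.prems by (auto simp: v'_def)
   then have v': "v' : ?D"
    using insert.prems True finite_subset[OF sub insert.hyps(1)]
    by (auto simp: v'_def PiE_iff extensional_def)
   have "v = s i (v i) \<oplus>\<^bsub>?D\<^esub> v'"
    using insert.prems(1) vi by (intro ext) (auto simp: s_def v'_def PiE_iff extensional_def)
   then have "p v = p (s i (v i)) \<oplus>\<^sub>M p v'" using pl(3)[OF s[OF vi] v'] by metis
   then show ?thesis using add[OF sl vi pl(2)[OF v'] insert.IH[OF v' sub]] by metis
  qed
 qed
 obtain v where v: "v : ?D" "m = p v" using m p(2) by blast
 then show ?thesis using main[of "{i \<in> I. v i \<noteq> \<zero>\<^sub>W}" v] by auto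
qed

text \<open>The trace of W in M, built up as finite sums of values of homomorphisms from W.\<close>

inductive_set gen_span :: "('r, 'z) ring_scheme => ('k, 'w, 'r, 'x) bimodule_scheme => ('l, 'm, 'r, 'y) bimodule_scheme => 'm set"
 for T W M where
 zero: "\<zero>\<^sub>M \<in> gen_span T W M"
| add: "[|f \<in> right_hom T W M; w : W; m \<in> gen_span T W M|] ==> f w \<oplus>\<^sub>M m \<in> gen_span T W M"

lemma gen_span_add:
 assumes "right_module T W" "right_linear T W M f" "w : W" "m \<in> gen_span T W M"
 shows "f w \<oplus>\<^sub>M m \<in> gen_span T W M"
 using gen_span.add[of "restrict f (carrier W)" T W M w m] assms
 by (simp add: right_hom_def right_linear_restrict)

text \<open>The homomorphisms from W to M themselves serve as index set, each acting on its own copy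
  of W.\<close>

lemma generated_byI:
 fixes M :: "('l, 'm, 'r) bimodule" and W :: "('k, 'w, 'r, 'x) bimodule_scheme"
 assumes W: "right_module T W" and M: "right_module T M" and gen: "carrier M \<subseteq> gen_span T W M"
 shows "M \<in> generated_by T W"
proof -
 interpret W: right_module T W by fact
 interpret M: right_module T M by fact
 let ?I = "right_hom T W M"
 let ?D = "direct_sum ?I W" and ?s = "\<lambda>f w. \<lambda>i\<in>?I. if i = f then w else \<zero>\<^sub>W"
 have lin: "right_linear T W M f" if "f \<in> ?I" for f using that by (simp add: right_hom_def)
 interpret D: right_module T ?D by (rule right_module_direct_sum[OF W])
 show ?thesis
 proof (rule direct_sum_eval[OF W M, of ?I "\<lambda>f. f", OF lin], assumption)
  fix p assume p: "right_linear T ?D M p" and s: "!!i w. [|i \<in> ?I; w : W|] ==> p (?s i w) = i w"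
  have "m \<in> p ` carrier ?D" if "m \<in> gen_span T W M" for m
   using that
  proof (induction rule: gen_span.induct)
   case zero
   show ?case using additive_zero[OF D.ab_M M.ab_M right_linearD(1)[OF p]] D.M.zero_closed by (metis imageI)
  next
   case (add f w m)
   then obtain u where u: "u : ?D" "m = p u" by blast
   have v: "?s f w : ?D" by (rule direct_sum_memI[of _ _ _ "{f}"]) (use add(2) in auto)
   show ?case
    by (rule image_eqI[OF _ D.M.a_closed[OF v u(1)]]) (simp only: right_linearD(3)[OF p v u(1)] s[OF add(1,2)] u(2))
  qed
  then have "p ` carrier ?D = carrier M" using gen right_linearD(2)[OF p] by blast
  moreover have "restrict p (carrier ?D) \<in> right_hom T ?D M"
   using p right_linear_restrict[OF D.right_module_axioms, of M p] by (simp add: right_hom_def del: direct_sum_simps)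
  ultimately show ?thesis
   unfolding generated_by_def using M
   by (intro CollectI conjI exI[of _ ?I] exI[of _ "restrict p (carrier ?D)"]) (simp_all del: direct_sum_simps)
 qed
qed

section \<open>Coinvariants modulo a submodule\<close>

context lp_coring begin

text \<open>The generators form a list rather than a set, for inductions on their number; D is the
  carrier of A or of B.\<close>

primrec lspan :: "('l, 'm, 'c => 'a, 'y) bimodule_scheme => 'a set => 'm list => 'm set" where
 "lspan X D [] = {\<zero>\<^sub>X}"
| "lspan X D (y # ys) = {(y \<star>\<^sub>X scal a) \<oplus>\<^sub>X s | a s. a \<in> D \<and> s \<in> lspan X D ys}"

text \<open>The elements whose class modulo K lies in \<open>sco\<close>, stated without the
  quotient module.\<close>

definition mco :: "('l, 'm, 'c => 'a, 'y) bimodule_scheme => 'm set => 'm set" where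
 "mco X K = {v \<in> carrier X. \<forall>g\<in>carrier S. (v \<star>\<^sub>X g) \<ominus>\<^sub>X (v \<star>\<^sub>X scal (g x)) \<in> K}"

lemma S_x: "g : S ==> g x : A"
 by (simp add: S_closed x)

lemma B_subset: "carrier B \<subseteq> carrier A"
 using B_A by blast

context
 fixes X :: "('l, 'm, 'c => 'a, 'y) bimodule_scheme"
 assumes X: "right_module S X"
begin

interpretation X: right_module S X by (rule X)
interpretation XA: right_module A "as_A X" by (rule right_as_A[OF X])

lemmas scal_closed = XA.rsmult_closed[simplified]

lemma scal_facts:
 "[|y : X; a : A; b : A|] ==> y \<star>\<^sub>X scal (a \<oplus>\<^sub>A b) = (y \<star>\<^sub>X scal a) \<oplus>\<^sub>X (y \<star>\<^sub>X scal b)"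
 "[|y : X; a : A; b : A|] ==> y \<star>\<^sub>X scal (a \<otimes>\<^sub>A b) = (y \<star>\<^sub>X scal a) \<star>\<^sub>X scal b"
 "[|y : X; a : A; b : A|] ==> y \<star>\<^sub>X scal (a \<ominus>\<^sub>A b) = (y \<star>\<^sub>X scal a) \<ominus>\<^sub>X (y \<star>\<^sub>X scal b)"
 "y : X ==> y \<star>\<^sub>X scal \<one>\<^sub>A = y"
 "y : X ==> y \<star>\<^sub>X scal \<zero>\<^sub>A = \<zero>\<^sub>X"
 "[|y : X; z : X; a : A|] ==> (y \<oplus>\<^sub>X z) \<star>\<^sub>X scal a = (y \<star>\<^sub>X scal a) \<oplus>\<^sub>X (z \<star>\<^sub>X scal a)"
 using XA.rsmult_r_distr XA.rsmult_assoc XA.rsmult_minus XA.rsmult_one XA.rsmult_zero XA.rsmult_l_distr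
 by (simp_all add: a_minus_def a_inv_def m_inv_def as_A_def)

lemma lspan_closed: "[|set ys \<subseteq> carrier X; D \<subseteq> carrier A; v \<in> lspan X D ys|] ==> v : X"
 by (induction ys arbitrary: v) (auto simp: scal_closed)

lemma lspan_zero: "[|set ys \<subseteq> carrier X; \<zero>\<^sub>A \<in> D|] ==> \<zero>\<^sub>X \<in> lspan X D ys"
proof (induction ys)
 case (Cons y ys)
 have "\<zero>\<^sub>X = (y \<star>\<^sub>X scal \<zero>\<^sub>A) \<oplus>\<^sub>X \<zero>\<^sub>X" using Cons.prems(1) by (simp add: scal_facts(5))
 then show ?case using Cons by auto
qed simp

lemma lspan_append:
 assumes "set ys \<subseteq> carrier X" "set zs \<subseteq> carrier X" "D \<subseteq> carrier A" "u \<in> lspan X D ys" "v \<in> lspan X D zs"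
 shows "u \<oplus>\<^sub>X v \<in> lspan X D (ys @ zs)"
 using assms
proof (induction ys arbitrary: u)
 case Nil
 then show ?case using lspan_closed[OF Nil(2,3,5)] by simp
next
 case (Cons y ys)
 obtain a s where u: "u = (y \<star>\<^sub>X scal a) \<oplus>\<^sub>X s" "a \<in> D" "s \<in> lspan X D ys" using Cons.prems(4) by auto
 have "s \<oplus>\<^sub>X v \<in> lspan X D (ys @ zs)" using Cons u(3) by simp
 moreover have "u \<oplus>\<^sub>X v = (y \<star>\<^sub>X scal a) \<oplus>\<^sub>X (s \<oplus>\<^sub>X v)"
  using Cons.prems(1-3,5) u(2,3) lspan_closed[of ys D s] lspan_closed[of zs D v] subsetD[OF Cons.prems(3)]
  by (simp add: u(1) X.M.a_assoc scal_closed)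
 ultimately show ?case using u(2) by auto
qed

lemma lspan_add:
 assumes "set ys \<subseteq> carrier X" "u \<in> lspan X (carrier A) ys" "v \<in> lspan X (carrier A) ys"
 shows "u \<oplus>\<^sub>X v \<in> lspan X (carrier A) ys"
 using assms
proof (induction ys arbitrary: u v)
 case (Cons y ys)
 obtain a s where u: "u = (y \<star>\<^sub>X scal a) \<oplus>\<^sub>X s" "a : A" "s \<in> lspan X (carrier A) ys" using Cons.prems(2) by auto
 obtain b t where v: "v = (y \<star>\<^sub>X scal b) \<oplus>\<^sub>X t" "b : A" "t \<in> lspan X (carrier A) ys" using Cons.prems(3) by auto
 have c: "s : X" "t : X" "y : X" using Cons.prems(1) u v lspan_closed[of ys "carrier A"] by auto
 have "u \<oplus>\<^sub>X v = (y \<star>\<^sub>X scal (a \<oplus>\<^sub>A b)) \<oplus>\<^sub>X (s \<oplus>\<^sub>X t)"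
  using c u(2) v(2) by (simp add: u(1) v(1) scal_facts(1) scal_closed X.M.a_ac)
 moreover have "s \<oplus>\<^sub>X t \<in> lspan X (carrier A) ys" using Cons u(3) v(3) by simp
 moreover have "a \<oplus>\<^sub>A b : A" using u(2) v(2) by simp
 ultimately show ?case by auto
qed simp

lemma scoD: "y \<in> sco X ==> y : X" "[|y \<in> sco X; g : S|] ==> y \<star>\<^sub>X g = y \<star>\<^sub>X scal (g x)"
 by (auto simp: sco_def)

text \<open>Acting by a and then by g is acting by the product of \<open>scal a\<close> and g. On y
  in \<open>sco\<close> this is multiplication by the value of the product at x, which is g(xa), the
  result of g acting on a in A.\<close>

lemma sco_hom:
 assumes "y \<in> sco X"
 shows "right_linear S A\<^sub>S X (\<lambda>a. y \<star>\<^sub>X scal a)"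
proof (rule right_linearI)
 note y = scoD(1)[OF assms]
 fix a g assume ag: "a : A\<^sub>S" "g : S"
 then have a: "a : A" by simp
 have "(y \<star>\<^sub>X scal a) \<star>\<^sub>X g = y \<star>\<^sub>X (scal a \<otimes>\<^sub>S g)"
  using X.rsmult_assoc[OF y scal_S[OF a] ag(2)] by simp
 also have "\<dots> = y \<star>\<^sub>X scal ((scal a \<otimes>\<^sub>S g) x)" by (rule scoD(2)[OF assms S_mult(2)[OF scal_S[OF a] ag(2)]])
 also have "\<dots> = y \<star>\<^sub>X scal (a \<star>\<^bsub>A\<^sub>S\<^esub> g)" using a ag(2) by (simp add: scal_mult x AS_act)
 finally show "y \<star>\<^sub>X scal (a \<star>\<^bsub>A\<^sub>S\<^esub> g) = y \<star>\<^sub>X scal a \<star>\<^sub>X g" by simp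
qed (use scoD(1)[OF assms] in \<open>simp_all add: scal_closed scal_facts(1)\<close>)

lemma sco_image:
 assumes "right_module S Y" "right_linear S Y X f" "y \<in> sco Y"
 shows "f y \<in> sco X"
 using assms(3) right_linearD(2)[OF assms(2)] right_linearD(4)[OF assms(2), symmetric] scal_S[OF S_x] by (simp add: sco_def)

lemma sco_scal: "[|y \<in> sco X; b : B|] ==> y \<star>\<^sub>X scal b \<in> sco X"
proof -
 assume y: "y \<in> sco X" and b: "b : B"
 note f = right_linearD[OF sco_hom[OF y]]
 have "b \<in> sco A\<^sub>S" using b sco_A by simp
 then show ?thesis using f(2,4) scal_S[OF S_x] B_A[OF b] unfolding sco_def by (simp add: f(4)[symmetric] del: dual_module_simps)
qed

lemma sco_add: "[|y \<in> sco X; z \<in> sco X|] ==> y \<oplus>\<^sub>X z \<in> sco X"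
 by (simp add: sco_def X.rsmult_l_distr scal_S S_x)

lemma sco_zero: "\<zero>\<^sub>X \<in> sco X"
 by (simp add: sco_def X.zero_rsmult scal_S S_x)

lemma lspan_sco: "[|set ys \<subseteq> sco X; v \<in> lspan X (carrier B) ys|] ==> v \<in> sco X"
 by (induction ys arbitrary: v) (auto simp: sco_zero intro!: sco_add sco_scal)

lemma sco_subset: "sco X \<subseteq> carrier X"
 by (auto simp: sco_def)

lemma lspan_submodule:
 assumes "set ys \<subseteq> sco X"
 shows "right_submodule (lspan X (carrier A) ys) S X"
proof (rule right_submoduleI[OF X])
 have ys: "set ys \<subseteq> carrier X" using assms sco_subset by blast
 show "lspan X (carrier A) ys \<subseteq> carrier X" using lspan_closed[OF ys order_refl] by blast
 show "\<zero>\<^sub>X \<in> lspan X (carrier A) ys" by (rule lspan_zero[OF ys]) simp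
 show "u \<oplus>\<^sub>X v \<in> lspan X (carrier A) ys" if "u \<in> lspan X (carrier A) ys" "v \<in> lspan X (carrier A) ys" for u v
  by (rule lspan_add[OF ys that])
 show "u \<star>\<^sub>X g \<in> lspan X (carrier A) ys" if "u \<in> lspan X (carrier A) ys" "g : S" for u g
  using assms that
 proof (induction ys arbitrary: u)
  case (Cons y ys)
  obtain a s where u: "u = (y \<star>\<^sub>X scal a) \<oplus>\<^sub>X s" "a : A" "s \<in> lspan X (carrier A) ys" using Cons.prems(2) by auto
  have c: "s : X" "y : X" using Cons.prems(1) u(3) lspan_closed[of ys "carrier A"] sco_subset by auto
  note f = right_linearD[OF sco_hom[of y]]
  have y: "y \<in> sco X" using Cons.prems(1) by simp
  have ag: "a \<star>\<^bsub>A\<^sub>S\<^esub> g : A"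
   using right_module.rsmult_closed[OF right_S_A, of a g] u(2) Cons.prems(3) by simp
  have "u \<star>\<^sub>X g = (y \<star>\<^sub>X scal (a \<star>\<^bsub>A\<^sub>S\<^esub> g)) \<oplus>\<^sub>X (s \<star>\<^sub>X g)"
   using f(4)[OF y _ Cons.prems(3), of a] u(2) c Cons.prems(3)
   by (simp add: u(1) X.rsmult_l_distr scal_closed del: dual_module_simps(4))
  then show ?case using Cons u(3) ag by auto
 qed (simp add: X.zero_rsmult)
qed

lemma gap_additive:
 assumes "g : S"
 shows "additive_map X X (\<lambda>v. (v \<star>\<^sub>X g) \<ominus>\<^sub>X (v \<star>\<^sub>X scal (g x)))"
proof -
 note gx = scal_S[OF S_x[OF assms]]
 have "(p \<oplus>\<^sub>X q) \<ominus>\<^sub>X (r \<oplus>\<^sub>X s) = (p \<ominus>\<^sub>X r) \<oplus>\<^sub>X (q \<ominus>\<^sub>X s)"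
  if "p : X" "q : X" "r : X" "s : X" for p q r s
  using that by (simp add: X.M.minus_eq X.M.minus_add X.M.a_ac)
 then show ?thesis
  using assms gx by (auto simp: additive_map_def X.rsmult_closed X.rsmult_l_distr)
qed

lemma mco_add:
 assumes K: "right_submodule K S X" and "u \<in> mco X K" "v \<in> mco X K"
 shows "u \<oplus>\<^sub>X v \<in> mco X K" "u \<ominus>\<^sub>X v \<in> mco X K"
 using assms(2,3) right_submoduleD(3,5)[OF K] gap_additive
  additive_minus[OF X.ab_M X.ab_M gap_additive]
 by (auto simp: mco_def additive_map_def)

lemma mco_sub:
 assumes "right_submodule K S X" "v \<in> K"
 shows "v \<in> mco X K"
 using right_submoduleD[OF assms(1)] assms(2) by (auto simp: mco_def scal_S S_x)

lemma sco_mco: "[|right_submodule K S X; v \<in> sco X|] ==> v \<in> mco X K"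
 using right_submoduleD(2)[of K S X] by (simp add: mco_def sco_def scal_closed S_x X.M.minus_eq X.M.r_neg)

lemma mco_zero: "v \<in> mco X {\<zero>\<^sub>X} \<longleftrightarrow> v \<in> sco X"
 by (auto simp: mco_def sco_def scal_closed S_x X.rsmult_closed minus_zero_iff[OF X.ab_M])

end

definition lifts_coinvariants :: bool where
 "lifts_coinvariants \<longleftrightarrow> (\<forall>K. right_submodule K S A\<^sub>S --> (\<forall>v\<in>mco A\<^sub>S K. \<exists>b\<in>carrier B. v \<ominus>\<^sub>A b \<in> K))"

definition coinvariants_generate :: bool where
 "coinvariants_generate \<longleftrightarrow> (\<forall>K. right_submodule K S A\<^sub>S -->
   (\<forall>k\<in>K. \<exists>bs. set bs \<subseteq> K \<inter> carrier B \<and> k \<in> lspan A\<^sub>S (carrier A) bs))"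

context
 fixes X :: "('l, 'm, 'c => 'a, 'y) bimodule_scheme"
 assumes X: "right_module S X" and Q: lifts_coinvariants
begin

interpretation X: right_module S X by (rule X)

lemma submodule_sumI: "[|k \<in> K; l \<in> L|] ==> k \<oplus>\<^sub>X l \<in> submodule_sum X K L"
 by (auto simp: submodule_sum_def)

lemma submodule_sum_minus: "[|right_submodule L S X; k \<in> K; k : X; l \<in> L|] ==> k \<ominus>\<^sub>X l \<in> submodule_sum X K L"
 unfolding X.M.minus_eq by (rule submodule_sumI) (auto simp: right_submoduleD)

text \<open>Modulo the span of \<open>ys\<close>, the coefficient of \<open>y\<close> is coinvariant modulo a submodule of \<open>A\<close>.\<close>

lemma lift_coinvariant:
 assumes "right_submodule K S X" "set ys \<subseteq> sco X" "v \<in> lspan X (carrier A) ys" "v \<in> mco X K"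
 shows "\<exists>w\<in>lspan X (carrier B) ys. v \<ominus>\<^sub>X w \<in> K"
 using assms
proof (induction ys arbitrary: v K)
 case Nil
 then show ?case using right_submoduleD(2,5)[OF Nil(1)] by simp
next
 case (Cons y ys)
 note K = right_submoduleD[OF Cons.prems(1)]
 let ?L = "lspan X (carrier A) ys"
 have y: "y \<in> sco X" "y : X" and ys: "set ys \<subseteq> sco X" using Cons.prems(2) sco_subset[OF X] by auto
 have L: "right_submodule ?L S X" by (rule lspan_submodule[OF X ys])
 note L' = right_submoduleD[OF L]
 have KL: "right_submodule (submodule_sum X K ?L) S X" by (rule right_submodule_sum[OF X Cons.prems(1) L])
 note KL' = right_submoduleD[OF KL]
 let ?f = "\<lambda>a. y \<star>\<^sub>X scal a"
 note f = right_linearD[OF sco_hom[OF X y(1)]]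
 \<comment> \<open>The coefficients a for which ya lies in K + L, where L is the span of the
   remaining generators. The lifting property of A is applied to this submodule, since ya = v - s
   with v coinvariant modulo K and s in L.\<close>
 define K0 where "K0 = {a \<in> carrier A\<^sub>S. ?f a \<in> submodule_sum X K ?L}"
 have K0: "right_submodule K0 S A\<^sub>S"
  unfolding K0_def by (rule right_submodule_preimage[OF right_S_A X sco_hom[OF X y(1)] KL])
 obtain a s where v: "v = ?f a \<oplus>\<^sub>X s" "a : A" "s \<in> ?L" using Cons.prems(3) by auto
 have c: "?f a : X" "s : X" "v : X" "?f a = v \<ominus>\<^sub>X s"
  using v L'(1) y scal_closed[OF X y(2) v(2)] by (auto simp: X.M.minus_eq X.M.a_assoc X.M.r_neg)
 have "a \<in> mco A\<^sub>S K0"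
 proof -
  {
   fix g assume g: "g : S"
   let ?gap = "\<lambda>v. (v \<star>\<^sub>X g) \<ominus>\<^sub>X (v \<star>\<^sub>X scal (g x))"
   have "?gap (v \<ominus>\<^sub>X s) = ?gap v \<ominus>\<^sub>X ?gap s"
    by (rule additive_minus[OF X.ab_M X.ab_M gap_additive[OF X g] c(3,2)])
   moreover have "?gap v \<in> K" using Cons.prems(4) g by (simp add: mco_def)
   moreover have "?gap s \<in> ?L" by (intro L'(5) L'(6) v(3) g scal_S S_x)
   ultimately have "?gap (?f a) \<in> submodule_sum X K ?L"
    using K(1) submodule_sum_minus[OF L, of _ K] c(4) by auto
   moreover have "a \<star>\<^bsub>A\<^sub>S\<^esub> g : A\<^sub>S" "a \<star>\<^bsub>A\<^sub>S\<^esub> scal (g x) : A\<^sub>S"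
    using right_module.rsmult_closed[OF right_S_A, of a] v(2) g scal_S[OF S_x[OF g]] by (simp_all del: dual_module_simps(4))
   moreover have "?f ((a \<star>\<^bsub>A\<^sub>S\<^esub> g) \<ominus>\<^bsub>A\<^sub>S\<^esub> (a \<star>\<^bsub>A\<^sub>S\<^esub> scal (g x))) = ?gap (?f a)"
    using additive_minus[OF right_moduleD(2)[OF right_S_A] X.ab_M f(1) calculation(2,3)]
     f(4)[of a g] f(4)[of a "scal (g x)"] v(2) g scal_S[OF S_x[OF g]] by (simp del: dual_module_simps(4))
   moreover have "(a \<star>\<^bsub>A\<^sub>S\<^esub> g) \<ominus>\<^bsub>A\<^sub>S\<^esub> (a \<star>\<^bsub>A\<^sub>S\<^esub> scal (g x)) : A\<^sub>S"
    using abelian_group.minus_closed[OF right_moduleD(2)[OF right_S_A] calculation(2,3)] .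
   ultimately have "(a \<star>\<^bsub>A\<^sub>S\<^esub> g) \<ominus>\<^bsub>A\<^sub>S\<^esub> (a \<star>\<^bsub>A\<^sub>S\<^esub> scal (g x)) \<in> K0"
    unfolding K0_def by (simp only: mem_Collect_eq simp_thms)
  }
  then show ?thesis unfolding mco_def using v(2) by (intro CollectI conjI ballI) simp_all
 qed
 then obtain b where b: "b : B" "a \<ominus>\<^sub>A b \<in> K0" using Q K0 unfolding lifts_coinvariants_def by blast
 have "?f a \<ominus>\<^sub>X ?f b \<in> submodule_sum X K ?L"
  using b v(2) scal_facts(3)[OF X y(2) v(2) B_A[OF b(1)]] by (simp add: K0_def)
 then obtain k l where kl: "?f a \<ominus>\<^sub>X ?f b = k \<oplus>\<^sub>X l" "k \<in> K" "l \<in> ?L" by (auto simp: submodule_sum_def)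
 have fb: "?f b : X" "?f b \<in> sco X" using scal_closed[OF X y(2) B_A[OF b(1)]] sco_scal[OF X y(1) b(1)] by auto
 have klc: "k : X" "l : X" using kl K(1) L'(1) by auto
 have fa: "?f a = (k \<oplus>\<^sub>X l) \<oplus>\<^sub>X ?f b" using kl(1) c(1) fb(1) by (metis X.M.minus_eq X.M.a_assoc X.M.l_neg X.M.a_inv_closed X.M.r_zero)
 \<comment> \<open>With y(a - b) = k + l, the remainder v - yb - k = l + s lies in L and is still
   coinvariant modulo K, so the induction hypothesis applies to it.\<close>
 have v': "l \<oplus>\<^sub>X s = (v \<ominus>\<^sub>X ?f b) \<ominus>\<^sub>X k"
 proof -
  have "v = ((l \<oplus>\<^sub>X s) \<oplus>\<^sub>X k) \<oplus>\<^sub>X ?f b" using klc fb(1) c(2) by (simp add: v(1) fa X.M.a_ac)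
  moreover have "(p \<oplus>\<^sub>X q) \<ominus>\<^sub>X q = p" if "p : X" "q : X" for p q
   using that by (simp add: X.M.minus_eq X.M.a_assoc X.M.r_neg)
  ultimately show ?thesis using klc fb(1) c(2) by simp
 qed
 have ls: "l \<oplus>\<^sub>X s \<in> ?L" by (rule L'(3)[OF kl(3) v(3)])
 have "l \<oplus>\<^sub>X s \<in> mco X K"
  unfolding v' by (intro mco_add(2)[OF X Cons.prems(1)] Cons.prems(4) sco_mco[OF X Cons.prems(1)] fb(2) mco_sub[OF X Cons.prems(1) kl(2)])
 then obtain w where w: "w \<in> lspan X (carrier B) ys" "(l \<oplus>\<^sub>X s) \<ominus>\<^sub>X w \<in> K"
  using Cons.IH[OF Cons.prems(1) ys ls] by blast
 have wc: "w : X" using lspan_closed[OF X _ B_subset w(1)] ys sco_subset[OF X] by blast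
 have "v \<ominus>\<^sub>X (?f b \<oplus>\<^sub>X w) = ((l \<oplus>\<^sub>X s) \<ominus>\<^sub>X w) \<oplus>\<^sub>X k"
 proof -
  have "v = ((l \<oplus>\<^sub>X s) \<oplus>\<^sub>X k) \<oplus>\<^sub>X ?f b" using klc fb(1) c(2) by (simp add: v(1) fa X.M.a_ac)
  moreover have "(p \<oplus>\<^sub>X q) \<ominus>\<^sub>X (q \<oplus>\<^sub>X w) = p \<ominus>\<^sub>X w" if "p : X" "q : X" for p q
   using that wc by (simp add: X.M.minus_eq X.M.minus_add X.M.a_assoc X.M.r_neg1 X.M.r_neg2)
  ultimately have "v \<ominus>\<^sub>X (?f b \<oplus>\<^sub>X w) = ((l \<oplus>\<^sub>X s) \<oplus>\<^sub>X k) \<ominus>\<^sub>X w" using klc fb(1) c(2) by simp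
  then show ?thesis using klc c(2) wc by (simp add: X.M.minus_eq X.M.a_ac)
 qed
 then have "v \<ominus>\<^sub>X (?f b \<oplus>\<^sub>X w) \<in> K" using K(3)[OF w(2) kl(2)] by simp
 moreover have "?f b \<oplus>\<^sub>X w \<in> lspan X (carrier B) (y # ys)" using b(1) w(1) by auto
 ultimately show ?case by blast
qed

text \<open>Write k = ya + s. The coefficient a lies in the submodule \<open>K0\<close> of A and is
  therefore spanned by coinvariants b in \<open>K0\<close>. Each yb differs from a coinvariant in K
  by an element of the span of the other generators. So k agrees with a combination of coinvariants
  in K up to an element of K in that smaller span.\<close>

lemma generate_coinvariant:
 assumes G: coinvariants_generate
  and "right_submodule K S X" "set ys \<subseteq> sco X" "k \<in> K" "k \<in> lspan X (carrier A) ys"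
 shows "\<exists>zs. set zs \<subseteq> K \<inter> sco X \<and> k \<in> lspan X (carrier A) zs"
 using assms(2-)
proof (induction ys arbitrary: k)
 case Nil
 then show ?case by (intro exI[of _ "[]"]) auto
next
 case (Cons y ys)
 note K = right_submoduleD[OF Cons.prems(1)]
 let ?L = "lspan X (carrier A) ys"
 have y: "y \<in> sco X" "y : X" and ys: "set ys \<subseteq> sco X" "set ys \<subseteq> carrier X" using Cons.prems(2) sco_subset[OF X] by auto
 have L: "right_submodule ?L S X" by (rule lspan_submodule[OF X ys(1)])
 note L' = right_submoduleD[OF L]
 have KL: "right_submodule (submodule_sum X K ?L) S X" by (rule right_submodule_sum[OF X Cons.prems(1) L])
 let ?f = "\<lambda>a. y \<star>\<^sub>X scal a"
 define K0 where "K0 = {a \<in> carrier A\<^sub>S. ?f a \<in> submodule_sum X K ?L}"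
 have K0: "right_submodule K0 S A\<^sub>S"
  unfolding K0_def by (rule right_submodule_preimage[OF right_S_A X sco_hom[OF X y(1)] KL])
 obtain a s where v: "k = ?f a \<oplus>\<^sub>X s" "a : A" "s \<in> ?L" using Cons.prems(4) by auto
 have c: "?f a : X" "s : X" "k : X" "?f a = k \<ominus>\<^sub>X s"
  using v L'(1) y scal_closed[OF X y(2) v(2)] by (auto simp: X.M.minus_eq X.M.a_assoc X.M.r_neg)
 have "a \<in> K0" using v(2) c(3,4) submodule_sum_minus[OF L Cons.prems(3) c(3) v(3)] by (simp add: K0_def)
 then obtain bs where bs: "set bs \<subseteq> K0 \<inter> carrier B" "a \<in> lspan A\<^sub>S (carrier A) bs"
  using G K0 unfolding coinvariants_generate_def by blast
 \<comment> \<open>If yb = k' + l with k' in K and l in L, then l is coinvariant modulo K. For a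
   lift w of l in the B-span of the other generators, yb - w is a coinvariant in K.\<close>
 have gen: "\<exists>z\<in>K \<inter> sco X. \<exists>w\<in>?L. ?f b = z \<oplus>\<^sub>X w" if b: "b \<in> K0" "b : B" for b
 proof -
  obtain k' l where kl: "?f b = k' \<oplus>\<^sub>X l" "k' \<in> K" "l \<in> ?L" using b(1) by (auto simp: K0_def submodule_sum_def)
  have klc: "k' : X" "l : X" using kl K(1) L'(1) by auto
  have fb: "?f b : X" "?f b \<in> sco X" using scal_closed[OF X y(2) B_A[OF b(2)]] sco_scal[OF X y(1) b(2)] by auto
  have l: "l = ?f b \<ominus>\<^sub>X k'" using klc by (simp add: kl(1) X.M.minus_eq X.M.a_comm[of k' l] X.M.a_assoc X.M.r_neg)
  have "l \<in> mco X K"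
   by (subst l) (intro mco_add(2)[OF X Cons.prems(1)] sco_mco[OF X Cons.prems(1)] fb(2) mco_sub[OF X Cons.prems(1) kl(2)])
  then obtain w where w: "w \<in> lspan X (carrier B) ys" "l \<ominus>\<^sub>X w \<in> K"
   using lift_coinvariant[OF Cons.prems(1) ys(1) kl(3)] by blast
  have ws: "w \<in> sco X" by (rule lspan_sco[OF X ys(1) w(1)])
  have wL: "w \<in> ?L"
  proof -
   have "lspan X (carrier B) zs \<subseteq> lspan X (carrier A) zs" for zs by (induction zs) (use B_subset in auto)
   then show ?thesis using w(1) by blast
  qed
  have wc: "w : X" using ws sco_subset[OF X] by blast
  have "?f b \<ominus>\<^sub>X w = k' \<oplus>\<^sub>X (l \<ominus>\<^sub>X w)" using klc wc by (simp add: kl(1) X.M.minus_eq X.M.a_assoc)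
  then have "?f b \<ominus>\<^sub>X w \<in> K" using K(3)[OF kl(2) w(2)] by simp
  moreover have "?f b \<ominus>\<^sub>X w \<in> sco X"
  proof -
   have 0: "right_submodule {\<zero>\<^sub>X} S X" by (rule right_submoduleI[OF X]) (simp_all add: X.zero_rsmult)
   show ?thesis using mco_add(2)[OF X 0] fb(2) ws mco_zero[OF X] by blast
  qed
  moreover have "?f b = (?f b \<ominus>\<^sub>X w) \<oplus>\<^sub>X w" using fb(1) wc by (simp add: X.M.minus_eq X.M.a_assoc X.M.l_neg)
  ultimately show ?thesis using wL by blast
 qed
 have "\<exists>zs t l. set zs \<subseteq> K \<inter> sco X \<and> t \<in> lspan X (carrier A) zs \<and> l \<in> ?L \<and> ?f a = t \<oplus>\<^sub>X l"
  using bs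
 proof (induction bs arbitrary: a)
  case Nil
  then show ?case using L'(2) scal_facts(5)[OF X y(2)] by (intro exI[of _ "[]"]) auto
 next
  case (Cons b bs)
  obtain d r where a: "a = (b \<star>\<^bsub>A\<^sub>S\<^esub> scal d) \<oplus>\<^sub>A r" "d : A" "r \<in> lspan A\<^sub>S (carrier A) bs" using Cons.prems(2) by auto
  have b: "b \<in> K0" "b : B" using Cons.prems(1) by auto
  have bd: "b \<star>\<^bsub>A\<^sub>S\<^esub> scal d = b \<otimes>\<^sub>A d" using dual_act_scal[OF comodule_AC, of b d] B_A[OF b(2)] a(2) by simp
  have r: "r : A" using lspan_closed[OF right_S_A _ order_refl a(3)] Cons.prems(1) B_A by auto
  obtain zs t l where z: "set zs \<subseteq> K \<inter> sco X" "t \<in> lspan X (carrier A) zs" "l \<in> ?L" "?f r = t \<oplus>\<^sub>X l"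
   using Cons.IH[OF _ a(3)] Cons.prems(1) by auto
  obtain z w where zw: "z \<in> K \<inter> sco X" "w \<in> ?L" "?f b = z \<oplus>\<^sub>X w" using gen[OF b] by blast
  have cc: "z : X" "w : X" "t : X" "l : X"
   using zw z L'(1) sco_subset[OF X] lspan_closed[OF X _ order_refl z(2)] by auto
  have wd: "w \<star>\<^sub>X scal d \<in> ?L" using L'(6)[OF zw(2) scal_S[OF a(2)]] .
  have "?f a = (?f b \<star>\<^sub>X scal d) \<oplus>\<^sub>X ?f r"
   using a(2) b r y(2) B_A[OF b(2)] unfolding a(1) bd by (simp add: scal_facts[OF X])
  also have "\<dots> = ((z \<star>\<^sub>X scal d) \<oplus>\<^sub>X t) \<oplus>\<^sub>X ((w \<star>\<^sub>X scal d) \<oplus>\<^sub>X l)"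
   using cc a(2) by (simp add: zw(3) z(4) scal_facts(6)[OF X] scal_closed[OF X] X.M.a_ac)
  finally show ?case
   using z zw a(2) wd by (intro exI[of _ "z # zs"] exI[of _ "(z \<star>\<^sub>X scal d) \<oplus>\<^sub>X t"] exI[of _ "(w \<star>\<^sub>X scal d) \<oplus>\<^sub>X l"])
    (auto intro: L'(3))
 qed
 then obtain zs t l where z: "set zs \<subseteq> K \<inter> sco X" "t \<in> lspan X (carrier A) zs" "l \<in> ?L" "?f a = t \<oplus>\<^sub>X l" by blast
 have zc: "set zs \<subseteq> carrier X" using z(1) K(1) by blast
 have tK: "t \<in> K"
  using z(1,2)
 proof (induction zs arbitrary: t)
  case (Cons z zs)
  then show ?case by (auto intro!: K(3) K(6) scal_S)
 qed (use K(2) in simp)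
 have tl: "t : X" "l : X" using tK K(1) z(3) L'(1) by auto
 \<comment> \<open>The part \<open>t\<close> spanned by coinvariants in K is subtracted; what is
   left lies in K and in the span of the remaining generators.\<close>
 have ls: "l \<oplus>\<^sub>X s = k \<ominus>\<^sub>X t" using tl c(2) by (simp add: v(1) z(4) X.M.minus_eq X.M.a_ac X.M.r_neg1 X.M.r_neg)
 obtain zs' where z': "set zs' \<subseteq> K \<inter> sco X" "l \<oplus>\<^sub>X s \<in> lspan X (carrier A) zs'"
  using Cons.IH[OF Cons.prems(1) ys(1), of "l \<oplus>\<^sub>X s"] L'(3)[OF z(3) v(3)] K(5)[OF Cons.prems(3) tK] ls by metis
 have zc': "set zs' \<subseteq> carrier X" using z'(1) K(1) by blast
 have "k = t \<oplus>\<^sub>X (l \<oplus>\<^sub>X s)" using tl c(2) by (simp add: v(1) z(4) X.M.a_assoc)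
 then have "k \<in> lspan X (carrier A) (zs @ zs')" using lspan_append[OF X zc zc' order_refl z(2) z'(2)] by simp
 then show ?case using z(1) z'(1) by (intro exI[of _ "zs @ zs'"]) auto
qed

end

end

section \<open>Unit and counit when coinvariants lift and generate\<close>

lemma right_submodule_self: "right_module R M ==> right_submodule (carrier M) R M"
proof -
 assume M: "right_module R M"
 then interpret right_module R M .
 show ?thesis by (rule right_submoduleI[OF M]) (simp_all add: rsmult_closed)
qed

context lp_coring begin

definition co_generated :: "('l, 'm, 'c => 'a, 'y) bimodule_scheme => bool" where
 "co_generated X \<longleftrightarrow> (\<forall>m\<in>carrier X. \<exists>ys. set ys \<subseteq> sco X \<and> m \<in> lspan X (carrier A) ys)"

lemma psi_surj:
 assumes M: "comodule A C M" and gen: "co_generated (dual_module M)"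
 shows "psi M ` carrier (coA M) = carrier M"
proof
 interpret T: tensor B "coM M" AA by (rule tensor_B[OF right_co[OF M]])
 interpret M: right_module A M by (rule comoduleD(1)[OF M])
 note psi = psi_additive[OF M, unfolded additive_map_def]
 show "psi M ` carrier (coA M) \<subseteq> carrier M" using psi by blast
 have "m \<in> psi M ` carrier (coA M)" if "set ys \<subseteq> co M" "m \<in> lspan (dual_module M) (carrier A) ys" for ys m
  using that
 proof (induction ys arbitrary: m)
  case Nil
  have "psi M \<zero>\<^bsub>T.T\<^esub> = \<zero>\<^sub>M" by (rule additive_zero[OF T.ab_T M.ab_M psi_additive[OF M]])
  then show ?case using Nil T.ab_T by (metis abelian_group.axioms(1) abelian_monoid.zero_closed dual_module_simps(2) imageI lspan.simps(1) singletonD)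
 next
  case (Cons y ys)
  obtain a s where m: "m = (y \<star>\<^bsub>dual_module M\<^esub> scal a) \<oplus>\<^sub>M s" "a : A" "s \<in> lspan (dual_module M) (carrier A) ys"
   using Cons.prems(2) by auto
  have y: "y \<in> co M" "y : M" using Cons.prems(1) coD(1) by auto
  obtain t where t: "t : T.T" "s = psi M t" using Cons.IH[OF _ m(3)] Cons.prems(1) by auto
  have p: "T.pt y a : T.T" using T.pure_closed[of y a] y(1) m(2) by simp
  have "psi M (T.pt y a \<oplus>\<^bsub>T.T\<^esub> t) = psi M (T.pt y a) \<oplus>\<^sub>M psi M t" using psi p t(1) by blast
  also have "\<dots> = m" using psi_pure[OF M y(1) m(2)] dual_act_scal[OF M y(2) m(2)] by (simp add: m(1) t(2))
  finally show ?case using p t(1) by (metis imageI T.ab_T abelian_group.axioms(1) abelian_monoid.a_closed)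
 qed
 then show "carrier M \<subseteq> psi M ` carrier (coA M)"
  using gen co_eq_sco[OF M] unfolding co_generated_def by (fastforce simp del: dual_module_simps(4))
qed

context
 fixes N :: "('l, 'n, 'a, 'y) bimodule_scheme"
 assumes N: "right_module B N"
begin

interpretation N: right_module B N by (rule N)
interpretation T: tensor B N AA by (rule tensor_B[OF N])
interpretation NA: right_module A "tensor_prod B N AA" by (rule right_NA[OF N])

abbreviation "dind \<equiv> dual_module (ind N)"

lemma dind: "right_module S dind"
 by (rule right_S_dual[OF comodule_ind[OF N]])

lemma dind_scal: "[|n : N; a : A|] ==> phi N n \<star>\<^bsub>dind\<^esub> scal a = T.pt n a"
proof -
 assume n: "n : N" and a: "a : A"
 have "phi N n \<star>\<^bsub>dind\<^esub> scal a = phi N n \<star>\<^bsub>tensor_prod B N AA\<^esub> a"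
  using dual_act_scal[OF comodule_ind[OF N] _ a, of "phi N n"] T.pure_closed[OF n] by simp
 also have "\<dots> = T.pt n a" using NA_mult[OF N n A.one_closed a] a by simp
 finally show ?thesis .
qed

lemma phi_sco: "n : N ==> phi N n \<in> sco dind"
 using unit_co[OF N] co_eq_sco[OF comodule_ind[OF N]] by simp

lemma phi_add: "[|n : N; n' : N|] ==> phi N (n \<oplus>\<^sub>N n') = phi N n \<oplus>\<^bsub>T.T\<^esub> phi N n'"
 by (simp add: T.pure_add_left)

lemma ind_span:
 assumes J: "right_submodule J B N" and t: "t : tensor_add B (N\<lparr>carrier := J\<rparr>) AA"
 shows "\<exists>ns. set ns \<subseteq> J \<and> tmap B (N\<lparr>carrier := J\<rparr>) N AA (\<lambda>n. n) t \<in> lspan dind (carrier A) (map (phi N) ns)"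
proof -
 let ?J = "N\<lparr>carrier := J\<rparr>" and ?i = "tmap B (N\<lparr>carrier := J\<rparr>) N AA (\<lambda>n. n)"
 note J' = right_submoduleD[OF J]
 interpret TJ: tensor B ?J AA by (rule tensor_B[OF submodule_module[OF N J]])
 have il: "right_linear B ?J N (\<lambda>n. n)" by (rule right_linearI) (use J'(1) in auto)
 note i = tmap_additive[OF TJ.ax T.ax il]
 show ?thesis using t
 proof (induction rule: TJ.induct)
  case (pure n a)
  then have n: "n : N" "a : A" using J'(1) by auto
  have "?i (TJ.pt n a) = (phi N n \<star>\<^bsub>dind\<^esub> scal a) \<oplus>\<^bsub>dind\<^esub> \<zero>\<^bsub>dind\<^esub>"
   using tmap_pure[OF TJ.ax T.ax il pure] dind_scal[OF n]
    abelian_monoid.r_zero[OF abelian_group.axioms(1)[OF T.ab_T] T.pure_closed[OF n(1)], of a] n(2) by simp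
  then show ?case using pure n(2) by (intro exI[of _ "[n]"]) (auto simp del: dual_module_simps(4))
 next
  case (add t u)
  then obtain ns ns' where *: "set ns \<subseteq> J" "?i t \<in> lspan dind (carrier A) (map (phi N) ns)"
   "set ns' \<subseteq> J" "?i u \<in> lspan dind (carrier A) (map (phi N) ns')" by blast
  have "set (map (phi N) l) \<subseteq> carrier dind" if "set l \<subseteq> J" for l
   using that J'(1) T.pure_closed by auto
  then have "?i t \<oplus>\<^bsub>dind\<^esub> ?i u \<in> lspan dind (carrier A) (map (phi N) ns @ map (phi N) ns')"
   using * by (intro lspan_append[OF dind]) auto
  then show ?case
   using * add(1,2) i by (intro exI[of _ "ns @ ns'"]) (auto simp: additive_map_def)
 qed
qed

lemma ind_span_all:
 assumes t: "t : T.T"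
 shows "\<exists>ns. set ns \<subseteq> carrier N \<and> t \<in> lspan dind (carrier A) (map (phi N) ns)"
 using ind_span[OF right_submodule_self[OF N], of t] tensor_map_ident[OF T.ax t] t by simp

text \<open>Lifting modulo 0 lets the coefficients be taken in B, and (n \<otimes> 1)b + n'
  \<otimes> 1 = (nb + n') \<otimes> 1 collects the combination into a single element of J.\<close>

lemma ind_lift:
 assumes Q: lifts_coinvariants and J: "right_submodule J B N"
  and t: "t \<in> sco dind" "set ns \<subseteq> J" "t \<in> lspan dind (carrier A) (map (phi N) ns)"
 shows "\<exists>n\<in>J. t = phi N n"
proof -
 note J' = right_submoduleD[OF J]
 interpret X: right_module S dind by (rule dind)
 have z: "right_submodule {\<zero>\<^bsub>dind\<^esub>} S dind"
  by (rule right_submoduleI[OF dind]) (use X.zero_rsmult X.M.zero_closed X.M.l_zero[OF X.M.zero_closed] in \<open>auto simp del: dual_module_simps\<close>)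
 have ns: "set (map (phi N) ns) \<subseteq> sco dind" using t(2) J'(1) phi_sco by auto
 have "t \<in> mco dind {\<zero>\<^bsub>dind\<^esub>}" using t(1) mco_zero[OF dind] by blast
 then obtain w where w: "w \<in> lspan dind (carrier B) (map (phi N) ns)" "t \<ominus>\<^bsub>dind\<^esub> w \<in> {\<zero>\<^bsub>dind\<^esub>}"
  using lift_coinvariant[OF dind Q z ns t(3)] by blast
 have "w \<in> sco dind" by (rule lspan_sco[OF dind ns w(1)])
 then have "t = w" using w(2) t(1) minus_zero_iff[OF X.ab_M] sco_subset[OF dind] by blast
 moreover have "w \<in> lspan dind (carrier B) (map (phi N) l) ==> set l \<subseteq> J ==> \<exists>n\<in>J. w = phi N n" for w l
 proof (induction l arbitrary: w)
  case Nil
  have "phi N \<zero>\<^sub>N = \<zero>\<^bsub>dind\<^esub>" using T.pure_zero_left[of "\<one>\<^sub>A"] by simp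
  then show ?case using Nil J'(2) by auto
 next
  case (Cons n l)
  obtain b s where *: "w = (phi N n \<star>\<^bsub>dind\<^esub> scal b) \<oplus>\<^bsub>dind\<^esub> s" "b : B" "s \<in> lspan dind (carrier B) (map (phi N) l)"
   using Cons.prems(1) by (auto simp del: dual_module_simps(4))
  obtain n' where n': "n' \<in> J" "s = phi N n'" using Cons.IH[OF *(3)] Cons.prems(2) by auto
  have n: "n \<in> J" "n : N" "n' : N" "n \<star>\<^sub>N b : N" using Cons.prems(2) J'(1) n'(1) N.rsmult_closed[OF _ *(2)] by auto
  have "phi N n \<star>\<^bsub>dind\<^esub> scal b = phi N (n \<star>\<^sub>N b)"
   using dind_scal[OF n(2) B_A[OF *(2)]] T.pure_balanced[OF n(2) *(2), of "\<one>\<^sub>A"] B_A[OF *(2)] by simp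
  then have "w = phi N ((n \<star>\<^sub>N b) \<oplus>\<^sub>N n')" using phi_add[OF n(4,3)] *(1) n'(2) by simp
  then show ?case using J'(3)[OF J'(6)[OF n(1) *(2)] n'(1)] by blast
 qed
 ultimately show ?thesis using w(1) t(2) by blast
qed

lemma unit_surj:
 assumes Q: lifts_coinvariants
 shows "phi N ` carrier N = co (ind N)"
proof
 have J: "right_submodule (carrier N) B N" by (rule right_submodule_self[OF N])
 show "phi N ` carrier N \<subseteq> co (ind N)" using unit_co[OF N] by blast
 show "co (ind N) \<subseteq> phi N ` carrier N"
 proof
  fix t assume t: "t \<in> co (ind N)"
  then have tc: "t : T.T" using coD(1)[OF t] by simp
  obtain ns where ns: "set ns \<subseteq> carrier N" "t \<in> lspan dind (carrier A) (map (phi N) ns)"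
   using ind_span_all[OF tc] by blast
  have "t \<in> sco dind" using t co_eq_sco[OF comodule_ind[OF N]] by simp
  then show "t \<in> phi N ` carrier N" using ind_lift[OF Q J _ ns] by blast
 qed
qed

end

text \<open>Coordinates are B-linear with values in B, so u \<otimes> a \<mapsto> u_i a is a
  well-defined map to A; it sends v \<otimes> 1 to v_i.\<close>

lemma coordinate_inj:
 fixes N :: "('l, 'i => 'a, 'a, 'y) bimodule_scheme"
 assumes N: "right_module B N" and "carrier N \<subseteq> I \<rightarrow>\<^sub>E carrier B"
  "!!v w i. i \<in> I ==> (v \<oplus>\<^sub>N w) i = v i \<oplus>\<^sub>B w i" "!!v b i. i \<in> I ==> (v \<star>\<^sub>N b) i = v i \<otimes>\<^sub>B b"
  and v: "v : N" "w : N" "phi N v = phi N w"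
 shows "v = w"
proof -
 interpret T: tensor B N AA by (rule tensor_B[OF N])
 have "v i = w i" if i: "i \<in> I" for i
 proof -
  have c: "u i : A" if "u : N" for u using assms(2) that i B_A by blast
  have "balanced B N AA A (\<lambda>u a. u i \<otimes>\<^sub>A a)"
   by (rule balancedI) (use c assms(3,4) i B_A in \<open>auto simp: A.l_distr A.r_distr A.m_assoc\<close>)
  note lift = T.lift_pure[OF A.abelian_group_axioms this]
  show ?thesis using lift[OF v(1), of "\<one>\<^sub>A"] lift[OF v(2), of "\<one>\<^sub>A"] v(3) c[OF v(1)] c[OF v(2)] by simp
 qed
 moreover have "v \<in> extensional I" "w \<in> extensional I" using assms(2) v(1,2) by (auto simp: PiE_def)
 ultimately show ?thesis by (rule extensionalityI[rotated 2])
qed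

text \<open>Cover N by a free module \<open>Fr\<close>, whose unit is injective by coordinates. If n
  = f(v) and n \<otimes> 1 = 0, right exactness puts v \<otimes> 1 into the image of K \<otimes> A,
  where K is the kernel of f. Being coinvariant, it is k \<otimes> 1 with k in K by
  \<open>ind_lift\<close>, so v = k and n = 0.\<close>

lemma unit_inj:
 fixes N :: "('l, 'n, 'a, 'y) bimodule_scheme"
 assumes Q: lifts_coinvariants and N: "right_module B N"
 shows "inj_on (phi N) (carrier N)"
proof -
 interpret N: right_module B N by (rule N)
 interpret T: tensor B N AA by (rule tensor_B[OF N])
 define Fr where "Fr = direct_sum (carrier N) (regular B)"
 have mod: "right_module B Fr" unfolding Fr_def
  by (rule right_module_direct_sum[OF bimoduleD(2)[OF bimodule_regular[OF ring_B]]])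
 obtain f where f: "right_linear B Fr N f" "f ` carrier Fr = carrier N"
  by (rule obtain_free_cover[OF N, folded Fr_def]) (rule that; assumption)
 have sub: "carrier Fr \<subseteq> carrier N \<rightarrow>\<^sub>E carrier B" by (auto simp: Fr_def)
 note Fr = mod f sub
 have Fr': "!!v w m. m : N ==> (v \<oplus>\<^bsub>Fr\<^esub> w) m = v m \<oplus>\<^sub>B w m"
  "!!v a m. m : N ==> (v \<star>\<^bsub>Fr\<^esub> a) m = v m \<otimes>\<^sub>B a"
  by (simp_all add: Fr_def)
 interpret TF: tensor B Fr AA by (rule tensor_B[OF Fr(1)])
 let ?K = "{v \<in> carrier Fr. f v = \<zero>\<^sub>N}"
 have K: "right_submodule ?K B Fr" by (rule right_submodule_kernel[OF Fr(1) N Fr(2)])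
 have add: "additive_map N T.T (phi N)"
  using phi_add[OF N] T.pure_closed by (simp add: additive_map_def)
 show ?thesis
 proof (rule additive_inj[OF N.ab_M T.ab_T add])
  fix n assume n: "n : N" "phi N n = \<zero>\<^bsub>T.T\<^esub>"
  obtain v where v: "v : Fr" "n = f v" using n(1) Fr(3) by blast
  have "tmap B Fr N AA f (phi Fr v) = \<zero>\<^bsub>T.T\<^esub>"
   using tmap_pure[OF TF.ax T.ax Fr(2) v(1), of "\<one>\<^sub>A"] n(2) v(2) by simp
  then obtain s where s: "s : tensor_add B (Fr\<lparr>carrier := ?K\<rparr>) AA"
   "tmap B (Fr\<lparr>carrier := ?K\<rparr>) Fr AA (\<lambda>m. m) s = phi Fr v"
   using tensor_right_exact[OF Fr(1) N left_B_AA Fr(2,3), of "phi Fr v"] TF.pure_closed[OF v(1)] by auto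
  obtain ns where ns: "set ns \<subseteq> ?K" "phi Fr v \<in> lspan (dual_module (ind Fr)) (carrier A) (map (phi Fr) ns)"
   using ind_span[OF Fr(1) K s(1)] s(2) by auto
  obtain k where k: "k \<in> ?K" "phi Fr v = phi Fr k"
   using ind_lift[OF Fr(1) Q K phi_sco[OF Fr(1) v(1)] ns] by blast
  have "v = k"
   by (rule coordinate_inj[OF Fr(1,4) Fr' v(1) _ k(2)]) (use k(1) in auto)
  then show "n = \<zero>\<^sub>N" using k(1) v(2) by simp
 qed
qed

lemma psi_inj:
 assumes Q: lifts_coinvariants and G: coinvariants_generate and M: "comodule A C M"
 shows "inj_on (psi M) (carrier (coA M))"
proof -
 interpret M: right_module A M by (rule comoduleD(1)[OF M])
 have N: "right_module B (coM M)" by (rule right_co[OF M])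
 interpret T: tensor B "coM M" AA by (rule tensor_B[OF N])
 let ?X = "dual_module (ind (coM M))"
 note X = dind[OF N] and indN = comodule_ind[OF N]
 have lin: "right_linear S ?X (dual_module M) (psi M)"
  using S_linear_iff_colinear[OF indN M] psi_colinear[OF M] by blast
 let ?K = "{t \<in> carrier ?X. psi M t = \<zero>\<^bsub>dual_module M\<^esub>}"
 have K: "right_submodule ?K S ?X" by (rule right_submodule_kernel[OF X right_S_dual[OF M] lin])
 show ?thesis
 proof (rule additive_inj[OF T.ab_T M.ab_M psi_additive[OF M]])
  fix t assume t: "t : T.T" "psi M t = \<zero>\<^sub>M"
  then have tK: "t \<in> ?K" by simp
  obtain ns where ns: "set ns \<subseteq> carrier (coM M)" "t \<in> lspan ?X (carrier A) (map (phi (coM M)) ns)"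
   using ind_span_all[OF N t(1)] by blast
  have nss: "set (map (phi (coM M)) ns) \<subseteq> sco ?X" using ns(1) phi_sco[OF N] by auto
  obtain zs where zs: "set zs \<subseteq> ?K \<inter> sco ?X" "t \<in> lspan ?X (carrier A) zs"
   using generate_coinvariant[OF X Q G K nss tK ns(2)] by blast
  have z0: "z = \<zero>\<^bsub>?X\<^esub>" if z: "z \<in> ?K \<inter> sco ?X" for z
  proof -
   have "z \<in> co (ind (coM M))" using z co_eq_sco[OF indN] by simp
   then obtain n where n: "n \<in> co M" "z = phi (coM M) n"
    using unit_surj[OF N Q] by auto
   have "n = \<zero>\<^sub>M" using psi_pure[OF M n(1) A.one_closed] M.rsmult_one[OF coD(1)[OF n(1)]] z n(2) by simp
   then show ?thesis using n(2) T.pure_zero_left[of "\<one>\<^sub>A"] by simp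
  qed
  interpret X: right_module S ?X by (rule X)
  have "t = \<zero>\<^bsub>?X\<^esub>" using zs
  proof (induction zs arbitrary: t)
   case (Cons z zs)
   have z: "z = \<zero>\<^bsub>?X\<^esub>" using z0 Cons.prems(1) by (simp only: list.set insert_subset)
   obtain a s where as: "t = (z \<star>\<^bsub>?X\<^esub> scal a) \<oplus>\<^bsub>?X\<^esub> s" "a : A" "s \<in> lspan ?X (carrier A) zs"
    using Cons.prems(2) by (auto simp del: dual_module_simps)
   have "s = \<zero>\<^bsub>?X\<^esub>" by (rule Cons.IH[OF _ as(3)]) (use Cons.prems(1) in simp)
   then show ?case using X.zero_rsmult[OF scal_S[OF as(2)]] X.M.l_zero[OF X.M.zero_closed] by (simp only: as(1) z)
  qed (simp only: lspan.simps singleton_iff)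
  then show "t = \<zero>\<^bsub>T.T\<^esub>" by simp
 qed
qed

theorem strong_structureI:
 assumes Q: lifts_coinvariants and G: coinvariants_generate
  and gen: "!!M :: (unit, 'u, 'a, 'c) comodule. comodule A C M ==> co_generated (dual_module M)"
 shows "strong_structure_theorem TYPE('u) A C x"
 unfolding strong_structure_iff bij_betw_def
 by (intro conjI allI impI psi_inj[OF Q G] psi_surj gen unit_inj[OF Q] unit_surj[OF _ Q])

end

section \<open>Quasiprojectivity and generation in terms of coinvariants\<close>

lemma subgenerated_byI:
 fixes X :: "(unit, 'u, 'r) bimodule" and G :: "(unit, 'u, 'r) bimodule"
 assumes X: "right_module T X" and G: "right_module T G" "G \<in> generated_by T W"
  and f: "right_linear T X G f" "inj_on f (carrier X)"
 shows "X \<in> subgenerated_by T W"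
proof -
 let ?K = "f ` carrier X" and ?g = "inv_into (carrier X) f"
 have K: "right_submodule ?K T G" by (rule right_submodule_image[OF X G(1) f(1)])
 have r: "right_linear T X (G\<lparr>carrier := ?K\<rparr>) f"
  using right_linearD[OF f(1)] by (intro right_linearI) auto
 have g: "?g n : X" "f (?g n) = n" if "n : G\<lparr>carrier := ?K\<rparr>" for n
  using that inv_into_into[of n f "carrier X"] f_inv_into_f[of n f "carrier X"] by auto
 have gf: "?g (f m) = m" if "m : X" for m by (rule inv_into_f_f[OF f(2) that])
 have l: "right_linear T (G\<lparr>carrier := ?K\<rparr>) X ?g"
  by (rule right_linear_inverse[OF X r g gf])
 note KM = submodule_module[OF G(1) K]
 have "right_iso T X (G\<lparr>carrier := ?K\<rparr>) (restrict f (carrier X))"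
  unfolding right_iso_def
 proof (intro conjI bexI)
  show "restrict f (carrier X) \<in> right_hom T X (G\<lparr>carrier := ?K\<rparr>)"
   using right_linear_restrict[OF X, of "G\<lparr>carrier := ?K\<rparr>" f] r by (simp add: right_hom_def)
  show "restrict ?g (carrier (G\<lparr>carrier := ?K\<rparr>)) \<in> right_hom T (G\<lparr>carrier := ?K\<rparr>) X"
   using right_linear_restrict[OF KM, of X ?g] l unfolding right_hom_def by blast
  show "\<forall>m\<in>carrier X. restrict ?g (carrier (G\<lparr>carrier := ?K\<rparr>)) (restrict f (carrier X) m) = m"
   using gf by simp
  show "\<forall>n\<in>carrier (G\<lparr>carrier := ?K\<rparr>). restrict f (carrier X) (restrict ?g (carrier (G\<lparr>carrier := ?K\<rparr>)) n) = n"
   using g by simp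
 qed
 then show ?thesis unfolding subgenerated_by_def using X G(2) K by blast
qed

context lp_coring begin

lemma lspan_carrier [simp]: "lspan (X\<lparr>carrier := K\<rparr>) D ys = lspan X D ys"
 by (induction ys) simp_all

lemma lspan_image:
 assumes "right_linear S X Y f" "right_module S X" "set ys \<subseteq> carrier X" "v \<in> lspan X (carrier A) ys" "right_module S Y"
 shows "f v \<in> lspan Y (carrier A) (map f ys)"
 using assms(3,4)
proof (induction ys arbitrary: v)
 case Nil
 then show ?case
  using additive_zero[OF right_moduleD(2)[OF assms(2)] right_moduleD(2)[OF assms(5)] right_linearD(1)[OF assms(1)]] by simp
next
 case (Cons y ys)
 note f = right_linearD[OF assms(1)]
 obtain a s where v: "v = (y \<star>\<^sub>X scal a) \<oplus>\<^sub>X s" "a : A" "s \<in> lspan X (carrier A) ys" using Cons.prems(2) by auto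
 have c: "y : X" "s : X" "y \<star>\<^sub>X scal a : X"
  using Cons.prems(1) lspan_closed[OF assms(2) _ order_refl v(3)] scal_closed[OF assms(2) _ v(2)] by auto
 have "f v = (f y \<star>\<^sub>Y scal a) \<oplus>\<^sub>Y f s" using f(3)[OF c(3,2)] f(4)[OF c(1) scal_S[OF v(2)]] by (simp only: v(1))
 then show ?case using Cons.IH[OF _ v(3)] Cons.prems(1) v(2) by auto
qed

lemma sco_sub: "K \<subseteq> carrier X ==> sco (X\<lparr>carrier := K\<rparr>) = K \<inter> sco X"
 by (auto simp: sco_def)

lemma co_generated_image:
 assumes X: "right_module S X" "co_generated X" and Y: "right_module S Y"
  and f: "right_linear S X Y f" "f ` carrier X = carrier Y"
 shows "co_generated Y"
 unfolding co_generated_def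
proof
 fix m assume "m : Y"
 then obtain v where v: "v : X" "m = f v" using f(2) by blast
 obtain ys where ys: "set ys \<subseteq> sco X" "v \<in> lspan X (carrier A) ys" using X(2) v(1) unfolding co_generated_def by blast
 have "set (map f ys) \<subseteq> sco Y" using sco_image[OF Y X(1) f(1)] ys(1) by auto
 moreover have "m \<in> lspan Y (carrier A) (map f ys)"
  using lspan_image[OF f(1) X(1) _ ys(2) Y] ys(1) sco_subset[OF X(1)] v(2) by blast
 ultimately show "\<exists>ys. set ys \<subseteq> sco Y \<and> m \<in> lspan Y (carrier A) ys" by blast
qed

lemma co_generated_copy:
 assumes "right_copy S X Y \<phi> \<psi>"
 shows "co_generated X \<longleftrightarrow> co_generated Y"
proof -
 note c = right_copyD[OF assms]
 have "\<phi> ` carrier X = carrier Y" "\<psi> ` carrier Y = carrier X" using c(5-8) by force+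
 then show ?thesis
  using co_generated_image[OF c(1) _ c(2,3)] co_generated_image[OF c(2) _ c(1,4)] by blast
qed

lemma AS_scal: "[|a : A; d : A|] ==> a \<star>\<^bsub>A\<^sub>S\<^esub> scal d = a \<otimes>\<^sub>A d"
 using dual_act_scal[OF comodule_AC, of a d] by simp

lemma one_sco: "\<one>\<^sub>A \<in> sco A\<^sub>S"
 using one_B sco_A by blast

lemma S_hom_A:
 assumes X: "right_module S X" and f: "right_linear S A\<^sub>S X f"
 shows "f \<one>\<^sub>A \<in> sco X" "a : A ==> f a = f \<one>\<^sub>A \<star>\<^sub>X scal a"
proof -
 show "f \<one>\<^sub>A \<in> sco X" by (rule sco_image[OF X right_S_A f one_sco])
 show "f a = f \<one>\<^sub>A \<star>\<^sub>X scal a" if "a : A"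
  using right_linearD(4)[OF f, of "\<one>\<^sub>A" "scal a"] AS_scal[OF A.one_closed that] scal_S[OF that] that by (simp del: dual_module_simps(4))
qed

lemma generated_by_A:
 fixes X :: "('l, 'm, 'c => 'a) bimodule"
 assumes X: "right_module S X"
 shows "X \<in> generated_by S A\<^sub>S \<longleftrightarrow> co_generated X"
proof
 assume gen: "X \<in> generated_by S A\<^sub>S"
 show "co_generated X"
  unfolding co_generated_def
 proof
  fix m assume m: "m : X"
  show "\<exists>ys. set ys \<subseteq> sco X \<and> m \<in> lspan X (carrier A) ys"
  proof (rule generated_by_induct[OF right_S_A gen m])
   show "\<exists>ys. set ys \<subseteq> sco X \<and> \<zero>\<^sub>X \<in> lspan X (carrier A) ys" by (intro exI[of _ "[]"]) simp
   fix f w m assume f: "right_linear S A\<^sub>S X f" "w : A\<^sub>S" and "\<exists>ys. set ys \<subseteq> sco X \<and> m \<in> lspan X (carrier A) ys"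
   then obtain ys where ys: "set ys \<subseteq> sco X" "m \<in> lspan X (carrier A) ys" by blast
   have w: "w : A" using f(2) by simp
   show "\<exists>ys. set ys \<subseteq> sco X \<and> f w \<oplus>\<^sub>X m \<in> lspan X (carrier A) ys"
    using ys S_hom_A(1)[OF X f(1)] S_hom_A(2)[OF X f(1) w] w by (intro exI[of _ "f \<one>\<^sub>A # ys"]) auto
  qed
 qed
next
 assume gen: "co_generated X"
 have "m \<in> gen_span S A\<^sub>S X" if "set ys \<subseteq> sco X" "m \<in> lspan X (carrier A) ys" for ys m
  using that
 proof (induction ys arbitrary: m)
  case (Cons y ys)
  then obtain a s where m: "m = (y \<star>\<^sub>X scal a) \<oplus>\<^sub>X s" "a : A" "s \<in> lspan X (carrier A) ys" by auto
  have "s \<in> gen_span S A\<^sub>S X" using Cons.IH[OF _ m(3)] Cons.prems(1) by simp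
  then show ?case
   using gen_span_add[OF right_S_A sco_hom[OF X, of y], of a s] Cons.prems(1) m(2) by (simp add: m(1))
 qed (simp add: gen_span.zero)
 then show "X \<in> generated_by S A\<^sub>S"
  using gen unfolding co_generated_def by (intro generated_byI[OF right_S_A X]) blast
qed

lemma generates_submodules_iff: "generates_submodules S A\<^sub>S \<longleftrightarrow> coinvariants_generate"
proof -
 have "A\<^sub>S\<lparr>carrier := K\<rparr> \<in> generated_by S A\<^sub>S \<longleftrightarrow> (\<forall>k\<in>K. \<exists>bs. set bs \<subseteq> K \<inter> carrier B \<and> k \<in> lspan A\<^sub>S (carrier A) bs)"
  if "right_submodule K S A\<^sub>S" for K
  using generated_by_A[OF submodule_module[OF right_S_A that]] sco_sub[OF right_submoduleD(1)[OF that]]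
  by (simp add: co_generated_def sco_A del: dual_module_simps)
 then show ?thesis unfolding generates_submodules_def coinvariants_generate_def by blast
qed

lemma finitely_generated_A: "finitely_generated_right S A\<^sub>S"
 unfolding finitely_generated_right_def
proof (intro exI[of _ "{\<one>\<^sub>A}"] conjI allI impI)
 fix K assume K: "right_submodule K S A\<^sub>S \<and> {\<one>\<^sub>A} \<subseteq> K"
 have "a \<in> K" if "a : A" for a
  using right_submoduleD(6)[of K S A\<^sub>S "\<one>\<^sub>A" "scal a"] K AS_scal[OF A.one_closed that] scal_S[OF that] that by (simp del: dual_module_simps(4))
 then show "K = carrier A\<^sub>S" using right_submoduleD(1)[of K S A\<^sub>S] K by auto
qed simp_all

lemma mco_quotient:
 assumes X: "right_module S X" and K: "right_submodule K S X" and v: "v \<in> mco X K"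
 shows "K +>\<^sub>X v \<in> sco (quotient_module X K)"
proof -
 interpret X: right_module S X by (rule X)
 note q = right_linearD[OF quotient_right_module(2)[OF X K]]
 have vc: "v : X" using v by (simp add: mco_def)
 have "(K +>\<^sub>X v) \<star>\<^bsub>quotient_module X K\<^esub> g = (K +>\<^sub>X v) \<star>\<^bsub>quotient_module X K\<^esub> scal (g x)" if g: "g : S" for g
 proof -
  have "K +>\<^sub>X (v \<star>\<^sub>X g) = K +>\<^sub>X (v \<star>\<^sub>X scal (g x))"
   using quotient_eq_iff[OF X K X.rsmult_closed[OF vc g] X.rsmult_closed[OF vc scal_S[OF S_x[OF g]]]] v g
   by (simp add: mco_def)
  then show ?thesis using q(4)[OF vc g] q(4)[OF vc scal_S[OF S_x[OF g]]] by simp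
 qed
 then show ?thesis using q(2)[OF vc] by (simp add: sco_def)
qed

lemma quasiprojective_iff: "quasiprojective S A\<^sub>S \<longleftrightarrow> lifts_coinvariants"
proof
 interpret AS: right_module S "A\<^sub>S" by (rule right_S_A)
 assume qp: "quasiprojective S A\<^sub>S"
 show lifts_coinvariants unfolding lifts_coinvariants_def
 proof (intro allI impI ballI)
  fix K v assume K: "right_submodule K S A\<^sub>S" and v: "v \<in> mco A\<^sub>S K"
  let ?Q = "quotient_module A\<^sub>S K" and ?q = "\<lambda>a. K +>\<^bsub>A\<^sub>S\<^esub> a"
  note Q = quotient_right_module[OF right_S_A K]
  note sub = right_submodule.axioms(1)[OF K]
  have vc: "v : A\<^sub>S" using v by (simp add: mco_def)
  have qv: "?q v \<in> sco ?Q" by (rule mco_quotient[OF right_S_A K v])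
  \<comment> \<open>The class of v is coinvariant, so multiplying it by a is a homomorphism from A
    to A/K; a lift of this homomorphism sends 1 to the wanted b.\<close>
  let ?g = "\<lambda>a. ?q v \<star>\<^bsub>?Q\<^esub> scal a"
  have g: "restrict ?g (carrier A\<^sub>S) \<in> right_hom S A\<^sub>S ?Q" "restrict ?q (carrier A\<^sub>S) \<in> right_hom S A\<^sub>S ?Q"
   using right_linear_restrict[OF right_S_A, of ?Q ?g] right_linear_restrict[OF right_S_A, of ?Q ?q] sco_hom[OF Q(1) qv] Q(2)
   by (simp_all only: right_hom_def mem_Collect_eq restrict_extensional simp_thms)
  have "restrict ?q (carrier A\<^sub>S) ` carrier A\<^sub>S = carrier ?Q"
   using quotient_abelian_group(3)[OF AS.ab_M sub] by (simp del: dual_module_simps quotient_module_simps)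
  then have "\<exists>h\<in>right_hom S A\<^sub>S A\<^sub>S. \<forall>p\<in>carrier A\<^sub>S. restrict ?q (carrier A\<^sub>S) (h p) = restrict ?g (carrier A\<^sub>S) p"
   by (intro qp[unfolded quasiprojective_def, rule_format, OF conjI[OF K conjI[OF g(2) conjI[OF _ g(1)]]]])
  then obtain h where h: "h \<in> right_hom S A\<^sub>S A\<^sub>S" "\<forall>p\<in>carrier A\<^sub>S. restrict ?q (carrier A\<^sub>S) (h p) = restrict ?g (carrier A\<^sub>S) p"
   by blast
  have hl: "right_linear S A\<^sub>S A\<^sub>S h" using h(1) by (simp only: right_hom_def mem_Collect_eq)
  have b: "h \<one>\<^sub>A : B" using S_hom_A(1)[OF right_S_A hl] sco_A by blast
  have "?q (h \<one>\<^sub>A) = ?g \<one>\<^sub>A" using h(2)[rule_format, of "\<one>\<^sub>A"] B_A[OF b] by simp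
  also have "\<dots> = ?q v" using scal_facts(4)[OF Q(1)] qv sco_subset[OF Q(1)] by blast
  finally have "v \<ominus>\<^bsub>A\<^sub>S\<^esub> h \<one>\<^sub>A \<in> K" using quotient_eq_iff[OF right_S_A K vc, of "h \<one>\<^sub>A"] B_A[OF b] by (simp del: dual_module_simps(2-))
  then show "\<exists>b\<in>carrier B. v \<ominus>\<^sub>A b \<in> K" using b by (auto simp: a_minus_def a_inv_def m_inv_def)
 qed
next
 interpret AS: right_module S "A\<^sub>S" by (rule right_S_A)
 assume Q1: lifts_coinvariants
 show "quasiprojective S A\<^sub>S" unfolding quasiprojective_def
 proof (intro allI impI, elim conjE)
  fix K q g
  let ?Q = "quotient_module A\<^sub>S K"
  assume K: "right_submodule K S A\<^sub>S" and q: "q \<in> right_hom S A\<^sub>S ?Q" "q ` carrier A\<^sub>S = carrier ?Q" and g: "g \<in> right_hom S A\<^sub>S ?Q"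
  note Q = quotient_right_module(1)[OF right_S_A K]
  interpret Q: right_module S ?Q by (rule Q)
  have ql: "right_linear S A\<^sub>S ?Q q" and gl: "right_linear S A\<^sub>S ?Q g" using q(1) g by (simp_all only: right_hom_def mem_Collect_eq)
  note q' = right_linearD[OF ql] and g1 = S_hom_A[OF Q gl]
  \<comment> \<open>The epimorphism q is any map onto A/K, perhaps not the projection, so the
    lifting property is applied to its own kernel.\<close>
  let ?L = "{a \<in> carrier A\<^sub>S. q a = \<zero>\<^bsub>?Q\<^esub>}"
  have L: "right_submodule ?L S A\<^sub>S" by (rule right_submodule_kernel[OF right_S_A Q ql])
  obtain v where v: "v : A\<^sub>S" "q v = g \<one>\<^sub>A"
   using q(2) g1(1) sco_subset[OF Q] by (metis (no_types, lifting) image_iff subsetD)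
  have "v \<in> mco A\<^sub>S ?L"
  proof -
   have "(v \<star>\<^bsub>A\<^sub>S\<^esub> s) \<ominus>\<^bsub>A\<^sub>S\<^esub> (v \<star>\<^bsub>A\<^sub>S\<^esub> scal (s x)) \<in> ?L" if s: "s : S" for s
   proof -
    note c = AS.rsmult_closed[OF v(1) s] AS.rsmult_closed[OF v(1) scal_S[OF S_x[OF s]]]
    have "q ((v \<star>\<^bsub>A\<^sub>S\<^esub> s) \<ominus>\<^bsub>A\<^sub>S\<^esub> (v \<star>\<^bsub>A\<^sub>S\<^esub> scal (s x))) = \<zero>\<^bsub>?Q\<^esub>"
     using additive_minus[OF AS.ab_M Q.ab_M q'(1) c]
      q'(4)[OF v(1) s] q'(4)[OF v(1) scal_S[OF S_x[OF s]]] scoD(2)[OF Q g1(1) s] v(2)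
      minus_zero_iff[OF Q.ab_M q'(2)[OF c(2)] q'(2)[OF c(2)]] by (simp only:)
    then show ?thesis using AS.M.minus_closed[OF c] by blast
   qed
   then show ?thesis unfolding mco_def using v(1) by blast
  qed
  then obtain b where b: "b : B" "v \<ominus>\<^sub>A b \<in> ?L" using Q1 L unfolding lifts_coinvariants_def by blast
  have bs: "b \<in> sco A\<^sub>S" "b : A\<^sub>S" using b(1) sco_A B_A by auto
  have "v \<ominus>\<^bsub>A\<^sub>S\<^esub> b \<in> ?L" using b(2) by (simp add: a_minus_def a_inv_def m_inv_def)
  then have qb: "q b = g \<one>\<^sub>A"
   using additive_minus[OF AS.ab_M Q.ab_M q'(1) v(1) bs(2)] v(2)
    minus_zero_iff[OF Q.ab_M q'(2)[OF v(1)] q'(2)[OF bs(2)]] by (simp del: dual_module_simps quotient_module_simps)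
  let ?h = "\<lambda>a. b \<star>\<^bsub>A\<^sub>S\<^esub> scal a"
  have "q (?h p) = g p" if p: "p : A\<^sub>S" for p
   using q'(4)[OF bs(2) scal_S, of p] g1(2)[of p] p qb by (simp del: dual_module_simps(4) quotient_module_simps)
  then show "\<exists>h\<in>right_hom S A\<^sub>S A\<^sub>S. \<forall>p\<in>carrier A\<^sub>S. q (h p) = g p"
   using right_linear_restrict[OF right_S_A, of A\<^sub>S ?h] sco_hom[OF right_S_A bs(1)]
   by (intro bexI[of _ "restrict ?h (carrier A\<^sub>S)"]) (simp_all add: right_hom_def del: dual_module_simps(4))
 qed
qed

end

section \<open>From a weak generator to lifting and generation\<close>

context lp_coring begin

lemma rational_AS: "a : A\<^sub>S ==> rational A\<^sub>S a"
 using rational_dual[OF comodule_AC] by simp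

lemma small_AS: "small TYPE('u) A\<^sub>S"
 using small_A by simp

lemma minus_B: "[|b : B; b' : B|] ==> b \<ominus>\<^sub>A b' : B"
 using right_submoduleD(5)[OF co_submodule[OF comodule_AC], of b b']
 by (simp add: coinvariant_ring_def a_minus_def a_inv_def m_inv_def)

lemma add_B: "[|b : B; b' : B|] ==> b \<oplus>\<^sub>A b' : B"
 using right_submoduleD(3)[OF co_submodule[OF comodule_AC], of b b'] by (simp add: coinvariant_ring_def)

text \<open>Rationality passes to quotients, so X/K is again a comodule and has a copy over
  \<open>'u\<close>. The projection is described by surjectivity and fibres, which hides the
  cosets.\<close>

lemma obtain_quotient_comodule:
 assumes X: "right_module S X" and rat: "!!y. y : X ==> rational X y"
  and small: "small TYPE('u) X" and K: "right_submodule K S X"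
 obtains M :: "(unit, 'u, 'a, 'c) comodule" and p where "comodule A C M" "right_linear S X (dual_module M) p"
  "p ` carrier X = carrier M" "!!a b. [|a : X; b : X|] ==> p a = p b \<longleftrightarrow> a \<ominus>\<^sub>X b \<in> K"
proof -
 interpret X: right_module S X by (rule X)
 let ?Q = "quotient_module X K" and ?q = "\<lambda>a. K +>\<^sub>X a"
 note Q = quotient_right_module[OF X K]
 have im: "?q ` carrier X = carrier ?Q"
  using quotient_abelian_group(3)[OF X.ab_M right_submodule.axioms(1)[OF K]] .
 have "small TYPE('u) ?Q" using lepoll_trans[OF image_lepoll small, of ?q] im by simp
 moreover have "rational ?Q y" if "y : ?Q" for y
  using that im rational_image[OF X Q] rat by (metis (no_types, lifting) imageE)
 ultimately obtain M :: "(unit, 'u, 'a, 'c) comodule" and \<phi> \<psi>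
  where M: "comodule A C M" "right_copy S ?Q (dual_module M) \<phi> \<psi>"
  using rational_comodule_copy[OF Q(1)] by metis
 note c = right_copyD[OF M(2)]
 note qc = right_linearD(2)[OF Q(2)]
 show ?thesis
 proof (rule that[OF M(1) right_linear_comp[OF Q(2) c(3)]])
  have "\<phi> ` carrier ?Q = carrier M" using c(6-8) by (force simp del: quotient_module_simps)
  then show "(\<lambda>a. \<phi> (?q a)) ` carrier X = carrier M" unfolding im[symmetric] by (simp add: image_image)
  show "\<phi> (?q a) = \<phi> (?q b) \<longleftrightarrow> a \<ominus>\<^sub>X b \<in> K" if "a : X" "b : X" for a b
   using quotient_eq_iff[OF X K that] c(5)[OF qc[OF that(1)]] c(5)[OF qc[OF that(2)]] by metis
 qed
qed

lemma mco_image: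
 assumes X: "right_module S X" and p: "right_linear S X Y p" and v: "v \<in> mco X K"
  and K: "!!a b. [|a : X; b : X; a \<ominus>\<^sub>X b \<in> K|] ==> p a = p b"
 shows "p v \<in> sco Y"
proof -
 have vc: "v : X" using v by (simp add: mco_def)
 have "p v \<star>\<^sub>Y g = p v \<star>\<^sub>Y scal (g x)" if g: "g : S" for g
  using K[OF right_module.rsmult_closed[OF X vc g] right_module.rsmult_closed[OF X vc scal_S[OF S_x[OF g]]]]
   right_linearD(4)[OF p vc g] right_linearD(4)[OF p vc scal_S[OF S_x[OF g]]] v g by (simp add: mco_def)
 then show ?thesis using right_linearD(2)[OF p vc] by (simp add: sco_def)
qed

lemma A_generated: "co_generated A\<^sub>S"
 unfolding co_generated_def
proof
 fix a assume a: "a : A\<^sub>S"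
 have "a = (\<one>\<^sub>A \<star>\<^bsub>A\<^sub>S\<^esub> scal a) \<oplus>\<^bsub>A\<^sub>S\<^esub> \<zero>\<^bsub>A\<^sub>S\<^esub>" using AS_scal[OF A.one_closed, of a] a by (simp del: dual_module_simps(4))
 then show "\<exists>ys. set ys \<subseteq> sco A\<^sub>S \<and> a \<in> lspan A\<^sub>S (carrier A) ys"
  using one_sco a by (intro exI[of _ "[\<one>\<^sub>A]"]) auto
qed

lemma coinvariant_span_submodule:
 assumes X: "right_module S X" and Y: "Y \<subseteq> sco X"
 shows "right_submodule {v \<in> carrier X. \<exists>ys. set ys \<subseteq> Y \<and> v \<in> lspan X (carrier A) ys} S X"
proof (rule right_submoduleI[OF X])
 interpret X: right_module S X by (rule X)
 let ?J = "{v \<in> carrier X. \<exists>ys. set ys \<subseteq> Y \<and> v \<in> lspan X (carrier A) ys}"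
 show "\<zero>\<^sub>X \<in> ?J" by (auto intro!: exI[of _ "[]"])
 fix u assume u: "u \<in> ?J"
 then obtain ys where ys: "set ys \<subseteq> Y" "u \<in> lspan X (carrier A) ys" by blast
 show "u \<star>\<^sub>X g \<in> ?J" if "g : S" for g
  using right_submoduleD(6)[OF lspan_submodule[OF X] ys(2) that] ys(1) Y u that by (auto intro!: X.rsmult_closed)
 show "u \<oplus>\<^sub>X v \<in> ?J" if v: "v \<in> ?J" for v
 proof -
  obtain zs where zs: "set zs \<subseteq> Y" "v \<in> lspan X (carrier A) zs" using v by blast
  have "set ys \<subseteq> carrier X" "set zs \<subseteq> carrier X" using ys(1) zs(1) Y sco_subset[OF X] by auto
  then have "u \<oplus>\<^sub>X v \<in> lspan X (carrier A) (ys @ zs)" by (rule lspan_append[OF X _ _ order_refl ys(2) zs(2)])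
  then show ?thesis using u v ys(1) zs(1) by (auto intro!: exI[of _ "ys @ zs"])
 qed
qed blast

text \<open>Injectivity of \<Psi> is available for comodules spanned by coinvariants; below it is
  applied to the quotients of A, which are spanned by the class of 1.\<close>

context
 assumes wg: "weak_generator TYPE('u) B AA"
  and inj: "!!M :: (unit, 'u, 'a, 'c) comodule. [|comodule A C M; co_generated (dual_module M)|] ==>
   inj_on (psi M) (carrier (coA M))"
begin

text \<open>For m coinvariant and a in A, ma = p(c) = p(1)c for some c, and injectivity of \<Psi>
  gives m \<otimes> a = p(1) \<otimes> c. So p(B) \<otimes> A maps onto co M \<otimes> A, and since
  A is a weak generator, p(B) = co M.\<close>

lemma quotient_lift:
 fixes M :: "(unit, 'u, 'a, 'c) comodule"
 assumes M: "comodule A C M" and p: "right_linear S A\<^sub>S (dual_module M) p" "p ` carrier A = carrier M"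
 shows "co M = p ` carrier B"
proof -
 have col: "colinear A C AC M p" using p(1) S_linear_iff_colinear[OF comodule_AC M] by blast
 have gen: "co_generated (dual_module M)"
  by (rule co_generated_image[OF right_S_A A_generated right_S_dual[OF M] p(1)]) (use p(2) in simp)
 note inj' = inj_onD[OF inj[OF M gen]]
 let ?P = "coM M" and ?I = "p ` carrier B"
 have P: "right_module B ?P" and PA: "right_module B (coM AC)" using right_co M comodule_AC by blast+
 have cAC: "carrier (coM AC) = carrier B" by (simp add: coinvariant_ring_def)
 have I: "right_submodule ?I B ?P"
  using right_submodule_image[OF PA P colinear_coM[OF comodule_AC M col]] by (simp only: cAC)
 note I' = right_submoduleD[OF I]
 interpret T: tensor B ?P AA by (rule tensor_B[OF P])
 interpret TI: tensor B "?P\<lparr>carrier := ?I\<rparr>" AA by (rule tensor_B[OF submodule_module[OF P I]])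
 have il: "right_linear B (?P\<lparr>carrier := ?I\<rparr>) ?P (\<lambda>m. m)" by (rule right_linearI) (use I'(1) in auto)
 have p1: "p \<one>\<^sub>A \<in> co M" "p \<one>\<^sub>A \<in> ?I" using colinear_from_A(1)[OF M col] one_B by blast+
 have "?I = carrier ?P"
 proof (rule weak_generator_eq[OF wg P left_B_AA _ I])
  show "small TYPE('u) ?P" by (rule subset_imp_lepoll) simp
  fix m a assume ma: "m : ?P" "a : AA"
  have m: "m \<in> co M" "m : M" and a: "a : A" using ma coD(1) by auto
  obtain c where c: "c : A" "m \<star>\<^sub>M a = p c"
   using p(2) right_module.rsmult_closed[OF comoduleD(1)[OF M] m(2) a] by blast
  have "psi M (T.pt (p \<one>\<^sub>A) c) = psi M (T.pt m a)"
   using psi_pure[OF M m(1) a] psi_pure[OF M p1(1) c(1)] colinear_from_A(2)[OF M col c(1)] c(2) by simp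
  moreover have "T.pt (p \<one>\<^sub>A) c : T.T" "T.pt m a : T.T"
   using T.pure_closed[OF ma] T.pure_closed[of "p \<one>\<^sub>A" c] p1(1) c(1) by simp_all
  ultimately have eq: "T.pt (p \<one>\<^sub>A) c = T.pt m a" by (rule inj')
  show "\<exists>s\<in>carrier TI.T. tmap B (?P\<lparr>carrier := ?I\<rparr>) ?P AA (\<lambda>p. p) s = T.pt m a"
   using tmap_pure[OF TI.ax T.ax il, of "p \<one>\<^sub>A" c] p1(2) c(1) TI.pure_closed[of "p \<one>\<^sub>A" c]
   by (intro bexI[of _ "TI.pt (p \<one>\<^sub>A) c"]) (simp_all add: eq)
 qed
 then show ?thesis by simp
qed

text \<open>Coinvariance modulo K says that the class in A/K is coinvariant, so
  \<open>quotient_lift\<close> for A/K yields the lift.\<close>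

lemma weak_generator_lifts: lifts_coinvariants
 unfolding lifts_coinvariants_def
proof (intro allI impI ballI)
 fix K v assume K: "right_submodule K S A\<^sub>S" and v: "v \<in> mco A\<^sub>S K"
 obtain M :: "(unit, 'u, 'a, 'c) comodule" and p where M: "comodule A C M" "right_linear S A\<^sub>S (dual_module M) p"
  "p ` carrier A\<^sub>S = carrier M" "!!a b. [|a : A\<^sub>S; b : A\<^sub>S|] ==> p a = p b \<longleftrightarrow> a \<ominus>\<^bsub>A\<^sub>S\<^esub> b \<in> K"
  using obtain_quotient_comodule[OF right_S_A rational_AS small_AS K] by blast
 have vc: "v : A\<^sub>S" using v by (simp add: mco_def)
 have "p v \<in> sco (dual_module M)" by (rule mco_image[OF right_S_A M(2) v]) (simp add: M(4))
 then have "p v \<in> p ` carrier B" using quotient_lift[OF M(1,2)] M(3) co_eq_sco[OF M(1)] by simp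
 then obtain b where b: "b : B" "p v = p b" by blast
 then show "\<exists>b\<in>carrier B. v \<ominus>\<^sub>A b \<in> K" using M(4)[OF vc, of b] B_A[OF b(1)] by (auto simp: a_minus_def a_inv_def m_inv_def)
qed

text \<open>Let J be the span of the coinvariants in K, and choose for each coinvariant m of A/K a
  lift l(m) in B. Then m \<otimes> a \<mapsto> l(m)a defines a map from co(A/K) \<otimes> A to A/J.
  For k in K, the tensor p(1) \<otimes> k is killed by \<Psi>, hence 0, while its image is the class
  of k. So k lies in J.\<close>

lemma weak_generator_generates: coinvariants_generate
 unfolding coinvariants_generate_def
proof (intro allI impI ballI)
 fix K k assume K: "right_submodule K S A\<^sub>S" and k: "k \<in> K"
 note K' = right_submoduleD[OF K]
 let ?J = "{v \<in> carrier A\<^sub>S. \<exists>ys. set ys \<subseteq> K \<inter> carrier B \<and> v \<in> lspan A\<^sub>S (carrier A) ys}"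
 have J: "right_submodule ?J S A\<^sub>S"
  by (rule coinvariant_span_submodule[OF right_S_A]) (use sco_A in blast)
 obtain M :: "(unit, 'u, 'a, 'c) comodule" and p where M: "comodule A C M" "right_linear S A\<^sub>S (dual_module M) p"
  "p ` carrier A\<^sub>S = carrier M" "!!a b. [|a : A\<^sub>S; b : A\<^sub>S|] ==> p a = p b \<longleftrightarrow> a \<ominus>\<^bsub>A\<^sub>S\<^esub> b \<in> K"
  using obtain_quotient_comodule[OF right_S_A rational_AS small_AS K] by blast
 have pA: "p ` carrier A = carrier M" and pK: "!!a b. [|a : A; b : A|] ==> p a = p b \<longleftrightarrow> a \<ominus>\<^sub>A b \<in> K"
  using M(3,4) by (simp_all add: a_minus_def a_inv_def m_inv_def)
 have col: "colinear A C AC M p" using M(2) S_linear_iff_colinear[OF comodule_AC M(1)] by blast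
 then have pl: "right_linear A AC M p" by (simp add: colinear_def)
 note p = right_linearD[OF pl, simplified]
 have gen: "co_generated (dual_module M)"
  by (rule co_generated_image[OF right_S_A A_generated right_S_dual[OF M(1)] M(2)]) (use pA in simp)
 note inj' = inj_onD[OF inj[OF M(1) gen]]
 interpret M: right_module A M by (rule comoduleD(1)[OF M(1)])
 let ?Q = "quotient_module A\<^sub>S ?J" and ?q = "\<lambda>a. ?J +>\<^bsub>A\<^sub>S\<^esub> a"
 interpret AS: right_module S "A\<^sub>S" by (rule right_S_A)
 note Q = quotient_right_module[OF right_S_A J]
 interpret Q: right_module S ?Q by (rule Q(1))
 note q = right_linearD[OF Q(2)]
 have qc: "?q a : ?Q" if "a : A" for a using q(2)[of a] that by (simp del: quotient_module_simps)
 have qadd: "?q (a \<oplus>\<^sub>A b) = ?q a \<oplus>\<^bsub>?Q\<^esub> ?q b" if "a : A" "b : A" for a b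
  using q(3)[of a b] that by (simp del: quotient_module_simps)
 have qJ: "?q a = \<zero>\<^bsub>?Q\<^esub> \<longleftrightarrow> a \<in> ?J" if "a : A" for a
  using quotient_abelian_group(4)[OF AS.ab_M right_submodule.axioms(1)[OF J], of a] that by (simp del: quotient_module_simps)
 \<comment> \<open>Two lifts of one class differ by a coinvariant in K, whose multiples lie in J by
   construction. Balancedness reduces to this, because sums and B-multiples of lifts are again
   lifts.\<close>
 have wd: "?q (b \<otimes>\<^sub>A a) = ?q (b' \<otimes>\<^sub>A a)" if b: "b : B" "b' : B" "p b = p b'" and a: "a : A" for b b' a
 proof -
  note bA = B_A[OF b(1)] B_A[OF b(2)]
  have bb: "b \<ominus>\<^sub>A b' \<in> K \<inter> carrier B"
   using pK[OF bA] b minus_B[OF b(1,2)] by blast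
  have "(b \<otimes>\<^sub>A a) \<ominus>\<^sub>A (b' \<otimes>\<^sub>A a) = ((b \<ominus>\<^sub>A b') \<star>\<^bsub>A\<^sub>S\<^esub> scal a) \<oplus>\<^bsub>A\<^sub>S\<^esub> \<zero>\<^bsub>A\<^sub>S\<^esub>"
   using AS_scal[OF A.minus_closed[OF bA] a] bA a by (simp add: A.minus_eq A.l_distr A.l_minus del: dual_module_simps(4))
  also have "\<dots> \<in> lspan A\<^sub>S (carrier A) [b \<ominus>\<^sub>A b']" using a by auto
  finally have "(b \<otimes>\<^sub>A a) \<ominus>\<^sub>A (b' \<otimes>\<^sub>A a) \<in> ?J" using bb bA a by (auto intro!: exI[of _ "[b \<ominus>\<^sub>A b']"])
  then show ?thesis
   using quotient_eq_iff[OF right_S_A J, of "b \<otimes>\<^sub>A a" "b' \<otimes>\<^sub>A a"] bA a by (simp add: a_minus_def a_inv_def m_inv_def)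
 qed
 have "\<forall>m\<in>co M. \<exists>b\<in>carrier B. p b = m" using quotient_lift[OF M(1,2) pA] by auto
 then obtain l where l: "l m : B" "p (l m) = m" if "m \<in> co M" for m by metis
 have lA: "l m : A" if "m \<in> co M" for m using l(1)[OF that] B_A by blast
 note coM = right_submoduleD[OF co_submodule[OF M(1)]]
 interpret T: tensor B "coM M" AA by (rule tensor_B[OF right_co[OF M(1)]])
 have bal: "balanced B (coM M) AA ?Q (\<lambda>m a. ?q (l m \<otimes>\<^sub>A a))"
 proof (rule balancedI)
  fix m a assume ma: "m : coM M" "a : AA"
  then have m: "m \<in> co M" and a: "a : A" by auto
  show "?q (l m \<otimes>\<^sub>A a) : ?Q" using qc lA[OF m] a by blast
  show "?q (l m \<otimes>\<^sub>A (a \<oplus>\<^bsub>AA\<^esub> a')) = ?q (l m \<otimes>\<^sub>A a) \<oplus>\<^bsub>?Q\<^esub> ?q (l m \<otimes>\<^sub>A a')" if "a' : AA" for a'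
   using qadd[of "l m \<otimes>\<^sub>A a" "l m \<otimes>\<^sub>A a'"] that lA[OF m] a by (simp add: A.r_distr del: quotient_module_simps)
  show "?q (l (m \<oplus>\<^bsub>coM M\<^esub> m') \<otimes>\<^sub>A a) = ?q (l m \<otimes>\<^sub>A a) \<oplus>\<^bsub>?Q\<^esub> ?q (l m' \<otimes>\<^sub>A a)" if "m' : coM M" for m'
  proof -
   have m': "m' \<in> co M" using that by simp
   have "?q (l (m \<oplus>\<^sub>M m') \<otimes>\<^sub>A a) = ?q ((l m \<oplus>\<^sub>A l m') \<otimes>\<^sub>A a)"
    using l[OF m] l[OF m'] l[OF coM(3)[OF m m']] p(3)[OF lA[OF m] lA[OF m']] a by (intro wd add_B) simp_all
   then show ?thesis
    using qadd[of "l m \<otimes>\<^sub>A a" "l m' \<otimes>\<^sub>A a"] lA[OF m] lA[OF m'] a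
    by (simp add: A.l_distr del: quotient_module_simps)
  qed
  show "?q (l (m \<star>\<^bsub>coM M\<^esub> b) \<otimes>\<^sub>A a) = ?q (l m \<otimes>\<^sub>A (b \<odot>\<^bsub>AA\<^esub> a))" if b: "b : B" for b
  proof -
   have "?q (l (m \<star>\<^sub>M b) \<otimes>\<^sub>A a) = ?q ((l m \<otimes>\<^sub>A b) \<otimes>\<^sub>A a)"
    using l[OF m] l[OF coM(6)[OF m b]] p(4)[OF lA[OF m] B_A[OF b]] a b by (intro wd mult_B) simp_all
   then show ?thesis using lA[OF m] a B_A[OF b] by (simp add: A.m_assoc)
  qed
 qed
 have kA: "k : A" using K'(1) k by auto
 have p1: "p \<one>\<^sub>A \<in> co M" using colinear_from_A(1)[OF M(1) col] by blast
 have "psi M (T.pt (p \<one>\<^sub>A) k) = p k" using psi_pure[OF M(1) p1 kA] colinear_from_A(2)[OF M(1) col kA] by simp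
 also have "\<dots> = p \<zero>\<^sub>A" using pK[OF kA A.zero_closed] k kA by (simp add: A.minus_eq)
 also have "\<dots> = psi M \<zero>\<^bsub>T.T\<^esub>"
  using additive_zero[OF T.ab_T M.ab_M psi_additive[OF M(1)]]
   additive_zero[OF AS.ab_M right_moduleD(2)[OF right_S_dual[OF M(1)]] right_linearD(1)[OF M(2)]] by simp
 finally have "T.pt (p \<one>\<^sub>A) k = \<zero>\<^bsub>T.T\<^esub>"
  by (rule inj') (use T.pure_closed[of "p \<one>\<^sub>A" k] p1 kA T.ab_T in \<open>simp_all add: abelian_group_def abelian_monoid.zero_closed\<close>)
 then have "?q (l (p \<one>\<^sub>A) \<otimes>\<^sub>A k) = \<zero>\<^bsub>?Q\<^esub>"
  using T.lift_pure[OF Q.ab_M bal, of "p \<one>\<^sub>A" k] p1 kA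
   additive_zero[OF T.ab_T Q.ab_M T.lift_additive[OF Q.ab_M bal]]
  by (simp add: del: quotient_module_simps)
 \<comment> \<open>Both l(p(1)) and 1 are lifts of p(1).\<close>
 moreover have "?q (l (p \<one>\<^sub>A) \<otimes>\<^sub>A k) = ?q (\<one>\<^sub>A \<otimes>\<^sub>A k)" by (rule wd[OF l(1)[OF p1] one_B l(2)[OF p1] kA])
 ultimately have "k \<in> ?J" using qJ[OF kA] kA by (simp del: quotient_module_simps)
 then show "\<exists>bs. set bs \<subseteq> K \<inter> carrier B \<and> k \<in> lspan A\<^sub>S (carrier A) bs" by blast
qed

end

end

section \<open>Modules subgenerated by A and by C\<close>

context lp_coring begin

abbreviation "CM \<equiv> coring_comodule C"
abbreviation "C\<^sub>S \<equiv> dual_module CM"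

lemma dual_C_act: "c \<star>\<^bsub>C\<^sub>S\<^esub> g = dact c g"
 by (simp add: tensor_eval_def dact_def)

lemma right_S_C: "right_module S C\<^sub>S"
 by (rule right_S_dual[OF comodule_C])

text \<open>Rationality passes to homomorphic images, sums and submodules, hence to everything that
  W subgenerates.\<close>

lemma subgenerated_rational:
 fixes X :: "(unit, 'u, 'c => 'a) bimodule"
 assumes W: "right_module S W" "!!w. w : W ==> rational W w"
  and X: "X \<in> subgenerated_by S W" and y: "y : X"
 shows "rational X y"
proof -
 obtain G :: "(unit, 'u, 'c => 'a) bimodule" and K f where *: "right_module S X" "G \<in> generated_by S W"
  "right_submodule K S G" "right_iso S X (G\<lparr>carrier := K\<rparr>) f"
  using X unfolding subgenerated_by_def by blast
 have G: "right_module S G" using *(2) unfolding generated_by_def by blast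
 note KG = submodule_module[OF G *(3)]
 have rG: "rational G m" if m: "m : G" for m
 proof (rule generated_by_induct[OF W(1) *(2) m])
  show "rational G \<zero>\<^sub>G"
   using right_module.zero_rsmult[OF G] by (auto simp: rational_def)
  fix h w u assume h: "right_linear S W G h" "w : W" and u: "u : G" "rational G u"
  show "rational G (h w \<oplus>\<^sub>G u)"
   by (rule rational_add[OF G right_linearD(2)[OF h] u(1) rational_image[OF W(1) G h W(2)[OF h(2)]] u(2)])
 qed
 obtain g where g: "g \<in> right_hom S (G\<lparr>carrier := K\<rparr>) X" "!!m. m : X ==> g (f m) = m" and f: "f \<in> right_hom S X (G\<lparr>carrier := K\<rparr>)"
  using *(4) unfolding right_iso_def by blast
 have gl: "right_linear S (G\<lparr>carrier := K\<rparr>) X g" using g(1) by (simp add: right_hom_def)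
 have fy: "f y : G\<lparr>carrier := K\<rparr>" using f right_linearD(2)[OF _ y] unfolding right_hom_def by blast
 have "rational (G\<lparr>carrier := K\<rparr>) (f y)"
  using rG[of "f y"] fy right_submoduleD(1)[OF *(3)] by (auto simp: rational_def)
 then show ?thesis using rational_image[OF KG *(1) gl fy] g(2)[OF y] by simp
qed

text \<open>C with its left A-action and the right action of the dual ring, so that M \<otimes> C
  becomes a module over the dual ring through its second factor.\<close>

definition Cd :: "('a, 'c, 'c => 'a) bimodule" where
 "Cd = \<lparr>carrier = carrier C, monoid.mult = undefined, one = undefined, ring.zero = \<zero>\<^sub>C, add = add C,
   smult = smult C, rsmult = dact\<rparr>"

lemma Cd_simps [simp]: "carrier Cd = carrier C" "\<zero>\<^bsub>Cd\<^esub> = \<zero>\<^sub>C" "add Cd = add C" "smult Cd = smult C" "rsmult Cd = dact"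
 by (simp_all add: Cd_def)

lemma Cd_tensor: "tensor_add A M Cd = tensor_add A M C" "pure_tensor A M Cd = pure_tensor A M C"
 using pure_tensor_cong[of M M Cd C A] by simp_all

lemma bimodule_Cd: "bimodule A S Cd"
proof (rule bimoduleI)
 have ab: "abelian_group Cd" by (rule abelian_group_cong[OF C_left.ab_M]) simp_all
 show "left_module A Cd"
  by (rule left_moduleI[OF ring_A ab])
   (simp_all add: C_left.lsmult_closed C_left.lsmult_l_distr C_left.lsmult_r_distr C_left.lsmult_assoc C_left.lsmult_one)
 have "rsmult C\<^sub>S = dact" by (intro ext) (rule dual_C_act)
 then show "right_module S Cd" using right_module_cong[of Cd "C\<^sub>S" S] right_S_C by simp
 show "(a \<odot>\<^bsub>Cd\<^esub> m) \<star>\<^bsub>Cd\<^esub> b = a \<odot>\<^bsub>Cd\<^esub> (m \<star>\<^bsub>Cd\<^esub> b)" if "a : A" "m : Cd" "b : S" for a m b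
  using left_linearD(4)[OF dact_linear[OF that(3)]] that by simp
qed

text \<open>The coaction embeds X into X \<otimes> C, on which the dual ring acts through C: it is
  linear because the evaluations of both sides agree, and injective by the counit law. The target is
  generated by C through the maps c \<mapsto> y \<otimes> c.\<close>

lemma rational_subgenerated:
 fixes X :: "(unit, 'u, 'c => 'a) bimodule"
 assumes X: "right_module S X" and rat: "!!y. y : X ==> rational X y"
 shows "X \<in> subgenerated_by S C\<^sub>S"
proof -
 obtain \<rho> where \<rho>: "comodule A C (with_coaction (as_A X) \<rho>)"
  "!!y g. [|y : X; g : S|] ==> tensor_eval (as_A X) g (\<rho> y) = y \<star>\<^sub>X g"
  using rational_comodule[OF X rat] by blast
 note XA = right_as_A[OF X]
 interpret X: right_module S X by (rule X)
 interpret T: tensor A "as_A X" C by (rule tensor_C[OF XA])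
 let ?Y = "tensor_prod A (as_A X) Cd"
 have Y: "right_module S ?Y" by (rule right_module_tensor_prod[OF XA bimodule_Cd])
 interpret Y: right_module S ?Y by (rule Y)
 have Yc: "carrier ?Y = carrier T.T" "add ?Y = add T.T" by (simp_all add: Cd_tensor)
 have \<rho>l: "right_linear A (as_A X) (tensor_prod A (as_A X) C) \<rho>" using comoduleD(2)[OF \<rho>(1)] by simp
 note \<rho>D = right_linearD[OF \<rho>l, simplified]
 have act: "T.pt y c \<star>\<^bsub>?Y\<^esub> g = T.pt y (dact c g)" if "y : X" "c : C" "g : S" for y c g
  using rsmult_pure[OF XA bimodule_Cd that(3), of y c] that by (simp add: Cd_tensor)
 have eval_act: "tensor_eval (as_A X) h (t \<star>\<^bsub>?Y\<^esub> g) = tensor_eval (as_A X) (g \<otimes>\<^sub>S h) t"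
  if t: "t : T.T" and g: "g : S" and h: "h : S" for t g h
 proof -
  interpret h: eval_setting A "as_A X" C h by (rule eval_S[OF XA h])
  interpret gh: eval_setting A "as_A X" C "g \<otimes>\<^sub>S h" by (rule eval_S[OF XA S_mult(2)[OF g h]])
  have "additive_map T.T T.T (\<lambda>t. t \<star>\<^bsub>?Y\<^esub> g)"
   using Y.additive_rsmult[OF g] by (simp add: additive_map_def Cd_tensor)
  then have a: "additive_map T.T (as_A X) (\<lambda>t. tensor_eval (as_A X) h (t \<star>\<^bsub>?Y\<^esub> g))"
   by (rule additive_comp[OF _ h.eval_additive])
  show ?thesis
  proof (rule T.additive_eqI[OF a gh.eval_additive _ t])
   fix y c assume "y : as_A X" and c: "c : C"
   then have y: "y : X" by simp
   have "(g \<otimes>\<^sub>S h) c = h (dact c g)" using S_mult(1)[OF g h] c by simp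
   then show "tensor_eval (as_A X) h (T.pt y c \<star>\<^bsub>?Y\<^esub> g) = tensor_eval (as_A X) (g \<otimes>\<^sub>S h) (T.pt y c)"
    using h.eval_pure[of y "dact c g"] gh.eval_pure[of y c] y c dact_closed[OF g c] by (simp only: act[OF y c g] as_A_simps)
  qed
 qed
 have \<rho>S: "right_linear S X ?Y \<rho>"
 proof (rule right_linearI)
  fix y g assume y: "y : X" and g: "g : S"
  have c: "\<rho> (y \<star>\<^sub>X g) : T.T" "\<rho> y : T.T" using \<rho>D(2) X.rsmult_closed[OF y g] y by auto
  show "\<rho> (y \<star>\<^sub>X g) = \<rho> y \<star>\<^bsub>?Y\<^esub> g"
  proof (rule tensor_eval_inject[OF XA c(1)])
   show "\<rho> y \<star>\<^bsub>?Y\<^esub> g : T.T" using Y.rsmult_closed[of "\<rho> y" g] c(2) g by (simp add: Cd_tensor)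
   show "tensor_eval (as_A X) h (\<rho> (y \<star>\<^sub>X g)) = tensor_eval (as_A X) h (\<rho> y \<star>\<^bsub>?Y\<^esub> g)" if h: "h : S" for h
    using \<rho>(2)[OF X.rsmult_closed[OF y g] h] eval_act[OF c(2) g h] \<rho>(2)[OF y S_mult(2)[OF g h]] X.rsmult_assoc[OF y g h] by simp
  qed
 qed (use \<rho>D in \<open>simp_all add: Cd_tensor\<close>)
 have "small TYPE('u) ?Y"
  unfolding Yc(1) by (rule small_MC[OF XA]) (rule subset_imp_lepoll, simp)
 then obtain G :: "(unit, 'u, 'c => 'a) bimodule" and \<phi> \<psi> where G: "right_copy S ?Y G \<phi> \<psi>"
  using obtain_right_copy[OF Y] by blast
 note c = right_copyD[OF G]
 interpret G: right_module S G by (rule c(2))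
 note \<phi> = right_linearD[OF c(3)]
 have "G \<in> generated_by S C\<^sub>S"
 proof (rule generated_byI[OF right_S_C c(2)])
  have "\<phi> t \<oplus>\<^sub>G m \<in> gen_span S C\<^sub>S G" if "t : T.T" "m \<in> carrier G \<inter> gen_span S C\<^sub>S G" for t m
   using that
  proof (induction arbitrary: m rule: T.induct)
   case (pure y d)
   then have y: "y : X" "d : C" by auto
   have yc: "T.pt y e : ?Y" if "e : C" for e using T.pure_closed[of y e] y(1) that by (simp add: Cd_tensor)
   have "right_linear S C\<^sub>S G (\<lambda>e. \<phi> (T.pt y e))"
   proof (rule right_linearI)
    fix e assume "e : C\<^sub>S"
    then have e: "e : C" by simp
    show "\<phi> (T.pt y e) : G" using \<phi>(2)[OF yc[OF e]] .
    show "\<phi> (T.pt y (e \<oplus>\<^bsub>C\<^sub>S\<^esub> e')) = \<phi> (T.pt y e) \<oplus>\<^sub>G \<phi> (T.pt y e')" if "e' : C\<^sub>S" for e'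
     using \<phi>(3)[OF yc[OF e] yc[of e']] T.pure_add_right[of y e e'] y(1) e that by (simp add: Cd_tensor)
    show "\<phi> (T.pt y (e \<star>\<^bsub>C\<^sub>S\<^esub> g)) = \<phi> (T.pt y e) \<star>\<^sub>G g" if "g : S" for g
     using \<phi>(4)[OF yc[OF e] that] act[OF y(1) e that] by (simp add: dual_C_act del: dual_module_simps(4))
   qed
   then show ?case using gen_span_add[OF right_S_C _ _, of G _ d m] y(2) pure.prems by simp
  next
   case (add t u)
   have tu: "t : ?Y" "u : ?Y" using add(1,2) by (simp_all add: Cd_tensor)
   have "\<phi> u \<oplus>\<^sub>G m \<in> carrier G \<inter> gen_span S C\<^sub>S G" using add.IH(2)[OF add.prems] add.prems \<phi>(2)[OF tu(2)] by simp
   then have "\<phi> t \<oplus>\<^sub>G (\<phi> u \<oplus>\<^sub>G m) \<in> gen_span S C\<^sub>S G" by (rule add.IH(1))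
   moreover have "\<phi> (t \<oplus>\<^bsub>T.T\<^esub> u) = \<phi> t \<oplus>\<^sub>G \<phi> u" using \<phi>(3)[OF tu] by (simp add: Cd_tensor)
   ultimately show ?case using \<phi>(2)[OF tu(1)] \<phi>(2)[OF tu(2)] add.prems by (simp add: G.M.a_assoc)
  qed
  note sp = this
  show "carrier G \<subseteq> gen_span S C\<^sub>S G"
  proof
   fix m assume m: "m : G"
   have "\<psi> m : T.T" using c(8)[OF m] by (simp only: Yc)
   then show "m \<in> gen_span S C\<^sub>S G" using sp[of "\<psi> m" "\<zero>\<^sub>G"] c(6)[OF m] m gen_span.zero[of G S "C\<^sub>S"] by simp
  qed
 qed
 moreover have "inj_on (\<lambda>y. \<phi> (\<rho> y)) (carrier X)"
 proof (rule inj_onI)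
  fix y y' assume y: "y : X" "y' : X" "\<phi> (\<rho> y) = \<phi> (\<rho> y')"
  have "\<rho> y = \<rho> y'" using c(5)[OF right_linearD(2)[OF \<rho>S y(1)]] c(5)[OF right_linearD(2)[OF \<rho>S y(2)]] y(3) by metis
  then show "y = y'" using \<rho>(2)[OF y(1) counit_S] \<rho>(2)[OF y(2) counit_S] X.rsmult_one[OF y(1)] X.rsmult_one[OF y(2)] by metis
 qed
 ultimately show ?thesis by (intro subgenerated_byI[OF X c(2) _ right_linear_comp[OF \<rho>S c(3)]])
qed

lemma subgenerated_by_C: "X \<in> subgenerated_by S C\<^sub>S \<longleftrightarrow> right_module S X \<and> (\<forall>y\<in>carrier X. rational X y)"
 for X :: "(unit, 'u, 'c => 'a) bimodule"
proof -
 have "rational C\<^sub>S c" if "c : C\<^sub>S" for c using rational_dual[OF comodule_C] that by simp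
 moreover have "right_module S X" if "X \<in> subgenerated_by S C\<^sub>S" using that unfolding subgenerated_by_def by blast
 ultimately show ?thesis using subgenerated_rational[OF right_S_C] rational_subgenerated by blast
qed

lemma subgenerated_by_A_subset:
 "(subgenerated_by S A\<^sub>S :: (unit, 'u, 'c => 'a) bimodule set) \<subseteq> subgenerated_by S C\<^sub>S"
proof
 fix X :: "(unit, 'u, 'c => 'a) bimodule" assume X: "X \<in> subgenerated_by S A\<^sub>S"
 then show "X \<in> subgenerated_by S C\<^sub>S"
  using subgenerated_rational[OF right_S_A rational_AS X] unfolding subgenerated_by_C
  by (auto simp: subgenerated_by_def[of S "A\<^sub>S"])
qed

text \<open>The comodule co M \<otimes> A is spanned by the coinvariants m \<otimes> 1, and \<Psi>
  maps it onto M.\<close>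

lemma strong_structure_generated:
 assumes sst: "strong_structure_theorem TYPE('u) A C x" and M: "comodule A C M" and small: "small TYPE('u) M"
 shows "co_generated (dual_module M)"
proof -
 have N: "right_module B (coM M)" by (rule right_co[OF M])
 interpret T: tensor B "coM M" AA by (rule tensor_B[OF N])
 have lin: "right_linear S (dual_module (ind (coM M))) (dual_module M) (psi M)"
  using S_linear_iff_colinear[OF comodule_ind[OF N] M] psi_colinear[OF M] by blast
 have "psi M ` carrier T.T = carrier M" using strong_structureD(1)[OF sst M small] by (simp add: bij_betw_def)
 moreover have "co_generated (dual_module (ind (coM M)))"
  unfolding co_generated_def
 proof
  fix t assume "t : dual_module (ind (coM M))"
  then obtain ns where ns: "set ns \<subseteq> carrier (coM M)" "t \<in> lspan (dual_module (ind (coM M))) (carrier A) (map (phi (coM M)) ns)"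
   using ind_span_all[OF N, of t] by auto
  then show "\<exists>ys. set ys \<subseteq> sco (dual_module (ind (coM M))) \<and> t \<in> lspan (dual_module (ind (coM M))) (carrier A) ys"
   using phi_sco[OF N] by (intro exI[of _ "map (phi (coM M)) ns"]) auto
 qed
 ultimately show ?thesis
  using co_generated_image[OF right_S_dual[OF comodule_ind[OF N]] _ right_S_dual[OF M] lin] by simp
qed

lemma strong_structure_subgenerated:
 assumes sst: "strong_structure_theorem TYPE('u) A C x"
 shows "subgenerated_by S C\<^sub>S = (subgenerated_by S A\<^sub>S :: (unit, 'u, 'c => 'a) bimodule set)"
proof (rule equalityI[OF _ subgenerated_by_A_subset], rule subsetI)
 fix X :: "(unit, 'u, 'c => 'a) bimodule" assume "X \<in> subgenerated_by S C\<^sub>S"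
 then have X: "right_module S X" "!!y. y : X ==> rational X y" unfolding subgenerated_by_C by auto
 have small: "small TYPE('u) Y" for Y :: "(unit, 'u, 'c => 'a) bimodule" by (rule subset_imp_lepoll) simp
 obtain M :: "(unit, 'u, 'a, 'c) comodule" and \<phi> \<psi> where M: "comodule A C M" "right_copy S X (dual_module M) \<phi> \<psi>"
  using rational_comodule_copy[OF X small] by blast
 note c = right_copyD[OF M(2)]
 have "co_generated (dual_module M)"
  by (rule strong_structure_generated[OF sst M(1)]) (rule subset_imp_lepoll, simp)
 then have "dual_module M \<in> generated_by S A\<^sub>S" using generated_by_A[OF c(2)] by blast
 moreover have "inj_on \<phi> (carrier X)" using c(5) by (metis inj_onI)
 ultimately show "X \<in> subgenerated_by S A\<^sub>S" by (intro subgenerated_byI[OF X(1) c(2) _ c(3)])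
qed

text \<open>A comodule embeds into a module generated by A. By \<open>generate_coinvariant\<close>
  its image is spanned by the coinvariants that it contains, and this passes back to the
  comodule.\<close>

lemma subgenerated_strong_structure:
 assumes Q: lifts_coinvariants and G: coinvariants_generate
  and eq: "subgenerated_by S C\<^sub>S = (subgenerated_by S A\<^sub>S :: (unit, 'u, 'c => 'a) bimodule set)"
 shows "strong_structure_theorem TYPE('u) A C x"
proof (rule strong_structureI[OF Q G])
 fix M :: "(unit, 'u, 'a, 'c) comodule" assume M: "comodule A C M"
 have "dual_module M \<in> subgenerated_by S C\<^sub>S"
  using right_S_dual[OF M] rational_dual[OF M] unfolding subgenerated_by_C by simp
 then obtain H :: "(unit, 'u, 'c => 'a) bimodule" and K f where *: "H \<in> generated_by S A\<^sub>S"
  "right_submodule K S H" "right_iso S (dual_module M) (H\<lparr>carrier := K\<rparr>) f"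
  unfolding eq subgenerated_by_def[of S "A\<^sub>S"] by blast
 have H: "right_module S H" using *(1) unfolding generated_by_def by blast
 note K = submodule_module[OF H *(2)]
 have Kg: "co_generated (H\<lparr>carrier := K\<rparr>)"
  unfolding co_generated_def
 proof
  fix k assume k: "k : H\<lparr>carrier := K\<rparr>"
  then have "k : H" "k \<in> K" using right_submoduleD(1)[OF *(2)] by auto
  then obtain ys where "set ys \<subseteq> sco H" "k \<in> lspan H (carrier A) ys"
   using *(1) unfolding generated_by_A[OF H] co_generated_def by blast
  then show "\<exists>ys. set ys \<subseteq> sco (H\<lparr>carrier := K\<rparr>) \<and> k \<in> lspan (H\<lparr>carrier := K\<rparr>) (carrier A) ys"
   using generate_coinvariant[OF H Q G *(2) _ \<open>k \<in> K\<close>] unfolding sco_sub[OF right_submoduleD(1)[OF *(2)]] lspan_carrier by blast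
 qed
 obtain g where g: "g \<in> right_hom S (H\<lparr>carrier := K\<rparr>) (dual_module M)" "\<forall>m\<in>carrier (dual_module M). g (f m) = m"
  and f: "f \<in> right_hom S (dual_module M) (H\<lparr>carrier := K\<rparr>)"
  using *(3) unfolding right_iso_def by blast
 have gl: "right_linear S (H\<lparr>carrier := K\<rparr>) (dual_module M) g" and fl: "right_linear S (dual_module M) (H\<lparr>carrier := K\<rparr>) f"
  using g(1) f by (simp_all only: right_hom_def mem_Collect_eq)
 have "g ` carrier (H\<lparr>carrier := K\<rparr>) = carrier (dual_module M)"
 proof (intro equalityI subsetI)
  show "m : dual_module M" if "m \<in> g ` carrier (H\<lparr>carrier := K\<rparr>)" for m
   using that right_linearD(2)[OF gl] by blast
  show "m \<in> g ` carrier (H\<lparr>carrier := K\<rparr>)" if "m : dual_module M" for m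
   by (rule image_eqI[of m g "f m", OF g(2)[rule_format, OF that, symmetric] right_linearD(2)[OF fl that]])
 qed
 then show "co_generated (dual_module M)"
  by (rule co_generated_image[OF K Kg right_S_dual[OF M] gl])
qed

lemma strong_structure_lifts:
 assumes sst: "strong_structure_theorem TYPE('u) A C x"
 shows lifts_coinvariants coinvariants_generate
proof -
 have wg: "weak_generator TYPE('u) B AA" by (rule strong_structure_weak_generator[OF sst])
 have "inj_on (psi M) (carrier (coA M))" if "comodule A C M" for M :: "(unit, 'u, 'a, 'c) comodule"
  using strong_structureD(1)[OF sst that] subset_imp_lepoll[of "carrier M" UNIV] by (auto simp: bij_betw_def)
 then show lifts_coinvariants coinvariants_generate
  using weak_generator_lifts[OF wg] weak_generator_generates[OF wg] by blast+
qed

end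

section \<open>A as a progenerator\<close>

context lp_coring begin

text \<open>For m in co N, ma = q(\<Psi>(t)) because q and \<Psi> are onto, and injectivity of
  \<Psi> for N gives m \<otimes> a = (q \<otimes> A)(t). So q(co L) \<otimes> A maps onto co N
  \<otimes> A, and the weak generator A gives q(co L) = co N. This is projectivity of A in terms of
  elements.\<close>

lemma strong_structure_coinvariant_lift:
 fixes L N :: "(unit, 'u, 'a, 'c) comodule"
 assumes sst: "strong_structure_theorem TYPE('u) A C x" and L: "comodule A C L" and N: "comodule A C N"
  and q: "colinear A C L N q" "q ` carrier L = carrier N"
 shows "q ` co L = co N"
proof -
 let ?P = "coM N" and ?I = "q ` co L"
 have small: "small TYPE('u) M" for M :: "(unit, 'u, 'a, 'c) comodule" by (rule subset_imp_lepoll) simp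
 note psiL = strong_structureD(1)[OF sst L small] and psiN = strong_structureD(1)[OF sst N small]
 have P: "right_module B ?P" and PL: "right_module B (coM L)" using right_co N L by blast+
 have ql: "right_linear B (coM L) ?P q" by (rule colinear_coM[OF L N q(1)])
 have I: "right_submodule ?I B ?P"
  using right_submodule_image[OF PL P ql] by simp
 note I' = right_submoduleD[OF I]
 let ?PI = "?P\<lparr>carrier := ?I\<rparr>"
 interpret T: tensor B ?P AA by (rule tensor_B[OF P])
 interpret TL: tensor B "coM L" AA by (rule tensor_B[OF PL])
 interpret TI: tensor B ?PI AA by (rule tensor_B[OF submodule_module[OF P I]])
 have il: "right_linear B ?PI ?P (\<lambda>m. m)" by (rule right_linearI) (use I'(1) in auto)
 have qI: "right_linear B (coM L) ?PI q"
  using right_linearD[OF ql] by (intro right_linearI) auto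
 have "?I = carrier ?P"
 proof (rule weak_generator_eq[OF strong_structure_weak_generator[OF sst] P left_B_AA _ I])
  show "small TYPE('u) ?P" by (rule subset_imp_lepoll) simp
  fix m a assume ma: "m : ?P" "a : AA"
  have m: "m \<in> co N" "m : N" and a: "a : A" using ma coD(1) by auto
  have "m \<star>\<^sub>N a \<in> q ` (psi L ` carrier TL.T)"
   using q(2) right_module.rsmult_closed[OF comoduleD(1)[OF N] m(2) a] psiL by (simp add: bij_betw_def)
  then obtain t where t: "t : TL.T" "m \<star>\<^sub>N a = q (psi L t)" by blast
  let ?t = "tmap B (coM L) ?P AA q t" and ?s = "tmap B (coM L) ?PI AA q t"
  have c: "?t : T.T" "?s : TI.T"
   using tmap_additive[OF TL.ax T.ax ql]
    tmap_additive[OF TL.ax TI.ax qI] t(1) by (auto simp: additive_map_def)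
  have "psi N ?t = psi N (T.pt m a)"
   using psi_natural[OF L N q(1) t(1)] psi_pure[OF N m(1) a] t(2) by simp
  then have "?t = T.pt m a"
   using psiN c(1) T.pure_closed[OF ma] by (auto simp: bij_betw_def dest: inj_onD)
  moreover have "tmap B ?PI ?P AA (\<lambda>p. p) ?s = ?t"
   using tmap_compose[OF TL.ax TI.ax T.ax qI il t(1)] by simp
  ultimately show "\<exists>s\<in>carrier TI.T. tmap B ?PI ?P AA (\<lambda>p. p) s = T.pt m a" using c(2) by metis
 qed
 then show ?thesis by simp
qed

lemma co_hom_maps: "[|comodule A C M; m \<in> co M|] ==> (\<lambda>a\<in>carrier A. m \<star>\<^sub>M a) \<in> colinear_maps A C AC M"
 using colinear_restrict[OF comodule_AC _ co_hom] by simp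

text \<open>A colinear map from A is evaluation at a coinvariant, so projectivity is the lifting of
  coinvariants. A is a generator because two maps that agree on all images of A agree on the values
  of \<Psi> at pure tensors, and these span M.\<close>

lemma strong_structure_progenerator:
 assumes sst: "strong_structure_theorem TYPE('u) A C x"
 shows "comodule_progenerator TYPE('u) A C AC"
 unfolding comodule_progenerator_def
proof (intro conjI finitely_generated_A)
 show "projective_comodule TYPE('u) A C AC"
  unfolding projective_comodule_def
 proof (intro allI impI, elim conjE)
  fix L N :: "(unit, 'u, 'a, 'c) comodule" and q g
  assume L: "comodule A C L" and N: "comodule A C N" and q: "q \<in> colinear_maps A C L N" "q ` carrier L = carrier N"
   and g: "g \<in> colinear_maps A C AC N"
  have qc: "colinear A C L N q" and gc: "colinear A C AC N g" using q(1) g colinear_maps_iff L N comodule_AC by blast+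
  note g1 = colinear_from_A[OF N gc]
  obtain l where l: "l \<in> co L" "q l = g \<one>\<^sub>A"
   using strong_structure_coinvariant_lift[OF sst L N qc q(2)] g1(1) by (metis imageE)
  have "q (l \<star>\<^sub>L a) = g a" if "a : A" for a
   using qc right_linearD(4)[of A L N q l a] coD(1)[OF l(1)] l(2) g1(2)[OF that] that by (simp add: colinear_def)
  then show "\<exists>h\<in>colinear_maps A C AC L. \<forall>p\<in>carrier AC. q (h p) = g p"
   by (intro bexI[OF _ co_hom_maps[OF L l(1)]]) simp
 qed
 show "generator_comodule TYPE('u) A C AC"
  unfolding generator_comodule_def
 proof (intro allI impI, elim conjE)
  fix M N :: "(unit, 'u, 'a, 'c) comodule" and f g
  assume M: "comodule A C M" and N: "comodule A C N" and f: "f \<in> colinear_maps A C M N" and g: "g \<in> colinear_maps A C M N"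
   and ne: "f \<noteq> g"
  have fl: "colinear A C M N f" "f \<in> extensional (carrier M)" and gl: "colinear A C M N g" "g \<in> extensional (carrier M)"
   using f g colinear_maps_iff M N by blast+
  have add: "additive_map M N f" "additive_map M N g" using fl(1) gl(1) by (simp_all add: colinear_def right_linear_def)
  interpret T: tensor B "coM M" AA by (rule tensor_B[OF right_co[OF M]])
  show "\<exists>h\<in>colinear_maps A C AC M. \<exists>p\<in>carrier AC. f (h p) \<noteq> g (h p)"
  proof (rule ccontr)
   assume neg: "\<not> ?thesis"
   have eq: "f (psi M t) = g (psi M t)" if t: "t : T.T" for t
   proof (rule T.additive_eqI[OF additive_comp[OF psi_additive[OF M] add(1)] additive_comp[OF psi_additive[OF M] add(2)] _ t])
    fix m a assume "m : coM M" "a : AA"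
    then have m: "m \<in> co M" and a: "a : A" by simp_all
    have "f ((\<lambda>a\<in>carrier A. m \<star>\<^sub>M a) a) = g ((\<lambda>a\<in>carrier A. m \<star>\<^sub>M a) a)"
    proof (rule ccontr)
     assume "\<not> ?thesis"
     then have "\<exists>h\<in>colinear_maps A C AC M. \<exists>p\<in>carrier AC. f (h p) \<noteq> g (h p)"
      using a by (intro bexI[OF _ co_hom_maps[OF M m]] bexI[of _ a]) simp_all
     then show False using neg by (rule notE[rotated])
    qed
    then show "f (psi M (T.pt m a)) = g (psi M (T.pt m a))" using psi_pure[OF M m a] a by simp
   qed
   have "psi M ` carrier T.T = carrier M"
    using strong_structureD(1)[OF sst M] subset_imp_lepoll[of "carrier M" UNIV] by (auto simp: bij_betw_def)
   then have "f m = g m" if "m : M" for m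
   proof -
    have "m \<in> psi M ` carrier T.T" using that \<open>psi M ` carrier T.T = carrier M\<close> by simp
    then obtain t where "t : T.T" "m = psi M t" by (rule imageE)
    then show ?thesis using eq[of t] by (simp only:)
   qed
   then show False using ne extensionalityI[OF fl(2) gl(2)] by blast
  qed
 qed
qed

text \<open>Every comodule is spanned by its coinvariants: modulo their span each map from A becomes
  0, so the generator A cannot tell the projection from 0. Projectivity, applied to the map from A
  to A/K given by a coinvariant class, yields the lifting property.\<close>

lemma progenerator_strong_structure:
 assumes "comodule_progenerator TYPE('u) A C AC"
 shows "strong_structure_theorem TYPE('u) A C x"
proof -
 have proj: "projective_comodule TYPE('u) A C AC" and gr: "generator_comodule TYPE('u) A C AC"
  using assms by (auto simp: comodule_progenerator_def)
 have gen: "co_generated (dual_module M)" if M: "comodule A C M" for M :: "(unit, 'u, 'a, 'c) comodule"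
 proof -
  let ?X = "dual_module M"
  have X: "right_module S ?X" by (rule right_S_dual[OF M])
  interpret X: right_module S ?X by (rule X)
  let ?T = "{v \<in> carrier ?X. \<exists>ys. set ys \<subseteq> sco ?X \<and> v \<in> lspan ?X (carrier A) ys}"
  have T: "right_submodule ?T S ?X" by (rule coinvariant_span_submodule[OF X order_refl])
  have rat: "rational ?X y" if "y : ?X" for y using rational_dual[OF M] that by simp
  have small: "small TYPE('u) ?X" by (rule subset_imp_lepoll) simp
  obtain N :: "(unit, 'u, 'a, 'c) comodule" and p where N: "comodule A C N" "right_linear S ?X (dual_module N) p"
   "p ` carrier ?X = carrier N" "!!a b. [|a : ?X; b : ?X|] ==> p a = p b \<longleftrightarrow> a \<ominus>\<^bsub>?X\<^esub> b \<in> ?T"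
   using obtain_quotient_comodule[OF X rat small T] by blast
  interpret N: right_module S "dual_module N" by (rule right_S_dual[OF N(1)])
  have p0: "p \<zero>\<^bsub>?X\<^esub> = \<zero>\<^sub>N"
   using additive_zero[OF X.ab_M N.ab_M right_linearD(1)[OF N(2)]] by simp
  have pT: "p m = \<zero>\<^sub>N \<longleftrightarrow> m \<in> ?T" if m: "m : ?X" for m
  proof -
   have "m \<ominus>\<^bsub>?X\<^esub> \<zero>\<^bsub>?X\<^esub> = m" using X.M.minus_equality[OF X.M.l_zero[OF X.M.zero_closed] X.M.zero_closed X.M.zero_closed] m
    by (simp only: X.M.minus_eq X.M.r_zero)
   then show ?thesis using N(4)[OF m X.M.zero_closed] p0 by simp
  qed
  have "right_linear S ?X (dual_module N) (\<lambda>_. \<zero>\<^bsub>dual_module N\<^esub>)"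
   using N.zero_rsmult N.M.l_zero[OF N.M.zero_closed] N.M.zero_closed by (intro right_linearI) (simp_all del: dual_module_simps)
  then have c: "colinear A C M N p" "colinear A C M N (\<lambda>_. \<zero>\<^bsub>dual_module N\<^esub>)" using S_linear_iff_colinear[OF M N(1)] N(2) by blast+
  note r = colinear_restrict[OF M N(1) c(1)] colinear_restrict[OF M N(1) c(2)]
  show ?thesis
  proof (rule ccontr)
   assume "\<not> ?thesis"
   then obtain m where m: "m : M" "m \<notin> ?T" unfolding co_generated_def by auto
   have "restrict p (carrier M) m \<noteq> restrict (\<lambda>_. \<zero>\<^bsub>dual_module N\<^esub>) (carrier M) m"
    using pT[of m] m by simp
   then have "restrict p (carrier M) \<noteq> restrict (\<lambda>_. \<zero>\<^bsub>dual_module N\<^esub>) (carrier M)" by (rule contrapos_nn) (simp only:)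
   from gr[unfolded generator_comodule_def, rule_format, OF conjI[OF M conjI[OF N(1) conjI[OF r(1) conjI[OF r(2) this]]]]]
   obtain h a where h: "h \<in> colinear_maps A C AC M" "a : AC"
    "restrict p (carrier M) (h a) \<noteq> restrict (\<lambda>_. \<zero>\<^bsub>dual_module N\<^esub>) (carrier M) (h a)"
    by blast
   have a: "a : A" using h(2) by simp
   have hc: "colinear A C AC M h" by (rule conjunct2[OF colinear_maps_iff[OF comodule_AC M, THEN iffD1, OF h(1)]])
   note h1 = colinear_from_A[OF M hc]
   have y: "h \<one>\<^sub>A \<in> sco ?X" "h \<one>\<^sub>A : M" using h1(1) coD(1)[OF h1(1)] by (simp_all only: co_eq_sco[OF M])
   have ha: "h a : ?X" using right_linearD(2)[of A AC M h a] hc a by (simp add: colinear_def)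
   have "h a = (h \<one>\<^sub>A \<star>\<^bsub>?X\<^esub> scal a) \<oplus>\<^bsub>?X\<^esub> \<zero>\<^bsub>?X\<^esub>"
    using h1(2)[OF a] dual_act_scal[OF M y(2) a] X.M.r_zero[OF ha] by simp
   then have "h a \<in> lspan ?X (carrier A) [h \<one>\<^sub>A]"
    unfolding lspan.simps using a by (intro CollectI exI conjI) (assumption, assumption, rule singletonI)
   then have "h a \<in> ?T" using ha y(1) by (intro CollectI conjI exI[of _ "[h \<one>\<^sub>A]"]) simp_all
   then show False using h(3) pT[OF ha] ha by simp
  qed
 qed
 have small: "small TYPE('u) X" if "carrier X \<subseteq> carrier A\<^sub>S" for X :: "(unit, 'a, 'c => 'a) bimodule"
  using lepoll_subset[OF small_AS that] .
 have G: coinvariants_generate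
  unfolding generates_submodules_iff[symmetric] generates_submodules_def
 proof (intro allI impI)
  fix K assume K: "right_submodule K S A\<^sub>S"
  let ?K = "A\<^sub>S\<lparr>carrier := K\<rparr>"
  have X: "right_module S ?K" by (rule submodule_module[OF right_S_A K])
  have rat: "rational ?K y" if "y : ?K" for y
   using rational_AS[of y] right_submoduleD(1)[OF K] that by (auto simp: rational_def simp del: dual_module_simps)
  have "small TYPE('u) ?K" by (rule small) (use right_submoduleD(1)[OF K] in simp)
  then obtain M :: "(unit, 'u, 'a, 'c) comodule" and \<phi> \<psi> where M: "comodule A C M" "right_copy S ?K (dual_module M) \<phi> \<psi>"
   using rational_comodule_copy[OF X rat] by blast
  show "?K \<in> generated_by S A\<^sub>S"
   using gen[OF M(1)] co_generated_copy[OF M(2)] generated_by_A[OF X] by blast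
 qed
 have Q: lifts_coinvariants
  unfolding lifts_coinvariants_def
 proof (intro allI impI ballI)
  fix K v assume K: "right_submodule K S A\<^sub>S" and v: "v \<in> mco A\<^sub>S K"
  have vc: "v : A\<^sub>S" using v by (simp add: mco_def)
  obtain N :: "(unit, 'u, 'a, 'c) comodule" and p where N: "comodule A C N" "right_linear S A\<^sub>S (dual_module N) p"
   "p ` carrier A\<^sub>S = carrier N" "!!a b. [|a : A\<^sub>S; b : A\<^sub>S|] ==> p a = p b \<longleftrightarrow> a \<ominus>\<^bsub>A\<^sub>S\<^esub> b \<in> K"
   using obtain_quotient_comodule[OF right_S_A rational_AS small_AS K] by blast
  \<comment> \<open>Projectivity tests epimorphisms between comodules over \<open>'u\<close>, so a
    copy of A replaces A as the source of the projection.\<close>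
  obtain L :: "(unit, 'u, 'a, 'c) comodule" and \<phi> \<psi> where L: "comodule A C L" "right_copy S A\<^sub>S (dual_module L) \<phi> \<psi>"
   using rational_comodule_copy[OF right_S_A rational_AS small_AS] by blast
  note c = right_copyD[OF L(2)]
  have pv: "p v \<in> co N" unfolding co_eq_sco[OF N(1)] by (rule mco_image[OF right_S_A N(2) v]) (simp add: N(4))
  have qc: "colinear A C L N (\<lambda>l. p (\<psi> l))" using S_linear_iff_colinear[OF L(1) N(1)] right_linear_comp[OF c(4) N(2)] by blast
  have "\<psi> ` carrier L = carrier A\<^sub>S"
  proof
   show "\<psi> ` carrier L \<subseteq> carrier A\<^sub>S" using c(8) by (simp add: image_subset_iff)
   show "carrier A\<^sub>S \<subseteq> \<psi> ` carrier L" using c(5,7) by (metis dual_module_simps(1) image_eqI subsetI)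
  qed
  then have "restrict (\<lambda>l. p (\<psi> l)) (carrier L) ` carrier L = carrier N" using N(3) by (simp add: image_image[symmetric])
  from proj[unfolded projective_comodule_def, rule_format, OF conjI[OF L(1) conjI[OF N(1) conjI[OF
    colinear_restrict[OF L(1) N(1) qc] conjI[OF this co_hom_maps[OF N(1) pv]]]]]]
  obtain h where h: "h \<in> colinear_maps A C AC L"
   "\<forall>a\<in>carrier AC. restrict (\<lambda>l. p (\<psi> l)) (carrier L) (h a) = (\<lambda>a\<in>carrier A. p v \<star>\<^sub>N a) a" by (rule bexE)
  have "colinear A C AC L h" by (rule conjunct2[OF colinear_maps_iff[OF comodule_AC L(1), THEN iffD1, OF h(1)]])
  then have h1: "h \<one>\<^sub>A \<in> co L" by (rule colinear_from_A(1)[OF L(1)])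
  note h1' = coD(1)[OF h1]
  have b: "\<psi> (h \<one>\<^sub>A) : B"
   using sco_image[OF right_S_A c(2,4), of "h \<one>\<^sub>A"] h1 by (simp only: co_eq_sco[OF L(1)] sco_A)
  have "p (\<psi> (h \<one>\<^sub>A)) = p v"
   using h(2)[rule_format, of "\<one>\<^sub>A"] h1' right_module.rsmult_one[OF comoduleD(1)[OF N(1)] coD(1)[OF pv]] by simp
  then have "v \<ominus>\<^bsub>A\<^sub>S\<^esub> \<psi> (h \<one>\<^sub>A) \<in> K" using N(4)[OF vc, of "\<psi> (h \<one>\<^sub>A)"] B_A[OF b] by simp
  then show "\<exists>b\<in>carrier B. v \<ominus>\<^sub>A b \<in> K" using b by (auto simp: a_minus_def a_inv_def m_inv_def)
 qed
 show ?thesis by (rule strong_structureI[OF Q G gen])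
qed

section \<open>The equivalent conditions over a locally projective coring\<close>

theorem strong_structure_lp_iff:
 assumes flat: "flat_left TYPE('u) A C"
 shows "strong_structure_theorem TYPE('u) A C x \<longleftrightarrow> faithfully_flat TYPE('u) B AA \<and> bijective_\<Psi>' A C x CM" (is "?s \<longleftrightarrow> ?P3")
  and "strong_structure_theorem TYPE('u) A C x \<longleftrightarrow> faithfully_flat TYPE('u) B AA \<and>
     (\<forall>M :: (unit, 'u, 'a, 'c) comodule. comodule A C M \<and> dual_module M \<in> subgenerated_by S A\<^sub>S --> bijective_\<Psi>' A C x M) \<and>
     subgenerated_by S C\<^sub>S = (subgenerated_by S A\<^sub>S :: (unit, 'u, 'c => 'a) bimodule set)" (is "_ \<longleftrightarrow> ?P4")
  and "strong_structure_theorem TYPE('u) A C x \<longleftrightarrow> quasiprojective S A\<^sub>S \<and> generates_submodules S A\<^sub>S \<and>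
     weak_generator TYPE('u) B AA \<and>
     subgenerated_by S C\<^sub>S = (subgenerated_by S A\<^sub>S :: (unit, 'u, 'c => 'a) bimodule set)"
  and "strong_structure_theorem TYPE('u) A C x \<longleftrightarrow> quasiprogenerator S A\<^sub>S \<and>
     subgenerated_by S C\<^sub>S = (subgenerated_by S A\<^sub>S :: (unit, 'u, 'c => 'a) bimodule set)"
  and "strong_structure_theorem TYPE('u) A C x \<longleftrightarrow> weak_generator TYPE('u) B AA \<and>
     (\<forall>M :: (unit, 'u, 'a, 'c) comodule. comodule A C M \<and> dual_module M \<in> generated_by S A\<^sub>S -->
       comodule_iso A C (ind (homA M)) M (counit_\<Psi>' A C x M)) \<and>
     subgenerated_by S A\<^sub>S = (subgenerated_by S C\<^sub>S :: (unit, 'u, 'c => 'a) bimodule set)" (is "_ \<longleftrightarrow> ?P7")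
  and "strong_structure_theorem TYPE('u) A C x \<longleftrightarrow> comodule_progenerator TYPE('u) A C AC"
proof -
 let ?\<sigma> = "subgenerated_by S C\<^sub>S = (subgenerated_by S A\<^sub>S :: (unit, 'u, 'c => 'a) bimodule set)"
 note 2 = strong_structure_iff_galois[OF flat]
 note sub = strong_structure_subgenerated and wg = strong_structure_weak_generator
 have psi: "bij_psi M" if "?s" "comodule A C M" for M :: "(unit, 'u, 'a, 'c) comodule"
  using strong_structureD(1)[OF that subset_imp_lepoll] by simp
 show 3: "?s \<longleftrightarrow> ?P3" by (simp add: 2 galois_iff_psi bijective_psi'[OF comodule_C])
 have qG: "quasiprojective S A\<^sub>S \<and> generates_submodules S A\<^sub>S \<and> ?\<sigma> \<longleftrightarrow> ?s"
  unfolding quasiprojective_iff generates_submodules_iff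
  using subgenerated_strong_structure sub strong_structure_lifts by blast
 show "?s \<longleftrightarrow> quasiprojective S A\<^sub>S \<and> generates_submodules S A\<^sub>S \<and> weak_generator TYPE('u) B AA \<and> ?\<sigma>"
  using qG wg by blast
 show "?s \<longleftrightarrow> quasiprogenerator S A\<^sub>S \<and> ?\<sigma>"
  using qG finitely_generated_A unfolding quasiprogenerator_def by blast
 show "?s \<longleftrightarrow> comodule_progenerator TYPE('u) A C AC"
  using strong_structure_progenerator progenerator_strong_structure by blast
 show "?s \<longleftrightarrow> ?P4"
 proof
  assume s: ?s
  then show ?P4 using 2 sub psi bijective_psi' by blast
 next
  assume 4: ?P4
  \<comment> \<open>The hypothesis speaks of comodules over \<open>'u\<close>, so it is applied to a
    copy of C. The copy is rational, hence subgenerated by C and, by the equality assumed, by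
    A.\<close>
  obtain M :: "(unit, 'u, 'a, 'c) comodule" and \<phi> \<psi>
   where M: "comodule A C M" "right_copy A CM M \<phi> \<psi>" "colinear A C CM M \<phi>" "colinear A C M CM \<psi>"
   using obtain_comodule_copy[OF comodule_C] small_C by auto
  have "dual_module M \<in> subgenerated_by S C\<^sub>S"
   using right_S_dual[OF M(1)] rational_dual[OF M(1)] unfolding subgenerated_by_C by simp
  then have "bij_psi M" using 4 M(1) bijective_psi' by blast
  then have "bij_psi CM" by (rule psi_bij_copy[OF comodule_C M])
  then show ?s using 3 4 bijective_psi'[OF comodule_C] by blast
 qed
 show "?s \<longleftrightarrow> ?P7"
 proof
  assume s: ?s
  then show ?P7 using wg sub[OF s] psi counit_iso'_iff by blast
 next
  assume 7: ?P7
  have inj: "inj_on (psi M) (carrier (coA M))" if M: "comodule A C M" "co_generated (dual_module M)"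
   for M :: "(unit, 'u, 'a, 'c) comodule"
   using 7 counit_iso'_iff[OF M(1)] M generated_by_A[OF right_S_dual[OF M(1)]] unfolding bij_betw_def by blast
  have w: "weak_generator TYPE('u) B AA" and \<sigma>: ?\<sigma> using 7 by blast+
  show ?s by (rule subgenerated_strong_structure[OF weak_generator_lifts[OF w inj] weak_generator_generates[OF w inj] \<sigma>])
 qed
qed

end

section \<open>Equivalences of categories\<close>

text \<open>The record \<open>category\<close> carries no axioms; these are the laws on which the
  argument relies.\<close>

locale category_laws =
 fixes C :: "('o, 'f) category"
 assumes ident_mor: "X \<in> obj C ==> ident C X \<in> mor C X X"
  and comp_mor: "[|X \<in> obj C; Y \<in> obj C; Z \<in> obj C; f \<in> mor C X Y; g \<in> mor C Y Z|] ==> comp C X g f \<in> mor C X Z"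
  and comp_assoc: "[|X \<in> obj C; Y \<in> obj C; Z \<in> obj C; W \<in> obj C; f \<in> mor C X Y; g \<in> mor C Y Z; h \<in> mor C Z W|] ==>
   comp C X h (comp C X g f) = comp C X (comp C Y h g) f"
  and comp_ident: "[|X \<in> obj C; Y \<in> obj C; f \<in> mor C X Y|] ==> comp C X f (ident C X) = f"
   "[|X \<in> obj C; Y \<in> obj C; f \<in> mor C X Y|] ==> comp C X (ident C Y) f = f"
begin

lemma iso_cancel_left:
 assumes "iso_in C X Y t" and X: "X \<in> obj C" and Y: "Y \<in> obj C" and W: "W \<in> obj C"
  and f: "f \<in> mor C W X" and g: "g \<in> mor C W X" and eq: "comp C W t f = comp C W t g"
 shows "f = g"
proof -
 obtain s where t: "t \<in> mor C X Y" and s: "s \<in> mor C Y X" "comp C X s t = ident C X"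
  using assms(1) unfolding iso_in_def by blast
 have *: "comp C W s (comp C W t f) = f" "comp C W s (comp C W t g) = g"
  by (simp_all only: comp_assoc[OF W X Y X f t s(1)] comp_assoc[OF W X Y X g t s(1)] comp_ident(2)[OF W X f] comp_ident(2)[OF W X g] s(2))
 show ?thesis using *(1) unfolding eq *(2) by (rule sym)
qed

lemma iso_cancel_right:
 assumes "iso_in C X Y t" and X: "X \<in> obj C" and Y: "Y \<in> obj C" and Z: "Z \<in> obj C"
  and f: "f \<in> mor C Y Z" and g: "g \<in> mor C Y Z" and eq: "comp C X f t = comp C X g t"
 shows "f = g"
proof -
 obtain s where t: "t \<in> mor C X Y" and s: "s \<in> mor C Y X" "comp C Y t s = ident C Y"
  using assms(1) unfolding iso_in_def by blast
 have *: "comp C Y (comp C X f t) s = f" "comp C Y (comp C X g t) s = g"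
  by (simp_all only: comp_assoc[OF Y X Y Z s(1) t f, symmetric] comp_assoc[OF Y X Y Z s(1) t g, symmetric]
    comp_ident(1)[OF Y Z f] comp_ident(1)[OF Y Z g] s(2))
 show ?thesis using *(1) unfolding eq *(2) by (rule sym)
qed

end

lemma is_functorD:
 assumes "is_functor C D F Fm"
 shows "X \<in> obj C ==> F X \<in> obj D"
  and "[|X \<in> obj C; Y \<in> obj C; f \<in> mor C X Y|] ==> Fm X Y f \<in> mor D (F X) (F Y)"
  and "X \<in> obj C ==> Fm X X (ident C X) = ident D (F X)"
  and "[|X \<in> obj C; Y \<in> obj C; Z \<in> obj C; f \<in> mor C X Y; g \<in> mor C Y Z|] ==>
   Fm X Z (comp C X g f) = comp D (F X) (Fm Y Z g) (Fm X Y f)"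
 using assms unfolding is_functor_def by blast+

text \<open>By naturality, f after \<tau> X equals \<tau> Y after H f, so H f determines f once the
  isomorphism \<tau> X is cancelled. Applied to GF and to FG, this makes F and G faithful.\<close>

lemma natural_iso_to_id_faithful:
 assumes C: "category_laws C" and nat: "natural_iso_to_id C H Hm \<tau>" and H: "!!X. X \<in> obj C ==> H X \<in> obj C"
  and XY: "X \<in> obj C" "Y \<in> obj C" and f: "f \<in> mor C X Y" and g: "g \<in> mor C X Y" and eq: "Hm X Y f = Hm X Y g"
 shows "f = g"
proof (rule category_laws.iso_cancel_right[OF C _ H[OF XY(1)] XY f g])
 show "iso_in C (H X) X (\<tau> X)" using nat XY(1) unfolding natural_iso_to_id_def by blast
 have "comp C (H X) (\<tau> Y) (Hm X Y h) = comp C (H X) h (\<tau> X)" if "h \<in> mor C X Y" for h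
  using nat XY that unfolding natural_iso_to_id_def by blast
 then show "comp C (H X) f (\<tau> X) = comp C (H X) g (\<tau> X)" using f g eq by metis
qed

lemma equivalence_fully_faithful:
 assumes C: "category_laws C" and D: "category_laws D" and eq: "is_equivalence C D F Fm"
 shows "[|X \<in> obj C; Y \<in> obj C|] ==> bij_betw (Fm X Y) (mor C X Y) (mor D (F X) (F Y))"
  and "N \<in> obj D ==> \<exists>X\<in>obj C. \<exists>f. iso_in D (F X) N f"
proof -
 interpret C: category_laws C by (rule C)
 interpret D: category_laws D by (rule D)
 obtain G Gm \<tau> \<sigma> where F: "is_functor C D F Fm" and G: "is_functor D C G Gm"
  and \<tau>: "natural_iso_to_id C (\<lambda>X. G (F X)) (\<lambda>X Y f. Gm (F X) (F Y) (Fm X Y f)) \<tau>"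
  and \<sigma>: "natural_iso_to_id D (\<lambda>X. F (G X)) (\<lambda>X Y f. Fm (G X) (G Y) (Gm X Y f)) \<sigma>"
  using eq unfolding is_equivalence_def by blast
 note F = is_functorD[OF F] and G = is_functorD[OF G]
 show "\<exists>X\<in>obj C. \<exists>f. iso_in D (F X) N f" if N: "N \<in> obj D"
  using \<sigma> G(1)[OF N] N unfolding natural_iso_to_id_def by blast
 show "bij_betw (Fm X Y) (mor C X Y) (mor D (F X) (F Y))" if X: "X \<in> obj C" and Y: "Y \<in> obj C"
  unfolding bij_betw_def
 proof
  show "inj_on (Fm X Y) (mor C X Y)"
   using natural_iso_to_id_faithful[OF C \<tau> G(1)[OF F(1)] X Y] by (auto intro!: inj_onI)
  show "Fm X Y ` mor C X Y = mor D (F X) (F Y)"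
  proof
   show "Fm X Y ` mor C X Y \<subseteq> mor D (F X) (F Y)" using F(2)[OF X Y] by blast
   show "mor D (F X) (F Y) \<subseteq> Fm X Y ` mor C X Y"
   proof
    fix g assume g: "g \<in> mor D (F X) (F Y)"
    note FX = F(1)[OF X] and FY = F(1)[OF Y]
    note GX = G(1)[OF FX] and GY = G(1)[OF FY] and Gg = G(2)[OF FX FY g]
    have tX: "iso_in C (G (F X)) X (\<tau> X)" and tY: "iso_in C (G (F Y)) Y (\<tau> Y)"
     using \<tau> X Y unfolding natural_iso_to_id_def by blast+
    obtain s where t: "\<tau> X \<in> mor C (G (F X)) X" and s: "s \<in> mor C X (G (F X))" "comp C (G (F X)) s (\<tau> X) = ident C (G (F X))"
     using tX unfolding iso_in_def by blast
    have t': "\<tau> Y \<in> mor C (G (F Y)) Y" using tY unfolding iso_in_def by blast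
    note tg = C.comp_mor[OF GX GY Y Gg t']
    \<comment> \<open>The composite of \<tau> Y, G g and the inverse of \<tau> X. Naturality gives
      G(F f) = G g, and G is faithful.\<close>
    let ?f = "comp C X (comp C (G (F X)) (\<tau> Y) (Gm (F X) (F Y) g)) s"
    have f: "?f \<in> mor C X Y" by (rule C.comp_mor[OF X GX Y s(1) tg])
    have "comp C (G (F X)) (\<tau> Y) (Gm (F X) (F Y) (Fm X Y ?f)) = comp C (G (F X)) ?f (\<tau> X)"
     using \<tau> X Y f unfolding natural_iso_to_id_def by blast
    also have "\<dots> = comp C (G (F X)) (\<tau> Y) (Gm (F X) (F Y) g)"
     by (simp only: C.comp_assoc[OF GX X GX Y t s(1) tg, symmetric] s(2) C.comp_ident(1)[OF GX Y tg])
    finally have *: "Gm (F X) (F Y) (Fm X Y ?f) = Gm (F X) (F Y) g"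
     by (rule C.iso_cancel_left[OF tY GY Y GX G(2)[OF FX FY F(2)[OF X Y f]] Gg])
    have "Fm X Y ?f = g"
     by (rule natural_iso_to_id_faithful[OF D \<sigma> F(1)[OF G(1)] FX FY F(2)[OF X Y f] g]) (simp_all add: *)
    then show "g \<in> Fm X Y ` mor C X Y" by (rule image_eqI[OF sym f])
   qed
  qed
 qed
qed

text \<open>Choose for each N an object G N and an isomorphism e N from F(G N) to N. A morphism is
  sent to the preimage under F of its conjugate by e, and every identity needed can be checked after
  applying the faithful F.\<close>

lemma fully_faithful_equivalence:
 assumes C: "category_laws C" and D: "category_laws D" and F: "is_functor C D F Fm"
  and ff: "!!X Y. [|X \<in> obj C; Y \<in> obj C|] ==> bij_betw (Fm X Y) (mor C X Y) (mor D (F X) (F Y))"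
  and es: "!!N. N \<in> obj D ==> \<exists>X\<in>obj C. \<exists>f. iso_in D (F X) N f"
 shows "is_equivalence C D F Fm"
proof -
 interpret C: category_laws C by (rule C)
 interpret D: category_laws D by (rule D)
 note Fun = is_functorD[OF F]
 have "\<forall>N\<in>obj D. \<exists>X f g. X \<in> obj C \<and> f \<in> mor D (F X) N \<and> g \<in> mor D N (F X) \<and>
  comp D (F X) g f = ident D (F X) \<and> comp D N f g = ident D N"
  using es unfolding iso_in_def by blast
 then obtain G e i where G: "!!N. N \<in> obj D ==> G N \<in> obj C"
  and e: "!!N. N \<in> obj D ==> e N \<in> mor D (F (G N)) N" and i: "!!N. N \<in> obj D ==> i N \<in> mor D N (F (G N))"
  and ie: "!!N. N \<in> obj D ==> comp D (F (G N)) (i N) (e N) = ident D (F (G N))"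
  and ei: "!!N. N \<in> obj D ==> comp D N (e N) (i N) = ident D N"
  unfolding bchoice_iff by metis
 define Fi where "Fi X Y = inv_into (mor C X Y) (Fm X Y)" for X Y
 have Fi: "Fi X Y g \<in> mor C X Y" "Fm X Y (Fi X Y g) = g" if "X \<in> obj C" "Y \<in> obj C" "g \<in> mor D (F X) (F Y)" for X Y g
  using ff[OF that(1,2)] that(3) inv_into_into[of g "Fm X Y" "mor C X Y"] f_inv_into_f[of g "Fm X Y" "mor C X Y"]
  by (auto simp: Fi_def bij_betw_def)
 have inj: "f = f'" if "X \<in> obj C" "Y \<in> obj C" "f \<in> mor C X Y" "f' \<in> mor C X Y" "Fm X Y f = Fm X Y f'" for X Y f f'
  using ff[OF that(1,2)] that(3-) by (auto simp: bij_betw_def dest: inj_onD)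
 define c where "c N N' g = comp D (F (G N)) (i N') (comp D (F (G N)) g (e N))" for N N' g
 have c: "c N N' g \<in> mor D (F (G N)) (F (G N'))" "comp D (F (G N)) (e N') (c N N' g) = comp D (F (G N)) g (e N)"
  if N: "N \<in> obj D" and N': "N' \<in> obj D" and g: "g \<in> mor D N N'" for N N' g
 proof -
  note o = Fun(1)[OF G[OF N]] Fun(1)[OF G[OF N']]
  note ge = D.comp_mor[OF o(1) N N' e[OF N] g]
  show "c N N' g \<in> mor D (F (G N)) (F (G N'))" unfolding c_def by (rule D.comp_mor[OF o(1) N' o(2) ge i[OF N']])
  show "comp D (F (G N)) (e N') (c N N' g) = comp D (F (G N)) g (e N)"
   by (simp only: c_def D.comp_assoc[OF o(1) N' o(2) N' ge i[OF N'] e[OF N']] ei[OF N'] D.comp_ident(2)[OF o(1) N' ge])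
 qed
 \<comment> \<open>The conjugate is the only morphism that makes e natural, so the identity and
   composition laws for G reduce to naturality squares.\<close>
 have c_unique: "c N N' g = k" if N: "N \<in> obj D" "N' \<in> obj D" "g \<in> mor D N N'" and k: "k \<in> mor D (F (G N)) (F (G N'))"
  "comp D (F (G N)) (e N') k = comp D (F (G N)) g (e N)" for N N' g k
 proof (rule D.iso_cancel_left[OF _ Fun(1)[OF G[OF N(2)]] N(2) Fun(1)[OF G[OF N(1)]] c(1)[OF N] k(1)])
  show "iso_in D (F (G N')) N' (e N')" unfolding iso_in_def using e[OF N(2)] i[OF N(2)] ie[OF N(2)] ei[OF N(2)] by blast
  show "comp D (F (G N)) (e N') (c N N' g) = comp D (F (G N)) (e N') k" by (simp only: c(2)[OF N] k(2))
 qed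
 define Gm where "Gm N N' g = Fi (G N) (G N') (c N N' g)" for N N' g
 have Gm: "Gm N N' g \<in> mor C (G N) (G N')" "Fm (G N) (G N') (Gm N N' g) = c N N' g"
  if N: "N \<in> obj D" "N' \<in> obj D" "g \<in> mor D N N'" for N N' g
  unfolding Gm_def using Fi[OF G[OF N(1)] G[OF N(2)] c(1)[OF N]] by blast+
 have GF: "is_functor D C G Gm"
  unfolding is_functor_def
 proof (intro conjI ballI)
  fix N assume N: "N \<in> obj D"
  show "G N \<in> obj C" by (rule G[OF N])
  note GN = G[OF N]
  note FGN = Fun(1)[OF GN]
  show "Gm N N (ident D N) = ident C (G N)"
  proof (rule inj[OF GN GN Gm(1)[OF N N D.ident_mor[OF N]] C.ident_mor[OF GN]])
   have "c N N (ident D N) = ident D (F (G N))"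
    by (rule c_unique[OF N N D.ident_mor[OF N] D.ident_mor[OF FGN]])
     (simp only: D.comp_ident[OF FGN N e[OF N]])
   then show "Fm (G N) (G N) (Gm N N (ident D N)) = Fm (G N) (G N) (ident C (G N))"
    by (simp only: Gm(2)[OF N N D.ident_mor[OF N]] Fun(3)[OF GN])
  qed
  fix N' assume N': "N' \<in> obj D"
  note GN' = G[OF N']
  note FGN' = Fun(1)[OF GN']
  fix g assume g: "g \<in> mor D N N'"
  show "Gm N N' g \<in> mor C (G N) (G N')" by (rule Gm(1)[OF N N' g])
 next
  fix N N' N'' g h
  assume N: "N \<in> obj D" and N': "N' \<in> obj D" and N'': "N'' \<in> obj D" and g: "g \<in> mor D N N'" and h: "h \<in> mor D N' N''"
  note o = G[OF N] G[OF N'] G[OF N'']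
  note Fo = Fun(1)[OF o(1)] Fun(1)[OF o(2)] Fun(1)[OF o(3)]
  note m = Gm(1)[OF N N' g] Gm(1)[OF N' N'' h] and cg = c[OF N N' g] and ch = c[OF N' N'' h]
  note hg = D.comp_mor[OF N N' N'' g h]
  show "Gm N N'' (comp D N h g) = comp C (G N) (Gm N' N'' h) (Gm N N' g)"
  proof (rule inj[OF o(1,3) Gm(1)[OF N N'' hg] C.comp_mor[OF o m]])
   have "c N N'' (comp D N h g) = comp D (F (G N)) (c N' N'' h) (c N N' g)"
   proof (rule c_unique[OF N N'' hg D.comp_mor[OF Fo cg(1) ch(1)]])
    have "comp D (F (G N)) (e N'') (comp D (F (G N)) (c N' N'' h) (c N N' g)) =
      comp D (F (G N)) (comp D (F (G N')) h (e N')) (c N N' g)"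
     by (simp only: D.comp_assoc[OF Fo N'' cg(1) ch(1) e[OF N'']] ch(2))
    also have "\<dots> = comp D (F (G N)) h (comp D (F (G N)) g (e N))"
     by (simp only: D.comp_assoc[OF Fo(1,2) N' N'' cg(1) e[OF N'] h, symmetric] cg(2))
    also have "\<dots> = comp D (F (G N)) (comp D N h g) (e N)" by (rule D.comp_assoc[OF Fo(1) N N' N'' e[OF N] g h])
    finally show "comp D (F (G N)) (e N'') (comp D (F (G N)) (c N' N'' h) (c N N' g)) = comp D (F (G N)) (comp D N h g) (e N)" .
   qed
   then show "Fm (G N) (G N'') (Gm N N'' (comp D N h g)) = Fm (G N) (G N'') (comp C (G N) (Gm N' N'' h) (Gm N N' g))"
    by (simp only: Gm(2)[OF N N'' hg] Fun(4)[OF o m] Gm(2)[OF N N' g] Gm(2)[OF N' N'' h])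
  qed
 qed
 have natD: "natural_iso_to_id D (\<lambda>X. F (G X)) (\<lambda>X Y f. Fm (G X) (G Y) (Gm X Y f)) e"
  unfolding natural_iso_to_id_def
 proof (intro conjI ballI)
  show "iso_in D (F (G N)) N (e N)" if N: "N \<in> obj D" for N
   unfolding iso_in_def using e[OF N] i[OF N] ie[OF N] ei[OF N] by blast
  show "comp D (F (G N)) (e N') (Fm (G N) (G N') (Gm N N' g)) = comp D (F (G N)) g (e N)"
   if "N \<in> obj D" "N' \<in> obj D" "g \<in> mor D N N'" for N N' g
   by (simp only: Gm(2)[OF that] c(2)[OF that])
 qed
 \<comment> \<open>The preimage under F of the isomorphism e at F X; its inverse is the preimage of
   i.\<close>
 define \<tau> where "\<tau> X = Fi (G (F X)) X (e (F X))" for X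
 have natC: "natural_iso_to_id C (\<lambda>X. G (F X)) (\<lambda>X Y f. Gm (F X) (F Y) (Fm X Y f)) \<tau>"
  unfolding natural_iso_to_id_def
 proof (intro conjI ballI)
  have \<tau>: "\<tau> X \<in> mor C (G (F X)) X" "Fm (G (F X)) X (\<tau> X) = e (F X)" if X: "X \<in> obj C" for X
   unfolding \<tau>_def using Fi[OF G[OF Fun(1)[OF X]] X e[OF Fun(1)[OF X]]] by blast+
  fix X assume X: "X \<in> obj C"
  note FX = Fun(1)[OF X]
  note GFX = G[OF FX]
  let ?s = "Fi X (G (F X)) (i (F X))"
  note s = Fi[OF X GFX i[OF FX]]
  have "comp C (G (F X)) ?s (\<tau> X) = ident C (G (F X))"
   by (rule inj[OF GFX GFX C.comp_mor[OF GFX X GFX \<tau>(1)[OF X] s(1)] C.ident_mor[OF GFX]])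
    (simp only: Fun(4)[OF GFX X GFX \<tau>(1)[OF X] s(1)] s(2) \<tau>(2)[OF X] ie[OF FX] Fun(3)[OF GFX])
  moreover have "comp C X (\<tau> X) ?s = ident C X"
   by (rule inj[OF X X C.comp_mor[OF X GFX X s(1) \<tau>(1)[OF X]] C.ident_mor[OF X]])
    (simp only: Fun(4)[OF X GFX X s(1) \<tau>(1)[OF X]] s(2) \<tau>(2)[OF X] ei[OF FX] Fun(3)[OF X])
  ultimately show "iso_in C (G (F X)) X (\<tau> X)" unfolding iso_in_def using \<tau>(1)[OF X] s(1) by blast
  fix Y f assume Y: "Y \<in> obj C" and f: "f \<in> mor C X Y"
  note FY = Fun(1)[OF Y]
  note GFY = G[OF FY] and Ff = Fun(2)[OF X Y f]
  note gm = Gm[OF FX FY Ff]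
  show "comp C (G (F X)) (\<tau> Y) (Gm (F X) (F Y) (Fm X Y f)) = comp C (G (F X)) f (\<tau> X)"
   by (rule inj[OF GFX Y C.comp_mor[OF GFX GFY Y gm(1) \<tau>(1)[OF Y]] C.comp_mor[OF GFX X Y \<tau>(1)[OF X] f]])
    (simp only: Fun(4)[OF GFX GFY Y gm(1) \<tau>(1)[OF Y]] Fun(4)[OF GFX X Y \<tau>(1)[OF X] f] gm(2) \<tau>(2)[OF X] \<tau>(2)[OF Y] c(2)[OF FX FY Ff])
 qed
 show ?thesis unfolding is_equivalence_def using F GF natC natD by blast
qed

section \<open>The functor of coinvariants as an equivalence\<close>

lemma right_copy_trans:
 assumes "right_copy R M N \<phi> \<psi>" "right_copy R N P \<phi>' \<psi>'"
 shows "right_copy R M P (\<lambda>m. \<phi>' (\<phi> m)) (\<lambda>p. \<psi> (\<psi>' p))"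
proof -
 note c = right_copyD[OF assms(1)] and d = right_copyD[OF assms(2)]
 show ?thesis by (rule right_copyI[OF c(1) d(2) right_linear_comp[OF c(3) d(3)]]) (simp_all add: c d)
qed

lemma right_homD:
 assumes "g \<in> right_hom R M N"
 shows "right_linear R M N g" "g \<in> extensional (carrier M)"
 using assms by (simp_all add: right_hom_def)

lemma right_copy_hom_bij:
 assumes "right_copy R M M' \<phi> \<psi>" "right_copy R N N' \<phi>' \<psi>'"
 shows "bij_betw (\<lambda>g. \<lambda>m\<in>carrier M'. \<phi>' (g (\<psi> m))) (right_hom R M N) (right_hom R M' N')"
proof (rule bij_betwI[where g = "\<lambda>g. \<lambda>m\<in>carrier M. \<psi>' (g (\<phi> m))"])
 note c = right_copyD[OF assms(1)] and d = right_copyD[OF assms(2)]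
 note hom = right_homD
 show "(\<lambda>g. \<lambda>m\<in>carrier M'. \<phi>' (g (\<psi> m))) \<in> right_hom R M N \<rightarrow> right_hom R M' N'"
  using right_linear_restrict[OF c(2), of N'] right_linear_comp[OF right_linear_comp[OF c(4) hom(1)] d(3)]
  by (simp add: right_hom_def)
 show "(\<lambda>g. \<lambda>m\<in>carrier M. \<psi>' (g (\<phi> m))) \<in> right_hom R M' N' \<rightarrow> right_hom R M N"
  using right_linear_restrict[OF c(1), of N] right_linear_comp[OF right_linear_comp[OF c(3) hom(1)] d(4)]
  by (simp add: right_hom_def)
 show "(\<lambda>m\<in>carrier M. \<psi>' ((\<lambda>m\<in>carrier M'. \<phi>' (g (\<psi> m))) (\<phi> m))) = g" if "g \<in> right_hom R M N" for g
  using c(5,7) d(5) right_linearD(2)[OF hom(1)[OF that]] extensional_arb[OF hom(2)[OF that]] by (intro ext) (auto simp: restrict_def)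
 show "(\<lambda>m\<in>carrier M'. \<phi>' ((\<lambda>m\<in>carrier M. \<psi>' (g (\<phi> m))) (\<psi> m))) = g" if "g \<in> right_hom R M' N'" for g
  using c(6,8) d(6) right_linearD(2)[OF hom(1)[OF that]] extensional_arb[OF hom(2)[OF that]] by (intro ext) (auto simp: restrict_def)
qed

context small_coring begin

abbreviation "comodules \<equiv> (comodule_category A C :: ((unit, 'u, 'a, 'c) comodule, 'u => 'u) category)"
abbreviation "modules \<equiv> (module_category TYPE('u) B :: ((unit, 'a => 'u, 'a) bimodule, ('a => 'u) => ('a => 'u)) category)"
abbreviation "homF h M \<equiv> (\<lambda>f\<in>colinear_maps A C AC M. compose (carrier A) h f)"

text \<open>Full faithfulness of the Hom functor seen on coinvariants, where a morphism acts by mere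
  restriction.\<close>

definition fully_faithful_co :: bool where
 "fully_faithful_co \<longleftrightarrow> (\<forall>(M :: (unit, 'u, 'a, 'c) comodule) (N :: (unit, 'u, 'a, 'c) comodule).
   comodule A C M \<and> comodule A C N -->
   bij_betw (\<lambda>h. restrict h (co M)) (colinear_maps A C M N) (right_hom B (coM M) (coM N)))"

text \<open>Essential surjectivity, with N over \<open>'u\<close> in place of the type
  \<open>'a => 'u\<close> in which the Hom modules live.\<close>

definition dense_co :: bool where
 "dense_co \<longleftrightarrow> (\<forall>N :: (unit, 'u, 'a) bimodule. right_module B N -->
   (\<exists>(M :: (unit, 'u, 'a, 'c) comodule) \<phi> \<psi>. comodule A C M \<and> right_copy B N (coM M) \<phi> \<psi>))"

lemma category_comodules: "category_laws comodules"
proof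
 fix X Y Z W :: "(unit, 'u, 'a, 'c) comodule" and f g h
 show "ident comodules X \<in> mor comodules X X" if "X \<in> obj comodules"
  using that colinear_restrict[OF _ _ colinear_ident[of X]] by (simp add: comodule_category_def)
 assume X: "X \<in> obj comodules" and Y: "Y \<in> obj comodules"
 assume f: "f \<in> mor comodules X Y"
 note c = colinear_maps_iff
 have fe: "f \<in> extensional (carrier X)" and fc: "colinear A C X Y f" using f X Y c[of X Y f] by (simp_all add: comodule_category_def)
 have fX: "m : X ==> f m : Y" for m using fc right_linearD(2) by (force simp: colinear_def)
 show "comp comodules X f (ident comodules X) = f" "comp comodules X (ident comodules Y) f = f"
  using fe fX by (auto simp: comodule_category_def compose_def extensional_def fun_eq_iff)
 assume Z: "Z \<in> obj comodules" and g: "g \<in> mor comodules Y Z"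
 have gc: "colinear A C Y Z g" using g Y Z c[of Y Z g] by (simp add: comodule_category_def)
 have "colinear A C X Z (\<lambda>m. g (f m))" by (rule colinear_compose[OF _ _ _ fc gc]) (use X Y Z in \<open>simp_all add: comodule_category_def\<close>)
 then show "comp comodules X g f \<in> mor comodules X Z"
  using colinear_restrict[of X Z "\<lambda>m. g (f m)"] X Z by (simp add: comodule_category_def compose_def)
 show "comp comodules X h (comp comodules X g f) = comp comodules X (comp comodules Y h g) f"
  using fX by (auto simp: comodule_category_def compose_def fun_eq_iff)
qed

lemma category_modules: "category_laws modules"
proof
 fix X Y Z W :: "(unit, 'a => 'u, 'a) bimodule" and f g h
 show "ident modules X \<in> mor modules X X" if "X \<in> obj modules"
  using that right_linear_restrict[of B X X "\<lambda>m. m"] right_linear_ident[of B X] by (simp add: module_category_def right_hom_def)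
 assume X: "X \<in> obj modules" and Y: "Y \<in> obj modules"
 assume f: "f \<in> mor modules X Y"
 have fe: "f \<in> extensional (carrier X)" and fc: "right_linear B X Y f" using f by (simp_all add: module_category_def right_hom_def)
 have fX: "m : X ==> f m : Y" for m by (rule right_linearD(2)[OF fc])
 show "comp modules X f (ident modules X) = f" "comp modules X (ident modules Y) f = f"
  using fe fX by (auto simp: module_category_def compose_def extensional_def fun_eq_iff)
 assume Z: "Z \<in> obj modules" and g: "g \<in> mor modules Y Z"
 have gc: "right_linear B Y Z g" using g by (simp add: module_category_def right_hom_def)
 show "comp modules X g f \<in> mor modules X Z"
  using right_linear_comp[OF fc gc] right_linear_restrict[of B X Z "\<lambda>m. g (f m)"] X by (simp add: module_category_def compose_def right_hom_def)
 show "comp modules X h (comp modules X g f) = comp modules X (comp modules Y h g) f"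
  using fX by (auto simp: module_category_def compose_def fun_eq_iff)
qed

lemma small_homA: "comodule A C M ==> small TYPE('u) (homA M)" for M :: "(unit, 'u, 'a, 'c) comodule"
 unfolding lepoll_def using right_copyD(5)[OF hom_copy[of M]]
 by (intro exI[of _ "\<lambda>f. f \<one>\<^sub>A"] conjI inj_on_inverseI[of _ "\<lambda>m. \<lambda>a\<in>carrier A. m \<star>\<^sub>M a"]) simp_all

lemma colinear_maps_A:
 assumes N: "comodule A C N" and f: "f \<in> colinear_maps A C AC N"
 shows "colinear A C AC N f" "a : A ==> f a : N" "a \<notin> carrier A ==> f a = undefined"
proof -
 have *: "f \<in> extensional (carrier A)" "colinear A C AC N f" using f by (simp_all add: colinear_maps_iff[OF comodule_AC N])
 then have l: "right_linear A AC N f" by (simp add: colinear_def)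
 show "colinear A C AC N f" by (rule *(2))
 show "f a : N" if "a : A" by (rule right_linearD(2)[OF l]) (simp add: that)
 show "f a = undefined" if "a \<notin> carrier A" by (rule extensional_arb[OF *(1) that])
qed

lemma homF_apply:
 assumes "f \<in> colinear_maps A C AC M"
 shows "homF h M f = compose (carrier A) h f" "homF h M f \<one>\<^sub>A = h (f \<one>\<^sub>A)"
 using assms by (simp_all add: compose_def)

lemma homF_closed:
 assumes M: "comodule A C M" and N: "comodule A C N" and h: "colinear A C M N h" and f: "f \<in> colinear_maps A C AC M"
 shows "homF h M f \<in> colinear_maps A C AC N"
proof -
 have "colinear A C AC M f" using f colinear_maps_iff[OF comodule_AC M] by blast
 then have "colinear A C AC N (\<lambda>a. h (f a))" by (rule colinear_compose[OF comodule_AC M N _ h])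
 from colinear_restrict[OF comodule_AC N this] show ?thesis using f by (simp add: compose_def)
qed

lemma homF_hom:
 assumes M: "comodule A C M" and N: "comodule A C N" and h: "colinear A C M N h"
 shows "homF h M \<in> right_hom B (homA M) (homA N)"
proof -
 note cM = right_copyD[OF hom_copy[OF M]] and cN = right_copyD[OF hom_copy[OF N]]
 have hl: "right_linear B (coM M) (coM N) h" by (rule colinear_coM[OF M N h])
 have "right_linear B (homA M) (homA N) (\<lambda>f. \<lambda>a\<in>carrier A. h (f \<one>\<^sub>A) \<star>\<^sub>N a)"
  using right_linear_comp[OF right_linear_comp[OF cM(3) hl] cN(4)] .
 moreover have "restrict (\<lambda>f. \<lambda>a\<in>carrier A. h (f \<one>\<^sub>A) \<star>\<^sub>N a) (carrier (homA M)) = homF h M"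
 proof
  fix f show "restrict (\<lambda>f. \<lambda>a\<in>carrier A. h (f \<one>\<^sub>A) \<star>\<^sub>N a) (carrier (homA M)) f = homF h M f"
   using cN(5)[of "homF h M f"] homF_closed[OF M N h, of f] homF_apply(2)[of f M h] by auto
 qed
 ultimately have "right_linear B (homA M) (homA N) (homF h M)"
  using right_linear_restrict[OF cM(1), of "homA N" "\<lambda>f. \<lambda>a\<in>carrier A. h (f \<one>\<^sub>A) \<star>\<^sub>N a"] by (simp only:)
 then show ?thesis by (simp add: right_hom_def)
qed

lemma functor_homA: "is_functor comodules modules (colinear_hom_module A C x) (\<lambda>M N h. homF h M)"
 unfolding is_functor_def
proof (intro conjI ballI)
 fix X Y :: "(unit, 'u, 'a, 'c) comodule" and f
 assume X: "X \<in> obj comodules"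
 then have cX: "comodule A C X" by (simp add: comodule_category_def)
 show "homA X \<in> obj modules"
  using right_copyD(1)[OF hom_copy[OF cX]] small_homA[OF cX] by (simp add: module_category_def)
 have fX: "k \<in> colinear_maps A C AC X ==> a : A ==> k a : X" "k \<in> colinear_maps A C AC X ==> a \<notin> carrier A ==> k a = undefined" for k a
  using colinear_maps_A[OF cX, of k] by blast+
 show "homF (ident comodules X) X = ident modules (homA X)"
 proof
  fix k
  have "compose (carrier A) (\<lambda>m\<in>carrier X. m) k = k" if k: "k \<in> colinear_maps A C AC X"
  proof
   show "compose (carrier A) (\<lambda>m\<in>carrier X. m) k a = k a" for a
    using fX(1)[OF k, of a] fX(2)[OF k, of a] by (cases "a : A") (simp_all add: compose_def)
  qed
  then show "homF (ident comodules X) X k = ident modules (homA X) k"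
   by (simp add: comodule_category_def module_category_def)
 qed
 assume Y: "Y \<in> obj comodules" and f: "f \<in> mor comodules X Y"
 then have cY: "comodule A C Y" and fc: "colinear A C X Y f" using colinear_maps_iff[OF cX, of Y f] by (auto simp: comodule_category_def)
 show "homF f X \<in> mor modules (homA X) (homA Y)" using homF_hom[OF cX cY fc] by (simp add: module_category_def)
next
 fix X Y Z :: "(unit, 'u, 'a, 'c) comodule" and f g
 assume X: "X \<in> obj comodules" and Y: "Y \<in> obj comodules" and Z: "Z \<in> obj comodules"
  and f: "f \<in> mor comodules X Y" and g: "g \<in> mor comodules Y Z"
 have cX: "comodule A C X" and cY: "comodule A C Y" using X Y by (simp_all add: comodule_category_def)
 have fc: "colinear A C X Y f" using f colinear_maps_iff[OF cX cY] by (simp add: comodule_category_def)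
 have fX: "k \<in> colinear_maps A C AC X ==> a : A ==> k a : X" for k a
  using colinear_maps_A[OF cX, of k] by blast
 show "homF (comp comodules X g f) X = comp modules (homA X) (homF g Y) (homF f X)"
 proof
  fix k
  show "homF (comp comodules X g f) X k = comp modules (homA X) (homF g Y) (homF f X) k"
   using homF_closed[OF cX cY fc, of k] fX[of k]
   by (auto simp: comodule_category_def module_category_def compose_def fun_eq_iff)
 qed
qed

lemma iso_in_modules:
 shows "[|N \<in> obj modules; N' \<in> obj modules; right_copy B N N' \<phi> \<psi>|] ==> iso_in modules N N' (restrict \<phi> (carrier N))"
  and "[|N \<in> obj modules; N' \<in> obj modules; iso_in modules N N' f|] ==> \<exists>g. right_copy B N N' f g"
proof -
 assume N: "N \<in> obj modules" "N' \<in> obj modules"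
 have m: "right_module B N" "right_module B N'" using N by (simp_all add: module_category_def)
 {
  assume "right_copy B N N' \<phi> \<psi>"
  note c = right_copyD[OF this]
  show "iso_in modules N N' (restrict \<phi> (carrier N))"
   unfolding iso_in_def
  proof (intro conjI bexI[of _ "restrict \<psi> (carrier N')"])
   show "restrict \<phi> (carrier N) \<in> mor modules N N'" "restrict \<psi> (carrier N') \<in> mor modules N' N"
    using right_linear_restrict[OF m(1), of N' \<phi>] right_linear_restrict[OF m(2), of N \<psi>] c(3,4)
    by (simp_all add: module_category_def right_hom_def)
   show "comp modules N (restrict \<psi> (carrier N')) (restrict \<phi> (carrier N)) = ident modules N"
    "comp modules N' (restrict \<phi> (carrier N)) (restrict \<psi> (carrier N')) = ident modules N'"
    using c(5-8) by (auto simp: module_category_def compose_def fun_eq_iff)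
  qed
 }
 assume "iso_in modules N N' f"
 then obtain g where g: "f \<in> right_hom B N N'" "g \<in> right_hom B N' N" "compose (carrier N) g f = (\<lambda>n\<in>carrier N. n)"
  "compose (carrier N') f g = (\<lambda>n\<in>carrier N'. n)"
  by (auto simp: iso_in_def module_category_def)
 have l: "right_linear B N N' f" "right_linear B N' N g" using g(1,2) by (simp_all add: right_hom_def)
 have "g (f n) = n" if "n : N" for n using fun_cong[OF g(3), of n] that by (simp add: compose_def)
 moreover have "f (g n) = n" if "n : N'" for n using fun_cong[OF g(4), of n] that by (simp add: compose_def)
 ultimately have "right_copy B N N' f g" by (intro right_copyI m l(1) right_linearD(2)[OF l(2)])
 then show "\<exists>g. right_copy B N N' f g" by blast
qed

text \<open>Evaluation at 1 conjugates composition with h into the restriction of h to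
  coinvariants.\<close>

lemma homF_bij_iff:
 assumes M: "comodule A C M" and N: "comodule A C N"
 shows "bij_betw (\<lambda>h. homF h M) (colinear_maps A C M N) (right_hom B (homA M) (homA N)) \<longleftrightarrow>
  bij_betw (\<lambda>h. restrict h (co M)) (colinear_maps A C M N) (right_hom B (coM M) (coM N))"
proof -
 let ?c = "\<lambda>g. \<lambda>m\<in>carrier (coM M). (g (\<lambda>a\<in>carrier A. m \<star>\<^sub>M a)) \<one>\<^sub>A"
 have "bij_betw (\<lambda>h. homF h M) (colinear_maps A C M N) (right_hom B (homA M) (homA N)) \<longleftrightarrow>
   bij_betw (?c \<circ> (\<lambda>h. homF h M)) (colinear_maps A C M N) (right_hom B (coM M) (coM N))"
  by (rule bij_betw_comp_iff2[OF right_copy_hom_bij[OF hom_copy[OF M] hom_copy[OF N]]])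
   (use homF_hom[OF M N] colinear_maps_iff[OF M N] in blast)
 also have "\<dots> \<longleftrightarrow> bij_betw (\<lambda>h. restrict h (co M)) (colinear_maps A C M N) (right_hom B (coM M) (coM N))"
 proof (rule bij_betw_cong)
  fix h
  have "homF h M (\<lambda>a\<in>carrier A. m \<star>\<^sub>M a) \<one>\<^sub>A = h m" if m: "m \<in> co M" for m
   using homF_apply(2)[of "\<lambda>a\<in>carrier A. m \<star>\<^sub>M a" M h] right_copyD(8)[OF hom_copy[OF M], of m] m
    right_module.rsmult_one[OF comoduleD(1)[OF M] coD(1)[OF m]] by simp
  then show "(?c \<circ> (\<lambda>h. homF h M)) h = restrict h (co M)" unfolding comp_apply by (intro ext) (simp del: restrict_apply add: restrict_def)
 qed
 finally show ?thesis .
qed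

lemma hom_functor_equivalence_iff:
 "hom_functor_equivalence TYPE('u) A C x \<longleftrightarrow> fully_faithful_co \<and> dense_co"
proof -
 have ff: "fully_faithful_co \<longleftrightarrow> (\<forall>M\<in>obj comodules. \<forall>N\<in>obj comodules.
   bij_betw (\<lambda>h. homF h M) (mor comodules M N) (mor modules (homA M) (homA N)))"
  unfolding fully_faithful_co_def by (auto simp: comodule_category_def module_category_def homF_bij_iff)
 have dense: "dense_co \<longleftrightarrow> (\<forall>N\<in>obj modules. \<exists>X\<in>obj comodules. \<exists>f. iso_in modules (homA X) N f)"
  unfolding dense_co_def
 proof safe
  fix N assume D: "\<forall>N :: (unit, 'u, 'a) bimodule. right_module B N -->
    (\<exists>(M :: (unit, 'u, 'a, 'c) comodule) \<phi> \<psi>. comodule A C M \<and> right_copy B N (coM M) \<phi> \<psi>)" and o: "N \<in> obj modules"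
  have N: "right_module B N" "small TYPE('u) N" using o by (simp_all add: module_category_def)
  obtain N' :: "(unit, 'u, 'a) bimodule" and \<phi> \<psi> where N': "right_copy B N N' \<phi> \<psi>" by (rule obtain_right_copy[OF N])
  obtain M :: "(unit, 'u, 'a, 'c) comodule" and \<phi>' \<psi>' where M: "comodule A C M" "right_copy B N' (coM M) \<phi>' \<psi>'"
   using D right_copyD(2)[OF N'] by blast
  have Mo: "M \<in> obj comodules" using M(1) by (simp add: comodule_category_def)
  show "\<exists>X\<in>obj comodules. \<exists>f. iso_in modules (homA X) N f"
   using iso_in_modules(1)[OF is_functorD(1)[OF functor_homA Mo] o
     right_copy_trans[OF hom_copy[OF M(1)] right_copy_sym[OF right_copy_trans[OF N' M(2)]]]] Mo by blast
 next
  fix N :: "(unit, 'u, 'a) bimodule"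
  assume D: "\<forall>N\<in>obj modules. \<exists>X\<in>obj comodules. \<exists>f. iso_in modules (homA X) N f" and N: "right_module B N"
  \<comment> \<open>Constant functions embed \<open>'u\<close> into \<open>'a => 'u\<close>, the
    type in which the objects of \<open>modules\<close> have their carriers.\<close>
  have "carrier N \<lesssim> (UNIV :: ('a => 'u) set)"
   unfolding lepoll_def by (intro exI[of _ "\<lambda>u _. u"]) (auto simp: inj_on_def fun_eq_iff)
  then obtain N' :: "(unit, 'a => 'u, 'a) bimodule" and \<phi> \<psi> where N': "right_copy B N N' \<phi> \<psi>" by (rule obtain_right_copy[OF N])
  note c = right_copyD[OF N']
  have "inj_on \<psi> (carrier N')" using c(6) by (metis inj_onI)
  then have o: "N' \<in> obj modules" using c(2) by (auto simp: module_category_def lepoll_def)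
  obtain M f where M: "M \<in> obj comodules" "iso_in modules (homA M) N' f" using D o by blast
  have cM: "comodule A C M" using M(1) by (simp add: comodule_category_def)
  obtain g where "right_copy B (homA M) N' f g"
   using iso_in_modules(2)[OF is_functorD(1)[OF functor_homA M(1)] o M(2)] by blast
  from right_copy_trans[OF right_copy_trans[OF N' right_copy_sym[OF this]] hom_copy[OF cM]]
  show "\<exists>(M :: (unit, 'u, 'a, 'c) comodule) \<phi> \<psi>. comodule A C M \<and> right_copy B N (coM M) \<phi> \<psi>" using cM by blast
 qed
 show ?thesis
  unfolding ff dense hom_functor_equivalence_def
  using equivalence_fully_faithful[OF category_comodules category_modules, where Fm = "\<lambda>M N h. homF h M"]
   fully_faithful_equivalence[OF category_comodules category_modules functor_homA] by blast
qed

lemma colinear_eq_on_span: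
 assumes M: "comodule A C M" and surj: "psi M ` carrier (coA M) = carrier M" and N: "comodule A C N"
  and h: "colinear A C M N h" "colinear A C M N h'" and eq: "!!m. m \<in> co M ==> h m = h' m" and m: "m : M"
 shows "h m = h' m"
proof -
 interpret T: tensor B "coM M" AA by (rule tensor_B[OF right_co[OF M]])
 have l: "right_linear A M N h" "right_linear A M N h'" using h by (simp_all add: colinear_def)
 obtain t where t: "t : T.T" "m = psi M t" using m surj by blast
 have "h (psi M t) = h' (psi M t)"
 proof (rule T.additive_eqI[OF additive_comp[OF psi_additive[OF M] right_linearD(1)[OF l(1)]]
    additive_comp[OF psi_additive[OF M] right_linearD(1)[OF l(2)]] _ t(1)])
  fix n a assume "n : coM M" "a : AA"
  then have n: "n \<in> co M" and a: "a : A" by simp_all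
  show "h (psi M (T.pt n a)) = h' (psi M (T.pt n a))"
   using psi_pure[OF M n a] right_linearD(4)[OF l(1) coD(1)[OF n] a] right_linearD(4)[OF l(2) coD(1)[OF n] a] eq[OF n] by simp
 qed
 then show ?thesis by (simp only: t(2))
qed

lemma strong_structure_co:
 assumes sst: "strong_structure_theorem TYPE('u) A C x"
 shows fully_faithful_co dense_co
proof -
 have psi: "bij_psi M" if "comodule A C M" for M :: "(unit, 'u, 'a, 'c) comodule"
  using strong_structureD(1)[OF sst that subset_imp_lepoll] by simp
 show fully_faithful_co unfolding fully_faithful_co_def
 proof (intro allI impI, elim conjE)
  fix M N :: "(unit, 'u, 'a, 'c) comodule"
  assume M: "comodule A C M" and N: "comodule A C N"
  note iff = colinear_maps_iff[OF M N]
  have full: "\<exists>h. colinear A C M N h \<and> (\<forall>m\<in>co M. h m = k m)" if k: "right_linear B (coM M) (coM N) k" for k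
  proof -
   note RM = right_co[OF M] and RN = right_co[OF N]
   interpret TM: tensor B "coM M" AA by (rule tensor_B[OF RM])
   interpret TN: tensor B "coM N" AA by (rule tensor_B[OF RN])
   \<comment> \<open>The extension of k will be \<Psi>^-1 for M, followed by k \<otimes> A and
     \<Psi> for N.\<close>
   let ?i = "inv_into (carrier TM.T) (psi M)" and ?k = "tmap B (coM M) (coM N) AA k"
   have i: "?i m : TM.T" "psi M (?i m) = m" if "m : M" for m
    using that inv_into_into[of m "psi M" "carrier TM.T"] f_inv_into_f[of m "psi M" "carrier TM.T"] psi[OF M] by (auto simp: bij_betw_def)
   have ip: "?i (psi M t) = t" if "t : TM.T" for t by (rule inv_into_f_f[OF bij_betw_imp_inj_on[OF psi[OF M]] that])
   have ic: "colinear A C M (ind (coM M)) ?i"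
    by (rule colinear_inverse[OF comodule_ind[OF RM] M psi_colinear[OF M]]) (use i ip in auto)
   have hc: "colinear A C M N (\<lambda>m. psi N (?k (?i m)))"
    by (intro colinear_compose[OF M comodule_ind[OF RN] N _ psi_colinear[OF N]]
      colinear_compose[OF M comodule_ind[OF RM] comodule_ind[OF RN] ic] ind_colinear[OF RM RN k])
   moreover have "psi N (?k (?i m)) = k m" if m: "m \<in> co M" for m
   proof -
    have km: "k m \<in> co N" using right_linearD(2)[OF k, of m] m by simp
    have "psi M (TM.pt m \<one>\<^sub>A) = m" using psi_pure[OF M m A.one_closed] right_module.rsmult_one[OF comoduleD(1)[OF M] coD(1)[OF m]] by simp
    then have "?i m = TM.pt m \<one>\<^sub>A" using ip[of "TM.pt m \<one>\<^sub>A"] TM.pure_closed[of m "\<one>\<^sub>A"] m by simp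
    then have "?k (?i m) = TN.pt (k m) \<one>\<^sub>A"
     using tmap_pure[OF TM.ax TN.ax k, of m "\<one>\<^sub>A"] m by simp
    then show ?thesis using psi_pure[OF N km A.one_closed] right_module.rsmult_one[OF comoduleD(1)[OF N] coD(1)[OF km]] by simp
   qed
   ultimately show ?thesis by blast
  qed
  show "bij_betw (\<lambda>h. restrict h (co M)) (colinear_maps A C M N) (right_hom B (coM M) (coM N))"
   unfolding bij_betw_def
  proof (intro conjI equalityI subsetI inj_onI)
   fix h h' assume h: "h \<in> colinear_maps A C M N" "h' \<in> colinear_maps A C M N" and eq: "restrict h (co M) = restrict h' (co M)"
   have "h m = h' m" if "m \<in> co M" for m using fun_cong[OF eq, of m] that by simp
   then have "h m = h' m" if "m : M" for m
    using colinear_eq_on_span[OF M bij_betw_imp_surj_on[OF psi[OF M]] N, of h h'] h that unfolding iff by blast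
   then show "h = h'" using h extensionalityI unfolding iff by blast
  next
   fix k assume "k \<in> (\<lambda>h. restrict h (co M)) ` colinear_maps A C M N"
   then show "k \<in> right_hom B (coM M) (coM N)"
    using colinear_coM[OF M N] right_linear_restrict[OF right_co[OF M], of "coM N"] by (auto simp: right_hom_def iff)
  next
   fix k assume k: "k \<in> right_hom B (coM M) (coM N)"
   then obtain h where h: "colinear A C M N h" "\<forall>m\<in>co M. h m = k m" using full unfolding right_hom_def by blast
   have "restrict (restrict h (carrier M)) (co M) = k"
    using h(2) coD(1)[of _ M] extensional_arb[OF right_homD(2)[OF k]] by (intro ext) (auto simp: restrict_def)
   then show "k \<in> (\<lambda>h. restrict h (co M)) ` colinear_maps A C M N" using colinear_restrict[OF M N h(1)] by blast
  qed
 qed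
 show dense_co unfolding dense_co_def
 proof (intro allI impI)
  fix N :: "(unit, 'u, 'a) bimodule"
  assume N: "right_module B N"
  have sN: "small TYPE('u) N" by (rule subset_imp_lepoll) simp
  have phi: "bij_phi N" by (rule strong_structureD(2)[OF sst N sN])
  obtain M :: "(unit, 'u, 'a, 'c) comodule" and \<phi> \<psi>
   where M: "comodule A C M" "right_copy A (ind N) M \<phi> \<psi>" "colinear A C (ind N) M \<phi>" "colinear A C M (ind N) \<psi>"
   using obtain_comodule_copy[OF comodule_ind[OF N]] small_NA[OF N sN] by auto
  have co: "carrier (coM (ind N)) = phi N ` carrier N" using phi by (simp add: bij_betw_def)
  have "right_copy B N (coM (ind N)) (phi N) (inv_into (carrier N) (phi N))"
  proof (rule right_copyI[OF N right_co[OF comodule_ind[OF N]] unit_linear[OF N]])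
   show "inv_into (carrier N) (phi N) t : N" "phi N (inv_into (carrier N) (phi N) t) = t" if "t : coM (ind N)" for t
    using that unfolding co by (rule inv_into_into, rule f_inv_into_f)
   show "inv_into (carrier N) (phi N) (phi N n) = n" if "n : N" for n
    by (rule inv_into_f_f[OF bij_betw_imp_inj_on[OF phi] that])
  qed
  from right_copy_trans[OF this co_copy[OF comodule_ind[OF N] M]]
  show "\<exists>(M :: (unit, 'u, 'a, 'c) comodule) \<phi> \<psi>. comodule A C M \<and> right_copy B N (coM M) \<phi> \<psi>" using M(1) by blast
 qed
qed

text \<open>Fullness extends the unit of co M to a colinear map s from M to co M \<otimes> A. Then
  \<Psi> after s is the identity on coinvariants, hence everywhere by faithfulness, and s after
  \<Psi> is the identity on pure tensors. For \<Phi>, density reduces to N = co M, where the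
  restriction of \<Psi> to coinvariants is the inverse.\<close>

lemma co_strong_structure:
 assumes ff: fully_faithful_co and dense: dense_co
 shows "strong_structure_theorem TYPE('u) A C x"
proof -
 have full: "\<exists>h. colinear A C M N h \<and> (\<forall>m\<in>co M. h m = k m)"
  if M: "comodule A C M" and N: "comodule A C N" and k: "right_linear B (coM M) (coM N) k" for M N :: "(unit, 'u, 'a, 'c) comodule" and k
 proof -
  have "restrict k (co M) \<in> right_hom B (coM M) (coM N)"
   using right_linear_restrict[OF right_co[OF M], of "coM N" k] k by (simp add: right_hom_def)
  then obtain h where h: "h \<in> colinear_maps A C M N" "restrict k (co M) = restrict h (co M)"
   using ff M N unfolding fully_faithful_co_def bij_betw_def by blast
  have "h m = k m" if "m \<in> co M" for m using fun_cong[OF h(2), of m] that by simp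
  then show ?thesis using h(1) colinear_maps_iff[OF M N] by blast
 qed
 have faith: "h m = m" if M: "comodule A C M" and h: "colinear A C M M h" "!!m. m \<in> co M ==> h m = m" and m: "m : M"
  for M :: "(unit, 'u, 'a, 'c) comodule" and h m
 proof -
  have "restrict (restrict h (carrier M)) (co M) = restrict (restrict (\<lambda>m. m) (carrier M)) (co M)"
   using h(2) coD(1)[of _ M] by (auto simp: fun_eq_iff)
  then have "restrict h (carrier M) = restrict (\<lambda>m. m) (carrier M)"
   using ff M colinear_restrict[OF M M h(1)] colinear_restrict[OF M M colinear_ident[of M]]
   unfolding fully_faithful_co_def bij_betw_def inj_on_def by blast
  then show ?thesis using m by (metis restrict_apply')
 qed
 have psi: "bij_psi M" if M: "comodule A C M" for M :: "(unit, 'u, 'a, 'c) comodule"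
 proof -
  note RM = right_co[OF M]
  note indM = comodule_ind[OF RM]
  interpret T: tensor B "coM M" AA by (rule tensor_B[OF RM])
  have "small TYPE('u) (coM M)" by (rule subset_imp_lepoll) simp
  \<comment> \<open>Fullness speaks of comodules over \<open>'u\<close>, so co M \<otimes> A is
    replaced by a copy.\<close>
  then obtain L :: "(unit, 'u, 'a, 'c) comodule" and \<phi> \<psi>
   where L: "comodule A C L" "right_copy A (ind (coM M)) L \<phi> \<psi>" "colinear A C (ind (coM M)) L \<phi>" "colinear A C L (ind (coM M)) \<psi>"
   using obtain_comodule_copy[OF indM] small_NA[OF RM] by auto
  note c = right_copyD[OF co_copy[OF indM L]]
  obtain s where s: "colinear A C M L s" "!!m. m \<in> co M ==> s m = \<phi> (phi (coM M) m)"
   using full[OF M L(1) right_linear_comp[OF unit_linear[OF RM] c(3)]] by blast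
  let ?s = "\<lambda>m. \<psi> (s m)"
  have sc: "colinear A C M (ind (coM M)) ?s" by (rule colinear_compose[OF M L(1) indM s(1) L(4)])
  have s1: "?s m = phi (coM M) m" if m: "m \<in> co M" for m
   using s(2)[OF m] c(5)[of "phi (coM M) m"] unit_co[OF RM, of m] m by simp
  have "psi M (?s m) = m" if m: "m : M" for m
  proof (rule faith[OF M colinear_compose[OF M indM M sc psi_colinear[OF M]] _ m])
   show "psi M (?s m) = m" if m: "m \<in> co M" for m
    using s1[OF m] psi_pure[OF M m A.one_closed] right_module.rsmult_one[OF comoduleD(1)[OF M] coD(1)[OF m]] by simp
  qed
  moreover have "?s (psi M t) = t" if t: "t : T.T" for t
  proof -
   have sl: "right_linear A M (ind (coM M)) ?s" using sc by (simp add: colinear_def)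
   have "additive_map T.T T.T (\<lambda>t. ?s (psi M t))"
    using additive_comp[OF psi_additive[OF M] right_linearD(1)[OF sl]] by (simp add: additive_map_def)
   then show ?thesis
   proof (rule T.additive_eqI[where g = "\<lambda>t. t", OF _ _ _ t])
    show "additive_map T.T T.T (\<lambda>t. t)" by (simp add: additive_map_def)
    fix m a assume "m : coM M" "a : AA"
    then have m: "m : coM M" "m \<in> co M" and a: "a : A" by simp_all
    show "?s (psi M (T.pt m a)) = T.pt m a"
     using psi_pure[OF M m(2) a] right_linearD(4)[OF sl coD(1)[OF m(2)] a] s1[OF m(2)] NA_mult[OF RM m(1) A.one_closed a] a by simp
   qed
  qed
  moreover have "psi M t : M" if "t : T.T" for t using psi_additive[OF M] that by (auto simp: additive_map_def)
  moreover have "?s m : T.T" if "m : M" for m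
   using sc right_linearD(2)[of A M "ind (coM M)" ?s m] that by (simp add: colinear_def)
  ultimately show ?thesis by (intro bij_betwI[of _ _ _ ?s]) auto
 qed
 have "bij_phi N" if N: "right_module B N" for N :: "(unit, 'u, 'a) bimodule"
 proof -
  obtain M :: "(unit, 'u, 'a, 'c) comodule" and \<phi> \<psi> where M: "comodule A C M" "right_copy B N (coM M) \<phi> \<psi>"
   using dense N unfolding dense_co_def by blast
  note RM = right_co[OF M(1)]
  note indM = comodule_ind[OF RM]
  have pp: "psi M (phi (coM M) m) = m" if m: "m \<in> co M" for m
   using psi_pure[OF M(1) m A.one_closed] right_module.rsmult_one[OF comoduleD(1)[OF M(1)] coD(1)[OF m]] by simp
  have "bij_betw (phi (coM M)) (carrier (coM M)) (co (ind (coM M)))"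
  proof (rule bij_betwI[of _ _ _ "psi M"])
   show "phi (coM M) \<in> carrier (coM M) \<rightarrow> co (ind (coM M))" using unit_co[OF RM] by blast
   have pc: "psi M t \<in> co M" if "t \<in> co (ind (coM M))" for t by (rule colinear_co[OF indM M(1) psi_colinear[OF M(1)] that])
   then show "psi M \<in> co (ind (coM M)) \<rightarrow> carrier (coM M)" by simp
   show "psi M (phi (coM M) m) = m" if "m : coM M" for m using pp that by simp
   show "phi (coM M) (psi M t) = t" if t: "t \<in> co (ind (coM M))" for t
   proof (rule inj_onD[OF bij_betw_imp_inj_on[OF psi[OF M(1)]] pp[OF pc[OF t]]])
    show "t : coA M" using coD(1)[OF t] by simp
    show "phi (coM M) (psi M t) : coA M" using coD(1)[OF unit_co[OF RM, of "psi M t"]] pc[OF t] by simp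
   qed
  qed
  then show ?thesis by (rule phi_bij_copy[OF M(2)])
 qed
 then show ?thesis unfolding strong_structure_iff using psi by blast
qed

theorem strong_structure_iff_hom_equivalence:
 "strong_structure_theorem TYPE('u) A C x \<longleftrightarrow> hom_functor_equivalence TYPE('u) A C x"
 unfolding hom_functor_equivalence_iff using strong_structure_co co_strong_structure by blast

end

theorem theorem2p5:
  fixes A B :: "'a ring" and C :: "('a, 'c) coring" and x :: 'c
    and S :: "('c \<Rightarrow> 'a) ring"
    and A\<^sub>S :: "(unit, 'a, 'c \<Rightarrow> 'a) bimodule" and C\<^sub>S :: "(unit, 'c, 'c \<Rightarrow> 'a) bimodule"
  assumes universe: "infinite (UNIV :: 'u set)"
      "carrier A \<lesssim> (UNIV :: 'u set)" "carrier C \<lesssim> (UNIV :: 'u set)"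
    and ring: "ring A" "\<one>\<^bsub>A\<^esub> \<noteq> \<zero>\<^bsub>A\<^esub>"
    and coring: "coring A C" "group_like A C x"
    and B: "B = coinvariant_ring A C x"
    and S: "S = dual_ring A C"
    and A\<^sub>S: "A\<^sub>S = dual_module (ring_comodule A C x)"
    and C\<^sub>S: "C\<^sub>S = dual_module (coring_comodule C)"
    and flat: "flat_left TYPE('u) A C"
  shows
    "(strong_structure_theorem TYPE('u) A C x \<longleftrightarrow>
        faithfully_flat TYPE('u) B (regular A) \<and> galois A C x) \<and>
     (locally_projective TYPE('u) A C \<longrightarrow>
       (strong_structure_theorem TYPE('u) A C x \<longleftrightarrow>
          faithfully_flat TYPE('u) B (regular A) \<and> bijective_\<Psi>' A C x (coring_comodule C)) \<and>
       (strong_structure_theorem TYPE('u) A C x \<longleftrightarrow>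
          faithfully_flat TYPE('u) B (regular A) \<and>
          (\<forall>M :: (unit, 'u, 'a, 'c) comodule.
             comodule A C M \<and> dual_module M \<in> subgenerated_by S A\<^sub>S \<longrightarrow> bijective_\<Psi>' A C x M) \<and>
          subgenerated_by S C\<^sub>S = (subgenerated_by S A\<^sub>S :: (unit, 'u, 'c \<Rightarrow> 'a) bimodule set)) \<and>
       (strong_structure_theorem TYPE('u) A C x \<longleftrightarrow>
          quasiprojective S A\<^sub>S \<and> generates_submodules S A\<^sub>S \<and>
          weak_generator TYPE('u) B (regular A) \<and>
          subgenerated_by S C\<^sub>S = (subgenerated_by S A\<^sub>S :: (unit, 'u, 'c \<Rightarrow> 'a) bimodule set)) \<and>
       (strong_structure_theorem TYPE('u) A C x \<longleftrightarrow>
          quasiprogenerator S A\<^sub>S \<and>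
          subgenerated_by S C\<^sub>S = (subgenerated_by S A\<^sub>S :: (unit, 'u, 'c \<Rightarrow> 'a) bimodule set)) \<and>
       (strong_structure_theorem TYPE('u) A C x \<longleftrightarrow>
          weak_generator TYPE('u) B (regular A) \<and>
          (\<forall>M :: (unit, 'u, 'a, 'c) comodule.
             comodule A C M \<and> dual_module M \<in> generated_by S A\<^sub>S \<longrightarrow>
             comodule_iso A C (induced_comodule A C x (colinear_hom_module A C x M)) M
               (counit_\<Psi>' A C x M)) \<and>
          subgenerated_by S A\<^sub>S = (subgenerated_by S C\<^sub>S :: (unit, 'u, 'c \<Rightarrow> 'a) bimodule set)) \<and>
       (strong_structure_theorem TYPE('u) A C x \<longleftrightarrow> hom_functor_equivalence TYPE('u) A C x) \<and>
       (strong_structure_theorem TYPE('u) A C x \<longleftrightarrow>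
          comodule_progenerator TYPE('u) A C (ring_comodule A C x)))"
proof -
 interpret small_coring A C x "TYPE('u)"
  by (intro small_coring.intro grouplike_coring.intro coring_setting.intro grouplike_coring_axioms.intro
    small_coring_axioms.intro) fact+
 show ?thesis
  unfolding B S A\<^sub>S C\<^sub>S
  by (intro conjI impI strong_structure_iff_galois[OF flat] strong_structure_iff_hom_equivalence)
   (rule lp_coring.strong_structure_lp_iff[OF lp_coring.intro[OF small_coring_axioms lp_coring_axioms.intro] flat],
    assumption)+
qed

end
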